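(* Let $p,q$ be positive integers, let $T_{p,q}$ be the torus link with $d=\gcd(p,q)$ components, and for each $n\ge1$ let $M_n$ denote the Fox-completed $(\mathbb{Z}/n\mathbb{Z})^d$-cover of $S^3$ branched along $T_{p,q}$. Then the multivariable Alexander polynomial $\Delta_{T_{p,q}}$ of $T_{p,q}$ satisfies $$m\big(\Delta_{T_{p,q}}\big)=0,$$ and hence $$\lim_{n\to\infty}\frac{1}{n^d}\log\#\bigl(H_1(M_n;\mathbb{Z})_{\mathrm{tors}}\bigr)=0.$$
   Context: For a nonzero Laurent polynomial $P\in\mathbb{C}[t_1^{\pm1},\dots,t_r^{\pm1}]$, the logarithmic Mahler measure is $m(P)=\int_0^1\cdots\int_0^1\log|P(e^{2\pi i\theta_1},\dots,e^{2\pi i\theta_r})|\,d\theta_1\cdots d\theta_r$. The (multivariable) Alexander polynomial of a link in $S^3$ is well defined up to multiplication by $\pm$ a monomial. Writing $p=dp'$, $q=dq'$, the one of $T_{p,q}$ is, for $d\ge2$, $$\Delta_{T_{p,q}}(X_1,\dots,X_d)=\frac{\big((X_1\cdots X_d)^{p'q'}-1\big)^d}{\big((X_1\cdots X_d)^{p'}-1\big)\big((X_1\cdots X_d)^{q'}-1\big)},$$ and for $d=1$, $\Delta_{T_{p,q}}(t)=\frac{(t^{pq}-1)(t-1)}{(t^p-1)(t^q-1)}$. For an $r$-component link $\mathcal{L}\subset S^3$ with complement $X_{\mathcal{L}}=S^3\setminus\mathcal{L}$, one has $H_1(X_{\mathcal{L}};\mathbb{Z})\cong\mathbb{Z}^r$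 with the $i$-th meridian sent to the $i$-th standard basis vector; let $X_{\mathcal{L},n}\to X_{\mathcal{L}}$ be the covering with Galois group $(\mathbb{Z}/n\mathbb{Z})^r$ corresponding to the composite $\pi_1(X_{\mathcal{L}})\to\mathbb{Z}^r\to(\mathbb{Z}/n\mathbb{Z})^r$. Its Fox completion $M_n\to S^3$ is the closed $3$-manifold obtained by extending this covering to a branched covering of $S^3$ with branching along $\mathcal{L}$ (filling in over a tubular neighbourhood of each component, the branching being modelled on $z\mapsto z^n$ on a disc transverse to the link). $A_{\mathrm{tors}}$ denotes the torsion subgroup of an abelian group $A$. *)

theory Defs
  imports
    "HOL-Analysis.Analysis"
    "HOL-Homology.Homology"
    "Jordan_Normal_Form.Determinant"
begin

text \<open>
  The three-sphere is \<^term>\<open>sphere (0 :: complex \<times> complex) 1\<close>.  An ordered oriented link with \<open>r\<close>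
  components is given by 1-periodic smooth regular curves \<open>K 0, ..., K (r - 1)\<close>, injective on
  \<open>[0,1)\<close> and with disjoint images.
\<close>

type_synonym link = "nat \<Rightarrow> real \<Rightarrow> complex \<times> complex"

definition link_set :: "nat \<Rightarrow> link \<Rightarrow> (complex \<times> complex) set" where
  "link_set r K = (\<Union>i<r. K i ` {0..1})"

definition link_complement :: "nat \<Rightarrow> link \<Rightarrow> (complex \<times> complex) set" where
  "link_complement r K = sphere 0 1 - link_set r K"

text \<open>
  With \<open>d = gcd p q\<close>, \<open>p = d p'\<close> and \<open>q = d q'\<close>, component \<open>k < d\<close> is the curve
  \<open>u ^ p' = exp (2 \<pi> i k / d) * v ^ q'\<close> on the torus of all \<open>(u, v) / sqrt 2\<close> with
  \<open>|u| = |v| = 1\<close>.  All components are oriented in parallel.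
\<close>

definition torus_link :: "nat \<Rightarrow> nat \<Rightarrow> link" where
  "torus_link p q k t =
     (1 / sqrt 2) *\<^sub>R
       (cis (2 * pi * (real (q div gcd p q) * t + real k / real p)),
        cis (2 * pi * (real (p div gcd p q) * t)))"

definition loop_class :: "'a topology \<Rightarrow> (real \<Rightarrow> 'a) \<Rightarrow> 'a chain set" where
  "loop_class X \<gamma> =
     homologous_rel_set 1 X {} (frag_of (restrict (\<lambda>x. \<gamma> (x 1)) (standard_simplex 1)))"

definition coords :: "complex \<times> complex \<Rightarrow> real list" where
  "coords x = [Re (fst x), Im (fst x), Re (snd x), Im (snd x)]"

text \<open>
  The sphere is oriented as the boundary of the unit ball (outward normal first), so \<open>(u, v)\<close> is a
  positively oriented orthonormal frame of the plane normal to the tangent vector \<open>w\<close> at \<open>x\<close>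
  if \<open>(x, w, u, v)\<close> is a positive basis of the ambient space.
\<close>

definition positive_normal_frame ::
    "complex \<times> complex \<Rightarrow> complex \<times> complex \<Rightarrow> complex \<times> complex \<Rightarrow> complex \<times> complex \<Rightarrow> bool" where
  "positive_normal_frame x w u v \<longleftrightarrow>
     norm u = 1 \<and> norm v = 1 \<and> u \<bullet> v = 0 \<and>
     x \<bullet> u = 0 \<and> x \<bullet> v = 0 \<and> w \<bullet> u = 0 \<and> w \<bullet> v = 0 \<and>
     Determinant.det (mat_of_rows_list 4 (map coords [x, w, u, v])) > 0"

definition normal_circle ::
    "complex \<times> complex \<Rightarrow> complex \<times> complex \<Rightarrow> complex \<times> complex \<Rightarrow> real \<Rightarrow> real \<Rightarrow> complex \<times> complex" where
  "normal_circle x u v \<epsilon> t =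
     cos \<epsilon> *\<^sub>R x + sin \<epsilon> *\<^sub>R (cos (2 * pi * t) *\<^sub>R u + sin (2 * pi * t) *\<^sub>R v)"

text \<open>
  The isomorphism of the first homology of the complement with \<open>\<int>\<^sup>r\<close> (here the free abelian group on
  \<open>{..<r}\<close>) that sends the meridian of component \<open>i\<close> to the \<open>i\<close>-th basis vector; the meridian is
  any sufficiently small positively oriented normal circle.
\<close>

definition meridian_iso ::
    "nat \<Rightarrow> link \<Rightarrow> ((complex \<times> complex) chain set \<Rightarrow> nat \<Rightarrow>\<^sub>0 int) \<Rightarrow> bool" where
  "meridian_iso r K \<phi> \<longleftrightarrow>
     \<phi> \<in> Group.iso (homology_group 1 (top_of_set (link_complement r K)))
                   (free_Abelian_group {..<r}) \<and>
     (\<forall>i<r. \<forall>s\<in>{0..1}. \<forall>u v.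
        positive_normal_frame (K i s) (vector_derivative (K i) (at s)) u v \<longrightarrow>
        (\<forall>\<^sub>F \<epsilon> in at_right 0.
           \<phi> (loop_class (top_of_set (link_complement r K)) (normal_circle (K i s) u v \<epsilon>))
             = frag_of i))"

text \<open>
  The connected covering of the link complement corresponding to the kernel of the homomorphism
  from its fundamental group to \<open>(\<int>/n\<int>)\<^sup>r\<close> induced by \<open>\<phi>\<close>: a loop downstairs lifts to a closed path
  (from any starting point) iff it lies in that kernel.  Since \<open>0 dvd k\<close> means \<open>k = 0\<close>, the case
  \<open>n = 0\<close> is the universal abelian cover, with group \<open>\<int>\<^sup>r\<close>.
\<close>

definition abelian_cover ::
    "nat \<Rightarrow> link \<Rightarrow> ((complex \<times> complex) chain set \<Rightarrow> nat \<Rightarrow>\<^sub>0 int) \<Rightarrow> nat \<Rightarrow>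
     'a::real_normed_vector set \<Rightarrow> ('a \<Rightarrow> complex \<times> complex) \<Rightarrow> bool" where
  "abelian_cover r K \<phi> n E f \<longleftrightarrow>
     connected E \<and> covering_space E f (link_complement r K) \<and>
     (\<forall>\<gamma>. path \<gamma> \<and> path_image \<gamma> \<subseteq> E \<and> f (pathstart \<gamma>) = f (pathfinish \<gamma>) \<longrightarrow>
        (pathstart \<gamma> = pathfinish \<gamma> \<longleftrightarrow>
         (\<forall>i<r. int n dvd
            Poly_Mapping.lookup
              (\<phi> (loop_class (top_of_set (link_complement r K)) (f \<circ> \<gamma>))) i)))"

text \<open>
  No manifold structure on \<open>M\<close> is assumed: away from the link it is inherited from the covering, and
  over the link from the charts in which the map is \<open>(z, t) \<mapsto> (z ^ n, t)\<close>.  Compactness makes \<open>M\<close>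
  closed and determines it up to homeomorphism over the sphere.
\<close>

definition fox_completed_cover ::
    "nat \<Rightarrow> link \<Rightarrow> nat \<Rightarrow> 'a::real_normed_vector set \<Rightarrow> ('a \<Rightarrow> complex \<times> complex) \<Rightarrow> bool" where
  "fox_completed_cover r K n M f \<longleftrightarrow>
     compact M \<and> continuous_on M f \<and> f ` M = sphere 0 1 \<and>
     (\<exists>\<phi>. meridian_iso r K \<phi> \<and>
          abelian_cover r K \<phi> n (M \<inter> f -` link_complement r K) f) \<and>
     (\<forall>x\<in>M. f x \<in> link_set r K \<longrightarrow>
        (\<exists>U V g g' h h'.
           x \<in> U \<and> openin (top_of_set M) U \<and> openin (top_of_set (sphere 0 1)) V \<and> f ` U \<subseteq> V \<and>
           homeomorphism U (ball (0::complex) 1 \<times> {-1<..<1::real}) g g' \<and>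
           homeomorphism V (ball (0::complex) 1 \<times> {-1<..<1::real}) h h' \<and>
           h ` (V \<inter> link_set r K) = {0} \<times> {-1<..<1} \<and>
           (\<forall>y\<in>U. h (f y) = (fst (g y) ^ n, snd (g y)))))"

definition torsion_part :: "('a, 'b) monoid_scheme \<Rightarrow> 'a set" where
  "torsion_part G = {x \<in> carrier G. \<exists>k::nat. k > 0 \<and> x [^]\<^bsub>G\<^esub> k = \<one>\<^bsub>G\<^esub>}"

text \<open>
  A Laurent polynomial over \<open>'c\<close> is a finitely supported function from exponent vectors to
  coefficients; the product on \<^typ>\<open>(nat \<Rightarrow>\<^sub>0 int) \<Rightarrow>\<^sub>0 'c::comm_ring_1\<close> is convolution.
\<close>

type_synonym 'c laurent = "(nat \<Rightarrow>\<^sub>0 int) \<Rightarrow>\<^sub>0 'c"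

definition laurent_in :: "nat \<Rightarrow> ('c::zero) laurent set" where
  "laurent_in r = {P. \<forall>a \<in> Poly_Mapping.keys P. Poly_Mapping.keys a \<subseteq> {..<r}}"

text \<open>
  The condition on paths determines the deck transformation \<open>T a\<close>: as \<open>E\<close> is the universal abelian
  cover, all lifts from \<open>x\<close> of loops of class \<open>a\<close> end at the same point, namely \<open>T a x\<close>.
\<close>

definition deck_action ::
    "nat \<Rightarrow> link \<Rightarrow> ((complex \<times> complex) chain set \<Rightarrow> nat \<Rightarrow>\<^sub>0 int) \<Rightarrow>
     'a::real_normed_vector set \<Rightarrow> ('a \<Rightarrow> complex \<times> complex) \<Rightarrow>
     ((nat \<Rightarrow>\<^sub>0 int) \<Rightarrow> 'a \<Rightarrow> 'a) \<Rightarrow> bool" where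
  "deck_action r K \<phi> E f T \<longleftrightarrow>
     (\<forall>a. Poly_Mapping.keys a \<subseteq> {..<r} \<longrightarrow>
        (\<exists>S. homeomorphism E E (T a) S) \<and>
        (\<forall>x\<in>E. f (T a x) = f x) \<and>
        (\<forall>\<gamma>. path \<gamma> \<and> path_image \<gamma> \<subseteq> E \<and> pathfinish \<gamma> = T a (pathstart \<gamma>) \<longrightarrow>
           \<phi> (loop_class (top_of_set (link_complement r K)) (f \<circ> \<gamma>)) = a))"

definition laurent_act ::
    "'a::real_normed_vector set \<Rightarrow> ((nat \<Rightarrow>\<^sub>0 int) \<Rightarrow> 'a \<Rightarrow> 'a) \<Rightarrow> int laurent \<Rightarrow>
     'a chain set \<Rightarrow> 'a chain set" where
  "laurent_act E T P x =
     finprod (homology_group 1 (top_of_set E))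
       (\<lambda>a. hom_induced 1 (top_of_set E) {} (top_of_set E) {} (T a) x
              [^]\<^bsub>homology_group 1 (top_of_set E)\<^esub> Poly_Mapping.lookup P a)
       (Poly_Mapping.keys P)"

definition laurent_comb ::
    "'a::real_normed_vector set \<Rightarrow> ((nat \<Rightarrow>\<^sub>0 int) \<Rightarrow> 'a \<Rightarrow> 'a) \<Rightarrow> nat \<Rightarrow> (nat \<Rightarrow> int laurent) \<Rightarrow>
     (nat \<Rightarrow> 'a chain set) \<Rightarrow> 'a chain set" where
  "laurent_comb E T m c g =
     finprod (homology_group 1 (top_of_set E)) (\<lambda>j. laurent_act E T (c j) (g j)) {..<m}"

definition module_generators ::
    "nat \<Rightarrow> 'a::real_normed_vector set \<Rightarrow> ((nat \<Rightarrow>\<^sub>0 int) \<Rightarrow> 'a \<Rightarrow> 'a) \<Rightarrow> nat \<Rightarrow>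
     (nat \<Rightarrow> 'a chain set) \<Rightarrow> bool" where
  "module_generators r E T m g \<longleftrightarrow>
     (\<forall>j<m. g j \<in> carrier (homology_group 1 (top_of_set E))) \<and>
     (\<forall>x \<in> carrier (homology_group 1 (top_of_set E)).
        \<exists>c. (\<forall>j<m. c j \<in> laurent_in r) \<and> x = laurent_comb E T m c g)"

text \<open>
  Generators of the zeroth elementary (Fitting) ideal: the determinants of all square matrices whose
  rows are relations between the module generators \<open>g 0, ..., g (m - 1)\<close>.
\<close>

definition relation_dets ::
    "nat \<Rightarrow> 'a::real_normed_vector set \<Rightarrow> ((nat \<Rightarrow>\<^sub>0 int) \<Rightarrow> 'a \<Rightarrow> 'a) \<Rightarrow> nat \<Rightarrow>
     (nat \<Rightarrow> 'a chain set) \<Rightarrow> int laurent set" where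
  "relation_dets r E T m g =
     {Determinant.det A | A. A \<in> carrier_mat m m \<and>
        (\<forall>i<m. \<forall>j<m. A $$ (i, j) \<in> laurent_in r) \<and>
        (\<forall>i<m. laurent_comb E T m (\<lambda>j. A $$ (i, j)) g
                = \<one>\<^bsub>homology_group 1 (top_of_set E)\<^esub>)}"

text \<open>
  \<open>P\<close> is an Alexander polynomial of the link if it is a greatest common divisor of the zeroth
  elementary ideal of the first homology of the universal abelian cover, as a module over the ring of
  integral Laurent polynomials in \<open>r\<close> variables; this determines \<open>P\<close> up to a unit, that is, up to
  sign and a monomial.  The choice of the space that contains the cover \<open>E\<close> is harmless, as every
  3-manifold embeds in \<open>\<real>\<^sup>7\<close>.
\<close>

definition alexander_polynomial :: "nat \<Rightarrow> link \<Rightarrow> int laurent \<Rightarrow> bool" where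
  "alexander_polynomial r K P \<longleftrightarrow>
     (\<exists>\<phi> (E :: (real^7) set) f T m g.
        meridian_iso r K \<phi> \<and> abelian_cover r K \<phi> 0 E f \<and> deck_action r K \<phi> E f T \<and>
        module_generators r E T m g \<and>
        P \<in> laurent_in r \<and>
        (\<forall>D \<in> relation_dets r E T m g. P dvd D) \<and>
        (\<forall>Q \<in> laurent_in r. (\<forall>D \<in> relation_dets r E T m g. Q dvd D) \<longrightarrow> Q dvd P))"

definition laurent_eval :: "nat \<Rightarrow> complex laurent \<Rightarrow> (nat \<Rightarrow> complex) \<Rightarrow> complex" where
  "laurent_eval r P x =
     (\<Sum>a\<in>Poly_Mapping.keys P. Poly_Mapping.lookup P a * (\<Prod>j<r. x j powi Poly_Mapping.lookup a j))"

text \<open>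
  For nonzero \<open>P\<close> the integrand is absolutely integrable, so the integral over the cube is the
  iterated integral.
\<close>

definition log_mahler_measure :: "nat \<Rightarrow> complex laurent \<Rightarrow> real" where
  "log_mahler_measure r P =
     set_lebesgue_integral (Pi\<^sub>M {..<r} (\<lambda>_. lborel)) (Pi\<^sub>E {..<r} (\<lambda>_. {0..1}))
       (\<lambda>\<theta>. ln (cmod (laurent_eval r P (\<lambda>j. cis (2 * pi * \<theta> j)))))"

end

theory Submission
  imports
    Defs
    "HOL-Real_Asymp.Real_Asymp"
    "HOL-Computational_Algebra.Fundamental_Theorem_Algebra"
begin

text \<open>
  With \<open>d = gcd p q\<close>, the circle acts on the three-sphere by
  \<open>(u, v) \<mapsto> (cis (2 * pi * (q div d) * s) * u, cis (2 * pi * (p div d) * s) * v)\<close> and preserves the torus link.  In an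
  abelian cover of the complement, the lift of the full turn is therefore a deck transformation that is
  homotopic to the identity.  It belongs to the class \<open>\<eta>\<close> of an orbit, which is nonzero because
  \<open>(sqrt 2 * u) ^ p - (sqrt 2 * v) ^ q\<close> winds around zero along the orbit.

  In the universal abelian cover this means that \<open>t\<^sup>\<eta> - 1\<close> annihilates the Alexander module, so the
  Alexander polynomial divides a power of \<open>t\<^sup>\<eta> - 1\<close>.  In a variable that occurs in \<open>\<eta>\<close> it has a
  unimodular leading coefficient and all its roots on the unit circle, and the Mahler measure vanishes.

  In the cover with group \<open>(\<int>/n\<int>)\<^sup>d\<close> the turn has only \<open>O(n\<^bsup>d-1\<^esup>)\<close> orbits on every fibre.  Lifting a fixed finite
  cover of the sphere by small caps yields a graph that carries the first homology of the branched
  cover, with triangle relations, on which the turn acts trivially up to homology and with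
  \<open>O(n\<^bsup>d-1\<^esup>)\<close> orbits of vertices and edges.  Choosing representatives of torsion classes whose orbit sums
  lie in a box bounds the order of the torsion by \<open>n\<^sup>K (6 K + 1)\<^sup>K\<close> with \<open>K = O(n\<^bsup>d-1\<^esup>)\<close>.
\<close>

section \<open>Paths as singular 1-simplices\<close>

text \<open>The two claims are proved side by side from the same symmetry. Two difficulties shape
  the torsion bound. First, its constant must not depend on n, although the spaces M_n are given
  separately and without triangulations. Hence the cover by caps and the way its members contract
  are described on the sphere alone; they are found once, with the charts of M_1, and pulled back to
  every M_n. Second, orbit sums do not separate torsion classes: two lifts with the same orbit sum
  differ by h y - y, where y need not be a cycle. The boundary of y is an invariant 0-chain, and its
  residue modulo n determines the class of h y - y. This produces the factor
  \<open>n\<^sup>K\<close>. The box produces \<open>(6 K + 1)\<^sup>K\<close>, because a triangle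
  relation has orbit sums of size at most 3, so that K of them leave a remainder of size at most 3
  K. As K is O(n^(d-1)), the logarithm of the bound is O(n^(d-1) log n), which is negligible against
  n^d.\<close>

definition path_simplex :: "(real \<Rightarrow> 'a) \<Rightarrow> 'a chain" where
  "path_simplex g = frag_of (restrict (\<lambda>x. g (x 1)) (standard_simplex 1))"

definition point_simplex :: "'a \<Rightarrow> 'a chain" where
  "point_simplex x = frag_of (restrict (\<lambda>_. x) (standard_simplex 0))"

abbreviation null_chain :: "'a::topological_space set \<Rightarrow> 'a chain \<Rightarrow> bool" where
  "null_chain S \<equiv> singular_relboundary 1 (top_of_set S) {}"

lemma nat_cases_01: "i = 0 \<or> i = Suc 0 \<or> i > Suc 0" for i :: nat
  by linarith

lemma standard_simplex_1_iff:
  "x \<in> standard_simplex (Suc 0) \<longleftrightarrow>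
     x 0 = 1 - x (Suc 0) \<and> 0 \<le> x (Suc 0) \<and> x (Suc 0) \<le> 1 \<and> (\<forall>i>Suc 0. x i = 0)"
proof -
  have "0 \<le> x i \<and> x i \<le> 1"
    if "x 0 = 1 - x (Suc 0)" "0 \<le> x (Suc 0)" "x (Suc 0) \<le> 1" "\<forall>i>Suc 0. x i = 0" for i
    using that nat_cases_01[of i] by auto
  then show ?thesis unfolding standard_simplex_def by auto
qed

lemma standard_simplex_1_eq:
  "x \<in> standard_simplex (Suc 0) \<Longrightarrow>
     x = (\<lambda>i. if i = 0 then 1 - x (Suc 0) else if i = Suc 0 then x (Suc 0) else 0)"
  using nat_cases_01 by (force simp: standard_simplex_1_iff)

lemma path_simplex_cong:
  assumes "\<And>t. t \<in> {0..1} \<Longrightarrow> g t = h t"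
  shows "path_simplex g = path_simplex h"
  unfolding path_simplex_def using assms
  by (intro arg_cong[where f=frag_of] restrict_ext) (simp add: standard_simplex_1_iff)

lemma singular_simplex_path:
  assumes "path g" "path_image g \<subseteq> S"
  shows "singular_simplex 1 (top_of_set S) (restrict (\<lambda>x. g (x 1)) (standard_simplex 1))"
proof -
  have 1: "continuous_map (subtopology (powertop_real UNIV) (standard_simplex 1)) (top_of_set {0..1}) (\<lambda>x. x 1)"
    by (auto simp: continuous_map_in_subtopology standard_simplex_1_iff
      intro!: continuous_map_from_subtopology continuous_map_product_projection)
  have 2: "continuous_map (top_of_set {0..1}) (top_of_set S) g"
    using assms by (auto simp: path_def path_image_def)
  show ?thesis
    unfolding singular_simplex_def
    using continuous_map_compose[OF 1 2] by (auto simp: o_def elim!: continuous_map_eq)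
qed

lemma singular_chain_path_simplex:
  assumes "path g" "path_image g \<subseteq> S"
  shows "singular_chain 1 (top_of_set S) (path_simplex g)"
  using singular_simplex_path[OF assms] by (simp add: path_simplex_def singular_chain_of)

text \<open>With this converse, statements about arbitrary singular 1-chains reduce to statements
  about paths.\<close>

lemma singular_simplex_1_path:
  assumes "singular_simplex 1 (top_of_set S) \<sigma>"
  obtains g where "path g" "path_image g = \<sigma> ` standard_simplex 1" "frag_of \<sigma> = path_simplex g"
proof
  define v where "v t = (\<lambda>i::nat. if i = 0 then 1 - t else if i = Suc 0 then t else (0::real))" for t
  have v: "v t \<in> standard_simplex 1" if "t \<in> {0..1}" for t
    using that by (auto simp: v_def standard_simplex_1_iff)
  have v': "x = v (x 1)" if "x \<in> standard_simplex 1" for x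
    using standard_simplex_1_eq[of x] that by (simp add: v_def)
  have "continuous_map (top_of_set {0..1}) (subtopology (powertop_real UNIV) (standard_simplex 1)) v"
  proof -
    have "continuous_on {0..1} (\<lambda>t. v t i)" for i
      by (cases "i = 0"; cases "i = Suc 0") (auto simp: v_def intro!: continuous_intros)
    then show ?thesis
      using v by (auto simp: continuous_map_in_subtopology continuous_map_componentwise_UNIV)
  qed
  from continuous_map_compose[OF this] assms
  have "continuous_map (top_of_set {0..1}) (top_of_set S) (\<sigma> \<circ> v)"
    unfolding singular_simplex_def by blast
  then show "path (\<sigma> \<circ> v)" by (auto simp: path_def continuous_map_in_subtopology)
  have "standard_simplex 1 = v ` {0..1}"
  proof (intro subset_antisym subsetI)
    fix x assume "x \<in> standard_simplex 1"
    then show "x \<in> v ` {0..1}" using v'[of x] standard_simplex_1_iff[of x] by auto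
  qed (use v in auto)
  then show "path_image (\<sigma> \<circ> v) = \<sigma> ` standard_simplex 1"
    by (auto simp: path_image_def)
  have "\<sigma> = restrict (\<lambda>x. (\<sigma> \<circ> v) (x 1)) (standard_simplex 1)"
  proof
    fix x show "\<sigma> x = restrict (\<lambda>x. (\<sigma> \<circ> v) (x 1)) (standard_simplex 1) x"
    proof (cases "x \<in> standard_simplex 1")
      case True
      then have "v (x 1) = x" using v' by simp
      with True show ?thesis by simp
    next
      case False
      with assms show ?thesis by (simp add: singular_simplex_def extensional_def)
    qed
  qed
  then show "frag_of \<sigma> = path_simplex (\<sigma> \<circ> v)" by (metis path_simplex_def)
qed

lemma chain_boundary_path_simplex:
  "chain_boundary 1 (path_simplex g) = point_simplex (g 1) - point_simplex (g 0)"
proof -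
  have *: "singular_face 1 k (restrict (\<lambda>x. g (x 1)) (standard_simplex 1)) =
        restrict (\<lambda>_. g (if k = 0 then 1 else 0)) (standard_simplex 0)" if k: "k \<le> 1" for k
  proof -
    have "simplical_face k (\<lambda>j. if j = 0 then 1 else 0) \<in> standard_simplex 1"
      using k by (intro simplical_face_in_standard_simplex) auto
    moreover have "simplical_face k (\<lambda>j. if j = 0 then 1 else 0) (Suc 0) = (if k = 0 then 1 else (0::real))"
      using k by (auto simp: simplical_face_def)
    ultimately show ?thesis
      unfolding singular_face_def by (intro ext) (auto simp: standard_simplex_0 restrict_def)
  qed
  show ?thesis
    unfolding path_simplex_def chain_boundary_of point_simplex_def
    using *[of 0] *[of 1] by (simp del: singular_face_restrict)
qed

text \<open>The composite of \<open>\<Theta>\<close> with the affine map onto the triangle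
  \<open>a\<close>, \<open>b\<close>, \<open>c\<close> is a singular 2-simplex with these three
  paths as faces. Degenerate triangles yield the relations for joins, constant paths and reversed
  paths below.\<close>

lemma path_simplex_triangle:
  fixes \<Theta> :: "'b::real_normed_vector \<Rightarrow> 'a::topological_space"
  assumes "convex D" "continuous_on D \<Theta>" "\<Theta> ` D \<subseteq> S" "a \<in> D" "b \<in> D" "c \<in> D"
  shows "null_chain S (path_simplex (\<Theta> \<circ> linepath a b) + path_simplex (\<Theta> \<circ> linepath b c)
            - path_simplex (\<Theta> \<circ> linepath a c))"
proof -
  define w where "w x = x 0 *\<^sub>R a + x 1 *\<^sub>R b + x (2::nat) *\<^sub>R c" for x
  have st: "0 \<le> x 0 \<and> 0 \<le> x 1 \<and> 0 \<le> x 2 \<and> x 0 + x 1 + x 2 = 1" if "x \<in> standard_simplex 2" for x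
    using that by (auto simp: standard_simplex_def eval_nat_numeral)
  have w: "w x \<in> D" if "x \<in> standard_simplex 2" for x
  proof -
    have "(\<Sum>i\<in>{0,1,2::nat}. x i *\<^sub>R (if i = 0 then a else if i = 1 then b else c)) \<in> D"
      using st[OF that] assms by (intro convex_sum) auto
    then show ?thesis by (simp add: w_def add.assoc)
  qed
  have "continuous_map (subtopology (powertop_real UNIV) (standard_simplex 2)) euclidean (\<lambda>x. x i *\<^sub>R v)"
    for i :: nat and v :: 'b
  proof -
    have 1: "continuous_map (subtopology (powertop_real UNIV) (standard_simplex 2)) euclideanreal (\<lambda>x. x i)"
      by (intro continuous_map_from_subtopology continuous_map_product_projection) auto
    have 2: "continuous_map euclideanreal euclidean (\<lambda>t. t *\<^sub>R v)"
      by (auto intro!: continuous_intros)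
    show ?thesis using continuous_map_compose[OF 1 2] by (simp add: o_def)
  qed
  then have cw: "continuous_map (subtopology (powertop_real UNIV) (standard_simplex 2)) (top_of_set D) w"
    using w unfolding continuous_map_in_subtopology w_def
    by (intro conjI continuous_map_add) auto
  have "continuous_map (top_of_set D) (top_of_set S) \<Theta>" using assms by auto
  from continuous_map_compose[OF cw this]
  have ss: "singular_simplex 2 (top_of_set S) (restrict (\<Theta> \<circ> w) (standard_simplex 2))"
    unfolding singular_simplex_def by (auto elim!: continuous_map_eq)
  have face: "frag_of (singular_face 2 k (restrict (\<Theta> \<circ> w) (standard_simplex 2)))
     = path_simplex (\<lambda>t. \<Theta> (w (simplical_face k (\<lambda>i. if i = 0 then 1 - t else if i = 1 then t else 0))))"
     if "k \<le> 2" for k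
  proof -
    have "x = (\<lambda>i. if i = 0 then 1 - x 1 else if i = 1 then x 1 else 0)" if "x \<in> standard_simplex 1" for x
      using standard_simplex_1_eq[OF that[unfolded One_nat_def]] unfolding One_nat_def .
    then have "restrict (\<lambda>x. \<Theta> (w (simplical_face k x))) (standard_simplex 1) =
       restrict (\<lambda>x. \<Theta> (w (simplical_face k (\<lambda>i. if i = 0 then 1 - x 1 else if i = 1 then x 1 else 0)))) (standard_simplex 1)"
      by (intro restrict_ext) metis
    moreover have "simplical_face k x \<in> standard_simplex 2" if "x \<in> standard_simplex 1" for x
      using simplical_face_in_standard_simplex[of 2 k x] that \<open>k \<le> 2\<close> by auto
    then have "singular_face 2 k (restrict (\<Theta> \<circ> w) (standard_simplex 2)) = restrict (\<lambda>x. \<Theta> (w (simplical_face k x))) (standard_simplex 1)"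
      by (auto simp: singular_face_def fun_eq_iff restrict_def)
    ultimately show ?thesis by (simp add: path_simplex_def)
  qed
  have sum3: "(\<Sum>k\<le>2. h k) = h 0 + h 1 + h (2::nat)" for h :: "nat \<Rightarrow> 'a chain"
    by (simp add: eval_nat_numeral)
  have f0: "frag_of (singular_face 2 0 (restrict (\<Theta> \<circ> w) (standard_simplex 2))) = path_simplex (\<Theta> \<circ> linepath b c)"
    and f1: "frag_of (singular_face 2 1 (restrict (\<Theta> \<circ> w) (standard_simplex 2))) = path_simplex (\<Theta> \<circ> linepath a c)"
    and f2: "frag_of (singular_face 2 2 (restrict (\<Theta> \<circ> w) (standard_simplex 2))) = path_simplex (\<Theta> \<circ> linepath a b)"
    by (subst face, simp, intro path_simplex_cong, simp add: simplical_face_def w_def linepath_def)+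
  have "chain_boundary 2 (frag_of (restrict (\<Theta> \<circ> w) (standard_simplex 2))) =
    path_simplex (\<Theta> \<circ> linepath b c) - path_simplex (\<Theta> \<circ> linepath a c) + path_simplex (\<Theta> \<circ> linepath a b)"
    unfolding chain_boundary_of sum3 f0 f1 f2 by simp
  then show ?thesis
    using ss unfolding singular_boundary
    by (intro exI[of _ "frag_of (restrict (\<Theta> \<circ> w) (standard_simplex 2))"])
      (simp add: singular_chain_of numeral_2_eq_2)
qed

lemma null_chain_mono:
  assumes "null_chain S c" "S \<subseteq> T"
  shows "null_chain T c"
  using singular_boundary_mono[of S T 1 euclidean c] assms by simp

text \<open>The diagonal cuts the square into two triangles, whose relations are subtracted. The
  sides in the variable \<open>s\<close> record the tracks of the end points, so homotopies that
  move the ends are covered as well.\<close>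

lemma path_simplex_square:
  fixes K :: "real \<times> real \<Rightarrow> 'a::topological_space"
  assumes "continuous_on ({0..1} \<times> {0..1}) K" "K ` ({0..1} \<times> {0..1}) \<subseteq> S"
  shows "null_chain S (path_simplex (\<lambda>t. K (0,t)) + path_simplex (\<lambda>s. K (s,1))
          - path_simplex (\<lambda>s. K (s,0)) - path_simplex (\<lambda>t. K (1,t)))"
proof -
  have c: "convex ({0..1} \<times> {0..1::real} :: (real\<times>real) set)" by (simp add: convex_Times)
  note tri = path_simplex_triangle[OF c assms]
  have 1: "path_simplex (K \<circ> linepath (0,0) (0,1)) = path_simplex (\<lambda>t. K (0,t))"
    "path_simplex (K \<circ> linepath (0,1) (1,1)) = path_simplex (\<lambda>s. K (s,1))"
    "path_simplex (K \<circ> linepath (0,0) (1,0)) = path_simplex (\<lambda>s. K (s,0))"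
    "path_simplex (K \<circ> linepath (1,0) (1,1)) = path_simplex (\<lambda>t. K (1,t))"
    by (intro path_simplex_cong; simp add: linepath_def)+
  have 2: "null_chain S (path_simplex (K \<circ> linepath (0,0) (0,1)) + path_simplex (K \<circ> linepath (0,1) (1,1))
            - path_simplex (K \<circ> linepath (0,0) (1,1)))"
    by (rule tri) auto
  have 3: "null_chain S (path_simplex (K \<circ> linepath (0,0) (1,0)) + path_simplex (K \<circ> linepath (1,0) (1,1))
            - path_simplex (K \<circ> linepath (0,0) (1,1)))"
    by (rule tri) auto
  show ?thesis
    using singular_relboundary_diff[OF 2 3] unfolding 1 by (simp add: algebra_simps)
qed

text \<open>The triangle degenerates to the points 0, 1/2, 1 of the unit interval.\<close>

lemma path_simplex_join:
  assumes "path g" "path h" "pathfinish g = pathstart h" "path_image g \<subseteq> S" "path_image h \<subseteq> S"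
  shows "null_chain S (path_simplex g + path_simplex h - path_simplex (g +++ h))"
proof -
  have "path (g +++ h)" "path_image (g +++ h) \<subseteq> S"
    using assms by (auto simp: path_image_join)
  then have "null_chain S (path_simplex ((g +++ h) \<circ> linepath 0 (1/2)) + path_simplex ((g +++ h) \<circ> linepath (1/2) 1)
     - path_simplex ((g +++ h) \<circ> linepath 0 1))"
    by (intro path_simplex_triangle[of "{0..1}"]) (auto simp: path_def path_image_def)
  moreover have "path_simplex ((g +++ h) \<circ> linepath 0 (1/2)) = path_simplex g"
    "path_simplex ((g +++ h) \<circ> linepath 0 1) = path_simplex (g +++ h)"
    by (intro path_simplex_cong; simp add: linepath_def joinpaths_def)+
  moreover have "path_simplex ((g +++ h) \<circ> linepath (1/2) 1) = path_simplex h"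
    using assms(3) by (intro path_simplex_cong)
     (auto simp: linepath_def joinpaths_def pathfinish_def pathstart_def field_simps)
  ultimately show ?thesis by simp
qed

lemma path_simplex_const:
  assumes "x \<in> S"
  shows "null_chain S (path_simplex (\<lambda>_. x))"
proof -
  have "null_chain S (path_simplex ((\<lambda>_. x) \<circ> linepath (0::real) 0) + path_simplex ((\<lambda>_. x) \<circ> linepath (0::real) 0)
     - path_simplex ((\<lambda>_. x) \<circ> linepath (0::real) 0))"
    by (intro path_simplex_triangle[of UNIV]) (use assms in auto)
  then show ?thesis by (simp add: o_def)
qed

lemma path_simplex_reverse:
  assumes "path g" "path_image g \<subseteq> S"
  shows "null_chain S (path_simplex g + path_simplex (reversepath g))"
proof -
  have 1: "null_chain S (path_simplex (g \<circ> linepath 0 1) + path_simplex (g \<circ> linepath 1 0)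
     - path_simplex (g \<circ> linepath 0 0))"
    using assms by (intro path_simplex_triangle[of "{0..1}"]) (auto simp: path_def path_image_def)
  have 2: "path_simplex (g \<circ> linepath 0 1) = path_simplex g"
    "path_simplex (g \<circ> linepath 1 0) = path_simplex (reversepath g)"
    "path_simplex (g \<circ> linepath 0 0) = path_simplex (\<lambda>_. g 0)"
    by (intro path_simplex_cong; simp add: linepath_def reversepath_def)+
  have 3: "null_chain S (path_simplex (\<lambda>_. g 0))"
    using assms by (intro path_simplex_const) (auto simp: path_image_def)
  show ?thesis using singular_relboundary_add[OF 1 3] unfolding 2 by simp
qed

text \<open>Loops of \<open>U\<close> have to bound in the larger set \<open>M\<close> only. This
  suits sets off the branch locus: a small loop around a branch curve bounds in \<open>M\<close> but
  not in such a \<open>U\<close>.\<close>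

definition loops_null :: "'a::topological_space set \<Rightarrow> 'a set \<Rightarrow> bool" where
  "loops_null U M \<longleftrightarrow> U \<subseteq> M \<and>
     (\<forall>\<gamma>. path \<gamma> \<and> path_image \<gamma> \<subseteq> U \<and> pathfinish \<gamma> = pathstart \<gamma> \<longrightarrow> null_chain M (path_simplex \<gamma>))"

lemma loops_null_mono: "loops_null U M \<Longrightarrow> V \<subseteq> U \<Longrightarrow> loops_null V M"
  unfolding loops_null_def by (meson subset_trans)

text \<open>The three paths close up to a loop in \<open>U\<close>; the relations for joins and
  reversal compare its class with the alternating sum.\<close>

lemma loops_null_triangle:
  assumes U: "loops_null U M"
    and "path g" "path h" "path k" "path_image g \<subseteq> U" "path_image h \<subseteq> U" "path_image k \<subseteq> U"
    and "pathfinish g = pathstart h" "pathstart k = pathstart g" "pathfinish k = pathfinish h"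
  shows "null_chain M (path_simplex g + path_simplex h - path_simplex k)"
proof -
  have UM: "U \<subseteq> M" using U by (simp add: loops_null_def)
  let ?l = "(g +++ h) +++ reversepath k"
  have "path ?l" "path_image ?l \<subseteq> U" "pathfinish ?l = pathstart ?l"
    using assms by (auto simp: path_image_join)
  then have 1: "null_chain M (path_simplex ?l)" using U by (auto simp: loops_null_def)
  have 2: "null_chain M (path_simplex (g +++ h) + path_simplex (reversepath k) - path_simplex ?l)"
    using assms UM by (intro path_simplex_join) (auto simp: path_image_join)
  have 3: "null_chain M (path_simplex g + path_simplex h - path_simplex (g +++ h))"
    using assms UM by (intro path_simplex_join) (auto simp: path_image_join)
  have 4: "null_chain M (path_simplex k + path_simplex (reversepath k))"
    using assms UM by (intro path_simplex_reverse) auto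
  have "path_simplex g + path_simplex h - path_simplex k = 
    ((path_simplex g + path_simplex h - path_simplex (g +++ h)) + (path_simplex (g +++ h) + path_simplex (reversepath k) - path_simplex ?l))
     + path_simplex ?l - (path_simplex k + path_simplex (reversepath k))"
    by (simp add: algebra_simps)
  then show ?thesis
    using singular_relboundary_diff[OF singular_relboundary_add[OF singular_relboundary_add[OF 3 2] 1] 4] by metis
qed

lemma loops_null_parallel:
  assumes U: "loops_null U M"
    and "path g" "path h" "path_image g \<subseteq> U" "path_image h \<subseteq> U"
    and "pathstart g = pathstart h" "pathfinish g = pathfinish h"
  shows "null_chain M (path_simplex g - path_simplex h)"
proof -
  have UM: "U \<subseteq> M" using U by (simp add: loops_null_def)
  have s: "pathstart g \<in> U" using assms by (metis pathstart_in_path_image subsetD)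
  let ?c = "\<lambda>_::real. pathstart g"
  have 1: "null_chain M (path_simplex ?c + path_simplex g - path_simplex h)"
    using assms s by (intro loops_null_triangle[OF U]) (auto simp: path_image_def pathfinish_def pathstart_def path_def)
  have 2: "null_chain M (path_simplex ?c)"
    using s UM by (intro path_simplex_const) auto
  show ?thesis using singular_relboundary_diff[OF 1 2] by simp
qed

text \<open>A straight-line homotopy in the chart \<open>C\<close> contracts the loop to a point.
  The tracks of its two ends coincide and cancel in the square relation.\<close>

lemma loops_null_contractible:
  fixes U :: "'a::topological_space set" and C :: "'b::real_normed_vector set"
  assumes "homeomorphism U C g g'" "convex C" "U \<subseteq> M"
  shows "loops_null U M"
  unfolding loops_null_def
proof (intro conjI allI impI)
  fix \<gamma> :: "real \<Rightarrow> 'a" assume \<gamma>: "path \<gamma> \<and> path_image \<gamma> \<subseteq> U \<and> pathfinish \<gamma> = pathstart \<gamma>"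
  define K where "K = (\<lambda>(s,t). g' ((1 - s) *\<^sub>R g (\<gamma> t) + s *\<^sub>R g (\<gamma> 0)))"
  have gU: "g x \<in> C" if "x \<in> U" for x using assms that unfolding homeomorphism_def by blast
  have \<gamma>U: "\<gamma> t \<in> U" if "t \<in> {0..1}" for t using \<gamma> that by (auto simp: path_image_def)
  have in_C: "(1 - s) *\<^sub>R g (\<gamma> t) + s *\<^sub>R g (\<gamma> 0) \<in> C" if "s \<in> {0..1}" "t \<in> {0..1}" for s t
    using that by (intro convexD[OF assms(2)]) (auto intro!: gU \<gamma>U)
  have cg: "continuous_on {0..1} (\<lambda>t. g (\<gamma> t))"
    using \<gamma> assms(1) by (intro continuous_on_compose2[of U g "{0..1}" \<gamma>]) (auto simp: homeomorphism_def path_def path_image_def)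
  have "continuous_on ({0..1} \<times> {0..1}) (\<lambda>z::real\<times>real. g (\<gamma> (snd z)))"
    by (rule continuous_on_compose2[OF cg]) (auto intro!: continuous_intros)
  then have "continuous_on ({0..1} \<times> {0..1}) K"
    unfolding K_def case_prod_unfold using in_C assms(1)
    by (intro continuous_on_compose2[of C g' "{0..1} \<times> {0..1}"] continuous_intros) (auto simp: homeomorphism_def)
  moreover have "K ` ({0..1} \<times> {0..1}) \<subseteq> M"
  proof clarify
    fix s t :: real assume "s \<in> {0..1}" "t \<in> {0..1}"
    then have "g' ((1 - s) *\<^sub>R g (\<gamma> t) + s *\<^sub>R g (\<gamma> 0)) \<in> U"
      using imageI[OF in_C, of s t g'] homeomorphism_image2[OF assms(1)] by simp
    then show "K (s, t) \<in> M" using assms(3) by (auto simp: K_def)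
  qed
  ultimately have n: "null_chain M (path_simplex (\<lambda>t. K (0,t)) + path_simplex (\<lambda>s. K (s,1))
          - path_simplex (\<lambda>s. K (s,0)) - path_simplex (\<lambda>t. K (1,t)))"
    by (rule path_simplex_square)
  have 1: "path_simplex (\<lambda>t. K (0,t)) = path_simplex \<gamma>"
    using \<gamma>U assms(1) by (intro path_simplex_cong) (simp add: K_def homeomorphism_def)
  have 2: "(\<lambda>s. K (s,1)) = (\<lambda>s. K (s,0))" using \<gamma> by (simp add: K_def pathfinish_def pathstart_def)
  have 3: "null_chain M (path_simplex (\<lambda>t. K (1,t)))"
    using gU \<gamma>U[of 0] assms path_simplex_const[of "g' (g (\<gamma> 0))" M] by (auto simp: K_def homeomorphism_def)
  show "null_chain M (path_simplex \<gamma>)"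
    using singular_relboundary_add[OF n 3] unfolding 1 2 by simp
qed fact

section \<open>Torsion in groups carried by a graph with a periodic symmetry\<close>

text \<open>Gaussian elimination by induction on the coordinates: a vector with nonzero coordinate
  \<open>\<kappa>0\<close> serves as pivot, and its coefficient is chosen last.\<close>

lemma linear_dependence:
  fixes f :: "'i \<Rightarrow> 'k \<Rightarrow> real"
  assumes "finite K" "finite A" "card K < card A"
  shows "\<exists>\<beta>. (\<exists>a\<in>A. \<beta> a \<noteq> 0) \<and> (\<forall>\<kappa>\<in>K. (\<Sum>a\<in>A. \<beta> a * f a \<kappa>) = 0)"
  using assms
proof (induction K arbitrary: A f rule: finite_induct)
  case empty
  then have "A \<noteq> {}" by auto
  then show ?case by (intro exI[of _ "\<lambda>_. 1"]) auto
next
  case (insert \<kappa>0 K)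
  show ?case
  proof (cases "\<forall>a\<in>A. f a \<kappa>0 = 0")
    case True
    have "\<exists>\<beta>. (\<exists>a\<in>A. \<beta> a \<noteq> 0) \<and> (\<forall>\<kappa>\<in>K. (\<Sum>a\<in>A. \<beta> a * f a \<kappa>) = 0)"
      using insert.prems insert.hyps by (intro insert.IH) auto
    then obtain \<beta> where "\<exists>a\<in>A. \<beta> a \<noteq> 0" "\<forall>\<kappa>\<in>K. (\<Sum>a\<in>A. \<beta> a * f a \<kappa>) = 0" by blast
    with True show ?thesis by (intro exI[of _ \<beta>]) simp
  next
    case False
    then obtain a0 where a0: "a0 \<in> A" "f a0 \<kappa>0 \<noteq> 0" by blast
    define f' where "f' a \<kappa> = f a \<kappa> - f a \<kappa>0 / f a0 \<kappa>0 * f a0 \<kappa>" for a \<kappa>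
    have "\<exists>\<beta>. (\<exists>a\<in>A - {a0}. \<beta> a \<noteq> 0) \<and> (\<forall>\<kappa>\<in>K. (\<Sum>a\<in>A - {a0}. \<beta> a * f' a \<kappa>) = 0)"
      using insert.prems insert.hyps a0 by (intro insert.IH) auto
    then obtain \<beta> where \<beta>: "\<exists>a\<in>A - {a0}. \<beta> a \<noteq> 0" "\<And>\<kappa>. \<kappa> \<in> K \<Longrightarrow> (\<Sum>a\<in>A - {a0}. \<beta> a * f' a \<kappa>) = 0"
      by blast
    \<comment> \<open>The pivot gets the coefficient that makes coordinate \<open>\<kappa>0\<close>
      of the combination vanish.\<close>
    define \<gamma> where "\<gamma> = \<beta>(a0 := - (\<Sum>a\<in>A - {a0}. \<beta> a * f a \<kappa>0) / f a0 \<kappa>0)"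
    have eq: "(\<Sum>a\<in>A. \<gamma> a * f a \<kappa>) = (\<Sum>a\<in>A - {a0}. \<beta> a * f' a \<kappa>)" for \<kappa>
    proof -
      have "(\<Sum>a\<in>A. \<gamma> a * f a \<kappa>) = \<gamma> a0 * f a0 \<kappa> + (\<Sum>a\<in>A - {a0}. \<gamma> a * f a \<kappa>)"
        using insert.prems a0 by (intro sum.remove) auto
      also have "(\<Sum>a\<in>A - {a0}. \<gamma> a * f a \<kappa>) = (\<Sum>a\<in>A - {a0}. \<beta> a * f a \<kappa>)"
        by (intro sum.cong) (auto simp: \<gamma>_def)
      also have "\<gamma> a0 * f a0 \<kappa> = - ((\<Sum>a\<in>A - {a0}. \<beta> a * f a \<kappa>0) / f a0 \<kappa>0 * f a0 \<kappa>)"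
        by (simp add: \<gamma>_def)
      also have "(\<Sum>a\<in>A - {a0}. \<beta> a * f a \<kappa>0) / f a0 \<kappa>0 * f a0 \<kappa>
          = (\<Sum>a\<in>A - {a0}. \<beta> a * (f a \<kappa>0 / f a0 \<kappa>0 * f a0 \<kappa>))"
        unfolding sum_divide_distrib sum_distrib_right by (intro sum.cong) auto
      finally show ?thesis
        by (simp add: f'_def right_diff_distrib sum_subtractf)
    qed
    have "(\<Sum>a\<in>A - {a0}. \<beta> a * f' a \<kappa>0) = 0"
      using a0 by (simp add: f'_def)
    then have "\<forall>\<kappa>\<in>insert \<kappa>0 K. (\<Sum>a\<in>A. \<gamma> a * f a \<kappa>) = 0" using \<beta>(2) by (simp add: eq)
    moreover have "\<exists>a\<in>A. \<gamma> a \<noteq> 0" using \<beta>(1) by (auto simp: \<gamma>_def)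
    ultimately show ?thesis by blast
  qed
qed

text \<open>Caratheodory's argument: a rational combination of integer vectors can be supported on at
  most \<open>card K\<close> of them; the fractional parts of its coefficients leave a remainder in a box.\<close>

lemma torsion_representative_in_box:
  fixes f :: "'i \<Rightarrow> 'k \<Rightarrow> int" and c :: "'k \<Rightarrow> int"
  assumes K: "finite K" and f: "\<And>i \<kappa>. i \<in> T \<Longrightarrow> \<kappa> \<in> K \<Longrightarrow> \<bar>f i \<kappa>\<bar> \<le> b" and b0: "0 \<le> b"
    and d: "Poly_Mapping.keys d \<subseteq> T" "N > (0::int)"
    and c: "\<And>\<kappa>. \<kappa> \<in> K \<Longrightarrow> N * c \<kappa> = (\<Sum>i\<in>Poly_Mapping.keys d. Poly_Mapping.lookup d i * f i \<kappa>)"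
  shows "\<exists>d'. Poly_Mapping.keys d' \<subseteq> T \<and>
    (\<forall>\<kappa>\<in>K. \<bar>c \<kappa> - (\<Sum>i\<in>Poly_Mapping.keys d'. Poly_Mapping.lookup d' i * f i \<kappa>)\<bar> \<le> b * int (card K))"
proof -
  define P where "P A q \<longleftrightarrow> finite A \<and> A \<subseteq> T \<and> (\<forall>\<kappa>\<in>K. real_of_int (c \<kappa>) = (\<Sum>i\<in>A. q i * real_of_int (f i \<kappa>)))"
    for A :: "'i set" and q :: "'i \<Rightarrow> real"
  have "P (Poly_Mapping.keys d) (\<lambda>i. real_of_int (Poly_Mapping.lookup d i) / real_of_int N)"
    unfolding P_def
  proof (intro conjI ballI)
    fix \<kappa> assume "\<kappa> \<in> K"
    from c[OF this] have "real_of_int N * real_of_int (c \<kappa>) = (\<Sum>i\<in>Poly_Mapping.keys d. real_of_int (Poly_Mapping.lookup d i) * real_of_int (f i \<kappa>))"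
      by (metis (no_types, lifting) of_int_mult of_int_sum sum.cong)
    then have "real_of_int (c \<kappa>) = (\<Sum>i\<in>Poly_Mapping.keys d. real_of_int (Poly_Mapping.lookup d i) * real_of_int (f i \<kappa>)) / real_of_int N"
      using d(2) by (simp add: field_simps)
    then show "real_of_int (c \<kappa>) = (\<Sum>i\<in>Poly_Mapping.keys d. real_of_int (Poly_Mapping.lookup d i) / real_of_int N * real_of_int (f i \<kappa>))"
      by (simp add: sum_divide_distrib)
  qed (use d in auto)
  \<comment> \<open>Among all representations with real coefficients, one of minimal support;
    dividing the integral relation by \<open>N\<close> shows that there is one.\<close>
  then obtain A where A: "\<exists>q. P A q" and min: "\<And>B. \<exists>q. P B q \<Longrightarrow> card A \<le> card B"
    using ex_has_least_nat[of "\<lambda>A. \<exists>q. P A q" _ card] by blast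
  then obtain q where q: "P A q" by blast
  have finA: "finite A" using q by (simp add: P_def)
  have "card A \<le> card K"
  proof (rule ccontr)
    assume "\<not> ?thesis"
    then obtain \<beta> where \<beta>: "\<exists>a\<in>A. \<beta> a \<noteq> 0" "\<And>\<kappa>. \<kappa> \<in> K \<Longrightarrow> (\<Sum>a\<in>A. \<beta> a * real_of_int (f a \<kappa>)) = 0"
      using linear_dependence[OF K finA, of "\<lambda>a \<kappa>. real_of_int (f a \<kappa>)"] by auto
    then obtain a where a: "a \<in> A" "\<beta> a \<noteq> 0" by blast
    \<comment> \<open>The dependency is scaled so that the coefficient of \<open>a\<close> becomes
      0, which shrinks the support.\<close>
    define q' where "q' i = q i - q a / \<beta> a * \<beta> i" for i
    have "P (A - {a}) q'"
      unfolding P_def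
    proof (intro conjI ballI)
      fix \<kappa> assume \<kappa>: "\<kappa> \<in> K"
      have "(\<Sum>i\<in>A - {a}. q' i * real_of_int (f i \<kappa>)) = (\<Sum>i\<in>A. q' i * real_of_int (f i \<kappa>))"
        using a finA by (subst sum.remove[of A a]) (auto simp: q'_def)
      also have "\<dots> = (\<Sum>i\<in>A. q i * real_of_int (f i \<kappa>)) - q a / \<beta> a * (\<Sum>i\<in>A. \<beta> i * real_of_int (f i \<kappa>))"
        by (simp add: q'_def left_diff_distrib sum_subtractf sum_distrib_left mult.assoc)
      finally show "real_of_int (c \<kappa>) = (\<Sum>i\<in>A - {a}. q' i * real_of_int (f i \<kappa>))"
        using q \<kappa> \<beta>(2)[OF \<kappa>] by (simp add: P_def)
    qed (use q in \<open>auto simp: P_def\<close>)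
    then have "card A \<le> card (A - {a})" using min by blast
    then show False using a finA by (metis card_Diff1_less not_le)
  qed
  define d' where "d' = (\<Sum>i\<in>A. Poly_Mapping.single i \<lfloor>q i\<rfloor>)"
  have look: "Poly_Mapping.lookup d' i = (if i \<in> A then \<lfloor>q i\<rfloor> else 0)" for i
    using finA by (simp add: d'_def lookup_sum lookup_single when_def)
  have keys: "Poly_Mapping.keys d' \<subseteq> A"
    by (auto simp: in_keys_iff look split: if_splits)
  have box: "\<bar>c \<kappa> - (\<Sum>i\<in>Poly_Mapping.keys d'. Poly_Mapping.lookup d' i * f i \<kappa>)\<bar> \<le> b * int (card K)" if \<kappa>: "\<kappa> \<in> K" for \<kappa>
  proof -
    have "(\<Sum>i\<in>Poly_Mapping.keys d'. Poly_Mapping.lookup d' i * f i \<kappa>) = (\<Sum>i\<in>A. \<lfloor>q i\<rfloor> * f i \<kappa>)"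
      using finA keys by (intro sum.mono_neutral_cong_left) (auto simp: look in_keys_iff)
    then have "real_of_int (c \<kappa> - (\<Sum>i\<in>Poly_Mapping.keys d'. Poly_Mapping.lookup d' i * f i \<kappa>))
      = (\<Sum>i\<in>A. (q i - \<lfloor>q i\<rfloor>) * real_of_int (f i \<kappa>))"
      using q \<kappa> by (simp add: P_def left_diff_distrib sum_subtractf)
    also have "\<bar>\<dots>\<bar> \<le> (\<Sum>i\<in>A. \<bar>(q i - \<lfloor>q i\<rfloor>) * real_of_int (f i \<kappa>)\<bar>)" by (rule sum_abs)
    also have "\<dots> \<le> (\<Sum>i\<in>A. real_of_int b)"
    proof (rule sum_mono)
      fix i assume i: "i \<in> A"
      have "\<bar>q i - \<lfloor>q i\<rfloor>\<bar> \<le> 1" by linarith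
      moreover have "\<bar>real_of_int (f i \<kappa>)\<bar> \<le> real_of_int b"
        using f[of i \<kappa>] i q \<kappa> by (auto simp: P_def)
      ultimately have "\<bar>q i - \<lfloor>q i\<rfloor>\<bar> * \<bar>real_of_int (f i \<kappa>)\<bar> \<le> 1 * real_of_int b"
        using b0 by (intro mult_mono) simp_all
      then show "\<bar>(q i - \<lfloor>q i\<rfloor>) * real_of_int (f i \<kappa>)\<bar> \<le> real_of_int b"
        by (simp only: abs_mult mult_1)
    qed
    also have "\<dots> \<le> real_of_int (b * int (card K))"
      using b0 \<open>card A \<le> card K\<close> by (simp add: mult.commute mult_left_mono)
    finally show ?thesis by linarith
  qed
  have "A \<subseteq> T" using q unfolding P_def by (elim conjE)
  with keys have "Poly_Mapping.keys d' \<subseteq> T" by (rule subset_trans)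
  with box show ?thesis by (intro exI[of _ d'] conjI ballI)
qed

section \<open>Formal sums and linear extension\<close>

lemma frag_extend_frag_extend:
  "frag_extend f (frag_extend g c) = frag_extend (\<lambda>x. frag_extend f (g x)) c"
proof -
  have "Poly_Mapping.keys c \<subseteq> UNIV" by simp
  then show ?thesis
    by (induction c rule: frag_induction) (simp_all add: frag_extend_diff)
qed

lemma keys_frag_extend_subset:
  assumes "\<And>x. x \<in> Poly_Mapping.keys c \<Longrightarrow> Poly_Mapping.keys (f x) \<subseteq> S"
  shows "Poly_Mapping.keys (frag_extend f c) \<subseteq> S"
  using keys_frag_extend[of f c] assms by blast

lemma keys_diff_subset: "Poly_Mapping.keys a \<subseteq> S \<Longrightarrow> Poly_Mapping.keys b \<subseteq> S \<Longrightarrow> Poly_Mapping.keys (a - b) \<subseteq> S"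
  for a b :: "'a \<Rightarrow>\<^sub>0 int"
  using keys_diff[of a b] by blast

lemma keys_add_subset: "Poly_Mapping.keys a \<subseteq> S \<Longrightarrow> Poly_Mapping.keys b \<subseteq> S \<Longrightarrow> Poly_Mapping.keys (a + b) \<subseteq> S"
  for a b :: "'a \<Rightarrow>\<^sub>0 int"
  using keys_add[of a b] by blast

lemma lookup_frag_extend:
  "Poly_Mapping.lookup (frag_extend f c) y = (\<Sum>x\<in>Poly_Mapping.keys c. Poly_Mapping.lookup c x * Poly_Mapping.lookup (f x) y)"
  by (simp add: frag_extend_def lookup_sum)

lemma frag_extend_diff_fun: "frag_extend (\<lambda>x. f x - g x) c = frag_extend f c - frag_extend g c"
  by (intro poly_mapping_eqI) (simp add: lookup_frag_extend lookup_minus right_diff_distrib sum_subtractf)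

lemma lookup_frag_extend_inj:
  assumes "Poly_Mapping.keys c \<subseteq> S" "inj_on g S" "x \<in> S"
  shows "Poly_Mapping.lookup (frag_extend (\<lambda>x. frag_of (g x)) c) (g x) = Poly_Mapping.lookup c x"
  using assms(1)
proof (induction c rule: frag_induction)
  case (one y)
  then show ?case using assms by (auto simp: inj_on_def)
qed (auto simp: frag_extend_diff lookup_minus)

section \<open>Periodic maps and orbit sums\<close>

definition orbit :: "('a \<Rightarrow> 'a) \<Rightarrow> 'a \<Rightarrow> 'a set" where
  "orbit g x = range (\<lambda>j. (g ^^ j) x)"

text \<open>The map is controlled on \<open>S\<close> only. Periodicity replaces an inverse: it
  makes the map injective on \<open>S\<close> and turns forward orbits into full orbits.\<close>

locale periodic_map =
  fixes S :: "'a set" and g :: "'a \<Rightarrow> 'a" and n :: nat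
  assumes n_pos: "n > 0"
    and maps: "x \<in> S \<Longrightarrow> g x \<in> S"
    and periodic: "x \<in> S \<Longrightarrow> (g ^^ n) x = x"
begin

lemma funpow_in: "x \<in> S \<Longrightarrow> (g ^^ j) x \<in> S"
  by (induction j) (auto simp: maps)

lemma inj: "inj_on g S"
proof (rule inj_onI)
  fix x y assume xy: "x \<in> S" "y \<in> S" "g x = g y"
  have "(g ^^ n) z = (g ^^ (n - 1)) (g z)" for z
    using n_pos by (metis Suc_pred' funpow_Suc_right o_apply)
  then show "x = y" using xy periodic by metis
qed

lemma orbit_map: "x \<in> S \<Longrightarrow> orbit g (g x) = orbit g x"
proof
  assume x: "x \<in> S"
  have *: "(g ^^ j) (g x) = (g ^^ Suc j) x" for j by (metis funpow_swap1 funpow.simps(2) o_apply)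
  then show "orbit g (g x) \<subseteq> orbit g x" unfolding orbit_def by (auto simp del: funpow.simps)
  show "orbit g x \<subseteq> orbit g (g x)"
  proof -
    have "(g ^^ j) x \<in> orbit g (g x)" for j
    proof -
      have "(g ^^ j) x = (g ^^ j) ((g ^^ n) x)" using periodic x by simp
      also have "\<dots> = (g ^^ (j + (n - 1))) (g x)"
        using n_pos by (metis "*" Nat.add_diff_assoc Suc_pred' add_Suc_right comp_apply funpow_add less_eq_Suc_le One_nat_def)
      finally show ?thesis unfolding orbit_def by auto
    qed
    then show ?thesis unfolding orbit_def by auto
  qed
qed

lemma orbit_funpow: "x \<in> S \<Longrightarrow> orbit g ((g ^^ j) x) = orbit g x"
  by (induction j) (auto simp: orbit_map funpow_in)

definition rep :: "'a set \<Rightarrow> 'a" where "rep Q = (SOME x. x \<in> Q)"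

lemma rep_orbit: "\<exists>j. rep (orbit g x) = (g ^^ j) x"
proof -
  have "x \<in> orbit g x" unfolding orbit_def by (metis funpow_0 rangeI)
  then have "rep (orbit g x) \<in> orbit g x" unfolding rep_def by (rule someI)
  then show ?thesis by (auto simp: orbit_def)
qed

lemma rep_in: "x \<in> S \<Longrightarrow> rep (orbit g x) \<in> S"
  using rep_orbit[of x] funpow_in by metis

lemma orbit_rep: "x \<in> S \<Longrightarrow> orbit g (rep (orbit g x)) = orbit g x"
  using rep_orbit[of x] orbit_funpow by metis

abbreviation act :: "('a \<Rightarrow>\<^sub>0 int) \<Rightarrow> ('a \<Rightarrow>\<^sub>0 int)" where
  "act \<equiv> frag_extend (\<lambda>x. frag_of (g x))"

abbreviation orbit_chain :: "('a \<Rightarrow>\<^sub>0 int) \<Rightarrow> ('a set \<Rightarrow>\<^sub>0 int)" where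
  "orbit_chain \<equiv> frag_extend (\<lambda>x. frag_of (orbit g x))"

lemma keys_act: "Poly_Mapping.keys c \<subseteq> S \<Longrightarrow> Poly_Mapping.keys (act c) \<subseteq> S"
  by (intro keys_frag_extend_subset) (auto simp: maps)

lemma orbit_chain_act: "Poly_Mapping.keys c \<subseteq> S \<Longrightarrow> orbit_chain (act c) = orbit_chain c"
  by (simp add: frag_extend_frag_extend) (intro frag_extend_eq, auto simp: orbit_map)

lemma invariant_lookup:
  assumes c: "Poly_Mapping.keys c \<subseteq> S" "act c = c" and x: "x \<in> S"
  shows "Poly_Mapping.lookup c (rep (orbit g x)) = Poly_Mapping.lookup c x"
proof -
  have 1: "Poly_Mapping.lookup c (g y) = Poly_Mapping.lookup c y" if "y \<in> S" for y
    using lookup_frag_extend_inj[OF c(1) inj that] c(2) by simp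
  have "Poly_Mapping.lookup c ((g ^^ j) x) = Poly_Mapping.lookup c x" for j
    by (induction j) (auto simp: 1 funpow_in x)
  then show ?thesis using rep_orbit[of x] by metis
qed

text \<open>The coinvariants of a permutation module are free on the orbits. A difference of two
  points of one orbit telescopes into \<open>act y - y\<close>. Replacing all points by the
  representatives of their orbits turns \<open>c\<close> into a chain that depends on the orbit sum
  of \<open>c\<close> alone, hence into 0.\<close>

lemma orbit_chain_kernel:
  assumes c: "Poly_Mapping.keys c \<subseteq> S" "orbit_chain c = 0"
  shows "\<exists>y. Poly_Mapping.keys y \<subseteq> S \<and> c = act y - y"
proof -
  have "\<exists>y. Poly_Mapping.keys y \<subseteq> S \<and> frag_of ((g ^^ j) x) - frag_of x = act y - y" if x: "x \<in> S" for x j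
  proof (induction j)
    case (Suc j)
    then obtain y where y: "Poly_Mapping.keys y \<subseteq> S" "frag_of ((g ^^ j) x) - frag_of x = act y - y" by blast
    have "frag_of ((g ^^ Suc j) x) - frag_of x = act (y + frag_of ((g ^^ j) x)) - (y + frag_of ((g ^^ j) x))"
    proof -
      have "act (y + frag_of ((g ^^ j) x)) - (y + frag_of ((g ^^ j) x)) =
        (act y - y) + frag_of (g ((g ^^ j) x)) - frag_of ((g ^^ j) x)"
        by (simp add: frag_extend_add)
      then show ?thesis by (simp flip: y(2))
    qed
    moreover have "Poly_Mapping.keys (y + frag_of ((g ^^ j) x)) \<subseteq> S"
      using y(1) x funpow_in by (intro keys_add_subset) auto
    ultimately show ?case by blast
  qed (auto intro!: exI[of _ 0])
  then have "\<forall>x\<in>S. \<exists>y. Poly_Mapping.keys y \<subseteq> S \<and> frag_of (rep (orbit g x)) - frag_of x = act y - y"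
    using rep_orbit by metis
  then obtain y where y: "\<And>x. x \<in> S \<Longrightarrow> Poly_Mapping.keys (y x) \<subseteq> S"
    "\<And>x. x \<in> S \<Longrightarrow> frag_of (rep (orbit g x)) - frag_of x = act (y x) - y x" by metis
  define Y where "Y = frag_extend y c"
  have "act Y - Y = frag_extend (\<lambda>x. act (y x) - y x) c"
    unfolding Y_def frag_extend_frag_extend frag_extend_diff_fun ..
  also have "\<dots> = frag_extend (\<lambda>x. frag_of (rep (orbit g x)) - frag_of x) c"
    using c y(2) by (intro frag_extend_eq) auto
  also have "\<dots> = frag_extend (\<lambda>x. frag_of (rep (orbit g x))) c - frag_extend frag_of c"
    by (rule frag_extend_diff_fun)
  also have "frag_extend (\<lambda>x. frag_of (rep (orbit g x))) c = frag_extend (\<lambda>Q. frag_of (rep Q)) (orbit_chain c)"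
    by (simp add: frag_extend_frag_extend)
  finally have "act Y - Y = - c" using c(2) frag_expansion[of c] by simp
  then have "c = act (- Y) - (- Y)" by (simp add: frag_extend_minus algebra_simps)
  moreover have "Poly_Mapping.keys (- Y) \<subseteq> S"
    using c y(1) unfolding Y_def keys_minus by (intro keys_frag_extend_subset) auto
  ultimately show ?thesis by blast
qed

end

section \<open>Edge chains of a graph with a periodic symmetry\<close>

abbreviation edge_boundary :: "('v \<times> 'v \<Rightarrow>\<^sub>0 int) \<Rightarrow> ('v \<Rightarrow>\<^sub>0 int)" where
  "edge_boundary \<equiv> frag_extend (\<lambda>e. frag_of (snd e) - frag_of (fst e))"

locale graph_action =
  fixes V :: "'v set" and E :: "('v \<times> 'v) set" and h :: "'v \<Rightarrow> 'v" and n :: nat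
  assumes finite_V: "finite V" and V_nonempty: "V \<noteq> {}" and E_subset: "E \<subseteq> V \<times> V" and n_pos: "n > 0"
    and h_V: "v \<in> V \<Longrightarrow> h v \<in> V"
    and h_E: "e \<in> E \<Longrightarrow> map_prod h h e \<in> E"
    and h_periodic: "v \<in> V \<Longrightarrow> (h ^^ n) v = v"
    and connected: "a \<in> V \<Longrightarrow> b \<in> V \<Longrightarrow>
      \<exists>y. Poly_Mapping.keys y \<subseteq> E \<and> edge_boundary y = frag_of b - frag_of a"
begin

lemma funpow_map_prod: "(map_prod h h ^^ j) e = ((h ^^ j) (fst e), (h ^^ j) (snd e))"
  by (induction j) (auto simp: map_prod_def split_beta)

sublocale V: periodic_map V h n
  by unfold_locales (auto simp: n_pos h_V h_periodic)

sublocale E: periodic_map E "map_prod h h" n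
  using E_subset by unfold_locales (auto simp: n_pos h_E funpow_map_prod h_periodic)

lemma finite_E: "finite E"
  using finite_V E_subset by (meson finite_SigmaI finite_subset)

lemma keys_edge_boundary: "Poly_Mapping.keys c \<subseteq> E \<Longrightarrow> Poly_Mapping.keys (edge_boundary c) \<subseteq> V"
proof (intro keys_frag_extend_subset keys_diff_subset)
  fix e assume "Poly_Mapping.keys c \<subseteq> E" "e \<in> Poly_Mapping.keys c"
  then have "e \<in> V \<times> V" using E_subset by blast
  then show "Poly_Mapping.keys (frag_of (snd e)) \<subseteq> V" "Poly_Mapping.keys (frag_of (fst e)) \<subseteq> V" by auto
qed

lemma edge_boundary_act: "edge_boundary (E.act c) = V.act (edge_boundary c)"
  by (simp add: frag_extend_frag_extend frag_extend_diff)

lemma augmentation_edge_boundary: "frag_extend (\<lambda>_. frag_of ()) (edge_boundary c) = 0"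
  unfolding frag_extend_frag_extend by (rule frag_extend_eq_0) (simp add: frag_extend_diff)

text \<open>A chain with coefficient sum 0 is a combination of differences \<open>v - v0\<close>,
  and each of these is a boundary by connectedness.\<close>

lemma augmentation_kernel:
  assumes c: "Poly_Mapping.keys c \<subseteq> V" "frag_extend (\<lambda>_. frag_of ()) c = 0"
  shows "\<exists>y. Poly_Mapping.keys y \<subseteq> E \<and> edge_boundary y = c"
proof -
  obtain v0 where v0: "v0 \<in> V" using V_nonempty by blast
  have "\<forall>v\<in>V. \<exists>y. Poly_Mapping.keys y \<subseteq> E \<and> edge_boundary y = frag_of v - frag_of v0"
    using connected[OF v0] by simp
  from bchoice[OF this] obtain y where "\<forall>v\<in>V. Poly_Mapping.keys (y v) \<subseteq> E \<and> edge_boundary (y v) = frag_of v - frag_of v0" ..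
  then have y: "\<And>v. v \<in> V \<Longrightarrow> Poly_Mapping.keys (y v) \<subseteq> E"
    "\<And>v. v \<in> V \<Longrightarrow> edge_boundary (y v) = frag_of v - frag_of v0" by auto
  have "edge_boundary (frag_extend y c) = frag_extend (\<lambda>v. frag_of v - frag_of v0) c"
    unfolding frag_extend_frag_extend using c y(2) by (intro frag_extend_eq) auto
  also have "\<dots> = frag_extend frag_of c - frag_extend (\<lambda>_. frag_of v0) (frag_extend (\<lambda>_. frag_of ()) c)"
    by (simp add: frag_extend_diff_fun frag_extend_frag_extend)
  also have "\<dots> = c" by (simp add: c(2) frag_expansion[symmetric])
  finally show ?thesis
    using c y(1) by (intro exI[of _ "frag_extend y c"] conjI keys_frag_extend_subset) auto
qed

definition cycle :: "('v \<times> 'v \<Rightarrow>\<^sub>0 int) \<Rightarrow> bool" where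
  "cycle c \<longleftrightarrow> Poly_Mapping.keys c \<subseteq> E \<and> edge_boundary c = 0"

lemma cycle_0 [simp]: "cycle 0" by (simp add: cycle_def)

lemma cycle_diff: "cycle a \<Longrightarrow> cycle b \<Longrightarrow> cycle (a - b)"
  by (simp add: cycle_def keys_diff_subset frag_extend_diff)

lemma cycle_add: "cycle a \<Longrightarrow> cycle b \<Longrightarrow> cycle (a + b)"
  by (simp add: cycle_def keys_add_subset frag_extend_add)

lemma cycle_act: "cycle a \<Longrightarrow> cycle (E.act a)"
  by (simp add: cycle_def E.keys_act edge_boundary_act)

text \<open>\<open>y\<close> itself need not be closed: the boundary commutes with the action, so an
  invariant boundary cancels.\<close>

lemma cycle_act_diff:
  "Poly_Mapping.keys y \<subseteq> E \<Longrightarrow> V.act (edge_boundary y) = edge_boundary y \<Longrightarrow> cycle (E.act y - y)"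
  by (simp add: cycle_def E.keys_act keys_diff_subset edge_boundary_act frag_extend_diff)

end

text \<open>Abstract form of the nerve of a branched cover, with \<open>G\<close> its first homology
  and \<open>T\<close> the triangle relations. Torsion and relations are tied together by
  \<open>torsion_lift\<close>: a torsion class comes from a cycle with a positive multiple that is
  an integral combination of relations.\<close>

locale graph_realization = graph_action V E h n + G: comm_group G
  for V :: "'v set" and E h n and G :: "('g, 'b) monoid_scheme" +
  fixes T :: "('v \<times> 'v \<Rightarrow>\<^sub>0 int) set" and realize :: "('v \<times> 'v \<Rightarrow>\<^sub>0 int) \<Rightarrow> 'g"
  assumes relator_form: "t \<in> T \<Longrightarrow> \<exists>e1\<in>E. \<exists>e2\<in>E. \<exists>e3\<in>E. t = frag_of e1 + frag_of e2 - frag_of e3"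
    and relator_cycle: "t \<in> T \<Longrightarrow> edge_boundary t = 0"
    and realize_carrier: "cycle c \<Longrightarrow> realize c \<in> carrier G"
    and realize_add: "cycle a \<Longrightarrow> cycle b \<Longrightarrow> realize (a + b) = realize a \<otimes>\<^bsub>G\<^esub> realize b"
    and realize_relator: "t \<in> T \<Longrightarrow> realize t = \<one>\<^bsub>G\<^esub>"
    and realize_act: "cycle c \<Longrightarrow> realize (E.act c) = realize c"
    and torsion_lift: "x \<in> torsion_part G \<Longrightarrow>
      \<exists>c N d. cycle c \<and> realize c = x \<and> N > 0 \<and> Poly_Mapping.keys d \<subseteq> T \<and> frag_cmul N c = frag_extend id d"
begin

lemma relator: "t \<in> T \<Longrightarrow> cycle t"
proof -
  assume t: "t \<in> T"
  then obtain e1 e2 e3 where "e1 \<in> E" "e2 \<in> E" "e3 \<in> E" "t = frag_of e1 + frag_of e2 - frag_of e3"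
    using relator_form by blast
  then have "Poly_Mapping.keys t \<subseteq> E" by (simp add: keys_diff_subset keys_add_subset)
  then show ?thesis using relator_cycle[OF t] by (simp add: cycle_def)
qed

lemma real_0: "realize 0 = \<one>\<^bsub>G\<^esub>"
  using realize_add[of 0 0] realize_carrier[of 0] G.l_cancel_one[of "realize 0" "realize 0"] by simp

lemma realize_diff: "cycle a \<Longrightarrow> cycle b \<Longrightarrow> realize (a - b) = realize a \<otimes>\<^bsub>G\<^esub> inv\<^bsub>G\<^esub> realize b"
  using realize_add[of "a - b" b] realize_carrier[of a] realize_carrier[of b] realize_carrier[of "a - b"] cycle_diff[of a b]
    G.inv_solve_right[of "realize (a - b)" "realize a" "realize b"] by simp

lemma realize_eq_iff: "cycle a \<Longrightarrow> cycle b \<Longrightarrow> realize a = realize b \<longleftrightarrow> realize (a - b) = \<one>\<^bsub>G\<^esub>"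
proof -
  assume ab: "cycle a" "cycle b"
  have "realize a = realize b \<longleftrightarrow> realize a = \<one>\<^bsub>G\<^esub> \<otimes>\<^bsub>G\<^esub> realize b"
    by (simp only: G.l_one[OF realize_carrier[OF ab(2)]])
  also have "\<dots> \<longleftrightarrow> \<one>\<^bsub>G\<^esub> = realize (a - b)"
    unfolding realize_diff[OF ab] by (intro G.inv_solve_right[symmetric] realize_carrier ab G.one_closed)
  finally show ?thesis by (simp only: eq_commute)
qed

lemma realize_span:
  assumes "Poly_Mapping.keys d \<subseteq> T"
  shows "cycle (frag_extend id d) \<and> realize (frag_extend id d) = \<one>\<^bsub>G\<^esub>"
  using assms
proof (induction d rule: frag_induction)
  case (diff a b)
  then show ?case by (simp add: frag_extend_diff cycle_diff realize_diff)
qed (auto simp: real_0 relator realize_relator)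

lemma realize_sum:
  assumes "\<And>i. i < m \<Longrightarrow> cycle (f i)" "\<And>i. i < m \<Longrightarrow> realize (f i) = x" "x \<in> carrier G"
  shows "cycle (\<Sum>i<m. f i) \<and> realize (\<Sum>i<m. f i) = x [^]\<^bsub>G\<^esub> (m::nat)"
  using assms(1,2) by (induction m) (auto simp: real_0 cycle_add realize_add)

text \<open>For \<open>w = h y - y\<close> a cycle, \<open>n w\<close> and the sum of its \<open>n\<close> translates, which telescopes to
  \<open>0\<close>, have the same realization.\<close>

lemma realize_act_diff_power:
  assumes y: "Poly_Mapping.keys y \<subseteq> E" and inv: "V.act (edge_boundary y) = edge_boundary y"
  shows "realize (E.act y - y) [^]\<^bsub>G\<^esub> n = \<one>\<^bsub>G\<^esub>"
proof -
  define w where "w = E.act y - y"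
  have w: "cycle w" unfolding w_def by (rule cycle_act_diff[OF y inv])
  have 1: "cycle ((E.act ^^ j) w) \<and> realize ((E.act ^^ j) w) = realize w" for j
    by (induction j) (auto simp: w cycle_act realize_act)
  have 2: "(\<Sum>j<m. (E.act ^^ j) w) = (E.act ^^ m) y - y" for m
  proof (induction m)
    case (Suc m)
    have "(E.act ^^ m) w = (E.act ^^ m) (E.act y) - (E.act ^^ m) y"
      unfolding w_def by (induction m) (simp_all add: frag_extend_diff)
    then show ?case using Suc funpow_swap1[of E.act m y] by simp
  qed simp
  have 3: "(E.act ^^ n) y = y"
  proof -
    have "(E.act ^^ m) y = frag_extend (\<lambda>e. frag_of ((map_prod h h ^^ m) e)) y" for m
    proof (induction m)
      case 0 show ?case by (simp add: frag_expansion[symmetric])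
    next
      case (Suc m) then show ?case by (simp add: frag_extend_frag_extend)
    qed
    then have "(E.act ^^ n) y = frag_extend (\<lambda>e. frag_of ((map_prod h h ^^ n) e)) y" .
    also have "\<dots> = frag_extend frag_of y"
    proof (rule frag_extend_eq)
      fix e assume "e \<in> Poly_Mapping.keys y"
      with y have "e \<in> E" by blast
      then show "frag_of ((map_prod h h ^^ n) e) = frag_of e" by (simp only: E.periodic)
    qed
    also have "\<dots> = y" by (rule frag_expansion[symmetric])
    finally show ?thesis .
  qed
  have "realize (\<Sum>j<n. (E.act ^^ j) w) = realize w [^]\<^bsub>G\<^esub> n"
    using realize_sum[of n "\<lambda>j. (E.act ^^ j) w" "realize w"] 1 realize_carrier[OF w] by blast
  moreover have "(\<Sum>j<n. (E.act ^^ j) w) = 0" unfolding 2 3 by simp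
  ultimately have "realize w [^]\<^bsub>G\<^esub> n = \<one>\<^bsub>G\<^esub>" using real_0 by simp
  then show ?thesis unfolding w_def .
qed

end

section \<open>Counting torsion classes\<close>

context graph_realization
begin

text \<open>A relation consists of three edges, so its orbit sum has coefficients of size at most 3.
  Subtracting relations keeps the class and moves the orbit sum of its lift into the box.\<close>

lemma lift_in_box:
  assumes x: "x \<in> torsion_part G"
  shows "\<exists>c. cycle c \<and> realize c = x \<and>
    (\<forall>Q\<in>orbit (map_prod h h) ` E. \<bar>Poly_Mapping.lookup (E.orbit_chain c) Q\<bar> \<le> 3 * int (card (orbit (map_prod h h) ` E)))"
proof -
  obtain c N d where c: "cycle c" "realize c = x" "N > 0" "Poly_Mapping.keys d \<subseteq> T" "frag_cmul N c = frag_extend id d"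
    using torsion_lift[OF x] by blast
  let ?K = "orbit (map_prod h h) ` E" and ?f = "\<lambda>t. Poly_Mapping.lookup (E.orbit_chain t)"
  have span: "?f (frag_extend id d') Q = (\<Sum>t\<in>Poly_Mapping.keys d'. Poly_Mapping.lookup d' t * ?f t Q)" for d' Q
    by (simp only: frag_extend_frag_extend lookup_frag_extend[of "E.orbit_chain"] id_apply)
  have "\<exists>d'. Poly_Mapping.keys d' \<subseteq> T \<and>
    (\<forall>Q\<in>?K. \<bar>?f c Q - (\<Sum>t\<in>Poly_Mapping.keys d'. Poly_Mapping.lookup d' t * ?f t Q)\<bar> \<le> 3 * int (card ?K))"
  proof (rule torsion_representative_in_box)
    show "finite ?K" using finite_E by simp
    show "\<bar>?f t Q\<bar> \<le> 3" if "t \<in> T" for t Q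
      using relator_form[OF that] by (auto simp: frag_extend_add frag_extend_diff lookup_add lookup_minus)
    show "N * ?f c Q = (\<Sum>t\<in>Poly_Mapping.keys d. Poly_Mapping.lookup d t * ?f t Q)" for Q
      unfolding span[symmetric] c(5)[symmetric] by (simp add: frag_extend_cmul)
  qed (use c in auto)
  then obtain d' where d': "Poly_Mapping.keys d' \<subseteq> T"
    "\<And>Q. Q \<in> ?K \<Longrightarrow> \<bar>?f c Q - ?f (frag_extend id d') Q\<bar> \<le> 3 * int (card ?K)"
    unfolding span[symmetric] by blast
  have s: "cycle (frag_extend id d')" "realize (frag_extend id d') = \<one>\<^bsub>G\<^esub>" using realize_span[OF d'(1)] by auto
  have "realize (c - frag_extend id d') = x"
    using realize_diff[OF c(1) s(1)] s(2) c(2) realize_carrier[OF c(1)] by simp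
  moreover have "?f (c - frag_extend id d') Q = ?f c Q - ?f (frag_extend id d') Q" for Q
    by (simp only: frag_extend_diff lookup_minus)
  ultimately show ?thesis using d'(2) cycle_diff[OF c(1) s(1)] by (intro exI[of _ "c - frag_extend id d'"]) simp
qed

text \<open>For \<open>z = y - y'\<close> the boundary is invariant and divisible by
  \<open>n\<close>, say \<open>n c\<close>, and \<open>c\<close> is again the boundary of some
  \<open>u\<close>. Then \<open>z - n u\<close> is a cycle, so the action does not change its class;
  the remaining part is \<open>n\<close> times \<open>E.act u - u\<close>, and
  \<open>realize_act_diff_power\<close> says that it vanishes.\<close>

lemma realize_act_diff_cong:
  assumes y: "Poly_Mapping.keys y \<subseteq> E" "cycle (E.act y - y)"
    and y': "Poly_Mapping.keys y' \<subseteq> E" "cycle (E.act y' - y')"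
    and cong: "\<And>Q. Q \<in> orbit h ` V \<Longrightarrow> Poly_Mapping.lookup (edge_boundary y) (V.rep Q) mod int n
                  = Poly_Mapping.lookup (edge_boundary y') (V.rep Q) mod int n"
  shows "realize (E.act y - y) = realize (E.act y' - y')"
proof -
  define z where "z = y - y'"
  have z: "Poly_Mapping.keys z \<subseteq> E" using y y' by (simp add: z_def keys_diff_subset)
  have zeq: "E.act z - z = (E.act y - y) - (E.act y' - y')" by (simp add: z_def frag_extend_diff)
  then have zc: "cycle (E.act z - z)" using cycle_diff[OF y(2) y'(2)] by simp
  define b where "b = edge_boundary z"
  have bV: "Poly_Mapping.keys b \<subseteq> V" unfolding b_def using z by (rule keys_edge_boundary)
  have binv: "V.act b = b"
    using zc unfolding cycle_def b_def by (simp add: frag_extend_diff edge_boundary_act)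
  \<comment> \<open>An invariant chain is determined by its coefficients at the orbit
    representatives, so divisibility spreads from there to all vertices.\<close>
  have dvd: "int n dvd Poly_Mapping.lookup b v" for v
  proof (cases "v \<in> V")
    case True
    have "int n dvd Poly_Mapping.lookup b (V.rep (orbit h v))"
      using cong[of "orbit h v"] True unfolding b_def z_def by (simp add: frag_extend_diff lookup_minus mod_eq_dvd_iff)
    then show ?thesis using V.invariant_lookup[OF bV binv True] by simp
  next
    case False
    then have "Poly_Mapping.lookup b v = 0" using bV by (auto simp: in_keys_iff)
    then show ?thesis by simp
  qed
  define c where "c = (\<Sum>v\<in>Poly_Mapping.keys b. frag_cmul (Poly_Mapping.lookup b v div int n) (frag_of v))"
  have lc: "Poly_Mapping.lookup c v = Poly_Mapping.lookup b v div int n" for v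
  proof -
    have "Poly_Mapping.lookup c v = (\<Sum>w\<in>Poly_Mapping.keys b. if v = w then Poly_Mapping.lookup b w div int n else 0)"
      unfolding c_def lookup_sum by (intro sum.cong) auto
    then show ?thesis by (simp add: in_keys_iff)
  qed
  have bc: "b = frag_cmul (int n) c"
    by (intro poly_mapping_eqI) (simp add: lc dvd)
  have "Poly_Mapping.keys c \<subseteq> Poly_Mapping.keys b"
    unfolding subset_iff in_keys_iff lc by auto
  then have cV: "Poly_Mapping.keys c \<subseteq> V" using bV by (rule subset_trans)
  have n0: "int n \<noteq> 0" using n_pos by simp
  have cancel: "a = 0" if "frag_cmul (int n) a = 0" for a :: "'z \<Rightarrow>\<^sub>0 int"
    using that n0 by simp
  have "frag_cmul (int n) (V.act c - c) = 0"
    using binv unfolding bc frag_extend_cmul by (simp add: algebra_simps poly_mapping_eq_iff lookup_minus fun_eq_iff)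
  then have "V.act c - c = 0" using n0 by simp
  then have cinv: "V.act c = c" by simp
  \<comment> \<open>A boundary has coefficient sum 0; this persists after division by
    \<open>n\<close>, so \<open>c\<close> is a boundary too.\<close>
  have "frag_extend (\<lambda>_. frag_of ()) b = 0" unfolding b_def by (rule augmentation_edge_boundary)
  then have "frag_extend (\<lambda>_. frag_of ()) c = 0" unfolding bc frag_extend_cmul using n0 by simp
  then obtain u where u: "Poly_Mapping.keys u \<subseteq> E" "edge_boundary u = c" using augmentation_kernel[OF cV] by blast
  define w where "w = z - frag_cmul (int n) u"
  have w: "cycle w"
    unfolding cycle_def w_def
  proof
    show "Poly_Mapping.keys (z - frag_cmul (int n) u) \<subseteq> E"
      using z u(1) keys_cmul[of "int n" u] by (meson keys_diff_subset subset_trans)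
    show "edge_boundary (z - frag_cmul (int n) u) = 0"
      by (simp add: frag_extend_diff frag_extend_cmul u(2) bc[symmetric] b_def[symmetric])
  qed
  define v where "v = E.act u - u"
  have v: "cycle v" unfolding v_def by (rule cycle_act_diff) (simp_all add: u cinv)
  have power: "cycle (frag_cmul (int m) v) \<and> realize (frag_cmul (int m) v) = realize v [^]\<^bsub>G\<^esub> m" for m
  proof (induction m)
    case (Suc m)
    have "frag_cmul (int (Suc m)) v = frag_cmul (int m) v + v"
      using frag_cmul_distrib[of "int m" 1 v] by (simp add: add.commute)
    then show ?case using Suc v by (simp add: cycle_add realize_add)
  qed (simp add: real_0)
  have "realize v [^]\<^bsub>G\<^esub> n = \<one>\<^bsub>G\<^esub>"
    unfolding v_def by (rule realize_act_diff_power[OF u(1)]) (simp add: u cinv)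
  then have r1: "realize (frag_cmul (int n) v) = \<one>\<^bsub>G\<^esub>" using power by simp
  have r2: "realize (E.act w - w) = \<one>\<^bsub>G\<^esub>"
    using realize_diff[OF cycle_act[OF w] w] realize_act[OF w] realize_carrier[OF w] by simp
  have "E.act z - z = (E.act w - w) + frag_cmul (int n) v"
    unfolding w_def v_def by (intro poly_mapping_eqI) (simp add: frag_extend_diff frag_extend_cmul lookup_minus lookup_add algebra_simps)
  then have "realize (E.act z - z) = \<one>\<^bsub>G\<^esub>"
    using realize_add[OF cycle_diff[OF cycle_act[OF w] w], of "frag_cmul (int n) v"] power r1 r2 by simp
  then show ?thesis unfolding zeq by (simp only: realize_eq_iff[OF y(2) y'(2)])
qed

text \<open>A class is encoded by two data: the orbit sum of its lift, which lies in a box, and the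
  boundary modulo \<open>n\<close> of a chain that compares this lift with the lift of a reference
  class with the same orbit sum. By invariance the boundary is recorded at one vertex per
  orbit.\<close>

theorem card_torsion_le:
  shows "finite (torsion_part G)"
    and "card (torsion_part G) \<le> n ^ card (orbit h ` V) *
           (6 * card (orbit (map_prod h h) ` E) + 1) ^ card (orbit (map_prod h h) ` E)"
proof -
  let ?K = "orbit (map_prod h h) ` E" and ?L = "orbit h ` V"
  define b where "b = 3 * int (card ?K)"
  from bchoice[of "torsion_part G", OF ballI[OF lift_in_box]]
  obtain c where "\<forall>x\<in>torsion_part G. cycle (c x) \<and> realize (c x) = x \<and> (\<forall>Q\<in>?K. \<bar>Poly_Mapping.lookup (E.orbit_chain (c x)) Q\<bar> \<le> b)"
    unfolding b_def ..
  then have c: "\<And>x. x \<in> torsion_part G \<Longrightarrow> cycle (c x)" "\<And>x. x \<in> torsion_part G \<Longrightarrow> realize (c x) = x"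
    "\<And>x Q. x \<in> torsion_part G \<Longrightarrow> Q \<in> ?K \<Longrightarrow> \<bar>Poly_Mapping.lookup (E.orbit_chain (c x)) Q\<bar> \<le> b"
    by auto
  define key1 where "key1 x = restrict (Poly_Mapping.lookup (E.orbit_chain (c x))) ?K" for x
  \<comment> \<open>The choice depends on \<open>x\<close> only through \<open>key1 x\<close>, so
    classes with equal orbit sums share one reference class.\<close>
  define base where "base x = (SOME x'. x' \<in> torsion_part G \<and> key1 x' = key1 x)" for x
  have base: "base x \<in> torsion_part G \<and> key1 (base x) = key1 x" if "x \<in> torsion_part G" for x
    unfolding base_def by (rule someI[of _ x]) (use that in simp)
  have "\<exists>y. Poly_Mapping.keys y \<subseteq> E \<and> c x - c (base x) = E.act y - y" if x: "x \<in> torsion_part G" for x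
  proof (rule E.orbit_chain_kernel)
    have cE: "Poly_Mapping.keys (c x) \<subseteq> E" if "x \<in> torsion_part G" for x using c(1)[OF that] by (simp add: cycle_def)
    show "Poly_Mapping.keys (c x - c (base x)) \<subseteq> E"
      using cE x base by (intro keys_diff_subset) auto
    show "E.orbit_chain (c x - c (base x)) = 0"
    proof (rule poly_mapping_eqI)
      fix Q show "Poly_Mapping.lookup (E.orbit_chain (c x - c (base x))) Q = Poly_Mapping.lookup 0 Q"
      proof (cases "Q \<in> ?K")
        case True
        have "key1 (base x) Q = key1 x Q" using base[OF x] by simp
        with True have "Poly_Mapping.lookup (E.orbit_chain (c (base x))) Q = Poly_Mapping.lookup (E.orbit_chain (c x)) Q"
          by (simp only: key1_def restrict_apply if_True)
        then show ?thesis by (simp add: frag_extend_diff lookup_minus)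
      next
        case False
        have "Poly_Mapping.keys (E.orbit_chain (c x - c (base x))) \<subseteq> ?K"
          using cE x base by (intro keys_frag_extend_subset) (metis (no_types, lifting) keys_diff_subset image_eqI keys_frag_of singletonD subsetD subsetI)
        with False show ?thesis by (auto simp: in_keys_iff)
      qed
    qed
  qed
  then have "\<forall>x\<in>torsion_part G. \<exists>y. Poly_Mapping.keys y \<subseteq> E \<and> c x - c (base x) = E.act y - y" by blast
  from bchoice[OF this] obtain y where "\<forall>x\<in>torsion_part G. Poly_Mapping.keys (y x) \<subseteq> E \<and> c x - c (base x) = E.act (y x) - y x" ..
  then have y: "\<And>x. x \<in> torsion_part G \<Longrightarrow> Poly_Mapping.keys (y x) \<subseteq> E"
    "\<And>x. x \<in> torsion_part G \<Longrightarrow> c x - c (base x) = E.act (y x) - y x" by auto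
  define key2 where "key2 x = (\<lambda>Q\<in>?L. Poly_Mapping.lookup (edge_boundary (y x)) (V.rep Q) mod int n)" for x
  let ?B = "(?L \<rightarrow>\<^sub>E {0..<int n}) \<times> (?K \<rightarrow>\<^sub>E {-b..b})"
  have inj: "inj_on (\<lambda>x. (key2 x, key1 x)) (torsion_part G)"
  proof (rule inj_onI)
    fix x x' assume x: "x \<in> torsion_part G" and x': "x' \<in> torsion_part G" and "(key2 x, key1 x) = (key2 x', key1 x')"
    then have k: "key2 x = key2 x'" "key1 x = key1 x'" by auto
    then have b': "base x = base x'" by (simp add: base_def)
    have "realize (E.act (y x) - y x) = realize (E.act (y x') - y x')"
    proof (rule realize_act_diff_cong)
      show "cycle (E.act (y x) - y x)" "cycle (E.act (y x') - y x')"
        using c(1) base x x' y(2) cycle_diff by metis+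
      fix Q assume Q: "Q \<in> ?L"
      show "Poly_Mapping.lookup (edge_boundary (y x)) (V.rep Q) mod int n
                  = Poly_Mapping.lookup (edge_boundary (y x')) (V.rep Q) mod int n"
        using fun_cong[OF k(1), of Q] Q by (simp only: key2_def restrict_apply if_True)
    qed (use y x x' in auto)
    then have "realize (c x - c (base x)) = realize (c x' - c (base x))" using y(2)[OF x] y(2)[OF x'] b' by simp
    moreover have cb: "cycle (c (base x))" using base[OF x] c(1) by blast
    ultimately have "realize (c x) \<otimes>\<^bsub>G\<^esub> inv\<^bsub>G\<^esub> realize (c (base x)) = realize (c x') \<otimes>\<^bsub>G\<^esub> inv\<^bsub>G\<^esub> realize (c (base x))"
      using realize_diff c(1) x x' by simp
    then show "x = x'" using c(1,2) x x' cb realize_carrier by (metis G.inv_closed G.right_cancel)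
  qed
  have sub: "(\<lambda>x. (key2 x, key1 x)) ` torsion_part G \<subseteq> ?B"
  proof (rule image_subsetI)
    fix x assume x: "x \<in> torsion_part G"
    have "key1 x \<in> ?K \<rightarrow>\<^sub>E {-b..b}"
      unfolding key1_def
    proof (intro restrict_PiE_iff[THEN iffD2] ballI)
      fix Q assume "Q \<in> ?K"
      from c(3)[OF x this] show "Poly_Mapping.lookup (E.orbit_chain (c x)) Q \<in> {-b..b}" by auto
    qed
    moreover have "key2 x \<in> ?L \<rightarrow>\<^sub>E {0..<int n}"
      unfolding key2_def using n_pos by (intro restrict_PiE_iff[THEN iffD2] ballI) auto
    ultimately show "(key2 x, key1 x) \<in> ?B" by blast
  qed
  have fin: "finite ?B" using finite_V finite_E by (intro finite_cartesian_product finite_PiE) auto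
  show "finite (torsion_part G)" using inj_on_finite[OF inj sub fin] .
  have "card (torsion_part G) \<le> card ?B" by (rule card_inj_on_le[OF inj sub fin])
  also have "card ?B = n ^ card ?L * card {-b..b} ^ card ?K"
    using finite_V finite_E by (simp add: card_cartesian_product card_PiE)
  also have "card {-b..b} = 6 * card ?K + 1" unfolding b_def by simp
  finally show "card (torsion_part G) \<le> n ^ card ?L * (6 * card ?K + 1) ^ card ?K" .
qed

end

section \<open>First homology\<close>

text \<open>Keeps the degree of \<^term>\<open>homology_group 1\<close> in one normal form.\<close>

declare One_nat_def [simp del]

abbreviation H1 :: "'a::topological_space set \<Rightarrow> 'a chain set monoid" where
  "H1 S \<equiv> homology_group 1 (top_of_set S)"

abbreviation cycle1 :: "'a::topological_space set \<Rightarrow> 'a chain \<Rightarrow> bool" where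
  "cycle1 S \<equiv> singular_relcycle 1 (top_of_set S) {}"

abbreviation class1 :: "'a::topological_space set \<Rightarrow> 'a chain \<Rightarrow> 'a chain set" where
  "class1 S \<equiv> homologous_rel_set 1 (top_of_set S) {}"

lemma carrier_H1: "carrier (H1 S) = class1 S ` Collect (cycle1 S)"
  using carrier_relative_homology_group[of 1 "top_of_set S" "{}"] by simp

lemma one_H1: "\<one>\<^bsub>H1 S\<^esub> = Collect (null_chain S)"
  using one_relative_homology_group[of 1 "top_of_set S" "{}"] by simp

lemma class1_in_carrier: "cycle1 S c \<Longrightarrow> class1 S c \<in> carrier (H1 S)"
  unfolding carrier_H1 by blast

lemma class1_eq_one: "class1 S c = \<one>\<^bsub>H1 S\<^esub> \<longleftrightarrow> null_chain S c"
  unfolding one_H1 by (rule homologous_rel_set_eq_relboundary)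

lemma class1_eq_iff: "class1 S a = class1 S b \<longleftrightarrow> null_chain S (a - b)"
  by (rule trans[OF homologous_rel_set_eq]) (simp only: homologous_rel_def)

lemma class1_add:
  assumes "cycle1 S a" "cycle1 S b"
  shows "class1 S a \<otimes>\<^bsub>H1 S\<^esub> class1 S b = class1 S (a + b)"
proof -
  have "class1 S a \<otimes>\<^bsub>H1 S\<^esub> class1 S b = (\<Union>r\<in>class1 S a. \<Union>s\<in>class1 S b. {r + s})"
    using mult_relative_homology_group[of 1 "top_of_set S" "{}"] by simp
  also have "\<dots> = class1 S (a + b)"
  proof (intro equalityI subsetI)
    fix x assume "x \<in> (\<Union>r\<in>class1 S a. \<Union>s\<in>class1 S b. {r + s})"
    then show "x \<in> class1 S (a + b)" by (auto intro: homologous_rel_add)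
  next
    fix x assume x: "x \<in> class1 S (a + b)"
    have "homologous_rel 1 (top_of_set S) {} b (x - a)"
      using x homologous_rel_diff[of 1 "top_of_set S" "{}" "a + b" x a a] by simp
    then show "x \<in> (\<Union>r\<in>class1 S a. \<Union>s\<in>class1 S b. {r + s})" 
      by (intro UN_I[of a] UN_I[of "x - a"]) auto
  qed
  finally show ?thesis .
qed

lemma class1_pow:
  assumes "cycle1 S a"
  shows "class1 S a [^]\<^bsub>H1 S\<^esub> (m::nat) = class1 S (frag_cmul (int m) a)"
proof (induction m)
  case 0
  then show ?case using class1_eq_one[of S 0] by simp
next
  case (Suc m)
  have "frag_cmul (int (Suc m)) a = frag_cmul (int m) a + a"
    using frag_cmul_distrib[of "int m" 1 a] by (simp add: add.commute)
  then show ?case using Suc class1_add[of S "frag_cmul (int m) a" a] assms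
    by (simp add: singular_relcycle_cmul)
qed

lemma torsion_part_H1:
  assumes "x \<in> torsion_part (H1 S)"
  obtains z N where "cycle1 S z" "x = class1 S z" "N > (0::int)" "null_chain S (frag_cmul N z)"
proof -
  obtain k z where k: "k > (0::nat)" "x [^]\<^bsub>H1 S\<^esub> k = \<one>\<^bsub>H1 S\<^esub>" and z: "cycle1 S z" "x = class1 S z"
    using assms unfolding torsion_part_def carrier_H1 by blast
  then have "null_chain S (frag_cmul (int k) z)" by (simp add: class1_pow class1_eq_one)
  then show ?thesis using that[of z "int k"] k z by auto
qed

lemma loop_class_eq: "loop_class (top_of_set S) \<gamma> = class1 S (path_simplex \<gamma>)"
  by (simp add: loop_class_def path_simplex_def)

lemma cycle1_loop:
  assumes "path \<gamma>" "path_image \<gamma> \<subseteq> S" "pathfinish \<gamma> = pathstart \<gamma>"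
  shows "cycle1 S (path_simplex \<gamma>)"
  using singular_chain_path_simplex[OF assms(1,2)] chain_boundary_path_simplex[of \<gamma>] assms(3)
  by (simp add: singular_cycle pathfinish_def pathstart_def)

lemma class1_join:
  assumes "path g" "path_image g \<subseteq> S" "pathfinish g = pathstart g"
    and "path h" "path_image h \<subseteq> S" "pathfinish h = pathstart h" "pathstart h = pathstart g"
  shows "class1 S (path_simplex (g +++ h)) = class1 S (path_simplex g) \<otimes>\<^bsub>H1 S\<^esub> class1 S (path_simplex h)"
proof -
  have "null_chain S (path_simplex g + path_simplex h - path_simplex (g +++ h))"
    using assms by (intro path_simplex_join) auto
  then have "class1 S (path_simplex g + path_simplex h) = class1 S (path_simplex (g +++ h))"
    by (simp only: class1_eq_iff)
  then show ?thesis using assms by (simp add: class1_add cycle1_loop)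
qed

lemma class1_reverse:
  assumes "path g" "path_image g \<subseteq> S" "pathfinish g = pathstart g"
  shows "class1 S (path_simplex (reversepath g)) = inv\<^bsub>H1 S\<^esub> class1 S (path_simplex g)"
proof -
  have c: "cycle1 S (path_simplex g)" "cycle1 S (path_simplex (reversepath g))"
    using assms by (auto intro!: cycle1_loop)
  have "class1 S (path_simplex (reversepath g)) \<otimes>\<^bsub>H1 S\<^esub> class1 S (path_simplex g) = \<one>\<^bsub>H1 S\<^esub>"
    using path_simplex_reverse[OF assms(1,2)] c by (simp add: class1_add class1_eq_one add.commute)
  then show ?thesis
    using c by (intro group.inv_equality[symmetric] class1_in_carrier group_relative_homology_group)
qed

section \<open>Winding numbers\<close>

text \<open>Serves twice: with \<open>w\<close> the change of a logarithm it is a winding number,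
  and with \<open>w\<close> the value of a monomial it evaluates a Laurent polynomial.\<close>

definition weighted_sum :: "('a \<Rightarrow> complex) \<Rightarrow> ('a \<Rightarrow>\<^sub>0 int) \<Rightarrow> complex" where
  "weighted_sum w c = (\<Sum>x\<in>Poly_Mapping.keys c. of_int (Poly_Mapping.lookup c x) * w x)"

lemma weighted_sum_superset:
  assumes "finite A" "Poly_Mapping.keys c \<subseteq> A"
  shows "weighted_sum w c = (\<Sum>x\<in>A. of_int (Poly_Mapping.lookup c x) * w x)"
  unfolding weighted_sum_def using assms by (intro sum.mono_neutral_left) (auto simp: in_keys_iff)

lemma weighted_sum_diff: "weighted_sum w (a - b) = weighted_sum w a - weighted_sum w b"
proof -
  let ?A = "Poly_Mapping.keys a \<union> Poly_Mapping.keys b"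
  have "weighted_sum w (a - b) = (\<Sum>x\<in>?A. of_int (Poly_Mapping.lookup (a - b) x) * w x)"
    by (rule weighted_sum_superset) (simp, rule keys_diff)
  also have "\<dots> = weighted_sum w a - weighted_sum w b"
    by (subst (1 2) weighted_sum_superset[of ?A]) (auto simp: lookup_minus left_diff_distrib sum_subtractf)
  finally show ?thesis .
qed

lemma weighted_sum_0 [simp]: "weighted_sum w 0 = 0" by (simp add: weighted_sum_def)

lemma weighted_sum_of [simp]: "weighted_sum w (frag_of x) = w x" by (simp add: weighted_sum_def)

lemma weighted_sum_minus: "weighted_sum w (- a) = - weighted_sum w a"
  using weighted_sum_diff[of w 0 a] by simp

lemma weighted_sum_add: "weighted_sum w (a + b) = weighted_sum w a + weighted_sum w b"
  using weighted_sum_diff[of w a "- b"] by (simp add: weighted_sum_minus)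

lemma weighted_sum_cmul: "weighted_sum w (frag_cmul k a) = of_int k * weighted_sum w a"
proof -
  have "weighted_sum w (frag_cmul k a) = (\<Sum>x\<in>Poly_Mapping.keys a. of_int (Poly_Mapping.lookup (frag_cmul k a) x) * w x)"
    by (intro weighted_sum_superset) (simp_all add: keys_cmul)
  then show ?thesis by (simp add: weighted_sum_def sum_distrib_left mult.assoc)
qed

text \<open>A nonvanishing function defines an integral homomorphism on first homology, the pullback
  of the generator of the first cohomology of the punctured plane. It is built here on the chain
  level.\<close>

locale nonvanishing =
  fixes S :: "'a::topological_space set" and F :: "'a \<Rightarrow> complex"
  assumes cont_F: "continuous_on S F" and F_nz: "x \<in> S \<Longrightarrow> F x \<noteq> 0"
begin

definition edge_point :: "real \<Rightarrow> nat \<Rightarrow> real" where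
  "edge_point t = (\<lambda>i. if i = 0 then 1 - t else if i = 1 then t else 0)"

definition log_along :: "(real \<Rightarrow> 'a) \<Rightarrow> (real \<Rightarrow> complex) \<Rightarrow> bool" where
  "log_along g L \<longleftrightarrow> continuous_on {0..1} L \<and> (\<forall>t\<in>{0..1}. F (g t) = exp (L t))"

text \<open>The value chosen by \<open>SOME\<close> is independent of the logarithm by
  \<open>log_along_unique\<close>.\<close>

definition log_change :: "((nat \<Rightarrow> real) \<Rightarrow> 'a) \<Rightarrow> complex" where
  "log_change \<sigma> = (SOME z. \<exists>L. log_along (\<lambda>t. \<sigma> (edge_point t)) L \<and> z = (L 1 - L 0) / (2 * pi * \<i>))"

text \<open>Two continuous logarithms differ by a continuous function with values in the discrete
  set of multiples of \<open>2 * pi * \<i>\<close>, hence by a constant.\<close>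

lemma log_along_unique:
  assumes L: "log_along g L" and M: "log_along g M"
  shows "L 1 - L 0 = M 1 - M 0"
proof -
  define D where "D t = (L t - M t) / (2 * pi * \<i>)" for t
  have "D t \<in> \<int>" if "t \<in> {0..1}" for t
  proof -
    have "exp (L t) = exp (M t)" using L M that by (metis log_along_def)
    then obtain n where "L t = M t + of_int (2 * n) * pi * \<i>" unfolding exp_eq by blast
    then have "D t = of_int n" by (simp add: D_def)
    then show ?thesis by simp
  qed
  moreover have "continuous_on {0..1} D"
    using L M unfolding D_def log_along_def by (intro continuous_intros) auto
  ultimately have "D constant_on {0..1}"
  proof (intro continuous_discrete_range_constant)
    fix x :: real assume x: "x \<in> {0..1}" and D: "\<And>x. x \<in> {0..1} \<Longrightarrow> D x \<in> \<int>"
    show "\<exists>e>0. \<forall>y. y \<in> {0..1} \<and> D y \<noteq> D x \<longrightarrow> e \<le> norm (D y - D x)"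
    proof (intro exI[of _ 1] conjI allI impI)
      fix y assume y: "y \<in> {0..1} \<and> D y \<noteq> D x"
      then have "D y - D x \<in> \<int>" "D y - D x \<noteq> 0" using D x by auto
      then obtain k where "D y - D x = of_int k" "k \<noteq> 0" by (metis Ints_cases of_int_0)
      then show "1 \<le> norm (D y - D x)" by (simp add: norm_of_int)
    qed simp
  qed auto
  then have "D 0 = D 1" by (auto simp: constant_on_def)
  then show ?thesis by (simp add: D_def divide_eq_eq algebra_simps) (simp add: field_simps)
qed

lemma log_change_eq:
  assumes "log_along (\<lambda>t. \<sigma> (edge_point t)) L"
  shows "log_change \<sigma> = (L 1 - L 0) / (2 * pi * \<i>)"
  unfolding log_change_def
proof (rule some_equality)
  show "\<exists>M. log_along (\<lambda>t. \<sigma> (edge_point t)) M \<and> (L 1 - L 0) / (2 * pi * \<i>) = (M 1 - M 0) / (2 * pi * \<i>)"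
    using assms by blast
next
  fix z assume "\<exists>M. log_along (\<lambda>t. \<sigma> (edge_point t)) M \<and> z = (M 1 - M 0) / (2 * pi * \<i>)"
  then obtain M where M: "log_along (\<lambda>t. \<sigma> (edge_point t)) M" "z = (M 1 - M 0) / (2 * pi * \<i>)" by blast
  show "z = (L 1 - L 0) / (2 * pi * \<i>)"
    unfolding M(2) log_along_unique[OF M(1) assms] ..
qed

lemma edge_point_in: "t \<in> {0..1} \<Longrightarrow> edge_point t \<in> standard_simplex 1"
  using standard_simplex_1_iff[of "edge_point t"] by (auto simp: edge_point_def One_nat_def)

lemma log_change_path:
  assumes "log_along g L"
  shows "weighted_sum log_change (path_simplex g) = (L 1 - L 0) / (2 * pi * \<i>)"
proof -
  have "log_along (\<lambda>t. restrict (\<lambda>x. g (x 1)) (standard_simplex 1) (edge_point t)) L"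
    using assms edge_point_in unfolding log_along_def by (auto simp: edge_point_def)
  then show ?thesis by (simp add: path_simplex_def log_change_eq)
qed

lemma log_along_ex:
  assumes "path g" "path_image g \<subseteq> S"
  obtains L where "log_along g L"
proof -
  have c: "continuous_on {0..1} (F \<circ> g)"
    using assms cont_F by (intro continuous_on_compose) (auto simp: path_def path_image_def elim: continuous_on_subset)
  have "contractible {0..1::real}" by (simp add: convex_imp_contractible)
  moreover have "(F \<circ> g) t \<noteq> 0" if "t \<in> {0..1}" for t
    using F_nz[of "g t"] that assms(2) by (auto simp: path_image_def image_subset_iff)
  ultimately obtain L where "continuous_on {0..1} L" "\<And>t. t \<in> {0..1} \<Longrightarrow> (F \<circ> g) t = exp (L t)"
    using continuous_logarithm_on_contractible[OF c] by metis
  then show ?thesis using that[of L] by (simp add: log_along_def)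
qed

text \<open>A parametrization of the standard 2-simplex by a convex set in the plane, where
  logarithms exist by contractibility.\<close>

definition triangle_point :: "real \<times> real \<Rightarrow> nat \<Rightarrow> real" where
  "triangle_point x = (\<lambda>i. if i = 0 then 1 - fst x - snd x else if i = 1 then fst x else if i = 2 then snd x else 0)"

text \<open>A single logarithm exists on the whole triangle, and its changes along the three sides
  cancel.\<close>

lemma log_change_boundary_simplex:
  assumes "singular_simplex 2 (top_of_set S) \<sigma>"
  shows "weighted_sum log_change (chain_boundary 2 (frag_of \<sigma>)) = 0"
proof -
  define D where "D = {x::real\<times>real. 0 \<le> fst x \<and> 0 \<le> snd x \<and> fst x + snd x \<le> 1}"
  have "D = {x. inner (-1, 0) x \<le> 0} \<inter> {x. inner (0, -1) x \<le> 0} \<inter> {x. inner (1, 1) x \<le> 1}"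
    by (auto simp: D_def inner_prod_def)
  then have conv: "convex D" by (simp add: convex_Int convex_halfspace_le)
  have in2: "triangle_point x \<in> standard_simplex 2" if "x \<in> D" for x
  proof -
    have "(\<Sum>i\<le>2. triangle_point x i) = 1" by (simp add: triangle_point_def numeral_2_eq_2 One_nat_def)
    then show ?thesis using that by (auto simp: standard_simplex_def D_def triangle_point_def)
  qed
  have "continuous_map (top_of_set D) (subtopology (powertop_real UNIV) (standard_simplex 2)) triangle_point"
  proof -
    have "continuous_on D (\<lambda>x. triangle_point x i)" for i
      by (cases "i = 0"; cases "i = 1"; cases "i = 2") (auto simp: triangle_point_def intro!: continuous_intros)
    then show ?thesis using in2 by (auto simp: continuous_map_in_subtopology continuous_map_componentwise_UNIV)
  qed
  from continuous_map_compose[OF this, of "top_of_set S" \<sigma>] assms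
  have "continuous_map (top_of_set D) (top_of_set S) (\<sigma> \<circ> triangle_point)"
    by (simp add: singular_simplex_def)
  then have \<Theta>: "continuous_on D (\<sigma> \<circ> triangle_point)" "(\<sigma> \<circ> triangle_point) ` D \<subseteq> S"
    by (auto simp: continuous_map_in_subtopology)
  have c: "continuous_on D (F \<circ> (\<sigma> \<circ> triangle_point))"
    by (rule continuous_on_compose[OF \<Theta>(1) continuous_on_subset[OF cont_F \<Theta>(2)]])
  moreover have "(F \<circ> (\<sigma> \<circ> triangle_point)) x \<noteq> 0" if "x \<in> D" for x
    using F_nz[of "\<sigma> (triangle_point x)"] that \<Theta>(2) by auto
  ultimately obtain L where L: "continuous_on D L" "\<And>x. x \<in> D \<Longrightarrow> (F \<circ> (\<sigma> \<circ> triangle_point)) x = exp (L x)"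
    using continuous_logarithm_on_contractible[OF c] conv by (metis convex_imp_contractible)
  have face: "log_change (singular_face 2 k \<sigma>) = (L (e 1) - L (e 0)) / (2 * pi * \<i>)"
    if "k \<le> 2" "\<And>t. t \<in> {0..1} \<Longrightarrow> e t \<in> D" "continuous_on {0..1} e"
      "\<And>t. simplical_face k (edge_point t) = triangle_point (e t)" for k e
  proof -
    have "log_along (\<lambda>t. singular_face 2 k \<sigma> (edge_point t)) (\<lambda>t. L (e t))"
      unfolding log_along_def
    proof
      show "continuous_on {0..1} (\<lambda>t. L (e t))"
        using that by (intro continuous_on_compose2[OF L(1)]) auto
      show "\<forall>t\<in>{0..1}. F (singular_face 2 k \<sigma> (edge_point t)) = exp (L (e t))"
        using that edge_point_in L(2) by (auto simp: singular_face_def One_nat_def)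
    qed
    then show ?thesis by (simp add: log_change_eq)
  qed
  have f0: "log_change (singular_face 2 0 \<sigma>) = (L (0, 1) - L (1, 0)) / (2 * pi * \<i>)"
    by (subst face[of 0 "\<lambda>t. (1 - t, t)"])
      (auto simp: D_def simplical_face_def edge_point_def triangle_point_def fun_eq_iff intro!: continuous_intros)
  have f1: "log_change (singular_face 2 1 \<sigma>) = (L (0, 1) - L (0, 0)) / (2 * pi * \<i>)"
    by (subst face[of 1 "\<lambda>t. (0, t)"])
      (auto simp: D_def simplical_face_def edge_point_def triangle_point_def fun_eq_iff intro!: continuous_intros)
  have f2: "log_change (singular_face 2 2 \<sigma>) = (L (1, 0) - L (0, 0)) / (2 * pi * \<i>)"
    by (subst face[of 2 "\<lambda>t. (t, 0)"])
      (auto simp: D_def simplical_face_def edge_point_def triangle_point_def fun_eq_iff intro!: continuous_intros)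
  have "chain_boundary 2 (frag_of \<sigma>) = frag_of (singular_face 2 0 \<sigma>) - frag_of (singular_face 2 1 \<sigma>) + frag_of (singular_face 2 2 \<sigma>)"
    unfolding chain_boundary_of by (simp add: numeral_2_eq_2 One_nat_def)
  then show ?thesis
    by (simp add: weighted_sum_diff weighted_sum_add f0 f1 f2 flip: add_divide_distrib diff_divide_distrib)
qed

lemma log_change_null_chain:
  assumes "null_chain S c"
  shows "weighted_sum log_change c = 0"
proof -
  obtain d where d: "singular_chain 2 (top_of_set S) d" "chain_boundary 2 d = c"
    using assms unfolding singular_boundary by (auto simp: numeral_2_eq_2 One_nat_def)
  have "weighted_sum log_change (chain_boundary 2 d) = 0"
    using d(1) unfolding singular_chain_def
  proof (induction d rule: frag_induction)
    case (one \<sigma>) then show ?case by (simp add: log_change_boundary_simplex)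
  qed (auto simp: chain_boundary_diff weighted_sum_diff)
  then show ?thesis using d by simp
qed

text \<open>Comparing the continuous logarithm along each edge with a fixed branch at its end points shows
  integrality; the branch contributes nothing to a cycle.\<close>

lemma log_change_cycle_in_Ints:
  assumes "cycle1 S c"
  shows "weighted_sum log_change c \<in> \<int>"
proof -
  define br where "br \<tau> = Ln (F (\<tau> (\<lambda>j. if j = 0 then 1 else 0))) / (2 * pi * \<i>)" for \<tau> :: "(nat \<Rightarrow> real) \<Rightarrow> 'a"
  have c: "singular_chain 1 (top_of_set S) c" "chain_boundary 1 c = 0"
    using assms by (auto simp: singular_cycle)
  have "weighted_sum log_change c - weighted_sum br (chain_boundary 1 c) \<in> \<int>"
    using c(1) unfolding singular_chain_def
  proof (induction c rule: frag_induction)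
    case (one \<sigma>)
    then have "singular_simplex 1 (top_of_set S) \<sigma>" by simp
    then obtain g where g: "path g" "path_image g = \<sigma> ` standard_simplex 1" "frag_of \<sigma> = path_simplex g"
      by (rule singular_simplex_1_path)
    have gS: "path_image g \<subseteq> S"
      using \<open>singular_simplex 1 (top_of_set S) \<sigma>\<close> unfolding g(2) by (auto simp: singular_simplex_def continuous_map_in_subtopology)
    obtain L where L: "log_along g L" using log_along_ex[OF g(1) gS] .
    have "\<exists>n. (L t - Ln (F (g t))) / (2 * pi * \<i>) = of_int n" if "t \<in> {0..1}" for t
    proof -
      have "F (g t) \<noteq> 0" using F_nz[of "g t"] that gS by (auto simp: path_image_def image_subset_iff)
      then have "exp (L t) = exp (Ln (F (g t)))" using L that by (simp add: log_along_def)
      then obtain n where "L t = Ln (F (g t)) + of_int (2 * n) * pi * \<i>" unfolding exp_eq by blast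
      then show ?thesis by (intro exI[of _ n]) simp
    qed
    then obtain m n where mn: "(L 1 - Ln (F (g 1))) / (2 * pi * \<i>) = of_int m" "(L 0 - Ln (F (g 0))) / (2 * pi * \<i>) = of_int n"
      by (metis atLeastAtMost_iff order_refl zero_le_one)
    have "weighted_sum br (point_simplex x) = Ln (F x) / (2 * pi * \<i>)" for x
      by (simp add: point_simplex_def br_def)
    then have "weighted_sum log_change (frag_of \<sigma>) - weighted_sum br (chain_boundary 1 (frag_of \<sigma>))
      = (L 1 - Ln (F (g 1))) / (2 * pi * \<i>) - (L 0 - Ln (F (g 0))) / (2 * pi * \<i>)"
      unfolding g(3) chain_boundary_path_simplex weighted_sum_diff log_change_path[OF L]
      by (simp add: diff_divide_distrib)
    then show ?case unfolding mn by simp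
  next
    case (diff a b)
    have "weighted_sum log_change (a - b) - weighted_sum br (chain_boundary 1 (a - b)) =
      (weighted_sum log_change a - weighted_sum br (chain_boundary 1 a)) -
      (weighted_sum log_change b - weighted_sum br (chain_boundary 1 b))"
      by (simp add: chain_boundary_diff weighted_sum_diff)
    then show ?case using diff by simp
  qed simp
  then show ?thesis using c by simp
qed

text \<open>Evaluating the winding homomorphism on both sides of \<open>j [\<gamma>] = n [z]\<close>
  gives \<open>j w = n m\<close> with \<open>m\<close> an integer, because \<open>z\<close> is an
  integral cycle.\<close>

lemma multiple_divides_winding:
  assumes z: "cycle1 S z"
    and null: "null_chain S (frag_cmul j (path_simplex \<gamma>) - frag_cmul n z)"
    and \<gamma>: "\<And>t. t \<in> {0..1} \<Longrightarrow> F (\<gamma> t) = F (\<gamma> 0) * cis (2 * pi * of_int w * t)" "F (\<gamma> 0) \<noteq> 0"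
  shows "n dvd j * w"
proof -
  have "log_along \<gamma> (\<lambda>t. Ln (F (\<gamma> 0)) + \<i> * (2 * pi * of_int w * t))"
    unfolding log_along_def
  proof
    show "\<forall>t\<in>{0..1}. F (\<gamma> t) = exp (Ln (F (\<gamma> 0)) + \<i> * (2 * pi * of_int w * t))"
    proof
      fix t :: real assume t: "t \<in> {0..1}"
      show "F (\<gamma> t) = exp (Ln (F (\<gamma> 0)) + \<i> * (2 * pi * of_int w * t))"
        unfolding \<gamma>(1)[OF t] using \<gamma>(2) by (simp add: exp_add cis_conv_exp)
    qed
  qed (intro continuous_intros)
  from log_change_path[OF this] have 1: "weighted_sum log_change (path_simplex \<gamma>) = of_int w"
    unfolding mult_1_right mult_zero_right by simp
  obtain m where m: "weighted_sum log_change z = of_int m"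
    using log_change_cycle_in_Ints[OF z] by (auto elim: Ints_cases)
  have "weighted_sum log_change (frag_cmul j (path_simplex \<gamma>) - frag_cmul n z) = 0"
    by (rule log_change_null_chain[OF null])
  then have "of_int j * of_int w - of_int n * of_int m = (0 :: complex)"
    unfolding weighted_sum_diff weighted_sum_cmul 1 m .
  then have "(of_int (j * w - n * m) :: complex) = of_int 0"
    unfolding of_int_diff of_int_mult of_int_0 .
  then have "j * w - n * m = 0" unfolding of_int_eq_iff .
  then have "j * w = n * m" by (rule right_minus_eq[THEN iffD1])
  then show ?thesis by (rule dvdI)
qed

end

section \<open>Torus links and their circle action\<close>

locale torus =
  fixes p q :: nat
  assumes p_pos: "p > 0" and q_pos: "q > 0"
begin

abbreviation d :: nat where "d \<equiv> gcd p q"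
abbreviation p' :: nat where "p' \<equiv> p div d"
abbreviation q' :: nat where "q' \<equiv> q div d"
abbreviation L :: "(complex \<times> complex) set" where "L \<equiv> link_set d (torus_link p q)"
abbreviation X :: "(complex \<times> complex) set" where "X \<equiv> link_complement d (torus_link p q)"

text \<open>The Brieskorn polynomial of the link; the scaling by \<open>sqrt 2\<close> puts its
  zeros in the unit sphere onto the torus where both coordinates have modulus
  \<open>1 / sqrt 2\<close>.\<close>

definition F :: "complex \<times> complex \<Rightarrow> complex" where
  "F x = (complex_of_real (sqrt 2) * fst x) ^ p - (complex_of_real (sqrt 2) * snd x) ^ q"

lemma d_pos: "d > 0" using p_pos by simp
lemma p'_pos: "p' > 0" using p_pos by (simp add: div_greater_zero_iff)
lemma q'_pos: "q' > 0" using q_pos by (simp add: div_greater_zero_iff)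
lemma pq': "p * q' = q * p'" by (metis dvd_div_mult dvd_mult_div_cancel gcd_dvd1 gcd_dvd2 mult.commute)

lemma cis_cong: "x - y = 2 * pi * of_int m \<Longrightarrow> cis x = cis y"
proof -
  assume "x - y = 2 * pi * of_int m"
  then have x: "x = y + 2 * pi * of_int m" by linarith
  have "cis x = cis y * cis (2 * pi * of_int m)" unfolding x by (rule cis_mult[symmetric])
  also have "cis (2 * pi * of_int m) = 1" by (rule cis_multiple_2pi) simp
  finally show ?thesis by simp
qed

lemma cis_eqD: "cis x = cis y \<Longrightarrow> \<exists>m. x - y = 2 * pi * of_int m"
proof -
  assume "cis x = cis y"
  then have "sin x = sin y \<and> cos x = cos y" by (simp add: complex_eq_iff)
  then obtain m :: int where "x = y + 2 * pi * m" unfolding sin_cos_eq_iff by blast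
  then show ?thesis by (intro exI[of _ m]) simp
qed

lemma norm_sphere_iff: "x \<in> sphere 0 1 \<longleftrightarrow> (cmod (fst x))\<^sup>2 + (cmod (snd x))\<^sup>2 = 1"
  by (cases x) (simp add: norm_Pair)

text \<open>The sphere condition forces one radius above 1 as soon as the other is below 1, and then
  the two powers lie on different sides of 1.\<close>

lemma unit_radii:
  fixes a b :: real
  assumes "a \<ge> 0" "b \<ge> 0" "a\<^sup>2 + b\<^sup>2 = 2" "a ^ p = b ^ q"
  shows "a = 1 \<and> b = 1"
proof -
  consider "a < 1" | "a = 1" | "a > 1" by linarith
  then show ?thesis
  proof cases
    case 1
    then have "a\<^sup>2 < 1" using assms(1) abs_square_less_1[of a] by simp
    then have "b\<^sup>2 > 1" using assms by linarith
    then have "b > 1" using assms(2) abs_square_le_1[of b] by linarith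
    then have "b ^ q > 1" using q_pos by (simp add: one_less_power)
    moreover have "a ^ p < 1" using 1 assms(1) p_pos by (simp add: power_less_one_iff)
    ultimately show ?thesis using assms by linarith
  next
    case 2
    then have "b\<^sup>2 = 1" using assms by simp
    then show ?thesis using 2 assms(2) by (simp add: power2_eq_1_iff)
  next
    case 3
    then have "a\<^sup>2 > 1" by (simp add: one_less_power)
    then have "b\<^sup>2 < 1" using assms by linarith
    then have "b < 1" using abs_square_less_1[of b] by linarith
    then have "b ^ q < 1" using assms(2) q_pos by (simp add: power_less_one_iff)
    moreover have "a ^ p > 1" using 3 p_pos by (simp add: one_less_power)
    ultimately show ?thesis using assms by linarith
  qed
qed

lemma F_zero_torus:
  assumes "x \<in> sphere 0 1" "F x = 0"
  shows "cmod (fst x) = 1 / sqrt 2" "cmod (snd x) = 1 / sqrt 2"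
proof -
  define a b where "a = sqrt 2 * cmod (fst x)" and "b = sqrt 2 * cmod (snd x)"
  have "cmod ((complex_of_real (sqrt 2) * fst x) ^ p) = cmod ((complex_of_real (sqrt 2) * snd x) ^ q)" using assms(2) by (simp add: F_def)
  then have "a ^ p = b ^ q" by (simp add: norm_power norm_mult a_def b_def)
  moreover have "a\<^sup>2 + b\<^sup>2 = 2"
    using assms(1) unfolding norm_sphere_iff a_def b_def power_mult_distrib by simp
  ultimately have "a = 1 \<and> b = 1" by (intro unit_radii) (auto simp: a_def b_def)
  then show "cmod (fst x) = 1 / sqrt 2" "cmod (snd x) = 1 / sqrt 2"
    by (auto simp: a_def b_def field_simps)
qed

lemma torus_link_in: 
  assumes "k < d"
  shows "torus_link p q k t \<in> sphere 0 1" "F (torus_link p q k t) = 0"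
proof -
  let ?a = "2 * pi * (real q' * t + real k / real p)" and ?b = "2 * pi * (real p' * t)"
  have x: "torus_link p q k t = (cis ?a / sqrt 2, cis ?b / sqrt 2)"
    by (simp add: torus_link_def scaleR_conv_of_real)
  show "torus_link p q k t \<in> sphere 0 1"
    unfolding norm_sphere_iff x by (simp add: norm_divide power_divide)
  have "cis (real p * ?a) = cis (real q * ?b)"
  proof (rule cis_cong)
    have "real p * (real q' * t) = real q * (real p' * t)" using arg_cong[OF pq', of real] by simp
    then show "real p * ?a - real q * ?b = 2 * pi * of_int (int k)"
      using p_pos by (simp add: algebra_simps)
  qed
  then show "F (torus_link p q k t) = 0" unfolding F_def x by (simp add: Complex.DeMoivre)
qed

text \<open>On the torus the equation \<open>F x = 0\<close> says that the angles \<open>A\<close>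
  and \<open>B\<close>, measured in full turns, satisfy \<open>p A - q B = m\<close> for an integer
  \<open>m\<close>. Integer shifts of the angles change \<open>m\<close> by multiples of
  \<open>d\<close>, and the residue of \<open>m\<close> numbers the component.\<close>

lemma link_set_eq: "L = {x \<in> sphere 0 1. F x = 0}"
proof (intro equalityI subsetI)
  fix x assume "x \<in> L"
  then show "x \<in> {x \<in> sphere 0 1. F x = 0}" using torus_link_in by (auto simp: link_set_def)
next
  fix x assume "x \<in> {x \<in> sphere 0 1. F x = 0}"
  then have x: "x \<in> sphere 0 1" "F x = 0" by auto
  define A where "A = Arg (fst x) / (2 * pi)"
  define B where "B = Arg (snd x) / (2 * pi)"
  have u: "fst x = cis (2 * pi * A) / sqrt 2" "snd x = cis (2 * pi * B) / sqrt 2"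
    using F_zero_torus[OF x] rcis_cmod_Arg[of "fst x"] rcis_cmod_Arg[of "snd x"]
    by (simp_all add: A_def B_def rcis_def)
  have "cis (real p * (2 * pi * A)) = cis (real q * (2 * pi * B))"
    using x(2) unfolding F_def u by (simp add: Complex.DeMoivre)
  then obtain m where "real p * (2 * pi * A) - real q * (2 * pi * B) = 2 * pi * of_int m" using cis_eqD by blast
  then have "2 * pi * (real p * A - real q * B) = 2 * pi * of_int m" by (simp add: algebra_simps)
  then have m: "real p * A - real q * B = of_int m" by simp
  define k where "k = nat (m mod int d)"
  have k: "int k = m mod int d" "k < d" using d_pos by (auto simp: k_def nat_less_iff)
  have "coprime (int p') (int q')" using p_pos by (simp add: div_gcd_coprime)
  then obtain a b where ab: "a * int p' + b * int q' = 1"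
    by (metis bezout_int coprime_iff_gcd_eq_1)
  \<comment> \<open>Bezout coefficients scaled so that \<open>p i - q j = k - m\<close>; the shifted
    angles \<open>A + i\<close> and \<open>B + j\<close> then lie on the line that parametrizes
    component \<open>k\<close>.\<close>
  define i where "i = - (m div int d) * a"
  define j where "j = (m div int d) * b"
  have "int p' * i - int q' * j = - (m div int d) * (a * int p' + b * int q')"
    by (simp add: i_def j_def algebra_simps)
  then have ij: "int p' * i - int q' * j = - (m div int d)" using ab by simp
  define t where "t = (B + of_int j) / real p'"
  have t: "real p' * t = B + of_int j" using p'_pos by (simp add: t_def)
  have pr: "real p = real d * real p'" "real q = real d * real q'"
    using of_nat_mult[of d p', where ?'a=real] of_nat_mult[of d q', where ?'a=real]
    by (simp_all del: of_nat_mult)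
  have eq: "A + of_int i = real q' * t + real k / real p"
  proof -
    have "int d * (int p' * i - int q' * j) = - (int d * (m div int d))" unfolding ij by simp
    also have "\<dots> = int k - m" unfolding k(1) using mult_div_mod_eq[of "int d" m] by linarith
    finally have e: "real d * (real p' * of_int i - real q' * of_int j) = real k - of_int m"
      by (metis (mono_tags, lifting) of_int_diff of_int_mult of_int_of_nat_eq)
    have "real p * (A + of_int i - real q' * t) = real d * real p' * A + real d * real p' * of_int i - real d * real q' * (real p' * t)"
      unfolding pr(1) by (simp add: algebra_simps)
    also have "\<dots> = (real p * A - real q * B) + real d * (real p' * of_int i - real q' * of_int j)"
      unfolding t pr by (simp add: algebra_simps)
    also have "\<dots> = real k" unfolding m e by simp
    finally show ?thesis using p_pos by (simp add: field_simps)
  qed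
  \<comment> \<open>The curve is 1-periodic, but the link is the image of the unit interval, so the
    time is reduced modulo 1.\<close>
  define s where "s = t - of_int \<lfloor>t\<rfloor>"
  have s: "s \<in> {0..1}" unfolding s_def using floor_correct[of t] by (simp add: add.commute less_eq_real_def) (metis floor_eq_iff le_floor_iff less_eq_real_def linorder_not_le add.commute of_int_floor_le real_of_int_floor_add_one_gt)
  have shift: "cis (2 * pi * x) = cis (2 * pi * y)" if "x = y + of_int m" for x y :: real and m
    by (rule cis_cong[of _ _ m]) (simp add: that algebra_simps)
  have "cis (2 * pi * (real q' * s + real k / real p)) = cis (2 * pi * A)"
    by (rule shift[of _ _ "i - int q' * \<lfloor>t\<rfloor>"]) (use eq in \<open>simp add: s_def algebra_simps\<close>)
  moreover have "cis (2 * pi * (real p' * s)) = cis (2 * pi * B)"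
    by (rule shift[of _ _ "j - int p' * \<lfloor>t\<rfloor>"]) (use t in \<open>simp add: s_def algebra_simps\<close>)
  ultimately have "torus_link p q k s = (fst x, snd x)"
    unfolding torus_link_def u by (simp add: scaleR_conv_of_real)
  then have "torus_link p q k s = x" by simp
  then show "x \<in> L" unfolding link_set_def using k(2) s by blast
qed

lemma complement_eq: "X = {x \<in> sphere 0 1. F x \<noteq> 0}"
  unfolding link_complement_def link_set_eq by auto

lemma continuous_F: "continuous_on A F"
  unfolding F_def by (intro continuous_intros)

lemma closed_L: "closed L"
proof -
  have "L = sphere 0 1 \<inter> {x. F x = 0}" unfolding link_set_eq by blast
  then show ?thesis
    using continuous_closed_preimage_constant[OF continuous_F[of UNIV] closed_UNIV, of 0] by (simp add: closed_Int)
qed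

lemma openin_X: "openin (top_of_set (sphere 0 1)) X"
  unfolding link_complement_def Diff_eq using closed_L by (intro openin_open_Int) (simp add: open_Compl)

lemma X_subset: "X \<subseteq> sphere 0 1" unfolding link_complement_def by blast

lemma locally_path_connected_X: "locally path_connected X"
  using locally_open_subset[OF locally_path_connected_sphere openin_X] .

definition flow :: "real \<Rightarrow> complex \<times> complex \<Rightarrow> complex \<times> complex" where
  "flow s x = (cis (2 * pi * (real q' * s)) * fst x, cis (2 * pi * (real p' * s)) * snd x)"

lemma flow_0 [simp]: "flow 0 x = x" by (simp add: flow_def)

lemma flow_1 [simp]: "flow 1 x = x"
  using cis_multiple_2pi[of "real q'"] cis_multiple_2pi[of "real p'"] by (simp add: flow_def)

lemma flow_sphere: "x \<in> sphere 0 1 \<Longrightarrow> flow s x \<in> sphere 0 1"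
  unfolding norm_sphere_iff by (simp add: flow_def norm_mult)

text \<open>\<open>F\<close> is weighted homogeneous: since \<open>p q' = q p'\<close>, both of its
  monomials acquire the same factor. Every orbit off the link therefore has winding number
  \<open>p q'\<close>.\<close>

lemma F_flow: "F (flow s x) = cis (2 * pi * (real (p * q') * s)) * F x"
proof -
  have "cis (2 * pi * (real q' * s)) ^ p = cis (2 * pi * (real (p * q') * s))"
    unfolding Complex.DeMoivre by (simp add: ac_simps)
  moreover have "cis (2 * pi * (real p' * s)) ^ q = cis (2 * pi * (real (p * q') * s))"
    unfolding Complex.DeMoivre pq' by (simp add: ac_simps)
  ultimately show ?thesis
    by (simp add: F_def flow_def power_mult_distrib algebra_simps)
qed

lemma flow_X: "x \<in> X \<Longrightarrow> flow s x \<in> X"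
  unfolding complement_eq using flow_sphere[of x s] by (simp add: F_flow)

lemma continuous_flow: "continuous_on A (\<lambda>z. flow (fst z) (snd z))"
  unfolding flow_def cis_conv_exp by (intro continuous_intros)

sublocale nonvanishing X F
  using continuous_F by unfold_locales (auto simp: complement_eq)

end

section \<open>Abelian covers and the lifted circle action\<close>

text \<open>The value \<open>n = 0\<close> is the universal abelian cover and \<open>n > 0\<close>
  the finite ones, so both claims of the theorem draw on this locale.\<close>

locale torus_cover = torus p q for p q :: nat +
  fixes \<phi> :: "(complex \<times> complex) chain set \<Rightarrow> nat \<Rightarrow>\<^sub>0 int" and n :: nat
    and E :: "'a::real_normed_vector set" and f :: "'a \<Rightarrow> complex \<times> complex"
  assumes \<phi>_iso: "\<phi> \<in> Group.iso (H1 X) (free_Abelian_group {..<d})"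
    and cover: "abelian_cover d (torus_link p q) \<phi> n E f"
begin

definition \<Phi> :: "(real \<Rightarrow> complex \<times> complex) \<Rightarrow> nat \<Rightarrow>\<^sub>0 int" where
  "\<Phi> \<gamma> = \<phi> (class1 X (path_simplex \<gamma>))"

lemma covering: "covering_space E f X" and connected_E: "connected E"
  using cover by (auto simp: abelian_cover_def)

lemma closed_iff:
  assumes "path \<gamma>" "path_image \<gamma> \<subseteq> E" "f (pathstart \<gamma>) = f (pathfinish \<gamma>)"
  shows "pathstart \<gamma> = pathfinish \<gamma> \<longleftrightarrow> (\<forall>i<d. int n dvd Poly_Mapping.lookup (\<Phi> (f \<circ> \<gamma>)) i)"
  using cover assms unfolding abelian_cover_def \<Phi>_def loop_class_eq by blast

lemma f_E: "x \<in> E \<Longrightarrow> f x \<in> X"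
  using covering_space_imp_surjective[OF covering] by blast

lemma cont_f: "continuous_on E f"
  using covering by (rule covering_space_imp_continuous)

lemma locally_path_connected_E: "locally path_connected E"
  using covering_space_locally_path_connected_eq[OF covering] locally_path_connected_X by blast

lemma path_connected_E: "path_connected E"
  using connected_E unfolding path_connected_component connected_iff_connected_component
    path_component_eq_connected_component[OF locally_path_connected_E] .

lemma path_f: "path \<gamma> \<Longrightarrow> path_image \<gamma> \<subseteq> E \<Longrightarrow> path (f \<circ> \<gamma>) \<and> path_image (f \<circ> \<gamma>) \<subseteq> X"
  using f_E cont_f path_continuous_image[of \<gamma> f] continuous_on_subset
  by (fastforce simp: path_image_compose)

lemma \<phi>_hom: "\<phi> \<in> hom (H1 X) (free_Abelian_group {..<d})"
  using \<phi>_iso by (simp add: Group.iso_def)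

lemma \<phi>_mult: "a \<in> carrier (H1 X) \<Longrightarrow> b \<in> carrier (H1 X) \<Longrightarrow> \<phi> (a \<otimes>\<^bsub>H1 X\<^esub> b) = \<phi> a + \<phi> b"
  using hom_mult[OF \<phi>_hom] by simp

lemma group_hom_\<phi>: "group_hom (H1 X) (free_Abelian_group {..<d}) \<phi>"
  using \<phi>_hom by (simp add: group_hom_def group_hom_axioms_def)

lemma \<Phi>_keys:
  assumes "path g" "path_image g \<subseteq> X" "pathfinish g = pathstart g"
  shows "Poly_Mapping.keys (\<Phi> g) \<subseteq> {..<d}"
  using hom_in_carrier[OF \<phi>_hom class1_in_carrier[OF cycle1_loop[OF assms]]]
  unfolding \<Phi>_def carrier_free_Abelian_group_iff .

lemma \<Phi>_join:
  assumes "path g" "path_image g \<subseteq> X" "pathfinish g = pathstart g"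
    and "path h" "path_image h \<subseteq> X" "pathfinish h = pathstart h" "pathstart h = pathstart g"
  shows "\<Phi> (g +++ h) = \<Phi> g + \<Phi> h"
  using assms unfolding \<Phi>_def class1_join[OF assms]
  by (intro \<phi>_mult class1_in_carrier cycle1_loop)

lemma \<Phi>_reverse:
  assumes "path g" "path_image g \<subseteq> X" "pathfinish g = pathstart g"
  shows "\<Phi> (reversepath g) = - \<Phi> g"
  using group_hom.hom_inv[OF group_hom_\<phi> class1_in_carrier[OF cycle1_loop[OF assms]]] \<Phi>_keys[OF assms]
  unfolding \<Phi>_def class1_reverse[OF assms] by simp

lemma \<Phi>_cong: "null_chain X (path_simplex g - path_simplex h) \<Longrightarrow> \<Phi> g = \<Phi> h"
  unfolding \<Phi>_def by (simp only: class1_eq_iff[symmetric])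

lemma \<Phi>_cong': "(\<And>t. t \<in> {0..1} \<Longrightarrow> g t = h t) \<Longrightarrow> \<Phi> g = \<Phi> h"
  unfolding \<Phi>_def by (subst path_simplex_cong[of g h]) auto

text \<open>Going back along \<open>g\<close> and then along \<open>h\<close> is a path between the
  two end points, to which the characterization of closed lifts applies.\<close>

lemma endpoint_eq_iff:
  assumes g: "path g" "path_image g \<subseteq> E" and h: "path h" "path_image h \<subseteq> E"
    and start: "pathstart g = pathstart h"
    and loops: "f (pathfinish g) = f (pathstart g)" "f (pathfinish h) = f (pathstart h)"
  shows "pathfinish g = pathfinish h \<longleftrightarrow>
    (\<forall>i<d. int n dvd Poly_Mapping.lookup (\<Phi> (f \<circ> h)) i - Poly_Mapping.lookup (\<Phi> (f \<circ> g)) i)"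
proof -
  let ?l = "reversepath g +++ h"
  have fg: "path (f \<circ> g)" "path_image (f \<circ> g) \<subseteq> X" "pathfinish (f \<circ> g) = pathstart (f \<circ> g)"
    and fh: "path (f \<circ> h)" "path_image (f \<circ> h) \<subseteq> X" "pathfinish (f \<circ> h) = pathstart (f \<circ> h)"
    using path_f g h loops by (auto simp: pathfinish_compose pathstart_compose)
  have \<Phi>: "\<Phi> (f \<circ> ?l) = \<Phi> (f \<circ> h) - \<Phi> (f \<circ> g)"
    unfolding path_compose_join path_compose_reversepath
    using fg fh start by (subst \<Phi>_join) (auto simp: \<Phi>_reverse pathstart_compose)
  have "pathstart ?l = pathfinish ?l \<longleftrightarrow> (\<forall>i<d. int n dvd Poly_Mapping.lookup (\<Phi> (f \<circ> ?l)) i)"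
    using assms by (intro closed_iff) (auto simp: path_image_join)
  then show ?thesis unfolding \<Phi> by (simp add: lookup_minus)
qed

text \<open>The lift of the homotopy \<open>flow\<close> that starts at the identity. Times in the
  unit interval suffice to define the full turn.\<close>

definition lift_flow :: "real \<times> 'a \<Rightarrow> 'a" where
  "lift_flow = (SOME k. continuous_on ({0..1} \<times> E) k \<and> k \<in> ({0..1} \<times> E) \<rightarrow> E \<and> (\<forall>x\<in>E. k (0, x) = x) \<and>
     (\<forall>z\<in>{0..1} \<times> E. flow (fst z) (f (snd z)) = f (k z)))"

lemma lift_flow:
  shows continuous_lift_flow: "continuous_on ({0..1} \<times> E) lift_flow"
    and lift_flow_E: "\<And>s x. s \<in> {0..1} \<Longrightarrow> x \<in> E \<Longrightarrow> lift_flow (s, x) \<in> E"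
    and lift_flow_0: "\<And>x. x \<in> E \<Longrightarrow> lift_flow (0, x) = x"
    and f_lift_flow: "\<And>s x. s \<in> {0..1} \<Longrightarrow> x \<in> E \<Longrightarrow> f (lift_flow (s, x)) = flow s (f x)"
proof -
  have c: "continuous_on ({0..1} \<times> E) (\<lambda>z. flow (fst z) (f (snd z)))"
    using continuous_on_compose2[OF continuous_flow[of UNIV], of "{0..1} \<times> E" "\<lambda>z. (fst z, f (snd z))"]
      continuous_on_compose2[OF cont_f, of "{0..1} \<times> E" snd]
    by (force intro!: continuous_intros)
  obtain k where "continuous_on ({0..1} \<times> E) k" "k \<in> ({0..1} \<times> E) \<rightarrow> E" "\<And>x. x \<in> E \<Longrightarrow> k (0, x) = x"
    "\<And>z. z \<in> {0..1} \<times> E \<Longrightarrow> flow (fst z) (f (snd z)) = f (k z)"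
    by (rule covering_space_lift_homotopy[OF covering c, of "\<lambda>x. x"]) (auto simp: flow_X f_E)
  then have "\<exists>k. continuous_on ({0..1} \<times> E) k \<and> k \<in> ({0..1} \<times> E) \<rightarrow> E \<and> (\<forall>x\<in>E. k (0, x) = x) \<and>
     (\<forall>z\<in>{0..1} \<times> E. flow (fst z) (f (snd z)) = f (k z))" by blast
  from someI_ex[OF this, folded lift_flow_def]
  have k: "continuous_on ({0..1} \<times> E) lift_flow" "lift_flow \<in> ({0..1} \<times> E) \<rightarrow> E" "\<forall>x\<in>E. lift_flow (0, x) = x"
     "\<forall>z\<in>{0..1} \<times> E. flow (fst z) (f (snd z)) = f (lift_flow z)" by auto
  show "continuous_on ({0..1} \<times> E) lift_flow" by (rule k(1))
  show "\<And>s x. s \<in> {0..1} \<Longrightarrow> x \<in> E \<Longrightarrow> lift_flow (s, x) \<in> E" using k(2) by (auto simp: Pi_iff)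
  show "\<And>x. x \<in> E \<Longrightarrow> lift_flow (0, x) = x" using k(3) by blast
  show "\<And>s x. s \<in> {0..1} \<Longrightarrow> x \<in> E \<Longrightarrow> f (lift_flow (s, x)) = flow s (f x)" using k(4) by force
qed

definition turn :: "'a \<Rightarrow> 'a" where "turn x = lift_flow (1, x)"

lemma turn_E: "x \<in> E \<Longrightarrow> turn x \<in> E" by (simp add: turn_def lift_flow_E)

lemma f_turn: "x \<in> E \<Longrightarrow> f (turn x) = f x" by (simp add: turn_def f_lift_flow)

lemma continuous_turn: "continuous_on E turn"
  unfolding turn_def by (rule continuous_on_compose2[OF continuous_lift_flow]) (auto intro!: continuous_intros)

lemma path_lift_flow:
  assumes "x \<in> E"
  shows "path (\<lambda>s. lift_flow (s, x))" "path_image (\<lambda>s. lift_flow (s, x)) \<subseteq> E"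
    "pathstart (\<lambda>s. lift_flow (s, x)) = x" "pathfinish (\<lambda>s. lift_flow (s, x)) = turn x"
  using assms continuous_on_compose2[OF continuous_lift_flow, of "{0..1}" "\<lambda>s. (s, x)"]
    continuous_on_Pair[OF continuous_on_id continuous_on_const, of "{0..1::real}" x]
  by (auto simp: path_def path_image_def pathstart_def pathfinish_def turn_def lift_flow_0 lift_flow_E intro!: continuous_intros)

lemma path_flow:
  assumes "y \<in> X"
  shows "path (\<lambda>s. flow s y)" "path_image (\<lambda>s. flow s y) \<subseteq> X"
    "pathstart (\<lambda>s. flow s y) = y" "pathfinish (\<lambda>s. flow s y) = y"
  using assms continuous_on_compose2[OF continuous_flow[of UNIV], of "{0..1}" "\<lambda>s. (s, y)"]
    continuous_on_Pair[OF continuous_on_id continuous_on_const, of "{0..1::real}" y]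
  by (auto simp: path_def path_image_def pathstart_def pathfinish_def flow_X intro!: continuous_intros)

text \<open>The square \<open>(s, t) \<mapsto> lift_flow (s, g t)\<close> compares \<open>g\<close>
  with its image. The tracks of the end points stay as correction terms, which cancel when such
  relations are summed over a cycle.\<close>

lemma path_simplex_turn:
  assumes "path g" "path_image g \<subseteq> E"
  shows "null_chain E (path_simplex (turn \<circ> g) - path_simplex g
     - path_simplex (\<lambda>s. lift_flow (s, pathfinish g)) + path_simplex (\<lambda>s. lift_flow (s, pathstart g)))"
proof -
  have gE: "g t \<in> E" if "t \<in> {0..1}" for t using assms that by (auto simp: path_image_def)
  define K where "K = (\<lambda>z. lift_flow (fst z, g (snd z)))"
  have "continuous_on ({0..1} \<times> {0..1}) (\<lambda>z::real\<times>real. g (snd z))"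
    by (rule continuous_on_compose2[OF assms(1)[unfolded path_def] continuous_on_snd[OF continuous_on_id]]) auto
  then have "continuous_on ({0..1} \<times> {0..1}) (\<lambda>z::real\<times>real. (fst z, g (snd z)))"
    by (intro continuous_on_Pair continuous_on_fst[OF continuous_on_id])
  then have "continuous_on ({0..1} \<times> {0..1}) K"
    unfolding K_def by (rule continuous_on_compose2[OF continuous_lift_flow]) (auto simp: gE)
  moreover have "K ` ({0..1} \<times> {0..1}) \<subseteq> E"
    by (auto simp: K_def gE lift_flow_E)
  ultimately have sq: "null_chain E (path_simplex (\<lambda>t. K (0, t)) + path_simplex (\<lambda>s. K (s, 1))
          - path_simplex (\<lambda>s. K (s, 0)) - path_simplex (\<lambda>t. K (1, t)))"
    by (rule path_simplex_square)
  have K: "path_simplex (\<lambda>t. K (0, t)) = path_simplex g"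
    by (rule path_simplex_cong) (simp add: K_def gE lift_flow_0)
  have K': "(\<lambda>s. K (s, 1)) = (\<lambda>s. lift_flow (s, pathfinish g))"
    "(\<lambda>s. K (s, 0)) = (\<lambda>s. lift_flow (s, pathstart g))" "(\<lambda>t. K (1, t)) = turn \<circ> g"
    unfolding K_def turn_def pathfinish_def pathstart_def o_def fst_conv snd_conv by (rule refl)+
  have eq: "- (a + b - c - e) = e - a - b + c" for a b c e :: "'a chain" by simp
  have "null_chain E (- (path_simplex g + path_simplex (\<lambda>s. lift_flow (s, pathfinish g))
          - path_simplex (\<lambda>s. lift_flow (s, pathstart g)) - path_simplex (turn \<circ> g)))"
    unfolding singular_relboundary_minus using sq unfolding K K' .
  then show ?thesis unfolding eq .
qed

end

section \<open>The class of an orbit and the period of the turn\<close>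

context torus
begin

lemma X_nonempty: "X \<noteq> {}"
proof -
  have "(1, 0) \<in> X" unfolding complement_eq norm_sphere_iff using q_pos by (simp add: F_def power_0_left)
  then show ?thesis by blast
qed

text \<open>In the square swept out by \<open>g\<close> under the flow the bottom and the top side
  are both \<open>g\<close>, since the full turn is the identity downstairs. Only the two orbits
  remain.\<close>

lemma path_simplex_flow:
  assumes g: "path g" "path_image g \<subseteq> X"
  shows "null_chain X (path_simplex (\<lambda>s. flow s (pathfinish g)) - path_simplex (\<lambda>s. flow s (pathstart g)))"
proof -
  have gX: "g t \<in> X" if "t \<in> {0..1}" for t using g that by (auto simp: path_image_def)
  define K where "K = (\<lambda>z. flow (fst z) (g (snd z)))"
  have "continuous_on ({0..1} \<times> {0..1}) (\<lambda>z::real\<times>real. g (snd z))"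
    by (rule continuous_on_compose2[OF g(1)[unfolded path_def] continuous_on_snd[OF continuous_on_id]]) auto
  then have "continuous_on ({0..1} \<times> {0..1}) (\<lambda>z::real\<times>real. (fst z, g (snd z)))"
    by (intro continuous_on_Pair continuous_on_fst[OF continuous_on_id])
  then have "continuous_on ({0..1} \<times> {0..1}) K"
    using continuous_on_compose2[OF continuous_flow[of UNIV]] unfolding K_def by fastforce
  moreover have "K ` ({0..1} \<times> {0..1}) \<subseteq> X"
    by (auto simp: K_def intro!: flow_X gX)
  ultimately have sq: "null_chain X (path_simplex (\<lambda>t. K (0, t)) + path_simplex (\<lambda>s. K (s, 1))
          - path_simplex (\<lambda>s. K (s, 0)) - path_simplex (\<lambda>t. K (1, t)))"
    by (rule path_simplex_square)
  have K: "(\<lambda>t. K (0, t)) = g" "(\<lambda>t. K (1, t)) = g"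
    "(\<lambda>s. K (s, 1)) = (\<lambda>s. flow s (pathfinish g))" "(\<lambda>s. K (s, 0)) = (\<lambda>s. flow s (pathstart g))"
    by (simp_all add: K_def pathfinish_def pathstart_def)
  have "a + b - c - a = b - c" for a b c :: "(complex \<times> complex) chain" by simp
  then show ?thesis using sq unfolding K by simp
qed

end

context torus_cover
begin

lemma E_nonempty: "E \<noteq> {}"
  using covering_space_imp_surjective[OF covering] X_nonempty by blast

lemma path_connected_X: "path_connected X"
  using path_connected_continuous_image[OF cont_f path_connected_E] covering_space_imp_surjective[OF covering] by simp

text \<open>The base point is immaterial: \<open>X\<close> is path connected and orbits of points
  joined by a path are homologous, see \<open>\<Phi>_flow\<close>.\<close>

definition \<eta> :: "nat \<Rightarrow>\<^sub>0 int" where "\<eta> = \<Phi> (\<lambda>s. flow s (SOME y. y \<in> X))"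

lemma \<Phi>_flow:
  assumes "y \<in> X"
  shows "\<Phi> (\<lambda>s. flow s y) = \<eta>"
proof -
  have "(SOME y. y \<in> X) \<in> X" using X_nonempty by (simp add: some_in_eq)
  then obtain g where "path g" "path_image g \<subseteq> X" "pathstart g = (SOME y. y \<in> X)" "pathfinish g = y"
    using path_connected_X assms unfolding path_connected_def by blast
  then show ?thesis using path_simplex_flow[of g] unfolding \<eta>_def by (intro \<Phi>_cong) simp
qed

lemma \<eta>_keys: "Poly_Mapping.keys \<eta> \<subseteq> {..<d}"
  unfolding \<eta>_def using X_nonempty by (intro \<Phi>_keys) (simp_all add: path_flow some_in_eq)

lemma \<Phi>_lift_flow: "x \<in> E \<Longrightarrow> \<Phi> (f \<circ> (\<lambda>s. lift_flow (s, x))) = \<eta>"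
  using \<Phi>_flow[OF f_E] \<Phi>_cong'[of "f \<circ> (\<lambda>s. lift_flow (s, x))" "\<lambda>s. flow s (f x)"] by (simp add: f_lift_flow)

lemma \<Phi>_const:
  assumes "y \<in> X"
  shows "\<Phi> (\<lambda>_. y) = 0"
proof -
  have "class1 X (path_simplex (\<lambda>_. y)) = \<one>\<^bsub>H1 X\<^esub>"
    using path_simplex_const[OF assms] by (simp only: class1_eq_one)
  then show ?thesis using group_hom.hom_one[OF group_hom_\<phi>] by (simp add: \<Phi>_def)
qed

lemma funpow_turn_E: "x \<in> E \<Longrightarrow> (turn ^^ j) x \<in> E"
  by (induction j) (auto simp: turn_E)

lemma f_funpow_turn: "x \<in> E \<Longrightarrow> f ((turn ^^ j) x) = f x"
  by (induction j) (auto simp: f_turn funpow_turn_E)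

lemma path_to_funpow_turn:
  assumes x: "x \<in> E"
  shows "\<exists>g. path g \<and> path_image g \<subseteq> E \<and> pathstart g = x \<and> pathfinish g = (turn ^^ j) x \<and>
    \<Phi> (f \<circ> g) = frag_cmul (int j) \<eta>"
proof (induction j)
  case 0
  show ?case
    using x \<Phi>_const[OF f_E[OF x]]
    by (intro exI[of _ "\<lambda>_. x"]) (auto simp: path_def path_image_def pathstart_def pathfinish_def o_def)
next
  case (Suc j)
  then obtain g where g: "path g" "path_image g \<subseteq> E" "pathstart g = x" "pathfinish g = (turn ^^ j) x"
    "\<Phi> (f \<circ> g) = frag_cmul (int j) \<eta>" by blast
  let ?y = "(turn ^^ j) x"
  let ?h = "\<lambda>s. lift_flow (s, ?y)"
  have y: "?y \<in> E" using x by (rule funpow_turn_E)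
  note h = path_lift_flow[OF y]
  have "\<Phi> (f \<circ> (g +++ ?h)) = \<Phi> (f \<circ> g) + \<Phi> (f \<circ> ?h)"
    unfolding path_compose_join
    using path_f[OF g(1,2)] path_f[OF h(1,2)] g h y x
    by (intro \<Phi>_join) (auto simp: pathfinish_compose pathstart_compose f_funpow_turn f_turn)
  also have "\<dots> = frag_cmul (int j + 1) \<eta>" using g(5) \<Phi>_lift_flow[OF y] by (simp add: frag_cmul_distrib)
  finally have "\<Phi> (f \<circ> (g +++ ?h)) = frag_cmul (int (Suc j)) \<eta>" by (simp add: add.commute)
  moreover have "path (g +++ ?h)" "path_image (g +++ ?h) \<subseteq> E" "pathstart (g +++ ?h) = x"
    "pathfinish (g +++ ?h) = (turn ^^ Suc j) x"
    using g h by (auto simp: path_image_join)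
  ultimately show ?case by blast
qed

text \<open>Following \<open>j\<close> lifted orbits one after the other leads from \<open>x\<close>
  to its image along a path of class \<open>j \<eta>\<close>, and this path closes up exactly if its
  class vanishes modulo \<open>n\<close>.\<close>

lemma funpow_turn_eq_iff:
  assumes x: "x \<in> E"
  shows "(turn ^^ j) x = x \<longleftrightarrow> (\<forall>i<d. int n dvd int j * Poly_Mapping.lookup \<eta> i)"
proof -
  obtain g where g: "path g" "path_image g \<subseteq> E" "pathstart g = x" "pathfinish g = (turn ^^ j) x"
    "\<Phi> (f \<circ> g) = frag_cmul (int j) \<eta>" using path_to_funpow_turn[OF x] by blast
  have "x = (turn ^^ j) x \<longleftrightarrow> (\<forall>i<d. int n dvd Poly_Mapping.lookup (\<Phi> (f \<circ> g)) i)"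
    using closed_iff[OF g(1,2)] g(3,4) x by (simp add: f_funpow_turn)
  then show ?thesis unfolding g(5) by auto
qed

lemma funpow_turn_n: "x \<in> E \<Longrightarrow> (turn ^^ n) x = x"
  by (simp add: funpow_turn_eq_iff)

text \<open>The class of an orbit is divisible in the homology of the complement exactly as its image under
  \<open>\<phi>\<close> is divisible, so the winding number of \<open>F\<close> bounds the divisibility independently of \<open>\<phi>\<close>.\<close>

lemma dvd_winding:
  assumes dvd: "\<And>i. i < d \<Longrightarrow> N dvd j * Poly_Mapping.lookup \<eta> i"
  shows "N dvd j * int (p * q')"
proof -
  define y where "y = (SOME y. y \<in> X)"
  have y: "y \<in> X" unfolding y_def using X_nonempty by (simp add: some_in_eq)
  define \<gamma> where "\<gamma> = (\<lambda>s. flow s y)"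
  have \<gamma>: "cycle1 X (path_simplex \<gamma>)" unfolding \<gamma>_def using path_flow[OF y] by (intro cycle1_loop) auto
  \<comment> \<open>The quotient \<open>j \<eta> / N\<close>, coordinate by coordinate.
    \<open>N = 0\<close> is included, where divisibility means \<open>j \<eta> = 0\<close>; this
    case yields that \<open>\<eta>\<close> is nonzero.\<close>
  define c where "c = (\<Sum>i<d. Poly_Mapping.single i (if N = 0 then 0 else j * Poly_Mapping.lookup \<eta> i div N))"
  have lc: "Poly_Mapping.lookup c i = (if i < d \<and> N \<noteq> 0 then j * Poly_Mapping.lookup \<eta> i div N else 0)" for i
    by (auto simp: c_def lookup_sum lookup_single when_def)
  have c: "Poly_Mapping.keys c \<subseteq> {..<d}" by (auto simp: in_keys_iff lc split: if_splits)
  have eq: "frag_cmul j \<eta> = frag_cmul N c"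
  proof (rule poly_mapping_eqI)
    fix i show "Poly_Mapping.lookup (frag_cmul j \<eta>) i = Poly_Mapping.lookup (frag_cmul N c) i"
    proof (cases "i < d")
      case True
      then show ?thesis using dvd[OF True] by (auto simp: lc)
    next
      case False
      then have "Poly_Mapping.lookup \<eta> i = 0" using \<eta>_keys by (auto simp: in_keys_iff)
      with False show ?thesis by (simp add: lc)
    qed
  qed
  have "bij_betw \<phi> (carrier (H1 X)) (carrier (free_Abelian_group {..<d}))"
    using \<phi>_iso by (simp add: Group.iso_def)
  then have inj: "inj_on \<phi> (carrier (H1 X))" and surj: "\<phi> ` carrier (H1 X) = carrier (free_Abelian_group {..<d})"
    by (auto simp: bij_betw_def)
  have "c \<in> \<phi> ` carrier (H1 X)" unfolding surj using c by simp
  then obtain z where z: "cycle1 X z" "\<phi> (class1 X z) = c" unfolding carrier_H1 by blast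
  \<comment> \<open>A homomorphism respects integral multiples: induction for natural numbers, then
    passage to inverses for negative ones.\<close>
  have pow: "\<phi> (class1 X (frag_cmul k a)) = frag_cmul k (\<phi> (class1 X a))" if a: "cycle1 X a" for k a
  proof -
    have nat: "\<phi> (class1 X (frag_cmul (int m) a)) = frag_cmul (int m) (\<phi> (class1 X a))" for m
    proof (induction m)
      case 0
      show ?case using group_hom.hom_one[OF group_hom_\<phi>] class1_eq_one[of X 0] by simp
    next
      case (Suc m)
      have e: "frag_cmul (int (Suc m)) b = frag_cmul (int m) b + b" for b :: "'x \<Rightarrow>\<^sub>0 int"
        using frag_cmul_distrib[of "int m" 1 b] by (simp add: add.commute)
      have "class1 X (frag_cmul (int m) a + a) = class1 X (frag_cmul (int m) a) \<otimes>\<^bsub>H1 X\<^esub> class1 X a"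
        by (rule class1_add[symmetric]) (use a in \<open>simp_all add: singular_relcycle_cmul\<close>)
      then show ?case unfolding e
        using Suc \<phi>_mult[of "class1 X (frag_cmul (int m) a)" "class1 X a"] a
        by (simp add: class1_in_carrier singular_relcycle_cmul)
    qed
    show ?thesis
    proof (cases "k \<ge> 0")
      case True then show ?thesis using nat[of "nat k"] by simp
    next
      case False
      then obtain m where m: "k = - int m" by (metis neg_int_cases not_le)
      let ?a = "class1 X (frag_cmul (int m) a)" and ?b = "class1 X (frag_cmul k a)"
      have ca: "cycle1 X (frag_cmul (int m) a)" "cycle1 X (frag_cmul k a)" using a by (auto simp: singular_relcycle_cmul)
      have "frag_cmul (int m) a + frag_cmul k a = 0" unfolding m frag_cmul_distrib[symmetric] by simp
      then have "?a \<otimes>\<^bsub>H1 X\<^esub> ?b = \<one>\<^bsub>H1 X\<^esub>" using class1_add[OF ca] class1_eq_one[of X 0] by simp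
      then have "\<phi> ?a + \<phi> ?b = 0"
        using \<phi>_mult[of ?a ?b] ca group_hom.hom_one[OF group_hom_\<phi>] by (simp add: class1_in_carrier)
      then have "\<phi> ?b = - frag_cmul (int m) (\<phi> (class1 X a))" unfolding nat by (simp add: add_eq_0_iff)
      then show ?thesis by (simp add: m)
    qed
  qed
  have "\<phi> (class1 X (frag_cmul j (path_simplex \<gamma>))) = \<phi> (class1 X (frag_cmul N z))"
    unfolding pow[OF \<gamma>] pow[OF z(1)] z(2) using eq \<Phi>_flow[OF y] by (simp add: \<Phi>_def \<gamma>_def)
  then have "class1 X (frag_cmul j (path_simplex \<gamma>)) = class1 X (frag_cmul N z)"
    using inj \<gamma> z(1) by (intro inj_onD[OF inj] class1_in_carrier singular_relcycle_cmul)
  then have "null_chain X (frag_cmul j (path_simplex \<gamma>) - frag_cmul N z)" by (simp only: class1_eq_iff)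
  then show ?thesis
  proof (rule multiple_divides_winding[OF z(1)])
    show "F (\<gamma> t) = F (\<gamma> 0) * cis (2 * pi * real_of_int (int (p * q')) * t)" for t
      by (simp add: \<gamma>_def F_flow mult.assoc)
    show "F (\<gamma> 0) \<noteq> 0" using y by (simp add: \<gamma>_def F_nz)
  qed
qed

lemma winding_pos: "p * q' > 0" using p_pos q'_pos by simp

text \<open>If all coordinates vanished, 0 would divide the positive number
  \<open>p q'\<close>.\<close>

lemma \<eta>_nonzero: "\<exists>j<d. Poly_Mapping.lookup \<eta> j \<noteq> 0"
proof (rule ccontr)
  assume "\<not> ?thesis"
  then have "0 dvd (1::int) * int (p * q')" by (intro dvd_winding) auto
  then show False using winding_pos by simp
qed

text \<open>Bounds the period of every point below by \<open>n / (p q')\<close>, which is linear in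
  \<open>n\<close> and uniform over the cover.\<close>

lemma funpow_turn_neq:
  assumes "x \<in> E" "(turn ^^ j) x = x"
  shows "n dvd j * (p * q')"
  using dvd_winding[of "int n" "int j"] assms by (simp add: funpow_turn_eq_iff flip: of_nat_mult)

text \<open>Each point of the fibre is labelled by the class modulo \<open>n\<close> of a path to it
  from a fixed point; equal labels force equal end points.\<close>

lemma finite_fibre:
  assumes n: "n > 0" and y: "y \<in> X"
  shows "finite {x \<in> E. f x = y}" "card {x \<in> E. f x = y} \<le> n ^ d"
proof -
  let ?A = "{x \<in> E. f x = y}" and ?B = "{..<d} \<rightarrow>\<^sub>E {0..<int n}"
  have "y \<in> f ` E" using covering_space_imp_surjective[OF covering] y by simp
  then obtain x0 where x0: "x0 \<in> E" "f x0 = y" by auto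
  have "\<forall>x\<in>?A. \<exists>g. path g \<and> path_image g \<subseteq> E \<and> pathstart g = x0 \<and> pathfinish g = x"
    using path_connected_E x0 unfolding path_connected_def by blast
  from bchoice[OF this] obtain g where
    "\<forall>x\<in>?A. path (g x) \<and> path_image (g x) \<subseteq> E \<and> pathstart (g x) = x0 \<and> pathfinish (g x) = x" ..
  then have g: "path (g x) \<and> path_image (g x) \<subseteq> E \<and> pathstart (g x) = x0 \<and> pathfinish (g x) = x" if "x \<in> ?A" for x
    using that by (rule bspec)
  define lab where "lab x = (\<lambda>i\<in>{..<d}. Poly_Mapping.lookup (\<Phi> (f \<circ> g x)) i mod int n)" for x
  have inj: "inj_on lab ?A"
  proof (rule inj_onI)
    fix x x' assume x: "x \<in> ?A" and x': "x' \<in> ?A" and eq: "lab x = lab x'"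
    have "int n dvd Poly_Mapping.lookup (\<Phi> (f \<circ> g x')) i - Poly_Mapping.lookup (\<Phi> (f \<circ> g x)) i" if "i < d" for i
      using fun_cong[OF eq, of i] that by (simp add: lab_def mod_eq_dvd_iff[symmetric])
    then have "pathfinish (g x) = pathfinish (g x')"
      using g[OF x] g[OF x'] x x' x0 by (subst endpoint_eq_iff) auto
    then show "x = x'" using g x x' by simp
  qed
  have sub: "lab ` ?A \<subseteq> ?B" 
    unfolding lab_def using n by (intro image_subsetI restrict_PiE_iff[THEN iffD2] ballI) auto
  have fin: "finite ?B" by (intro finite_PiE) auto
  show "finite ?A" by (rule inj_on_finite[OF inj sub fin])
  have "card ?A \<le> card ?B" by (rule card_inj_on_le[OF inj sub fin])
  then show "card ?A \<le> n ^ d" by (simp add: card_PiE)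
qed

text \<open>The orbits are disjoint, each has at least \<open>n / (p q')\<close> points, and the
  fibre has at most \<open>n\<^sup>d\<close>.\<close>

lemma card_orbits_fibre:
  assumes n: "n > 0" and y: "y \<in> X"
  shows "card (orbit turn ` {x \<in> E. f x = y}) \<le> p * q' * n ^ (d - 1)"
proof -
  let ?A = "{x \<in> E. f x = y}" and ?w = "p * q'"
  interpret A: periodic_map ?A turn n
    using n by unfold_locales (auto simp: turn_E f_turn funpow_turn_n)
  \<comment> \<open>The integer ceiling of \<open>n / (p q')\<close>: the first \<open>m\<close>
    iterates of a point are distinct, as \<open>j p q' < n\<close> for \<open>j < m\<close>.\<close>
  define m where "m = (n + ?w - 1) div ?w"
  have wm: "n \<le> ?w * m"
  proof -
    have "n + ?w - 1 = ?w * m + (n + ?w - 1) mod ?w" unfolding m_def by (rule mult_div_mod_eq[symmetric])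
    moreover have "(n + ?w - 1) mod ?w < ?w" using winding_pos by (rule mod_less_divisor)
    ultimately show ?thesis by linarith
  qed
  have small: "j * ?w < n" if "j < m" for j
  proof -
    have "Suc j * ?w \<le> m * ?w" using that by (intro mult_le_mono1) simp
    also have "\<dots> \<le> n + ?w - 1" unfolding m_def by (rule div_times_less_eq_dividend)
    finally show ?thesis using winding_pos unfolding mult_Suc by linarith
  qed
  have orb: "m \<le> card Q \<and> Q \<subseteq> ?A" if Q: "Q \<in> orbit turn ` ?A" for Q
  proof -
    obtain x where x: "x \<in> ?A" "Q = orbit turn x" using Q by blast
    have QA: "Q \<subseteq> ?A" using A.funpow_in[OF x(1)] unfolding x(2) orbit_def by blast
    have "inj_on (\<lambda>j. (turn ^^ j) x) {..<m}"
    proof (rule linorder_inj_onI)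
      fix i j assume ij: "i < j" "i \<in> {..<m}" "j \<in> {..<m}"
      show "(turn ^^ i) x \<noteq> (turn ^^ j) x"
      proof
        assume "(turn ^^ i) x = (turn ^^ j) x"
        then have "(turn ^^ (j - i)) ((turn ^^ i) x) = (turn ^^ i) x"
          using ij funpow_add[of "j - i" i turn] by simp
        then have "n dvd (j - i) * ?w" using x(1) by (intro funpow_turn_neq[of "(turn ^^ i) x"]) (auto intro: funpow_turn_E)
        moreover have "0 < (j - i) * ?w" using ij winding_pos by simp
        moreover have "(j - i) * ?w < n" using small[of "j - i"] ij by simp
        ultimately show False by (simp add: nat_dvd_not_less)
      qed
    qed auto
    then have "card ((\<lambda>j. (turn ^^ j) x) ` {..<m}) = m" by (simp add: card_image)
    moreover have "(\<lambda>j. (turn ^^ j) x) ` {..<m} \<subseteq> Q" unfolding x(2) orbit_def by blast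
    ultimately show ?thesis using QA finite_fibre(1)[OF n y] card_mono finite_subset by metis
  qed
  have fin: "finite (orbit turn ` ?A)" using finite_fibre(1)[OF n y] by simp
  have disj: "Q \<inter> Q' = {}" if Q: "Q \<in> orbit turn ` ?A" and Q': "Q' \<in> orbit turn ` ?A" and ne: "Q \<noteq> Q'" for Q Q'
  proof (rule ccontr)
    assume "Q \<inter> Q' \<noteq> {}"
    then obtain z where z: "z \<in> Q" "z \<in> Q'" by blast
    have "orbit turn z = P" if P: "P \<in> orbit turn ` ?A" "z \<in> P" for P
    proof -
      obtain x where x: "x \<in> ?A" "P = orbit turn x" using P(1) by (rule imageE)
      then obtain j where "z = (turn ^^ j) x" using P(2) by (auto simp: orbit_def)
      then show ?thesis using A.orbit_funpow[OF x(1)] x(2) by simp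
    qed
    then show False using Q Q' z ne by blast
  qed
  have finQ: "finite Q" if "Q \<in> orbit turn ` ?A" for Q
    using orb[OF that] finite_fibre(1)[OF n y] by (meson finite_subset)
  have "card (orbit turn ` ?A) * m = (\<Sum>Q\<in>orbit turn ` ?A. m)" by simp
  also have "\<dots> \<le> (\<Sum>Q\<in>orbit turn ` ?A. card Q)" using orb by (intro sum_mono) blast
  also have "\<dots> = card (\<Union>(orbit turn ` ?A))"
    using disj finQ by (intro card_Union_disjoint[symmetric] pairwiseI) (simp_all add: disjnt_def)
  also have "\<dots> \<le> card ?A" using orb finite_fibre(1)[OF n y] by (intro card_mono) blast+
  also have "\<dots> \<le> n ^ d" by (rule finite_fibre(2)[OF n y])
  also have "n ^ d = n * n ^ (d - 1)" using d_pos by (metis power_eq_if not_gr_zero)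
  finally have "card (orbit turn ` ?A) * m \<le> n * n ^ (d - 1)" .
  then have "?w * (card (orbit turn ` ?A) * m) \<le> ?w * (n * n ^ (d - 1))" by (rule mult_le_mono2)
  moreover have "card (orbit turn ` ?A) * n \<le> card (orbit turn ` ?A) * (?w * m)" using wm by (rule mult_le_mono2)
  moreover have "card (orbit turn ` ?A) * (?w * m) = ?w * (card (orbit turn ` ?A) * m)" by (simp only: ac_simps)
  moreover have "?w * (n * n ^ (d - 1)) = (?w * n ^ (d - 1)) * n" by (simp only: ac_simps)
  ultimately have "card (orbit turn ` ?A) * n \<le> (?w * n ^ (d - 1)) * n" by linarith
  then show ?thesis using n by simp
qed

end

section \<open>The Alexander polynomial\<close>

context torus_cover
begin

text \<open>\<open>lift_flow\<close> is a homotopy from the identity to the turn.\<close>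

lemma hom_induced_turn:
  assumes x: "x \<in> carrier (H1 E)"
  shows "hom_induced 1 (top_of_set E) {} (top_of_set E) {} turn x = x"
proof -
  have "homotopic_with_canon (\<lambda>h. h \<in> {} \<rightarrow> {}) E E (\<lambda>x. lift_flow (0, x)) (\<lambda>x. lift_flow (1, x))"
    unfolding homotopic_with_def
    using continuous_lift_flow lift_flow_E by (intro exI[of _ lift_flow]) auto
  from homology_homotopy_axiom[OF this, of 1]
  have "hom_induced 1 (top_of_set E) {} (top_of_set E) {} turn x = hom_induced 1 (top_of_set E) {} (top_of_set E) {} (\<lambda>x. lift_flow (0, x)) x"
    unfolding turn_def[abs_def] by simp
  also have "\<dots> = x"
    by (rule hom_induced_id_gen[OF _ _ x]) (use continuous_on_compose2[OF continuous_lift_flow, of E "\<lambda>x. (0, x)"] in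
      \<open>auto simp: lift_flow_0 intro!: continuous_intros\<close>)
  finally show ?thesis .
qed

end

text \<open>The deck transformation \<open>T \<eta>\<close> is the turn and acts trivially on
  homology. Hence \<open>t^\<eta> - 1\<close> kills each of the \<open>m\<close> generators, and a
  scalar matrix of relations has the required determinant.\<close>

lemma relation_det_turn:
  assumes "p > 0" "q > 0"
    and \<phi>: "meridian_iso (gcd p q) (torus_link p q) \<phi>"
    and E: "abelian_cover (gcd p q) (torus_link p q) \<phi> 0 (E :: 'a::real_normed_vector set) f"
    and T: "deck_action (gcd p q) (torus_link p q) \<phi> E f T"
    and g: "module_generators (gcd p q) E T m g"
  obtains \<eta> where "Poly_Mapping.keys \<eta> \<subseteq> {..<gcd p q}" "\<exists>j<gcd p q. Poly_Mapping.lookup \<eta> j \<noteq> 0"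
    "(Poly_Mapping.single \<eta> 1 - 1) ^ m \<in> relation_dets (gcd p q) E T m g"
proof -
  interpret torus_cover p q \<phi> 0 E f
    using assms by unfold_locales (auto simp: meridian_iso_def)
  have deck: "(\<exists>S. homeomorphism E E (T a) S) \<and> (\<forall>x\<in>E. f (T a x) = f x) \<and>
      (\<forall>\<gamma>. path \<gamma> \<and> path_image \<gamma> \<subseteq> E \<and> pathfinish \<gamma> = T a (pathstart \<gamma>) \<longrightarrow> \<Phi> (f \<circ> \<gamma>) = a)"
    if "Poly_Mapping.keys a \<subseteq> {..<d}" for a
    using T that unfolding deck_action_def \<Phi>_def loop_class_eq by (elim allE[of _ a]) simp
  \<comment> \<open>In the universal abelian cover a path from \<open>x\<close> to its translate
    determines the translate by its class. This identifies \<open>T \<eta>\<close> with the turn and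
    \<open>T 0\<close> with the identity.\<close>
  have unique: "T a x = pathfinish h"
    if a: "Poly_Mapping.keys a \<subseteq> {..<d}" and h: "path h" "path_image h \<subseteq> E" "f (pathfinish h) = f (pathstart h)"
      "pathstart h = x" "\<Phi> (f \<circ> h) = a" for a x h
  proof -
    have x: "x \<in> E" using h by (metis pathstart_in_path_image subsetD)
    obtain S where "homeomorphism E E (T a) S" using deck[OF a] by blast
    then have Tx: "T a x \<in> E" using x by (metis homeomorphism_image1 imageI)
    then obtain \<gamma> where \<gamma>: "path \<gamma>" "path_image \<gamma> \<subseteq> E" "pathstart \<gamma> = x" "pathfinish \<gamma> = T a x"
      using path_connected_E x unfolding path_connected_def by blast
    have "\<Phi> (f \<circ> \<gamma>) = a" using deck[OF a] \<gamma> by simp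
    moreover have "f (T a x) = f x" using deck[OF a] x by simp
    ultimately have "pathfinish \<gamma> = pathfinish h"
      using \<gamma> h by (subst endpoint_eq_iff) auto
    then show ?thesis using \<gamma> by simp
  qed
  have T\<eta>: "T \<eta> x = turn x" if "x \<in> E" for x
    using unique[OF \<eta>_keys path_lift_flow(1,2)[OF that]] path_lift_flow(3,4)[OF that] \<Phi>_lift_flow[OF that] that
    by (simp add: f_turn)
  have T0: "T 0 x = x" if "x \<in> E" for x
    using unique[of 0 "\<lambda>_. x" x] \<Phi>_const[OF f_E[OF that]] that
    by (simp add: path_def path_image_def pathstart_def pathfinish_def o_def)
  interpret HE: comm_group "H1 E" by (rule abelian_homology_group)
  define P where "P = Poly_Mapping.single \<eta> (1::int) - 1"
  obtain j where j: "j < d" "Poly_Mapping.lookup \<eta> j \<noteq> 0" using \<eta>_nonzero by blast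
  then have \<eta>0: "\<eta> \<noteq> 0" by auto
  have lP: "Poly_Mapping.lookup P a = (if a = \<eta> then 1 else if a = 0 then -1 else 0)" for a
    using \<eta>0 by (auto simp: P_def lookup_minus lookup_single lookup_one when_def)
  have keysP: "Poly_Mapping.keys P = {\<eta>, 0}" using \<eta>0 by (auto simp: in_keys_iff lP split: if_splits)
  have P_in: "P \<in> laurent_in d" using \<eta>_keys by (simp add: laurent_in_def keysP)
  have ind_\<eta>: "hom_induced 1 (top_of_set E) {} (top_of_set E) {} (T \<eta>) x = x" if "x \<in> carrier (H1 E)" for x
    using hom_induced_turn[OF that] hom_induced_eq[of "top_of_set E" "T \<eta>" turn] T\<eta> by simp
  have ind_0: "hom_induced 1 (top_of_set E) {} (top_of_set E) {} (T 0) x = x" if "x \<in> carrier (H1 E)" for x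
    using hom_induced_id[OF that] hom_induced_eq[of "top_of_set E" "T 0" id] T0 by simp
  have act_P: "laurent_act E T P x = \<one>\<^bsub>H1 E\<^esub>" if x: "x \<in> carrier (H1 E)" for x
    unfolding laurent_act_def keysP
    using \<eta>0 x by (subst HE.finprod_insert) (auto simp: ind_\<eta> ind_0 lP HE.int_pow_neg)
  have act_0: "laurent_act E T 0 x = \<one>\<^bsub>H1 E\<^esub>" for x by (simp add: laurent_act_def)
  define A where "A = P \<cdot>\<^sub>m 1\<^sub>m m"
  have A: "A $$ (i, j) = (if i = j then P else 0)" if "i < m" "j < m" for i j
    using that by (simp add: A_def)
  have "det A = P ^ m" by (simp add: A_def det_smult)
  moreover have "det A \<in> relation_dets d E T m g"
    unfolding relation_dets_def
  proof (intro CollectI exI conjI allI impI)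
    show "A \<in> carrier_mat m m" by (simp add: A_def)
    show "A $$ (i, j) \<in> laurent_in d" if "i < m" "j < m" for i j
      using P_in by (simp add: A that laurent_in_def)
    show "laurent_comb E T m (\<lambda>j. A $$ (i, j)) g = \<one>\<^bsub>H1 E\<^esub>" if "i < m" for i
      unfolding laurent_comb_def
    proof (rule HE.finprod_one_eqI)
      fix j assume "j \<in> {..<m}"
      then have "g j \<in> carrier (H1 E)" "j < m" using g by (auto simp: module_generators_def)
      then show "laurent_act E T (A $$ (i, j)) (g j) = \<one>\<^bsub>H1 E\<^esub>"
        using that by (simp add: A act_P act_0)
    qed
  qed simp
  ultimately show thesis using that[OF \<eta>_keys \<eta>_nonzero] by (simp add: P_def)
qed

lemma alexander_polynomial_dvd:
  assumes "p > 0" "q > 0" "alexander_polynomial (gcd p q) (torus_link p q) \<Delta>"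
  obtains \<eta> m where "Poly_Mapping.keys \<eta> \<subseteq> {..<gcd p q}" "\<exists>j<gcd p q. Poly_Mapping.lookup \<eta> j \<noteq> 0"
    "\<Delta> dvd (Poly_Mapping.single \<eta> 1 - 1) ^ m"
proof -
  obtain \<phi> and E :: "(real^7) set" and f T m g where
    "meridian_iso (gcd p q) (torus_link p q) \<phi>" "abelian_cover (gcd p q) (torus_link p q) \<phi> 0 E f"
    "deck_action (gcd p q) (torus_link p q) \<phi> E f T" "module_generators (gcd p q) E T m g"
    and dvd: "\<forall>D \<in> relation_dets (gcd p q) E T m g. \<Delta> dvd D"
    using assms(3) unfolding alexander_polynomial_def by blast
  from relation_det_turn[OF assms(1,2) this(1-4)] obtain \<eta> where
    "Poly_Mapping.keys \<eta> \<subseteq> {..<gcd p q}" "\<exists>j<gcd p q. Poly_Mapping.lookup \<eta> j \<noteq> 0"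
    "(Poly_Mapping.single \<eta> 1 - 1) ^ m \<in> relation_dets (gcd p q) E T m g" .
  then show thesis using that dvd by blast
qed

section \<open>Local structure of branched covers\<close>

text \<open>Off \<open>Z\<close>, lying in the same path component is a relation that is constant on
  the points of each local patch; connectedness of \<open>S\<close> carries it from patch to patch,
  since every open piece contains points off \<open>Z\<close>.\<close>

lemma path_connected_minus:
  fixes S :: "'a::topological_space set"
  assumes S: "connected S"
    and local: "\<And>x. x \<in> S \<Longrightarrow> \<exists>T. openin (top_of_set S) T \<and> x \<in> T \<and> path_connected (T - Z)"
    and dense: "\<And>T. openin (top_of_set S) T \<Longrightarrow> T \<noteq> {} \<Longrightarrow> T - Z \<noteq> {}"
  shows "path_connected (S - Z)"
  unfolding path_connected_component
proof (intro ballI)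
  fix a b assume ab: "a \<in> S - Z" "b \<in> S - Z"
  show "path_component (S - Z) a b"
  proof (rule connected_induction[OF S, where P = "\<lambda>x. x \<notin> Z" and a = a])
    fix T x assume "openin (top_of_set S) T" "x \<in> T"
    then show "\<exists>z. z \<in> T \<and> z \<notin> Z" using dense by blast
  next
    fix x assume "x \<in> S"
    then obtain T where T: "openin (top_of_set S) T" "x \<in> T" "path_connected (T - Z)" using local by blast
    have TS: "T - Z \<subseteq> S - Z" using openin_imp_subset[OF T(1)] by blast
    have "path_component (S - Z) a z" if "y \<in> T" "z \<in> T" "y \<notin> Z \<and> z \<notin> Z \<and> path_component (S - Z) a y" for y z
    proof -
      have "path_component (T - Z) y z" using T(3) that unfolding path_connected_component by blast
      then have "path_component (S - Z) y z" using path_component_of_subset[OF TS] by blast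
      then show ?thesis using that path_component_trans by blast
    qed
    then show "\<exists>T. openin (top_of_set S) T \<and> x \<in> T \<and>
      (\<forall>y\<in>T. \<forall>z\<in>T. y \<notin> Z \<and> z \<notin> Z \<and> path_component (S - Z) a y \<longrightarrow> path_component (S - Z) a z)"
      using T by blast
  qed (use ab in \<open>auto intro: path_component_refl\<close>)
qed

text \<open>The topological trace of codimension two: arbitrarily small neighbourhoods that
  \<open>Z\<close> neither exhausts nor disconnects. It holds for the link in the sphere and for its
  preimage in the branched cover.\<close>

definition locally_nonseparating :: "'a::topological_space set \<Rightarrow> 'a set \<Rightarrow> bool" where
  "locally_nonseparating A Z \<longleftrightarrow>
     (\<forall>N x. openin (top_of_set A) N \<and> x \<in> N \<longrightarrow>
        (\<exists>U. openin (top_of_set A) U \<and> x \<in> U \<and> U \<subseteq> N \<and> path_connected (U - Z) \<and> U - Z \<noteq> {}))"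

lemma locally_nonseparating_minus:
  assumes A: "locally_nonseparating A Z" and S: "openin (top_of_set A) S"
  shows "S \<noteq> {} \<Longrightarrow> S - Z \<noteq> {}" "connected S \<Longrightarrow> path_connected (S - Z)"
proof -
  have SA: "S \<subseteq> A" using S openin_imp_subset by blast
  have sub: "\<exists>U. openin (top_of_set S) U \<and> x \<in> U \<and> U \<subseteq> N \<and> path_connected (U - Z) \<and> U - Z \<noteq> {}"
    if N: "openin (top_of_set S) N" "x \<in> N" for N x
  proof -
    have "openin (top_of_set A) N" using openin_trans[OF N(1) S] .
    with N(2) have "\<exists>U. openin (top_of_set A) U \<and> x \<in> U \<and> U \<subseteq> N \<and> path_connected (U - Z) \<and> U - Z \<noteq> {}"
      by (intro A[unfolded locally_nonseparating_def, rule_format] conjI)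
    then obtain U where U: "openin (top_of_set A) U" "x \<in> U" "U \<subseteq> N" "path_connected (U - Z)" "U - Z \<noteq> {}"
      by (elim exE conjE)
    have "U \<subseteq> S" using U(3) openin_imp_subset[OF N(1)] by (rule order_trans)
    then have "openin (top_of_set S) U" using SA by (rule openin_subset_trans[OF U(1)])
    then show ?thesis using U(2-5) by (intro exI[of _ U] conjI)
  qed
  have S': "openin (top_of_set S) S" by simp
  show "S - Z \<noteq> {}" if ne: "S \<noteq> {}"
  proof -
    obtain x where "x \<in> S" using ne by blast
    from sub[OF S' this] obtain U where U: "U \<subseteq> S" "U - Z \<noteq> {}" by (elim exE conjE)
    then show ?thesis by blast
  qed
  show "path_connected (S - Z)" if c: "connected S"
  proof (rule path_connected_minus[OF c])
    fix x assume "x \<in> S"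
    from sub[OF S' this] obtain U where "openin (top_of_set S) U" "x \<in> U" "path_connected (U - Z)" by (elim exE conjE)
    then show "\<exists>T. openin (top_of_set S) T \<and> x \<in> T \<and> path_connected (T - Z)" by (intro exI conjI)
  next
    fix T assume T: "openin (top_of_set S) T" "T \<noteq> {}"
    then obtain x where "x \<in> T" by blast
    from sub[OF T(1) this] obtain U where U: "U \<subseteq> T" "U - Z \<noteq> {}" by (elim exE conjE)
    then show "T - Z \<noteq> {}" by blast
  qed
qed

text \<open>A small product of a disc and an interval fits into the given neighbourhood in the
  chart; without the axis it is a punctured disc times an interval and stays path connected.\<close>

lemma cylinder_neighbourhood:
  fixes g :: "'a::topological_space \<Rightarrow> complex \<times> real"
  assumes g: "homeomorphism U (ball 0 1 \<times> {-1<..<1}) g g'"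
    and x: "x \<in> U" "fst (g x) = 0" and N: "openin (top_of_set U) N" "x \<in> N"
  obtains U' C where "openin (top_of_set U) U'" "x \<in> U'" "U' \<subseteq> N" "homeomorphism U' C g g'" "convex C"
    "path_connected {y \<in> U'. fst (g y) \<noteq> 0}" "{y \<in> U'. fst (g y) \<noteq> 0} \<noteq> {}"
proof -
  let ?D = "ball (0::complex) 1 \<times> {-1<..<1::real}"
  have oD: "open ?D" by (intro open_Times) auto
  have NU: "N \<subseteq> U" using N openin_imp_subset by blast
  have "openin (top_of_set ?D) (g ` N)" by (rule homeomorphism_imp_open_map[OF g N(1)])
  then have oN: "open (g ` N)" using oD by (metis openin_open_eq)
  have gx: "g x = (0, snd (g x))" using x(2) by (simp add: prod_eq_iff)
  then have "(0, snd (g x)) \<in> g ` N" using N(2) by (metis imageI)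
  from open_prod_elim[OF oN this]
  obtain A B where AB: "open A" "open B" "(0, snd (g x)) \<in> A \<times> B" "A \<times> B \<subseteq> g ` N" .
  then have AB0: "0 \<in> A" "snd (g x) \<in> B" by auto
  obtain a where a: "a > 0" "ball 0 a \<subseteq> A" using AB(1) AB0(1) open_contains_ball by blast
  obtain b where b: "b > 0" "ball (snd (g x)) b \<subseteq> B" using AB(2) AB0(2) open_contains_ball by blast
  define C where "C = ball (0::complex) a \<times> ball (snd (g x)) b"
  have CN: "C \<subseteq> g ` N" using a(2) b(2) AB(4) unfolding C_def by blast
  have gi: "g y \<in> ?D" "g' (g y) = y" if "y \<in> U" for y
    using g that unfolding homeomorphism_def by auto
  have g'i: "g' z \<in> U" "g (g' z) = z" if "z \<in> ?D" for z
    using g that unfolding homeomorphism_def by auto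
  have CD: "C \<subseteq> ?D" using CN gi(1) NU by blast
  define U' where "U' = g' ` C"
  have gU': "g ` U' = C" unfolding U'_def image_image using g'i(2) CD by force
  have U'N: "U' \<subseteq> N" unfolding U'_def using CN gi(2) NU by force
  have hom: "homeomorphism U' C g g'"
    by (rule homeomorphism_of_subsets[OF g _ CD gU']) (use U'N NU in blast)
  have oC: "open C" unfolding C_def by (intro open_Times) auto
  then have "openin (top_of_set ?D) C" using CD oD by (simp add: openin_open_eq)
  then have op: "openin (top_of_set U) U'"
    unfolding U'_def by (rule homeomorphism_imp_open_map[OF homeomorphism_symD[OF g]])
  have "g x \<in> C" unfolding C_def using a(1) b(1) by (subst gx) simp
  then have xU': "x \<in> U'" unfolding U'_def using gi(2)[OF x(1)] by (metis imageI)
  have conv: "convex C" unfolding C_def by (intro convex_Times convex_ball)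
  let ?P = "(ball (0::complex) a - {0}) \<times> ball (snd (g x)) b"
  have eq: "{y \<in> U'. fst (g y) \<noteq> 0} = g' ` ?P"
  proof (intro equalityI subsetI)
    fix y assume y: "y \<in> {y \<in> U'. fst (g y) \<noteq> 0}"
    then have "g y \<in> C" using gU' by blast
    then have "g y \<in> ?P" using y unfolding C_def by (simp add: mem_Times_iff)
    moreover have "y = g' (g y)" using gi(2) y U'N NU by (metis (no_types, lifting) mem_Collect_eq subsetD)
    ultimately show "y \<in> g' ` ?P" by (metis imageI)
  next
    fix y assume "y \<in> g' ` ?P"
    then obtain z where z: "z \<in> ?P" "y = g' z" by blast
    then have zC: "z \<in> C" unfolding C_def by auto
    then show "y \<in> {y \<in> U'. fst (g y) \<noteq> 0}" using z g'i(2)[of z] CD unfolding U'_def by auto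
  qed
  have "path_connected ?P"
    by (intro path_connected_Times path_connected_punctured_ball convex_imp_path_connected) auto
  moreover have "continuous_on ?P g'"
    using homeomorphism_cont2[OF hom] by (rule continuous_on_subset) (auto simp: C_def)
  ultimately have pc: "path_connected {y \<in> U'. fst (g y) \<noteq> 0}"
    unfolding eq by (rule path_connected_continuous_image[rotated])
  have "(complex_of_real (a / 2), snd (g x)) \<in> ?P" using a(1) b(1) by simp
  then have ne: "{y \<in> U'. fst (g y) \<noteq> 0} \<noteq> {}" unfolding eq by blast
  show ?thesis by (rule that[OF op xU' U'N hom conv pc ne])
qed

text \<open>Central projection onto the hyperplane \<open>y \<bullet> c = 1\<close> turns caps of the sphere into convex sets.\<close>

lemma sphere_caps:
  fixes c c' :: "'a::real_inner"
  assumes c: "c \<in> sphere 0 1" and a: "a > 0" "a' > 0"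
  defines "S \<equiv> {x \<in> sphere 0 1. x \<bullet> c > a \<and> x \<bullet> c' > a'}"
  obtains C g g' where "homeomorphism S (C :: 'a set) g g'" "convex C"
proof
  \<comment> \<open>With \<open>y = x / (x \<bullet> c)\<close> and
    \<open>norm y = 1 / (x \<bullet> c)\<close>, the conditions \<open>x \<bullet> c > a\<close> and
    \<open>x \<bullet> c' > a'\<close> become \<open>a * norm y < 1\<close> and
    \<open>a' * norm y < y \<bullet> c'\<close>, which are convex in \<open>y\<close>.\<close>
  let ?C = "{y. y \<bullet> c = 1} \<inter> {y. a * norm y < 1} \<inter> {y. a' * norm y - y \<bullet> c' < 0}"
  let ?g = "\<lambda>x. (1 / (x \<bullet> c)) *\<^sub>R x" and ?g' = "\<lambda>y. (1 / norm y) *\<^sub>R y"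
  have S: "norm x = 1 \<and> x \<bullet> c > a \<and> x \<bullet> c' > a' \<and> x \<bullet> c > 0" if "x \<in> S" for x using that a unfolding S_def by auto
  have C: "norm y > 0" if "y \<in> ?C" for y using that by auto
  show "homeomorphism S ?C ?g ?g'"
  proof (rule homeomorphismI)
    show "continuous_on S ?g" using S by (intro continuous_intros) force
    show "continuous_on ?C ?g'" using C by (intro continuous_intros) force
    show "?g ` S \<subseteq> ?C"
    proof (rule image_subsetI)
      fix x assume "x \<in> S"
      note s = S[OF this]
      have 1: "?g x \<bullet> c = 1" using s by simp
      have 2: "norm (?g x) = 1 / (x \<bullet> c)" using s by simp
      have 3: "a * norm (?g x) < 1" unfolding 2 using s by (simp add: divide_simps)
      have 4: "a' * norm (?g x) - ?g x \<bullet> c' = (a' - x \<bullet> c') / (x \<bullet> c)" unfolding 2 using s by (simp add: diff_divide_distrib)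
      have 5: "(a' - x \<bullet> c') / (x \<bullet> c) < 0" using s by (simp add: divide_less_0_iff)
      show "?g x \<in> ?C" using 1 3 5 unfolding 4[symmetric] by blast
    qed
    show "?g' ` ?C \<subseteq> S"
    proof (rule image_subsetI)
      fix y assume y: "y \<in> ?C"
      note n = C[OF y]
      have "norm (?g' y) = 1" using n by simp
      moreover have "?g' y \<bullet> c > a" using y n by (simp add: pos_less_divide_eq)
      moreover have "?g' y \<bullet> c' > a'" using y n by (simp add: pos_less_divide_eq)
      ultimately show "?g' y \<in> S" unfolding S_def by simp
    qed
    show "?g' (?g x) = x" if "x \<in> S" for x using S[OF that] by simp
    show "?g (?g' y) = y" if "y \<in> ?C" for y using C[OF that] that by simp
  qed
  have conv: "convex {y. m * norm y - y \<bullet> v < r}" if m: "m > 0" for m r :: real and v :: 'a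
  proof (rule convexI)
    fix x y and t u :: real
    assume xy: "x \<in> {y. m * norm y - y \<bullet> v < r}" "y \<in> {y. m * norm y - y \<bullet> v < r}" and tu: "t \<ge> 0" "u \<ge> 0" "t + u = 1"
    let ?z = "t *\<^sub>R x + u *\<^sub>R y"
    have "norm ?z \<le> t * norm x + u * norm y" using norm_triangle_ineq[of "t *\<^sub>R x" "u *\<^sub>R y"] tu by simp
    then have "m * norm ?z \<le> m * (t * norm x + u * norm y)" using m by (intro mult_left_mono) auto
    moreover have "?z \<bullet> v = t * (x \<bullet> v) + u * (y \<bullet> v)" by (simp add: inner_add_left)
    ultimately have "m * norm ?z - ?z \<bullet> v \<le> t * (m * norm x - x \<bullet> v) + u * (m * norm y - y \<bullet> v)"
      by (simp add: algebra_simps)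
    also have "\<dots> < r" using xy tu by (intro convex_bound_lt) auto
    finally show "?z \<in> {y. m * norm y - y \<bullet> v < r}" by simp
  qed
  have "{y. y \<bullet> c = 1} = {y. c \<bullet> y = 1}" by (simp add: inner_commute)
  then have "convex {y. y \<bullet> c = 1}" by (simp add: convex_hyperplane)
  moreover have "convex {y :: 'a. a * norm y < 1}" using conv[OF a(1), of 0 1] by simp
  ultimately show "convex ?C" using conv[OF a(2)] by (intro convex_Int)
qed

lemma path_connected_homeomorphic_convex:
  fixes C :: "'b::real_normed_vector set"
  assumes "homeomorphism U C g g'" "convex C"
  shows "path_connected U"
  using path_connected_continuous_image[OF homeomorphism_cont2[OF assms(1)] convex_imp_path_connected[OF assms(2)]]
  unfolding homeomorphism_image2[OF assms(1)] .

lemma sphere_ball_eq_cap: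
  fixes y :: "'a::real_inner"
  assumes "y \<in> sphere 0 1" "r > 0"
  shows "sphere 0 1 \<inter> ball y r = {x \<in> sphere 0 1. x \<bullet> y > 1 - r\<^sup>2 / 2}"
proof -
  have y: "y \<bullet> y = 1" using assms(1) by (simp add: norm_eq_1)
  have "dist y x < r \<longleftrightarrow> 1 - r\<^sup>2 / 2 < x \<bullet> y" if x: "norm x = 1" for x
  proof -
    have "x \<bullet> x = 1" using x by (simp add: norm_eq_1)
    then have "(dist y x)\<^sup>2 = 2 - 2 * (x \<bullet> y)"
      unfolding dist_norm power2_norm_eq_inner inner_diff_left inner_diff_right using y by (simp add: inner_commute)
    moreover have "dist y x < r \<longleftrightarrow> (dist y x)\<^sup>2 < r\<^sup>2"
      using power_strict_mono[of "dist y x" r 2] power_less_imp_less_base[of "dist y x" 2 r] assms(2)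
      by (intro iffI) simp_all
    ultimately show ?thesis by (simp only:) linarith
  qed
  then show ?thesis by (simp only: set_eq_iff Int_iff mem_ball mem_Collect_eq mem_sphere_0) blast
qed

lemma small_cap:
  fixes y :: "'a::real_inner"
  assumes N: "openin (top_of_set (sphere 0 1)) N" and y: "y \<in> N"
  obtains C D g g' where "openin (top_of_set (sphere 0 1)) C" "y \<in> C" "C \<subseteq> N"
    "homeomorphism C (D :: 'a set) g g'" "convex D"
proof -
  have ys: "y \<in> sphere 0 1" using N y openin_imp_subset by blast
  obtain e where e: "e > 0" "ball y e \<inter> sphere 0 1 \<subseteq> N"
    using N y unfolding openin_contains_ball by blast
  \<comment> \<open>Radius at most 1 makes the height \<open>1 - r\<^sup>2 / 2\<close> of the cap
    positive, as the central projection requires.\<close>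
  define r where "r = min e 1"
  have r: "r > 0" "r \<le> 1" "r \<le> e" using e(1) by (auto simp: r_def)
  define C where "C = sphere 0 1 \<inter> ball y r"
  have "r\<^sup>2 \<le> 1\<^sup>2" using r by (intro power_mono) auto
  then have pos: "1 - r\<^sup>2 / 2 > 0" by simp
  have "C = {x \<in> sphere 0 1. x \<bullet> y > 1 - r\<^sup>2 / 2 \<and> x \<bullet> y > 1 - r\<^sup>2 / 2}"
    unfolding C_def sphere_ball_eq_cap[OF ys r(1)] by simp
  then obtain D g g' where "homeomorphism C (D :: 'a set) g g'" "convex D"
    using sphere_caps[OF ys pos pos, of y] by metis
  moreover have "openin (top_of_set (sphere 0 1)) C" unfolding C_def by (intro openin_open_Int) auto
  moreover have "y \<in> C" using ys r by (simp add: C_def)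
  moreover have "C \<subseteq> N" unfolding C_def using e(2) r(3) by auto
  ultimately show ?thesis using that by blast
qed

context torus
begin

text \<open>The contraction may end on the link, but points off the link stay off it until time 0,
  so it can be lifted to any cover of the complement for positive times. The notion does not mention
  \<open>n\<close>.\<close>

definition contracts :: "(complex \<times> complex) set \<Rightarrow> bool" where
  "contracts V \<longleftrightarrow> (\<exists>y\<in>sphere 0 1. \<exists>G. continuous_on ({0..1::real} \<times> V) G \<and>
     (\<forall>v\<in>V. G (0, v) = y \<and> G (1, v) = v) \<and> (\<forall>c\<in>{0<..1}. \<forall>v\<in>V - L. G (c, v) \<in> X))"

text \<open>The contraction runs along straight segments in the chart towards the image of
  \<open>y\<close>.\<close>

lemma contracts_homeomorphic_convex:
  fixes D :: "'b::real_normed_vector set"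
  assumes h: "homeomorphism V D h h'" and D: "convex D" and y: "y \<in> V" and V: "V \<subseteq> sphere 0 1"
    and off: "\<And>c v. 0 < c \<Longrightarrow> c \<le> 1 \<Longrightarrow> v \<in> V - L \<Longrightarrow> h' ((1 - c) *\<^sub>R h y + c *\<^sub>R h v) \<in> X"
  shows "contracts V"
proof -
  define G where "G = (\<lambda>z. h' ((1 - fst z) *\<^sub>R h y + fst z *\<^sub>R h (snd z)))"
  have hD: "h v \<in> D" "h' (h v) = v" if "v \<in> V" for v
    using that homeomorphism_image1[OF h] homeomorphism_apply1[OF h] by auto
  have "continuous_on ({0..1::real} \<times> V) (\<lambda>z. h (snd z))"
    by (rule continuous_on_compose2[OF homeomorphism_cont1[OF h] continuous_on_snd[OF continuous_on_id]]) auto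
  then have "continuous_on ({0..1::real} \<times> V) (\<lambda>z. (1 - fst z) *\<^sub>R h y + fst z *\<^sub>R h (snd z))"
    by (intro continuous_intros)
  moreover have "(\<lambda>z. (1 - fst z) *\<^sub>R h y + fst z *\<^sub>R h (snd z)) ` ({0..1::real} \<times> V) \<subseteq> D"
  proof (rule image_subsetI)
    fix z assume "z \<in> {0..1::real} \<times> V"
    then have "0 \<le> fst z" "fst z \<le> 1" "snd z \<in> V" by auto
    then show "(1 - fst z) *\<^sub>R h y + fst z *\<^sub>R h (snd z) \<in> D"
      using hD(1) y by (intro convexD[OF D]) auto
  qed
  ultimately have "continuous_on ({0..1::real} \<times> V) G"
    unfolding G_def by (rule continuous_on_compose2[OF homeomorphism_cont2[OF h]])
  moreover have "\<forall>v\<in>V. G (0, v) = y \<and> G (1, v) = v" using hD y by (simp add: G_def)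
  moreover have "\<forall>c\<in>{0<..1}. \<forall>v\<in>V - L. G (c, v) \<in> X" using off by (simp add: G_def)
  ultimately show ?thesis unfolding contracts_def using y V
    by (intro bexI[of _ y] exI[of _ G] conjI) auto
qed

end

locale branched_cover = torus_cover p q \<phi> n "M \<inter> f -` link_complement (gcd p q) (torus_link p q)" f
  for p q \<phi> n and M :: "'a::real_normed_vector set" and f +
  assumes n_pos: "n > 0" and compact_M: "compact M" and continuous_f: "continuous_on M f"
    and surj: "f ` M = sphere 0 1"
    and charts: "\<forall>x\<in>M. f x \<in> link_set (gcd p q) (torus_link p q) \<longrightarrow>
        (\<exists>U V g g' h h'.
           x \<in> U \<and> openin (top_of_set M) U \<and> openin (top_of_set (sphere 0 1)) V \<and> f ` U \<subseteq> V \<and>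
           homeomorphism U (ball (0::complex) 1 \<times> {-1<..<1::real}) g g' \<and>
           homeomorphism V (ball (0::complex) 1 \<times> {-1<..<1::real}) h h' \<and>
           h ` (V \<inter> link_set (gcd p q) (torus_link p q)) = {0} \<times> {-1<..<1} \<and>
           (\<forall>y\<in>U. h (f y) = (fst (g y) ^ n, snd (g y))))"
begin

abbreviation "M0 \<equiv> M \<inter> f -` X"

lemma M0_eq: "M0 = M - f -` L"
  using surj unfolding link_complement_def by auto

lemma openin_M0: "openin (top_of_set M) M0"
  by (rule continuous_openin_preimage[OF continuous_f _ openin_X]) (use surj in auto)

text \<open>In the model \<open>(z, t) \<mapsto> (z\<^sup>n, t)\<close> the branch set is the axis
  \<open>z = 0\<close> on both sides, and \<open>z\<^sup>n = 0\<close> has 0 as its only root; so a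
  branch point is alone in its fibre within the chart.\<close>

lemma chart:
  assumes x: "x \<in> M" "f x \<in> L"
  obtains U V g g' h h' where "x \<in> U" "openin (top_of_set M) U" "openin (top_of_set (sphere 0 1)) V"
    "f ` U \<subseteq> V"
    "homeomorphism U (ball (0::complex) 1 \<times> {-1<..<1::real}) g g'"
    "homeomorphism V (ball (0::complex) 1 \<times> {-1<..<1::real}) h h'"
    "\<forall>v\<in>V. v \<in> L \<longleftrightarrow> fst (h v) = 0"
    "\<forall>y\<in>U. f y \<in> L \<longleftrightarrow> fst (g y) = 0"
    "\<forall>y\<in>U. f y = f x \<longrightarrow> y = x"
proof -
  obtain U V g g' h h' where U: "x \<in> U" "openin (top_of_set M) U" "openin (top_of_set (sphere 0 1)) V"
    and fU: "f ` U \<subseteq> V" and g: "homeomorphism U (ball (0::complex) 1 \<times> {-1<..<1::real}) g g'"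
    and h: "homeomorphism V (ball (0::complex) 1 \<times> {-1<..<1::real}) h h'"
    and hL: "h ` (V \<inter> L) = {0} \<times> {-1<..<1}" and hf: "\<forall>y\<in>U. h (f y) = (fst (g y) ^ n, snd (g y))"
    using charts[rule_format, OF x] by (elim exE conjE)
  have VL: "v \<in> L \<longleftrightarrow> fst (h v) = 0" if v: "v \<in> V" for v
  proof
    assume "v \<in> L"
    then have "h v \<in> {0} \<times> {-1<..<1}" using v unfolding hL[symmetric] by blast
    then show "fst (h v) = 0" by auto
  next
    assume 0: "fst (h v) = 0"
    have "h v \<in> ball 0 1 \<times> {-1<..<1}" using v homeomorphism_image1[OF h] by blast
    then have "h v \<in> h ` (V \<inter> L)" unfolding hL using 0 by (auto simp: mem_Times_iff)
    then obtain w where w: "w \<in> V" "w \<in> L" "h v = h w" by blast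
    then have "h' (h v) = h' (h w)" by (simp only:)
    then have "v = w" unfolding homeomorphism_apply1[OF h v] homeomorphism_apply1[OF h w(1)] .
    then show "v \<in> L" using w(2) by (simp only:)
  qed
  have UL: "f y \<in> L \<longleftrightarrow> fst (g y) = 0" if y: "y \<in> U" for y
  proof -
    have "f y \<in> L \<longleftrightarrow> fst (h (f y)) = 0" by (rule VL) (use fU y in blast)
    also have "fst (h (f y)) = fst (g y) ^ n" using hf y by simp
    finally show ?thesis using n_pos by simp
  qed
  have inj: "y = x" if y: "y \<in> U" and eq: "f y = f x" for y
  proof -
    have "fst (g y) = 0" "fst (g x) = 0" using UL[OF y] UL[OF U(1)] x(2) eq by auto
    moreover have "snd (g y) = snd (g x)" using hf y U(1) eq by (metis snd_conv)
    ultimately have "g y = g x" by (simp add: prod_eq_iff)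
    then have "g' (g y) = g' (g x)" by (simp only:)
    then show ?thesis unfolding homeomorphism_apply1[OF g y] homeomorphism_apply1[OF g U(1)] .
  qed
  show ?thesis using VL UL inj by (intro that[OF U fU g h]) blast+
qed

text \<open>At a branch point a small cylinder of the chart works; elsewhere a sheet of the covering
  over a small cap does.\<close>

lemma good_neighbourhood:
  assumes N: "openin (top_of_set M) N" and x: "x \<in> N"
  obtains U where "openin (top_of_set M) U" "x \<in> U" "U \<subseteq> N" "path_connected U" "path_connected (U - f -` L)"
    "U - f -` L \<noteq> {}" "loops_null U M" "\<forall>y\<in>U. f y = f x \<longrightarrow> y = x"
proof -
  have NM: "N \<subseteq> M" using N openin_imp_subset by blast
  have xM: "x \<in> M" using x NM by blast
  show ?thesis
  proof (cases "f x \<in> L")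
    case True
    obtain U V g g' h h' where U: "x \<in> U" "openin (top_of_set M) U" and V: "openin (top_of_set (sphere 0 1)) V"
      and fU: "f ` U \<subseteq> V"
      and g: "homeomorphism U (ball (0::complex) 1 \<times> {-1<..<1::real}) g g'"
      and h: "homeomorphism V (ball (0::complex) 1 \<times> {-1<..<1::real}) h h'"
      and VL: "\<forall>v\<in>V. v \<in> L \<longleftrightarrow> fst (h v) = 0"
      and UL: "\<forall>y\<in>U. f y \<in> L \<longleftrightarrow> fst (g y) = 0"
      and inj: "\<forall>y\<in>U. f y = f x \<longrightarrow> y = x"
      by (rule chart[OF xM True])
    have "openin (top_of_set M) (U \<inter> N)" using U(2) N by (rule openin_Int)
    then have UN: "openin (top_of_set U) (U \<inter> N)"
      by (rule openin_subset_trans) (use openin_imp_subset[OF U(2)] in auto)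
    have xUN: "x \<in> U \<inter> N" using U(1) x by blast
    have gx: "fst (g x) = 0" using bspec[OF UL U(1)] True by simp
    obtain U' C where U': "openin (top_of_set U) U'" "x \<in> U'" "U' \<subseteq> U \<inter> N" and C: "homeomorphism U' C g g'" "convex C"
      and pc: "path_connected {y \<in> U'. fst (g y) \<noteq> 0}" and ne: "{y \<in> U'. fst (g y) \<noteq> 0} \<noteq> {}"
      by (rule cylinder_neighbourhood[OF g U(1) gx UN xUN])
    have eq: "{y \<in> U'. fst (g y) \<noteq> 0} = U' - f -` L"
      using UL U'(3) by blast
    show ?thesis
    proof (rule that)
      show "openin (top_of_set M) U'" by (rule openin_trans[OF U'(1) U(2)])
      show "x \<in> U'" "U' \<subseteq> N" using U' by auto
      show "path_connected U'" by (rule path_connected_homeomorphic_convex[OF C])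
      show "path_connected (U' - f -` L)" "U' - f -` L \<noteq> {}" using pc ne unfolding eq by auto
      show "loops_null U' M" by (rule loops_null_contractible[OF C]) (use U'(3) NM in blast)
      show "\<forall>y\<in>U'. f y = f x \<longrightarrow> y = x" using inj U'(3) by blast
    qed
  next
    case False
    then have xM0: "x \<in> M0" using xM M0_eq by blast
    obtain T u k where T: "x \<in> T" "openin (top_of_set M0) T" and u: "f x \<in> u" "openin (top_of_set X) u"
      and k: "homeomorphism T u f k" by (rule covering_space_local_homeomorphism[OF covering xM0])
    have TM0: "T \<subseteq> M0" using openin_imp_subset[OF T(2)] .
    have TM: "openin (top_of_set M) T" by (rule openin_trans[OF T(2) openin_M0])
    have "openin (top_of_set M) (T \<inter> N)" using TM N by (rule openin_Int)
    then have "openin (top_of_set T) (T \<inter> N)"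
      by (rule openin_subset_trans) (use openin_imp_subset[OF TM] in auto)
    then have "openin (top_of_set u) (f ` (T \<inter> N))" by (rule homeomorphism_imp_open_map[OF k])
    then have "openin (top_of_set (sphere 0 1)) (f ` (T \<inter> N))" by (rule openin_trans[OF openin_trans[OF _ u(2)] openin_X])
    moreover have "f x \<in> f ` (T \<inter> N)" using T(1) x by blast
    ultimately obtain C D and g g' :: "complex \<times> complex \<Rightarrow> complex \<times> complex" where C: "openin (top_of_set (sphere 0 1)) C" "f x \<in> C" "C \<subseteq> f ` (T \<inter> N)"
      and g: "homeomorphism C D g g'" "convex D" by (rule small_cap)
    have Cu: "C \<subseteq> u" using C(3) homeomorphism_image1[OF k] by blast
    have kf: "k (f y) = y" if "y \<in> T" for y using homeomorphism_apply1[OF k that] .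
    have fk: "f (k v) = v" if "v \<in> u" for v using homeomorphism_apply2[OF k that] .
    define U where "U = k ` C"
    have UTN: "U \<subseteq> T \<inter> N" unfolding U_def using C(3) kf by auto
    have "f ` U = C" unfolding U_def image_image using fk Cu by force
    then have kU: "homeomorphism U C f k" using UTN Cu by (intro homeomorphism_of_subsets[OF k]) auto
    have hom: "homeomorphism U D (g \<circ> f) (k \<circ> g')" by (rule homeomorphism_compose[OF kU g(1)])
    have oC: "openin (top_of_set u) C"
      by (rule openin_subset_trans[OF C(1) Cu]) (use openin_imp_subset[OF u(2)] X_subset in blast)
    have "openin (top_of_set T) U" unfolding U_def by (rule homeomorphism_imp_open_map[OF homeomorphism_symD[OF k] oC])
    then have oU: "openin (top_of_set M) U" by (rule openin_trans[OF _ TM])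
    have UZ: "U - f -` L = U" using UTN TM0 M0_eq by blast
    have xU: "x \<in> U" unfolding U_def using kf[OF T(1)] C(2) by (metis imageI)
    have pc: "path_connected U" by (rule path_connected_homeomorphic_convex[OF hom g(2)])
    show ?thesis
    proof (rule that[OF oU xU _ pc])
      show "U \<subseteq> N" using UTN by blast
      show "path_connected (U - f -` L)" "U - f -` L \<noteq> {}" unfolding UZ using pc xU by auto
      show "loops_null U M" by (rule loops_null_contractible[OF hom g(2)]) (use UTN NM in blast)
      show "\<forall>y\<in>U. f y = f x \<longrightarrow> y = x"
      proof (intro ballI impI)
        fix y assume "y \<in> U" "f y = f x"
        then have "k (f y) = k (f x)" "y \<in> T" using UTN by auto
        then show "y = x" using kf T(1) by simp
      qed
    qed
  qed
qed

lemma nonseparating_M: "locally_nonseparating M (f -` L)"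
  unfolding locally_nonseparating_def
proof (intro allI impI, elim conjE)
  fix N x assume "openin (top_of_set M) N" "x \<in> N"
  then obtain U where "openin (top_of_set M) U" "x \<in> U" "U \<subseteq> N" "path_connected (U - f -` L)" "U - f -` L \<noteq> {}"
    by (rule good_neighbourhood)
  then show "\<exists>U. openin (top_of_set M) U \<and> x \<in> U \<and> U \<subseteq> N \<and> path_connected (U - f -` L) \<and> U - f -` L \<noteq> {}"
    by (intro exI[of _ U] conjI)
qed

text \<open>Flat charts for the link are the target charts of the branched cover; surjectivity of
  \<open>f\<close> provides one around every point of the link.\<close>

lemma nonseparating_sphere: "locally_nonseparating (sphere 0 1) L"
  unfolding locally_nonseparating_def
proof (intro allI impI, elim conjE)
  fix N and y :: "complex \<times> complex" assume N: "openin (top_of_set (sphere 0 1)) N" and y: "y \<in> N"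
  let ?G = "\<exists>U. openin (top_of_set (sphere 0 1)) U \<and> y \<in> U \<and> U \<subseteq> N \<and> path_connected (U - L) \<and> U - L \<noteq> {}"
  have ys: "y \<in> sphere 0 1" using N y openin_imp_subset by blast
  show ?G
  proof (cases "y \<in> L")
    case True
    obtain x where x: "x \<in> M" "y = f x" using ys surj by (metis imageE)
    have fxL: "f x \<in> L" using True x(2) by simp
    obtain U V g g' h h' where U: "x \<in> U" "openin (top_of_set M) U" and V: "openin (top_of_set (sphere 0 1)) V"
      and fU: "f ` U \<subseteq> V"
      and g: "homeomorphism U (ball (0::complex) 1 \<times> {-1<..<1::real}) g g'"
      and h: "homeomorphism V (ball (0::complex) 1 \<times> {-1<..<1::real}) h h'"
      and VL: "\<forall>v\<in>V. v \<in> L \<longleftrightarrow> fst (h v) = 0"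
      and UL: "\<forall>y\<in>U. f y \<in> L \<longleftrightarrow> fst (g y) = 0"
      and inj: "\<forall>y\<in>U. f y = f x \<longrightarrow> y = x"
      by (rule chart[OF x(1) fxL])
    have yV: "y \<in> V" using x U(1) fU by blast
    have "openin (top_of_set (sphere 0 1)) (V \<inter> N)" using V N by (rule openin_Int)
    then have VN: "openin (top_of_set V) (V \<inter> N)"
      by (rule openin_subset_trans) (use openin_imp_subset[OF V] in auto)
    have yVN: "y \<in> V \<inter> N" using yV y by blast
    have hy: "fst (h y) = 0" using bspec[OF VL yV] True by simp
    obtain U' C where U': "openin (top_of_set V) U'" "y \<in> U'" "U' \<subseteq> V \<inter> N"
      and pc: "path_connected {y \<in> U'. fst (h y) \<noteq> 0}" and ne: "{y \<in> U'. fst (h y) \<noteq> 0} \<noteq> {}"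
      by (rule cylinder_neighbourhood[OF h yV hy VN yVN])
    have eq: "{y \<in> U'. fst (h y) \<noteq> 0} = U' - L" using VL U'(3) by blast
    show ?G
      using openin_trans[OF U'(1) V] U' pc ne unfolding eq by (intro exI[of _ U'] conjI) auto
  next
    case False
    have NX: "openin (top_of_set (sphere 0 1)) (N \<inter> X)" using N openin_X by (rule openin_Int)
    have "y \<in> N \<inter> X" using y ys False unfolding link_complement_def by blast
    then obtain C D and g g' :: "complex \<times> complex \<Rightarrow> complex \<times> complex" where C: "openin (top_of_set (sphere 0 1)) C" "y \<in> C" "C \<subseteq> N \<inter> X"
      and g: "homeomorphism C D g g'" "convex D" by (rule small_cap[OF NX])
    have "C - L = C" using C(3) unfolding link_complement_def by blast
    then show ?G using C path_connected_homeomorphic_convex[OF g] by (intro exI[of _ C] conjI) auto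
  qed
qed

text \<open>In a chart that straightens the link, a segment from a point of the axis to a point off
  the axis meets the axis only where it starts.\<close>

lemma contracting_neighbourhood:
  assumes y: "y \<in> sphere 0 1"
  obtains V where "openin (top_of_set (sphere 0 1)) V" "y \<in> V" "contracts V"
proof (cases "y \<in> L")
  case True
  obtain x where x: "x \<in> M" "y = f x" using y surj by (metis imageE)
  have fxL: "f x \<in> L" using True x(2) by simp
    obtain U V g g' h h' where U: "x \<in> U" "openin (top_of_set M) U" and V: "openin (top_of_set (sphere 0 1)) V"
      and fU: "f ` U \<subseteq> V"
      and g: "homeomorphism U (ball (0::complex) 1 \<times> {-1<..<1::real}) g g'"
      and h: "homeomorphism V (ball (0::complex) 1 \<times> {-1<..<1::real}) h h'"
      and VL: "\<forall>v\<in>V. v \<in> L \<longleftrightarrow> fst (h v) = 0"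
      and UL: "\<forall>y\<in>U. f y \<in> L \<longleftrightarrow> fst (g y) = 0"
      and inj: "\<forall>y\<in>U. f y = f x \<longrightarrow> y = x"
      by (rule chart[OF x(1) fxL])
  have yV: "y \<in> V" using x U(1) fU by blast
  have VS: "V \<subseteq> sphere 0 1" using openin_imp_subset[OF V] .
  have conv: "convex (ball (0::complex) 1 \<times> {-1<..<1::real})" by (intro convex_Times) auto
  have "contracts V"
  proof (rule contracts_homeomorphic_convex[OF h conv yV VS])
    fix c :: real and v assume c: "0 < c" "c \<le> 1" and v: "v \<in> V - L"
    let ?z = "(1 - c) *\<^sub>R h y + c *\<^sub>R h v"
    have "h y \<in> ball 0 1 \<times> {-1<..<1}" "h v \<in> ball 0 1 \<times> {-1<..<1}"
      using imageI[OF yV, of h] imageI[of v V h] v unfolding homeomorphism_image1[OF h] by simp_all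
    then have z: "?z \<in> ball 0 1 \<times> {-1<..<1}" using c by (intro convexD[OF conv]) auto
    have "fst ?z = (1 - c) *\<^sub>R fst (h y) + c *\<^sub>R fst (h v)" by simp
    moreover have "fst (h y) = 0" using bspec[OF VL yV] True by (rule iffD1)
    moreover have "fst (h v) \<noteq> 0" using bspec[OF VL, of v] v by simp
    ultimately have "fst (h (h' ?z)) \<noteq> 0" unfolding homeomorphism_apply2[OF h z] using c by simp
    moreover have zV: "h' ?z \<in> V" using imageI[OF z, of h'] unfolding homeomorphism_image2[OF h] .
    ultimately have "h' ?z \<notin> L" using bspec[OF VL zV] by (simp only: simp_thms)
    then show "h' ?z \<in> X" using subsetD[OF VS zV] unfolding link_complement_def by (rule DiffI[rotated])
  qed
  then show ?thesis by (rule that[OF V yV])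
next
  case False
  have "y \<in> X" using y False unfolding link_complement_def by blast
  then obtain C D and g g' :: "complex \<times> complex \<Rightarrow> complex \<times> complex" where C: "openin (top_of_set (sphere 0 1)) C" "y \<in> C" "C \<subseteq> X"
    and g: "homeomorphism C D g g'" "convex D" by (rule small_cap[OF openin_X])
  have "contracts C"
  proof (rule contracts_homeomorphic_convex[OF g C(2)])
    show "C \<subseteq> sphere 0 1" using C(3) X_subset by blast
    fix c :: real and v assume c: "0 < c" "c \<le> 1" and v: "v \<in> C - L"
    have "(1 - c) *\<^sub>R g y + c *\<^sub>R g v \<in> D"
      using imageI[OF C(2), of g] imageI[of v C g] v c unfolding homeomorphism_image1[OF g(1)] by (intro convexD[OF g(2)]) simp_all
    from imageI[OF this, of g'] show "g' ((1 - c) *\<^sub>R g y + c *\<^sub>R g v) \<in> X"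
      unfolding homeomorphism_image2[OF g(1)] by (rule subsetD[OF C(3)])
  qed
  then show ?thesis by (rule that[OF C(1,2)])
qed

end

section \<open>Good covers of the sphere\<close>

context torus
begin

text \<open>Connected pairwise intersections off the link allow edges of the nerve to be counted in
  one fibre; contracting stars make loops in the star of a member bound upstairs. The definition
  sees only the sphere and the link, so one cover serves all \<open>n\<close>.\<close>

definition good_cover :: "(complex \<times> complex) set set \<Rightarrow> bool" where
  "good_cover \<B> \<longleftrightarrow> finite \<B> \<and> \<Union>\<B> = sphere 0 1 \<and> (\<forall>B\<in>\<B>. openin (top_of_set (sphere 0 1)) B) \<and>
     (\<forall>B\<in>\<B>. \<forall>B'\<in>\<B>. B \<inter> B' \<noteq> {} \<longrightarrow> path_connected (B \<inter> B' - L) \<and> B \<inter> B' - L \<noteq> {}) \<and>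
     (\<forall>B\<in>\<B>. \<exists>V. contracts V \<and> (\<forall>B'\<in>\<B>. B \<inter> B' \<noteq> {} \<longrightarrow> B' \<subseteq> V))"

end

context branched_cover
begin

text \<open>Caps of small equal radius around finitely many centres: a Lebesgue number puts each
  star into a contracting set, and the intersection of two caps is convex after central
  projection.\<close>

lemma good_cover_exists: "\<exists>\<B>. good_cover \<B>"
proof -
  let ?S = "sphere (0 :: complex \<times> complex) 1"
  let ?\<G> = "{W. open W \<and> contracts (?S \<inter> W)}"
  have S: "compact ?S" by simp
  have cov: "?S \<subseteq> \<Union>?\<G>"
  proof
    fix y assume "y \<in> ?S"
    then obtain V where V: "openin (top_of_set ?S) V" "y \<in> V" "contracts V" by (rule contracting_neighbourhood)
    then obtain W where "open W" "V = ?S \<inter> W" unfolding openin_open by blast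
    then show "y \<in> \<Union>?\<G>" using V by blast
  qed
  obtain e where e: "e > 0" "\<And>y. y \<in> ?S \<Longrightarrow> \<exists>W\<in>?\<G>. ball y e \<subseteq> W"
    by (rule Heine_Borel_lemma[OF S cov]) blast+
  \<comment> \<open>The caps that meet a given one lie within \<open>3 * r\<close> of its centre,
    hence inside the ball of radius \<open>e\<close>. The bound 1 makes the height of the caps
    positive.\<close>
  define r where "r = min (e / 4) 1"
  have r: "r > 0" "r \<le> 1" "4 * r \<le> e" using e(1) by (auto simp: r_def)
  have "?S \<subseteq> (\<Union>c\<in>?S. ball c r)" using r(1) by force
  then obtain C where C: "C \<subseteq> ?S" "finite C" "?S \<subseteq> (\<Union>c\<in>C. ball c r)"
    by (rule compactE_image[OF S, rotated]) auto
  define B where "B c = ?S \<inter> ball c r" for c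
  have "r\<^sup>2 \<le> 1\<^sup>2" using r by (intro power_mono) auto
  then have pos: "1 - r\<^sup>2 / 2 > 0" by simp
  have Bo: "openin (top_of_set ?S) (B c)" for c unfolding B_def by (intro openin_open_Int) auto
  have pc: "path_connected (B c \<inter> B c' - L) \<and> B c \<inter> B c' - L \<noteq> {}"
    if c: "c \<in> C" "c' \<in> C" and ne: "B c \<inter> B c' \<noteq> {}" for c c'
  proof -
    have c': "c \<in> ?S" "c' \<in> ?S" using c C(1) by auto
    have eq: "B c \<inter> B c' = {x \<in> ?S. x \<bullet> c > 1 - r\<^sup>2 / 2 \<and> x \<bullet> c' > 1 - r\<^sup>2 / 2}"
      unfolding B_def sphere_ball_eq_cap[OF c'(1) r(1)] sphere_ball_eq_cap[OF c'(2) r(1)] by blast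
    obtain D g g' where "homeomorphism (B c \<inter> B c') (D :: (complex \<times> complex) set) g g'" "convex D"
      unfolding eq by (rule sphere_caps[OF c'(1) pos pos])
    then have "connected (B c \<inter> B c')" by (intro path_connected_imp_connected path_connected_homeomorphic_convex)
    then show ?thesis
      using locally_nonseparating_minus[OF nonseparating_sphere openin_Int[OF Bo Bo]] ne by blast
  qed
  have star: "\<exists>V. contracts V \<and> (\<forall>B'\<in>B ` C. B c \<inter> B' \<noteq> {} \<longrightarrow> B' \<subseteq> V)" if c: "c \<in> C" for c
  proof -
    obtain W where W: "contracts (?S \<inter> W)" "ball c e \<subseteq> W" using e(2)[of c] c C(1) by blast
    have "B c' \<subseteq> ?S \<inter> W" if "B c \<inter> B c' \<noteq> {}" for c'
    proof
      fix x assume x: "x \<in> B c'"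
      obtain z where z: "z \<in> B c" "z \<in> B c'" using \<open>B c \<inter> B c' \<noteq> {}\<close> by blast
      have "dist c x \<le> dist c z + dist z c' + dist c' x"
        using dist_triangle[of c x z] dist_triangle[of z x c'] by linarith
      also have "\<dots> < e" using x z r unfolding B_def by (simp add: dist_commute)
      finally have "x \<in> ball c e" by simp
      then show "x \<in> ?S \<inter> W" using x W(2) unfolding B_def by blast
    qed
    then show ?thesis using W(1) by (intro exI[of _ "?S \<inter> W"]) blast
  qed
  have "\<Union>(B ` C) = ?S" using C(3) unfolding B_def by blast
  then have "good_cover (B ` C)"
    unfolding good_cover_def
  proof (intro conjI)
    show "finite (B ` C)" using C(2) by (rule finite_imageI)
    show "Ball (B ` C) (openin (top_of_set ?S))" using Bo by blast
    show "\<forall>b\<in>B ` C. \<forall>B'\<in>B ` C. b \<inter> B' \<noteq> {} \<longrightarrow> path_connected (b \<inter> B' - L) \<and> b \<inter> B' - L \<noteq> {}"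
    proof (intro ballI impI)
      fix b b' assume "b \<in> B ` C" "b' \<in> B ` C" and ne: "b \<inter> b' \<noteq> {}"
      then obtain c c' where c: "c \<in> C" "b = B c" "c' \<in> C" "b' = B c'" by blast
      show "path_connected (b \<inter> b' - L) \<and> b \<inter> b' - L \<noteq> {}"
        unfolding c(2,4) by (rule pc[OF c(1,3) ne[unfolded c(2,4)]])
    qed
    show "\<forall>b\<in>B ` C. \<exists>V. contracts V \<and> (\<forall>B'\<in>B ` C. b \<inter> B' \<noteq> {} \<longrightarrow> B' \<subseteq> V)"
    proof
      fix b assume "b \<in> B ` C"
      then obtain c where "c \<in> C" "b = B c" by blast
      then show "\<exists>V. contracts V \<and> (\<forall>B'\<in>B ` C. b \<inter> B' \<noteq> {} \<longrightarrow> B' \<subseteq> V)" by (simp only: star)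
    qed
  qed
  then show ?thesis by blast
qed

text \<open>Points are isolated in their fibres, also at branch points, and fibres are
  compact.\<close>

lemma finite_fibre_M: "finite {x \<in> M. f x = y}"
proof -
  let ?A = "{x \<in> M. f x = y}"
  have A: "compact ?A"
    by (rule closedin_compact[OF compact_M continuous_closedin_preimage_constant[OF continuous_f]])
  have "\<forall>x\<in>?A. \<exists>W. open W \<and> x \<in> W \<and> (\<forall>z\<in>M \<inter> W. f z = f x \<longrightarrow> z = x)"
  proof
    fix x assume "x \<in> ?A"
    then have M: "openin (top_of_set M) M" "x \<in> M" by auto
    obtain U where U: "openin (top_of_set M) U" "x \<in> U" "\<forall>y\<in>U. f y = f x \<longrightarrow> y = x"
      by (rule good_neighbourhood[OF M])
    then obtain W where "open W" "U = M \<inter> W" unfolding openin_open by blast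
    then show "\<exists>W. open W \<and> x \<in> W \<and> (\<forall>z\<in>M \<inter> W. f z = f x \<longrightarrow> z = x)"
      using U(2,3) by (intro exI[of _ W] conjI) simp_all
  qed
  from bchoice[OF this] obtain W where W: "\<forall>x\<in>?A. open (W x) \<and> x \<in> W x \<and> (\<forall>z\<in>M \<inter> W x. f z = f x \<longrightarrow> z = x)" ..
  have cov: "?A \<subseteq> (\<Union>x\<in>?A. W x)" using W by blast
  have "open (W x)" if "x \<in> ?A" for x using bspec[OF W that] by (rule conjunct1)
  from compactE_image[OF A this cov] obtain F where F: "F \<subseteq> ?A" "finite F" "?A \<subseteq> (\<Union>x\<in>F. W x)" .
  have "?A \<subseteq> F"
  proof
    fix z assume z: "z \<in> ?A"
    then obtain x where x: "x \<in> F" "z \<in> W x" using F(3) by blast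
    then have "x \<in> ?A" using F(1) by blast
    then have "z = x" using bspec[OF W \<open>x \<in> ?A\<close>] x(2) z by auto
    then show "z \<in> F" using x(1) by simp
  qed
  then show ?thesis using F(2) by (rule finite_subset)
qed

text \<open>The finitely many points of the fibre get disjoint good neighbourhoods, each within half
  the distance to the other points. A connected subset of their union lies in one of them.\<close>

lemma loops_null_near_fibre:
  obtains W where "openin (top_of_set M) W" "{x \<in> M. f x = y} \<subseteq> W"
    "\<forall>S. connected S \<and> S \<subseteq> W \<longrightarrow> loops_null S M"
proof -
  let ?A = "{x \<in> M. f x = y}"
  have "\<forall>x\<in>?A. \<exists>U. openin (top_of_set M) U \<and> x \<in> U \<and> loops_null U M \<and>
      (\<exists>d>0. U \<subseteq> ball x (d / 2) \<and> (\<forall>z\<in>?A. z \<noteq> x \<longrightarrow> d \<le> dist x z))"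
  proof
    fix x assume x: "x \<in> ?A"
    obtain d where d: "d > 0" "\<forall>z\<in>?A. z \<noteq> x \<longrightarrow> d \<le> dist x z"
      using finite_set_avoid[OF finite_fibre_M, of y x] by (elim exE conjE)
    have N: "openin (top_of_set M) (M \<inter> ball x (d / 2))" by (intro openin_open_Int) auto
    have "x \<in> M \<inter> ball x (d / 2)" using x d(1) by auto
    then obtain U where U: "openin (top_of_set M) U" "x \<in> U" "U \<subseteq> M \<inter> ball x (d / 2)" "loops_null U M"
      by (rule good_neighbourhood[OF N])
    have Ub: "U \<subseteq> ball x (d / 2)" using U(3) by blast
    show "\<exists>U. openin (top_of_set M) U \<and> x \<in> U \<and> loops_null U M \<and>
      (\<exists>d>0. U \<subseteq> ball x (d / 2) \<and> (\<forall>z\<in>?A. z \<noteq> x \<longrightarrow> d \<le> dist x z))"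
      using U(1,2,4) Ub d by (intro exI[of _ U] conjI exI[of _ d])
  qed
  from bchoice[OF this] obtain U where U: "\<forall>x\<in>?A. openin (top_of_set M) (U x) \<and> x \<in> U x \<and> loops_null (U x) M \<and>
      (\<exists>d>0. U x \<subseteq> ball x (d / 2) \<and> (\<forall>z\<in>?A. z \<noteq> x \<longrightarrow> d \<le> dist x z))" ..
  note U' = bspec[OF U]
  note Uo = conjunct1[OF U'] and Ux = conjunct1[OF conjunct2[OF U']]
    and Ul = conjunct1[OF conjunct2[OF conjunct2[OF U']]] and Ud = conjunct2[OF conjunct2[OF conjunct2[OF U']]]
  have disj: "U x \<inter> U x' = {}" if xx: "x \<in> ?A" "x' \<in> ?A" "x \<noteq> x'" for x x'
  proof (rule ccontr)
    assume "U x \<inter> U x' \<noteq> {}"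
    then obtain z where z: "z \<in> U x" "z \<in> U x'" by blast
    obtain d where d: "U x \<subseteq> ball x (d / 2)" "\<forall>z\<in>?A. z \<noteq> x \<longrightarrow> d \<le> dist x z" using Ud[OF xx(1)] by (elim exE conjE)
    obtain d' where d': "U x' \<subseteq> ball x' (d' / 2)" "\<forall>z\<in>?A. z \<noteq> x' \<longrightarrow> d' \<le> dist x' z" using Ud[OF xx(2)] by (elim exE conjE)
    have "dist x z < d / 2" "dist x' z < d' / 2" using d(1) d'(1) z by auto
    moreover have "d \<le> dist x x'" using bspec[OF d(2) xx(2)] xx(3) by simp
    moreover have "d' \<le> dist x' x" using bspec[OF d'(2) xx(1)] xx(3) by simp
    ultimately show False using dist_triangle3[of x x' z] by (simp add: dist_commute)
  qed
  have openU: "openin (top_of_set M) (\<Union>x\<in>F. U x)" if "F \<subseteq> ?A" for F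
    by (rule openin_Union) (use Uo that in blast)
  show ?thesis
  proof (rule that)
    show "openin (top_of_set M) (\<Union>x\<in>?A. U x)" by (rule openU) simp
    show "?A \<subseteq> (\<Union>x\<in>?A. U x)" using Ux by blast
    have "loops_null S M" if S: "connected S" "S \<subseteq> (\<Union>x\<in>?A. U x)" for S
    proof (cases "S = {}")
      case True
      then show ?thesis by (auto simp: loops_null_def path_image_def)
    next
      case False
      then obtain s x where s: "s \<in> S" "x \<in> ?A" "s \<in> U x" using S(2) by blast
      let ?V = "\<Union>z\<in>?A - {x}. U z"
      have SM: "S \<subseteq> M" using S(2) openin_imp_subset[OF openU[OF order_refl]] by blast
      have int: "openin (top_of_set S) (S \<inter> T)" if T: "openin (top_of_set M) T" for T
      proof -
        obtain O' where "open O'" "T = M \<inter> O'" using T unfolding openin_open by blast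
        moreover have "S \<inter> (M \<inter> O') = S \<inter> O'" using SM by blast
        ultimately show ?thesis by (simp only: openin_open_Int)
      qed
      have 1: "openin (top_of_set S) (S \<inter> U x)" "openin (top_of_set S) (S \<inter> ?V)"
        by (intro int Uo s(2), intro int openU Diff_subset)
      have 2: "S \<subseteq> (S \<inter> U x) \<union> (S \<inter> ?V)" using S(2) by blast
      have 3: "(S \<inter> U x) \<inter> (S \<inter> ?V) = {}" using disj[OF s(2)] by blast
      have "S \<inter> U x \<noteq> {}" using s by blast
      have "S \<inter> ?V = {}"
      proof (rule ccontr)
        assume "S \<inter> ?V \<noteq> {}"
        then have "\<exists>e1 e2. openin (top_of_set S) e1 \<and> openin (top_of_set S) e2 \<and> S \<subseteq> e1 \<union> e2 \<and>
            e1 \<inter> e2 = {} \<and> e1 \<noteq> {} \<and> e2 \<noteq> {}"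
          using 1 2 3 \<open>S \<inter> U x \<noteq> {}\<close> by (intro exI[of _ "S \<inter> U x"] exI[of _ "S \<inter> ?V"] conjI)
        then show False using S(1) unfolding connected_openin by (rule notE[rotated])
      qed
      then have "S \<subseteq> U x" using 2 by blast
      then show ?thesis by (rule loops_null_mono[OF Ul[OF s(2)]])
    qed
    then show "\<forall>S. connected S \<and> S \<subseteq> (\<Union>x\<in>?A. U x) \<longrightarrow> loops_null S M" by blast
  qed
qed

text \<open>The contraction is lifted along the loop from time 1 down to a small positive time,
  where it is still off the link. By compactness the lifted loop has then entered the neighbourhood
  \<open>W\<close> of the fibre over the limit point \<open>y\<close>, where loops bound.\<close>

lemma loops_null_contracts:
  assumes V: "contracts V"
  shows "loops_null (M0 \<inter> f -` V) M"
  unfolding loops_null_def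
proof (intro conjI allI impI)
  fix \<gamma> :: "real \<Rightarrow> 'a"
  assume "path \<gamma> \<and> path_image \<gamma> \<subseteq> M0 \<inter> f -` V \<and> pathfinish \<gamma> = pathstart \<gamma>"
  then have \<gamma>: "path \<gamma>" "path_image \<gamma> \<subseteq> M0 \<inter> f -` V" "pathfinish \<gamma> = pathstart \<gamma>" by auto
  have \<gamma>t: "\<gamma> t \<in> M0" "f (\<gamma> t) \<in> V - L" if "t \<in> {0..1}" for t
    using subsetD[OF \<gamma>(2)[unfolded M0_eq path_image_def] imageI[OF that]] unfolding M0_eq by simp_all
  obtain y G where G: "continuous_on ({0..1::real} \<times> V) G" "\<forall>v\<in>V. G (0, v) = y \<and> G (1, v) = v"
    "\<forall>c\<in>{0<..1}. \<forall>v\<in>V - L. G (c, v) \<in> X" using V unfolding contracts_def by (elim bexE exE conjE)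
  obtain W where W: "openin (top_of_set M) W" "{x \<in> M. f x = y} \<subseteq> W"
    "\<forall>S. connected S \<and> S \<subseteq> W \<longrightarrow> loops_null S M" by (rule loops_null_near_fibre[of y])
  \<comment> \<open>A compact set that misses \<open>y\<close>: a point of \<open>M\<close> whose
    image avoids \<open>Z\<close> lies in \<open>W\<close>.\<close>
  define Z where "Z = f ` (M - W)"
  have "closedin (top_of_set M) (M - W)" using W(1) by (simp add: closedin_diff)
  then have "compact (M - W)" using compact_M by (simp add: closedin_compact_eq)
  then have Z: "compact Z" unfolding Z_def by (intro compact_continuous_image continuous_on_subset[OF continuous_f]) auto
  have yZ: "y \<notin> Z" using W(2) unfolding Z_def by blast
  have "continuous_on {0..1} (f \<circ> \<gamma>)" using path_f[OF \<gamma>(1)] \<gamma>(2) unfolding path_def by blast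
  then have cf\<gamma>: "continuous_on ({0..1::real} \<times> {0..1::real}) (\<lambda>z. (f \<circ> \<gamma>) (snd z))"
    by (rule continuous_on_compose2[OF _ continuous_on_snd[OF continuous_on_id]]) auto
  have cG: "continuous_on ({0..1::real} \<times> {0..1::real}) (\<lambda>z. G (u (fst z), f (\<gamma> (snd z))))"
    if u: "continuous_on {0..1} u" "u ` {0..1} \<subseteq> {0..1}" for u
  proof (rule continuous_on_compose2[OF G(1)])
    have "continuous_on ({0..1::real} \<times> {0..1::real}) (\<lambda>z. u (fst z))"
      by (rule continuous_on_compose2[OF u(1) continuous_on_fst[OF continuous_on_id]]) auto
    then show "continuous_on ({0..1::real} \<times> {0..1::real}) (\<lambda>z. (u (fst z), f (\<gamma> (snd z))))"
      using cf\<gamma> by (intro continuous_on_Pair) (simp_all add: o_def)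
    show "(\<lambda>z. (u (fst z), f (\<gamma> (snd z)))) ` ({0..1} \<times> {0..1}) \<subseteq> {0..1} \<times> V"
      using u(2) \<gamma>t(2) by auto
  qed
  define g where "g = (\<lambda>z. G (fst z, f (\<gamma> (snd z))))"
  have g: "continuous_on ({0..1::real} \<times> {0..1::real}) g" unfolding g_def using cG[of "\<lambda>c. c"] by simp
  define Dz where "Dz = ({0..1::real} \<times> {0..1::real}) \<inter> g -` Z"
  have "closed Dz" unfolding Dz_def
    by (rule continuous_closed_preimage[OF g]) (auto intro: closed_Times compact_imp_closed[OF Z])
  then have "compact Dz"
    using compact_Int_closed[of "{0..1::real} \<times> {0..1::real}" Dz] compact_Times[of "{0..1::real}" "{0..1::real}"]
    by (simp add: Dz_def Int_absorb2 flip: Int_assoc)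
  then have D: "closed (fst ` Dz)" by (intro compact_imp_closed compact_continuous_image continuous_intros)
  have "0 \<notin> fst ` Dz"
  proof
    assume "0 \<in> fst ` Dz"
    then obtain t where "(0, t) \<in> Dz" by force
    then have t: "t \<in> {0..1}" "G (0, f (\<gamma> t)) \<in> Z" by (auto simp: Dz_def g_def)
    then show False using G(2) \<gamma>t(2)[OF t(1)] yZ by auto
  qed
  then obtain e where e: "e > 0" "ball 0 e \<subseteq> - fst ` Dz"
    using D open_contains_ball[of "- fst ` Dz"] by blast
  \<comment> \<open>The times at which the contracted loop meets \<open>Z\<close> form a closed set
    without 0; \<open>\<epsilon>\<close> lies below all of them.\<close>
  define \<epsilon> where "\<epsilon> = min (e / 2) 1"
  have \<epsilon>: "0 < \<epsilon>" "\<epsilon> \<le> 1" "\<epsilon> < e" using e(1) by (auto simp: \<epsilon>_def)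
  have \<epsilon>D: "\<epsilon> \<notin> fst ` Dz" using subsetD[OF e(2), of \<epsilon>] \<epsilon> by simp
  have \<epsilon>Z: "G (\<epsilon>, f (\<gamma> t)) \<notin> Z" if "t \<in> {0..1}" for t
  proof
    assume "G (\<epsilon>, f (\<gamma> t)) \<in> Z"
    then have "(\<epsilon>, t) \<in> Dz" using that \<epsilon> by (simp add: Dz_def g_def)
    then show False using \<epsilon>D by force
  qed
  \<comment> \<open>Runs from 1 to \<open>\<epsilon>\<close>, so time 0, where the contraction may
    hit the link, is never reached.\<close>
  define u where "u s = 1 - (1 - \<epsilon>) * s" for s :: real
  have u: "u s \<in> {0<..1}" if "s \<in> {0..1}" for s
  proof -
    have "(1 - \<epsilon>) * s \<le> (1 - \<epsilon>) * 1" using that \<epsilon> by (intro mult_left_mono) auto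
    moreover have "0 \<le> (1 - \<epsilon>) * s" using that \<epsilon> by simp
    ultimately
    show ?thesis using \<epsilon> unfolding u_def by simp
  qed
  define h where "h = (\<lambda>z. G (u (fst z), f (\<gamma> (snd z))))"
  have ch: "continuous_on ({0..1::real} \<times> {0..1::real}) h" unfolding h_def
  proof (rule cG)
    show "continuous_on {0..1} u" unfolding u_def by (intro continuous_intros)
    show "u ` {0..1} \<subseteq> {0..1}" using u by force
  qed
  have hX: "h \<in> {0..1} \<times> {0..1} \<rightarrow> X"
  proof
    fix z :: "real \<times> real" assume "z \<in> {0..1} \<times> {0..1}"
    then have "fst z \<in> {0..1}" "snd z \<in> {0..1}" by auto
    then show "h z \<in> X" unfolding h_def using G(3) u \<gamma>t(2) by blast
  qed
  have h0: "h (0, t) = f (\<gamma> t)" if "t \<in> {0..1}" for t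
    using G(2) \<gamma>t(2)[OF that] by (auto simp: h_def u_def)
  have \<gamma>c: "continuous_on {0..1} \<gamma>" using \<gamma>(1) by (simp add: path_def)
  have \<gamma>M0: "\<gamma> \<in> {0..1} \<rightarrow> M0" using \<gamma>t(1) by blast
  obtain k where ck: "continuous_on ({0..1::real} \<times> {0..1::real}) k" and kM0: "k \<in> {0..1} \<times> {0..1} \<rightarrow> M0"
    and k0: "\<And>t. t \<in> {0..1} \<Longrightarrow> k (0, t) = \<gamma> t" and kh: "\<And>z. z \<in> {0..1} \<times> {0..1} \<Longrightarrow> h z = f (k z)"
    by (rule covering_space_lift_homotopy[OF covering ch hX _ \<gamma>c \<gamma>M0]) (erule h0, rule that)
  have \<gamma>01: "\<gamma> 0 = \<gamma> 1" using \<gamma>(3) by (simp add: pathfinish_def pathstart_def)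
  have slice: "continuous_on {0..1} (\<lambda>s. k (s, t))" "continuous_on {0..1} (\<lambda>s. k (t, s))" if "t \<in> {0..1}" for t
    using that by (auto intro!: continuous_on_compose2[OF ck] continuous_intros)
  \<comment> \<open>Both sides lift the same path from the same point, as \<open>\<gamma>\<close> is
    closed. So the lifted loop stays closed, and its side terms cancel.\<close>
  have sides: "k (s, 0) = k (s, 1)" if s: "s \<in> {0..1}" for s
  proof (rule covering_space_lift_unique[OF covering, where ?g1.0 = "\<lambda>s. k (s, 0)" and ?g2.0 = "\<lambda>s. k (s, 1)" and a = 0 and T = "{0..1}" and f = "\<lambda>s. h (s, 0)"])
    show "k (0, 0) = k (0, 1)" using k0[of 0] k0[of 1] \<gamma>01 by simp
    show "continuous_on {0..1} (\<lambda>s. h (s, 0))"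
      by (rule continuous_on_compose2[OF ch]) (auto intro!: continuous_intros)
    show "(\<lambda>s. h (s, 0)) \<in> {0..1} \<rightarrow> X" using hX by auto
    show "continuous_on {0..1} (\<lambda>s. k (s, 0))" "continuous_on {0..1} (\<lambda>s. k (s, 1))" by (rule slice; simp)+
    show "(\<lambda>s. k (s, 0)) \<in> {0..1} \<rightarrow> M0" "(\<lambda>s. k (s, 1)) \<in> {0..1} \<rightarrow> M0" using kM0 by auto
    show "h (x, 0) = f (k (x, 0))" if "x \<in> {0..1}" for x using kh[of "(x, 0)"] that by simp
    show "h (x, 0) = f (k (x, 1))" if "x \<in> {0..1}" for x
      using kh[of "(x, 1)"] that \<gamma>01 by (simp add: h_def)
  qed (use s in auto)
  let ?k1 = "\<lambda>t. k (1, t)"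
  have sq: "null_chain M (path_simplex (\<lambda>t. k (0, t)) + path_simplex (\<lambda>s. k (s, 1))
      - path_simplex (\<lambda>s. k (s, 0)) - path_simplex ?k1)"
    by (rule path_simplex_square[OF ck]) (use kM0 in auto)
  have "path_simplex (\<lambda>t. k (0, t)) = path_simplex \<gamma>" by (rule path_simplex_cong) (rule k0)
  moreover have "path_simplex (\<lambda>s. k (s, 1)) = path_simplex (\<lambda>s. k (s, 0))"
    by (rule path_simplex_cong) (rule sides[symmetric])
  ultimately have 1: "null_chain M (path_simplex \<gamma> - path_simplex ?k1)" using sq by simp
  have p1: "path ?k1" unfolding path_def by (rule slice(2)) simp
  have "path_image ?k1 \<subseteq> W"
  proof
    fix x assume "x \<in> path_image ?k1"
    then obtain t where t: "t \<in> {0..1}" "x = k (1, t)" unfolding path_image_def by blast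
    have xM: "x \<in> M" using kM0 t by auto
    have "f x = h (1, t)" using kh[of "(1, t)"] t by simp
    also have "\<dots> = G (\<epsilon>, f (\<gamma> t))" by (simp add: h_def u_def)
    finally have "f x \<notin> Z" using \<epsilon>Z[OF t(1)] by simp
    then show "x \<in> W" using xM unfolding Z_def by blast
  qed
  then have "loops_null (path_image ?k1) M" using W(3) connected_path_image[OF p1] by blast
  moreover have "pathfinish ?k1 = pathstart ?k1" using sides[of 1] by (simp add: pathfinish_def pathstart_def)
  ultimately have 2: "null_chain M (path_simplex ?k1)" using p1 unfolding loops_null_def by blast
  show "null_chain M (path_simplex \<gamma>)" using singular_relboundary_add[OF 1 2] by simp
qed auto

end

section \<open>One-cycles of branched covers\<close>

text \<open>If \<open>\<rho>\<close> agrees on each simplex with the difference of a potential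
  \<open>l\<close> at its ends, up to the subgroup \<open>P\<close>, then its sum over a cycle lies
  in \<open>P\<close>: the potentials cancel. All comparisons of 1-cycles below have this
  form.\<close>

lemma potential_sum:
  fixes z :: "'s \<Rightarrow>\<^sub>0 int" and \<rho> :: "'s \<Rightarrow> 'k \<Rightarrow>\<^sub>0 int" and l :: "'x \<Rightarrow> 'k \<Rightarrow>\<^sub>0 int"
  assumes z: "Poly_Mapping.keys z \<subseteq> S" and P0: "P 0" and Pdiff: "\<And>a b. P a \<Longrightarrow> P b \<Longrightarrow> P (a - b)"
    and P: "\<And>\<sigma>. \<sigma> \<in> S \<Longrightarrow> P (\<rho> \<sigma> - (l (t \<sigma>) - l (s \<sigma>)))"
    and bd: "frag_extend (\<lambda>\<sigma>. frag_of (t \<sigma>) - frag_of (s \<sigma>)) z = 0"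
  shows "P (frag_extend \<rho> z)"
proof -
  have "frag_extend (\<lambda>\<sigma>. l (t \<sigma>) - l (s \<sigma>)) z = frag_extend l (frag_extend (\<lambda>\<sigma>. frag_of (t \<sigma>) - frag_of (s \<sigma>)) z)"
    by (simp only: frag_extend_frag_extend frag_extend_diff frag_extend_of)
  also have "\<dots> = 0" unfolding bd by simp
  finally have "frag_extend \<rho> z = frag_extend (\<lambda>\<sigma>. \<rho> \<sigma> - (l (t \<sigma>) - l (s \<sigma>))) z"
    by (simp only: frag_extend_diff_fun diff_zero)
  moreover have "P (frag_extend (\<lambda>\<sigma>. \<rho> \<sigma> - (l (t \<sigma>) - l (s \<sigma>))) z)"
    using z
  proof (induction z rule: frag_induction)
    case (diff a b)
    then show ?case using Pdiff by (simp only: frag_extend_diff)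
  qed (simp_all add: P0 P)
  ultimately show ?thesis by (simp only:)
qed

lemma chain_boundary_frag_extend:
  "chain_boundary p (frag_extend g c) = frag_extend (\<lambda>x. chain_boundary p (g x)) c"
  by (cases "p = 0") (simp_all add: chain_boundary_def frag_extend_frag_extend frag_extend_eq_0)

text \<open>Evaluation of singular 0-simplices at the vertex turns the boundary into a formal sum of
  points.\<close>

lemma ends_sum_zero:
  assumes ends: "\<And>\<sigma>. \<sigma> \<in> Poly_Mapping.keys z \<Longrightarrow>
      chain_boundary 1 (frag_of \<sigma>) = point_simplex (t \<sigma>) - point_simplex (s \<sigma>)"
    and bd: "chain_boundary 1 z = 0"
  shows "frag_extend (\<lambda>\<sigma>. frag_of (t \<sigma>) - frag_of (s \<sigma>)) z = 0"
proof -
  let ?\<pi> = "\<lambda>\<tau>. frag_of (\<tau> (\<lambda>i::nat. if i = 0 then 1 else 0 :: real))"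
  have pt: "frag_extend ?\<pi> (point_simplex x) = frag_of x" for x
    by (simp add: point_simplex_def standard_simplex_def)
  have "frag_extend (\<lambda>\<sigma>. chain_boundary 1 (frag_of \<sigma>)) z = chain_boundary 1 (frag_extend frag_of z)"
    by (simp only: chain_boundary_frag_extend)
  also have "\<dots> = 0" unfolding frag_expansion[symmetric] by (rule bd)
  finally have 0: "frag_extend (\<lambda>\<sigma>. chain_boundary 1 (frag_of \<sigma>)) z = 0" .
  have "frag_extend (\<lambda>\<sigma>. frag_of (t \<sigma>) - frag_of (s \<sigma>)) z =
      frag_extend (\<lambda>\<sigma>. frag_extend ?\<pi> (chain_boundary 1 (frag_of \<sigma>))) z"
    by (rule frag_extend_eq) (simp only: ends frag_extend_diff pt)
  also have "\<dots> = frag_extend ?\<pi> (frag_extend (\<lambda>\<sigma>. chain_boundary 1 (frag_of \<sigma>)) z)"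
    by (simp only: frag_extend_frag_extend)
  finally show ?thesis unfolding 0 by simp
qed

lemma simplex_paths:
  fixes S :: "'a::topological_space set"
  assumes "singular_chain 1 (top_of_set S) z"
  obtains g where "\<And>\<sigma>. \<sigma> \<in> Poly_Mapping.keys z \<Longrightarrow> path (g \<sigma>)"
    "\<And>\<sigma>. \<sigma> \<in> Poly_Mapping.keys z \<Longrightarrow> path_image (g \<sigma>) = \<sigma> ` standard_simplex 1"
    "\<And>\<sigma>. \<sigma> \<in> Poly_Mapping.keys z \<Longrightarrow> frag_of \<sigma> = path_simplex (g \<sigma>)"
    "\<And>\<sigma>. \<sigma> \<in> Poly_Mapping.keys z \<Longrightarrow> chain_boundary 1 (frag_of \<sigma>) = point_simplex (pathfinish (g \<sigma>)) - point_simplex (pathstart (g \<sigma>))"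
proof -
  have "\<forall>\<sigma>\<in>Poly_Mapping.keys z. \<exists>g. path g \<and> path_image g = \<sigma> ` standard_simplex 1 \<and> frag_of \<sigma> = path_simplex g"
  proof
    fix \<sigma> assume "\<sigma> \<in> Poly_Mapping.keys z"
    then have "singular_simplex 1 (top_of_set S) \<sigma>" using assms by (auto simp: singular_chain_def)
    then obtain g where "path g" "path_image g = \<sigma> ` standard_simplex 1" "frag_of \<sigma> = path_simplex g"
      by (rule singular_simplex_1_path)
    then show "\<exists>g. path g \<and> path_image g = \<sigma> ` standard_simplex 1 \<and> frag_of \<sigma> = path_simplex g"
      by (intro exI[of _ g] conjI)
  qed
  from bchoice[OF this] obtain g where
    g: "\<forall>\<sigma>\<in>Poly_Mapping.keys z. path (g \<sigma>) \<and> path_image (g \<sigma>) = \<sigma> ` standard_simplex 1 \<and> frag_of \<sigma> = path_simplex (g \<sigma>)" ..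
  show ?thesis
  proof (rule that)
    fix \<sigma> assume "\<sigma> \<in> Poly_Mapping.keys z"
    note g' = bspec[OF g this]
    show "path (g \<sigma>)" by (rule conjunct1[OF g'])
    show "path_image (g \<sigma>) = \<sigma> ` standard_simplex 1" by (rule conjunct1[OF conjunct2[OF g']])
    show f: "frag_of \<sigma> = path_simplex (g \<sigma>)" by (rule conjunct2[OF conjunct2[OF g']])
    show "chain_boundary 1 (frag_of \<sigma>) = point_simplex (pathfinish (g \<sigma>)) - point_simplex (pathstart (g \<sigma>))"
      unfolding f chain_boundary_path_simplex pathfinish_def pathstart_def ..
  qed
qed

lemma singular_chain_frag_extend_paths:
  assumes "\<And>\<sigma>. \<sigma> \<in> Poly_Mapping.keys z \<Longrightarrow> path (g \<sigma>)" "\<And>\<sigma>. \<sigma> \<in> Poly_Mapping.keys z \<Longrightarrow> path_image (g \<sigma>) \<subseteq> S"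
  shows "singular_chain 1 (top_of_set S) (frag_extend (\<lambda>\<sigma>. path_simplex (g \<sigma>)) z)"
  using assms by (intro singular_chain_extend singular_chain_path_simplex)

lemma loops_null_square:
  assumes U: "loops_null U M"
    and g: "path g1" "path g2" "path g3" "path g4"
    and i: "path_image g1 \<subseteq> U" "path_image g2 \<subseteq> U" "path_image g3 \<subseteq> U" "path_image g4 \<subseteq> U"
    and e: "pathfinish g1 = pathstart g2" "pathfinish g3 = pathstart g4" "pathstart g1 = pathstart g3" "pathfinish g2 = pathfinish g4"
  shows "null_chain M (path_simplex g1 + path_simplex g2 - (path_simplex g3 + path_simplex g4))"
proof -
  have UM: "U \<subseteq> M" using U by (simp add: loops_null_def)
  have 1: "null_chain M (path_simplex g1 + path_simplex g2 - path_simplex (g1 +++ g2))"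
    using g i e UM by (intro path_simplex_join) auto
  have 2: "null_chain M (path_simplex g3 + path_simplex g4 - path_simplex (g3 +++ g4))"
    using g i e UM by (intro path_simplex_join) auto
  have 3: "null_chain M (path_simplex (g1 +++ g2) - path_simplex (g3 +++ g4))"
    using g i e by (intro loops_null_parallel[OF U]) (auto simp: path_image_join)
  have "path_simplex g1 + path_simplex g2 - (path_simplex g3 + path_simplex g4) =
     (path_simplex g1 + path_simplex g2 - path_simplex (g1 +++ g2)) +
     ((path_simplex (g1 +++ g2) - path_simplex (g3 +++ g4)) - (path_simplex g3 + path_simplex g4 - path_simplex (g3 +++ g4)))"
    by simp
  then show ?thesis using singular_relboundary_add[OF 1 singular_relboundary_diff[OF 3 2]] by (simp only:)
qed

context branched_cover
begin

text \<open>Every 1-cycle is pushed off the branch set: subdivide it until each simplex lies in a good open set,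
  and move the vertices off the branch set inside the finitely many of these sets that contain them.\<close>

lemma homologous_in_M0:
  assumes z: "cycle1 M z"
  obtains z' where "cycle1 M0 z'" "null_chain M (z - z')"
proof -
  let ?\<U> = "{U. openin (top_of_set M) U \<and> path_connected (U - f -` L) \<and> loops_null U M}"
  have cov: "topspace (top_of_set M) \<subseteq> \<Union>?\<U>"
  proof
    fix x assume "x \<in> topspace (top_of_set M)"
    then have x: "openin (top_of_set M) M" "x \<in> M" by auto
    obtain U where "openin (top_of_set M) U" "x \<in> U" "path_connected (U - f -` L)" "loops_null U M"
      by (rule good_neighbourhood[OF x])
    then show "x \<in> \<Union>?\<U>" by blast
  qed
  have opn: "openin (top_of_set M) U" if "U \<in> ?\<U>" for U using that by simp
  obtain y where y: "cycle1 M y" and zy: "homologous_rel 1 (top_of_set M) {} z y"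
    and small: "\<forall>\<sigma>\<in>Poly_Mapping.keys y. \<exists>V\<in>?\<U>. \<sigma> \<in> standard_simplex 1 \<rightarrow> V"
    by (rule small_homologous_rel_relcycle_exists[OF opn cov z]) (assumption, rule that, blast+)
  let ?K = "Poly_Mapping.keys y"
  have yc: "singular_chain 1 (top_of_set M) y" "chain_boundary 1 y = 0" using y by (auto simp: singular_cycle)
  from bchoice[OF small[unfolded Bex_def]] obtain U where
    U0: "\<forall>\<sigma>\<in>?K. U \<sigma> \<in> ?\<U> \<and> \<sigma> \<in> standard_simplex 1 \<rightarrow> U \<sigma>" ..
  have Uo: "openin (top_of_set M) (U \<sigma>)" and Upc: "path_connected (U \<sigma> - f -` L)" and Uln: "loops_null (U \<sigma>) M"
    and Uim: "\<sigma> ` standard_simplex 1 \<subseteq> U \<sigma>" if "\<sigma> \<in> ?K" for \<sigma>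
    using bspec[OF U0 that] by auto
  obtain g where g: "\<And>\<sigma>. \<sigma> \<in> ?K \<Longrightarrow> path (g \<sigma>)"
    "\<And>\<sigma>. \<sigma> \<in> ?K \<Longrightarrow> path_image (g \<sigma>) = \<sigma> ` standard_simplex 1"
    "\<And>\<sigma>. \<sigma> \<in> ?K \<Longrightarrow> frag_of \<sigma> = path_simplex (g \<sigma>)"
    "\<And>\<sigma>. \<sigma> \<in> ?K \<Longrightarrow> chain_boundary 1 (frag_of \<sigma>) = point_simplex (pathfinish (g \<sigma>)) - point_simplex (pathstart (g \<sigma>))"
    by (rule simplex_paths[OF yc(1)]) (rule that)
  have gU: "path_image (g \<sigma>) \<subseteq> U \<sigma>" if "\<sigma> \<in> ?K" for \<sigma> using g(2)[OF that] Uim[OF that] by simp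
  have UM: "U \<sigma> \<subseteq> M" if "\<sigma> \<in> ?K" for \<sigma> using openin_imp_subset[OF Uo[OF that]] .
  have "\<forall>x\<in>M. \<exists>\<kappa>. path \<kappa> \<and> pathstart \<kappa> = x \<and> pathfinish \<kappa> \<in> M0 \<and> (\<forall>\<sigma>\<in>?K. x \<in> U \<sigma> \<longrightarrow> path_image \<kappa> \<subseteq> U \<sigma>)"
  proof
    fix x assume x: "x \<in> M"
    \<comment> \<open>The path chosen for \<open>x\<close> has to stay in every set
      \<open>U \<sigma>\<close> that contains \<open>x\<close>, because simplices that share the
      vertex share the path.\<close>
    let ?\<F> = "insert M (U ` {\<sigma> \<in> ?K. x \<in> U \<sigma>})"
    have "openin (top_of_set M) (\<Inter>?\<F>)" by (rule openin_Inter) (use Uo in auto)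
    moreover have "x \<in> \<Inter>?\<F>" using x by blast
    ultimately obtain W where W: "x \<in> W" "W \<subseteq> \<Inter>?\<F>" "path_connected W" "W - f -` L \<noteq> {}"
      by (rule good_neighbourhood)
    then obtain m where m: "m \<in> W" "m \<notin> f -` L" by blast
    then obtain \<kappa> where \<kappa>: "path \<kappa>" "path_image \<kappa> \<subseteq> W" "pathstart \<kappa> = x" "pathfinish \<kappa> = m"
      using W(1,3) unfolding path_connected_def by blast
    have "m \<in> M0" using m W(2) unfolding M0_eq by blast
    moreover have "path_image \<kappa> \<subseteq> U \<sigma>" if "\<sigma> \<in> ?K" "x \<in> U \<sigma>" for \<sigma> using \<kappa>(2) W(2) that by blast
    ultimately show "\<exists>\<kappa>. path \<kappa> \<and> pathstart \<kappa> = x \<and> pathfinish \<kappa> \<in> M0 \<and> (\<forall>\<sigma>\<in>?K. x \<in> U \<sigma> \<longrightarrow> path_image \<kappa> \<subseteq> U \<sigma>)"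
      using \<kappa> by (intro exI[of _ \<kappa>]) simp
  qed
  from bchoice[OF this] obtain \<kappa> where
    \<kappa>0: "\<forall>x\<in>M. path (\<kappa> x) \<and> pathstart (\<kappa> x) = x \<and> pathfinish (\<kappa> x) \<in> M0 \<and> (\<forall>\<sigma>\<in>?K. x \<in> U \<sigma> \<longrightarrow> path_image (\<kappa> x) \<subseteq> U \<sigma>)" ..
  have \<kappa>: "path (\<kappa> x)" "pathstart (\<kappa> x) = x" "pathfinish (\<kappa> x) \<in> M0" "\<And>\<sigma>. \<sigma> \<in> ?K \<Longrightarrow> x \<in> U \<sigma> \<Longrightarrow> path_image (\<kappa> x) \<subseteq> U \<sigma>"
    if "x \<in> M" for x using bspec[OF \<kappa>0 that] by simp_all
  let ?s = "\<lambda>\<sigma>. pathstart (g \<sigma>)" and ?t = "\<lambda>\<sigma>. pathfinish (g \<sigma>)" and ?m = "\<lambda>x. pathfinish (\<kappa> x)"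
  have sU: "?s \<sigma> \<in> U \<sigma>" "?t \<sigma> \<in> U \<sigma>" if "\<sigma> \<in> ?K" for \<sigma> using gU[OF that] by auto
  have sM: "?s \<sigma> \<in> M" "?t \<sigma> \<in> M" if "\<sigma> \<in> ?K" for \<sigma> using sU[OF that] UM[OF that] by auto
  have mU: "?m x \<in> U \<sigma> - f -` L" if "\<sigma> \<in> ?K" "x \<in> U \<sigma>" for x \<sigma>
  proof -
    have xM: "x \<in> M" using that UM by blast
    have "?m x \<in> path_image (\<kappa> x)" by (rule pathfinish_in_path_image)
    then show ?thesis using \<kappa>(3,4)[OF xM] that unfolding M0_eq by blast
  qed
  have "\<forall>\<sigma>\<in>?K. \<exists>k. path k \<and> path_image k \<subseteq> U \<sigma> - f -` L \<and> pathstart k = ?m (?s \<sigma>) \<and> pathfinish k = ?m (?t \<sigma>)"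
  proof
    fix \<sigma> assume \<sigma>: "\<sigma> \<in> ?K"
    show "\<exists>k. path k \<and> path_image k \<subseteq> U \<sigma> - f -` L \<and> pathstart k = ?m (?s \<sigma>) \<and> pathfinish k = ?m (?t \<sigma>)"
      using Upc[OF \<sigma>] mU[OF \<sigma> sU(1)[OF \<sigma>]] mU[OF \<sigma> sU(2)[OF \<sigma>]] unfolding path_connected_def by blast
  qed
  from bchoice[OF this] obtain k where
    k0: "\<forall>\<sigma>\<in>?K. path (k \<sigma>) \<and> path_image (k \<sigma>) \<subseteq> U \<sigma> - f -` L \<and> pathstart (k \<sigma>) = ?m (?s \<sigma>) \<and> pathfinish (k \<sigma>) = ?m (?t \<sigma>)" ..
  have k: "path (k \<sigma>)" "path_image (k \<sigma>) \<subseteq> U \<sigma> - f -` L" "pathstart (k \<sigma>) = ?m (?s \<sigma>)" "pathfinish (k \<sigma>) = ?m (?t \<sigma>)"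
    if "\<sigma> \<in> ?K" for \<sigma> using bspec[OF k0 that] by simp_all
  define z' where "z' = frag_extend (\<lambda>\<sigma>. path_simplex (k \<sigma>)) y"
  have bd: "frag_extend (\<lambda>\<sigma>. frag_of (?t \<sigma>) - frag_of (?s \<sigma>)) y = 0"
    by (rule ends_sum_zero[OF _ yc(2)]) (rule g(4))
  have sq: "null_chain M (frag_of \<sigma> - path_simplex (k \<sigma>) - (- path_simplex (\<kappa> (?t \<sigma>)) - - path_simplex (\<kappa> (?s \<sigma>))))"
    if \<sigma>: "\<sigma> \<in> ?K" for \<sigma>
  proof -
    have "null_chain M (path_simplex (g \<sigma>) + path_simplex (\<kappa> (?t \<sigma>)) - (path_simplex (\<kappa> (?s \<sigma>)) + path_simplex (k \<sigma>)))"
      using \<kappa>[OF sM(1)[OF \<sigma>]] \<kappa>[OF sM(2)[OF \<sigma>]] sU[OF \<sigma>] \<sigma> k[OF \<sigma>] g(1)[OF \<sigma>] gU[OF \<sigma>]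
      by (intro loops_null_square[OF Uln[OF \<sigma>]]) auto
    moreover have "frag_of \<sigma> - path_simplex (k \<sigma>) - (- path_simplex (\<kappa> (?t \<sigma>)) - - path_simplex (\<kappa> (?s \<sigma>))) =
      path_simplex (g \<sigma>) + path_simplex (\<kappa> (?t \<sigma>)) - (path_simplex (\<kappa> (?s \<sigma>)) + path_simplex (k \<sigma>))"
      unfolding g(3)[OF \<sigma>] by simp
    ultimately show ?thesis by (simp only:)
  qed
  have "null_chain M (frag_extend (\<lambda>\<sigma>. frag_of \<sigma> - path_simplex (k \<sigma>)) y)"
    by (rule potential_sum[where S = ?K and t = ?t and s = ?s and l = "\<lambda>x. - path_simplex (\<kappa> x)", OF order_refl _ _ _ bd])
      (simp, rule singular_relboundary_diff, assumption, assumption, rule sq)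
  then have yz': "null_chain M (y - z')"
    by (simp only: frag_extend_diff_fun z'_def frag_expansion[symmetric])
  have "singular_chain 1 (top_of_set M0) z'"
    unfolding z'_def
  proof (rule singular_chain_frag_extend_paths)
    fix \<sigma> assume \<sigma>: "\<sigma> \<in> ?K"
    show "path (k \<sigma>)" by (rule k(1)[OF \<sigma>])
    show "path_image (k \<sigma>) \<subseteq> M0" using k(2)[OF \<sigma>] UM[OF \<sigma>] unfolding M0_eq by blast
  qed
  moreover have "chain_boundary 1 z' = 0"
  proof -
    have "chain_boundary 1 z' = frag_extend (\<lambda>\<sigma>. point_simplex (?m (?t \<sigma>)) - point_simplex (?m (?s \<sigma>))) y"
      unfolding z'_def chain_boundary_frag_extend
      by (rule frag_extend_eq) (simp only: chain_boundary_path_simplex k(3,4)[unfolded pathstart_def[of "k _"] pathfinish_def[of "k _"]])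
    also have "\<dots> = frag_extend (\<lambda>x. point_simplex (?m x)) (frag_extend (\<lambda>\<sigma>. frag_of (?t \<sigma>) - frag_of (?s \<sigma>)) y)"
      by (simp only: frag_extend_frag_extend frag_extend_diff frag_extend_of)
    finally show ?thesis unfolding bd by simp
  qed
  ultimately have "cycle1 M0 z'" by (simp add: singular_cycle)
  moreover have "null_chain M (z - z')"
    using singular_relboundary_add[OF zy[unfolded homologous_rel_def] yz'] by simp
  ultimately show ?thesis by (rule that)
qed

end

section \<open>The nerve of a cover by caps\<close>

locale nerve = branched_cover p q \<phi> n M f
  for p q \<phi> n and M :: "'a::real_normed_vector set" and f +
  fixes \<B> :: "(complex \<times> complex) set set"
  assumes good: "good_cover \<B>"
begin

lemma finite_\<B>: "finite \<B>" using good by (simp add: good_cover_def)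

lemma openin_\<B>: "B \<in> \<B> \<Longrightarrow> openin (top_of_set (sphere 0 1)) B" using good by (simp add: good_cover_def)

lemma \<B>_cover: "x \<in> M \<Longrightarrow> \<exists>B\<in>\<B>. f x \<in> B"
proof -
  assume "x \<in> M"
  then have "f x \<in> \<Union>\<B>" using surj good unfolding good_cover_def by (metis imageI)
  then show ?thesis by blast
qed

lemma \<B>_Int:
  assumes "B \<in> \<B>" "B' \<in> \<B>" "B \<inter> B' \<noteq> {}"
  shows "path_connected (B \<inter> B' - L)" "B \<inter> B' - L \<noteq> {}"
  using good[unfolded good_cover_def, THEN conjunct2, THEN conjunct2, THEN conjunct2, THEN conjunct1,
      THEN bspec, OF assms(1), THEN bspec, OF assms(2), THEN mp, OF assms(3)] by simp_all

lemma openin_preimage: "B \<in> \<B> \<Longrightarrow> openin (top_of_set M) (M \<inter> f -` B)"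
  by (rule continuous_openin_preimage[OF continuous_f _ openin_\<B>]) (use surj in auto)

text \<open>The component is formed in \<open>M\<close>, with branch points filled in, before the
  branch set is removed. This labels branch points too, and the set stays path connected because the
  branch set does not separate.\<close>

definition W :: "(complex \<times> complex) set \<Rightarrow> 'a \<Rightarrow> 'a set" where
  "W B x = path_component_set (M \<inter> f -` B) x - f -` L"

lemma W_subset: "W B x \<subseteq> M0 \<inter> f -` B"
  using path_component_subset[of "M \<inter> f -` B" x] unfolding W_def M0_eq by blast

lemma W_cong: "path_component (M \<inter> f -` B) x y \<Longrightarrow> W B y = W B x"
  unfolding W_def by (simp add: path_component_eq)

lemma W_refl: "x \<in> M0 \<Longrightarrow> f x \<in> B \<Longrightarrow> x \<in> W B x"
  unfolding W_def M0_eq by (simp add: path_component_refl)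

lemma locally_path_connected_M: "locally path_connected M"
proof (rule locallyI)
  fix N x assume N: "openin (top_of_set M) N" "x \<in> N"
  obtain U where "openin (top_of_set M) U" "x \<in> U" "U \<subseteq> N" "path_connected U" by (rule good_neighbourhood[OF N])
  then show "\<exists>U V. openin (top_of_set M) U \<and> path_connected V \<and> x \<in> U \<and> U \<subseteq> V \<and> V \<subseteq> N"
    by (intro exI[of _ U] conjI) auto
qed

lemma path_connected_W: "B \<in> \<B> \<Longrightarrow> path_connected (W B x)"
proof -
  assume B: "B \<in> \<B>"
  have "locally path_connected (M \<inter> f -` B)"
    by (rule locally_open_subset[OF locally_path_connected_M openin_preimage[OF B]])
  then have "openin (top_of_set M) (path_component_set (M \<inter> f -` B) x)"
    by (rule openin_trans[OF openin_path_component_locally_path_connected openin_preimage[OF B]])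
  then show ?thesis
    unfolding W_def by (rule locally_nonseparating_minus(2)[OF nonseparating_M])
      (intro path_connected_imp_connected path_connected_path_component)
qed

text \<open>Any point of \<open>M\<close> can be moved off the branch set without changing its components.\<close>

lemma W_common:
  assumes x: "x \<in> M" and B: "B1 \<in> \<B>" "B2 \<in> \<B>" "B3 \<in> \<B>" "f x \<in> B1" "f x \<in> B2" "f x \<in> B3"
  obtains y where "y \<in> M0" "f y \<in> B1" "f y \<in> B2" "f y \<in> B3" "W B1 y = W B1 x" "W B2 y = W B2 x" "W B3 y = W B3 x"
proof -
  have "openin (top_of_set M) ((M \<inter> f -` B1) \<inter> ((M \<inter> f -` B2) \<inter> (M \<inter> f -` B3)))"
    by (intro openin_Int openin_preimage B)
  moreover have "x \<in> (M \<inter> f -` B1) \<inter> ((M \<inter> f -` B2) \<inter> (M \<inter> f -` B3))" using x B by simp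
  ultimately obtain U where U: "x \<in> U" "U \<subseteq> (M \<inter> f -` B1) \<inter> ((M \<inter> f -` B2) \<inter> (M \<inter> f -` B3))"
    "path_connected U" "U - f -` L \<noteq> {}" by (rule good_neighbourhood)
  then obtain y where y: "y \<in> U" "y \<notin> f -` L" by blast
  have pc: "path_component U x y" using U(1,3) y(1) unfolding path_connected_component by blast
  have eq: "W B y = W B x" if "U \<subseteq> M \<inter> f -` B" for B
    by (rule W_cong[OF path_component_of_subset[OF that pc]])
  show ?thesis
  proof (rule that)
    show "y \<in> M0" using y U(2) unfolding M0_eq by blast
    show "f y \<in> B1" "f y \<in> B2" "f y \<in> B3" using y(1) U(2) by auto
    show "W B1 y = W B1 x" "W B2 y = W B2 x" "W B3 y = W B3 x" by (rule eq; use U(2) in blast)+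
  qed
qed

abbreviation node :: "(complex \<times> complex) set \<Rightarrow> 'a \<Rightarrow> (complex \<times> complex) set \<times> 'a set" where
  "node B x \<equiv> (B, W B x)"

text \<open>Vertices of the nerve of the pulled-back cover. A vertex remembers the member
  \<open>B\<close>, so equal components of different members are kept apart.\<close>

definition V :: "((complex \<times> complex) set \<times> 'a set) set" where
  "V = {node B y | B y. B \<in> \<B> \<and> y \<in> M0 \<and> f y \<in> B}"

text \<open>An edge is witnessed by a point common to both components. The diagonal edges with
  \<open>B = B'\<close> are included; they later let vertex orbits be counted by edge
  orbits.\<close>

definition Edges :: "(((complex \<times> complex) set \<times> 'a set) \<times> ((complex \<times> complex) set \<times> 'a set)) set" where
  "Edges = {(node B y, node B' y) | B B' y. B \<in> \<B> \<and> B' \<in> \<B> \<and> y \<in> M0 \<and> f y \<in> B \<and> f y \<in> B'}"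

abbreviation relator_of where
  "relator_of a b c \<equiv> frag_of (a, b) + frag_of (b, c) - frag_of (a, c)"

definition Relators :: "(((complex \<times> complex) set \<times> 'a set) \<times> ((complex \<times> complex) set \<times> 'a set) \<Rightarrow>\<^sub>0 int) set" where
  "Relators = {relator_of (node B1 y) (node B2 y) (node B3 y) | B1 B2 B3 y.
     B1 \<in> \<B> \<and> B2 \<in> \<B> \<and> B3 \<in> \<B> \<and> y \<in> M0 \<and> f y \<in> B1 \<and> f y \<in> B2 \<and> f y \<in> B3}"

lemma node_in_V: "x \<in> M \<Longrightarrow> B \<in> \<B> \<Longrightarrow> f x \<in> B \<Longrightarrow> node B x \<in> V"
proof -
  assume a: "x \<in> M" "B \<in> \<B>" "f x \<in> B"
  obtain y where "y \<in> M0" "f y \<in> B" "W B y = W B x" by (rule W_common[OF a(1,2,2,2,3,3,3)])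
  then show ?thesis unfolding V_def using a by (intro CollectI exI[of _ B] exI[of _ y]) simp
qed

lemma edge_in_Edges: "x \<in> M \<Longrightarrow> B \<in> \<B> \<Longrightarrow> B' \<in> \<B> \<Longrightarrow> f x \<in> B \<Longrightarrow> f x \<in> B' \<Longrightarrow> (node B x, node B' x) \<in> Edges"
proof -
  assume a: "x \<in> M" "B \<in> \<B>" "B' \<in> \<B>" "f x \<in> B" "f x \<in> B'"
  obtain y where "y \<in> M0" "f y \<in> B" "f y \<in> B'" "W B y = W B x" "W B' y = W B' x"
    by (rule W_common[OF a(1,2,3,3,4,5,5)])
  then show ?thesis unfolding Edges_def using a by (intro CollectI exI[of _ B] exI[of _ B'] exI[of _ y]) simp
qed

lemma relator_in_Relators:
  assumes a: "x \<in> M" "B1 \<in> \<B>" "B2 \<in> \<B>" "B3 \<in> \<B>" "f x \<in> B1" "f x \<in> B2" "f x \<in> B3"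
  shows "relator_of (node B1 x) (node B2 x) (node B3 x) \<in> Relators"
proof -
  obtain y where "y \<in> M0" "f y \<in> B1" "f y \<in> B2" "f y \<in> B3" "W B1 y = W B1 x" "W B2 y = W B2 x" "W B3 y = W B3 x"
    by (rule W_common[OF a])
  then show ?thesis unfolding Relators_def using a
    by (intro CollectI exI[of _ B1] exI[of _ B2] exI[of _ B3] exI[of _ y]) simp
qed

definition base :: "(complex \<times> complex) set \<times> 'a set \<Rightarrow> 'a" where "base v = (SOME y. y \<in> snd v)"

lemma V_D:
  assumes "v \<in> V"
  shows "fst v \<in> \<B>" "snd v \<subseteq> M0 \<inter> f -` fst v" "path_connected (snd v)" "base v \<in> snd v"
proof -
  obtain B y where v: "v = node B y" "B \<in> \<B>" "y \<in> M0" "f y \<in> B" using assms unfolding V_def by blast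
  show "fst v \<in> \<B>" "snd v \<subseteq> M0 \<inter> f -` fst v" "path_connected (snd v)"
    using v W_subset path_connected_W by simp_all
  have "y \<in> snd v" using W_refl v by simp
  then show "base v \<in> snd v" unfolding base_def by (rule someI)
qed

lemma base_M0: "v \<in> V \<Longrightarrow> base v \<in> M0" using V_D(2,4) by blast

lemma path_in_node:
  assumes "v \<in> V" "a \<in> snd v" "b \<in> snd v"
  obtains g where "path g" "path_image g \<subseteq> snd v" "pathstart g = a" "pathfinish g = b"
  using V_D(3)[OF assms(1)] assms(2,3) unfolding path_connected_def by blast

lemma Edges_D:
  assumes "e \<in> Edges"
  shows "fst e \<in> V" "snd e \<in> V" "snd (fst e) \<inter> snd (snd e) \<noteq> {}" "fst (fst e) \<inter> fst (snd e) \<noteq> {}"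
proof -
  obtain B B' y where e: "e = (node B y, node B' y)" "B \<in> \<B>" "B' \<in> \<B>" "y \<in> M0" "f y \<in> B" "f y \<in> B'"
    using assms unfolding Edges_def by blast
  then have "y \<in> M" by blast
  then show "fst e \<in> V" "snd e \<in> V" using e node_in_V by simp_all
  have "y \<in> W B y" "y \<in> W B' y" using e W_refl by simp_all
  then show "snd (fst e) \<inter> snd (snd e) \<noteq> {}" using e(1) by auto
  show "fst (fst e) \<inter> fst (snd e) \<noteq> {}" using e by auto
qed

definition edge_path where
  "edge_path e = (SOME g. path g \<and> path_image g \<subseteq> snd (fst e) \<union> snd (snd e) \<and>
     pathstart g = base (fst e) \<and> pathfinish g = base (snd e))"

lemma edge_path:
  assumes "e \<in> Edges"
  shows "path (edge_path e)" "path_image (edge_path e) \<subseteq> snd (fst e) \<union> snd (snd e)"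
    "pathstart (edge_path e) = base (fst e)" "pathfinish (edge_path e) = base (snd e)"
proof -
  note E = Edges_D[OF assms]
  have pc: "path_connected (snd (fst e) \<union> snd (snd e))"
    by (rule path_connected_Un[OF V_D(3)[OF E(1)] V_D(3)[OF E(2)] E(3)])
  have "\<exists>g. path g \<and> path_image g \<subseteq> snd (fst e) \<union> snd (snd e) \<and>
     pathstart g = base (fst e) \<and> pathfinish g = base (snd e)"
    by (rule bspec[OF bspec[OF pc[unfolded path_connected_def]]]) (use V_D(4)[OF E(1)] V_D(4)[OF E(2)] in simp_all)
  from someI_ex[OF this, folded edge_path_def]
  show "path (edge_path e)" "path_image (edge_path e) \<subseteq> snd (fst e) \<union> snd (snd e)"
    "pathstart (edge_path e) = base (fst e)" "pathfinish (edge_path e) = base (snd e)" by simp_all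
qed

definition star :: "(complex \<times> complex) set \<Rightarrow> 'a set" where
  "star B = M0 \<inter> f -` \<Union>{B' \<in> \<B>. B \<inter> B' \<noteq> {}}"

text \<open>The star lies over a contracting set, so its loops bound in \<open>M\<close> although
  the star avoids the branch set.\<close>

lemma star_null: "B \<in> \<B> \<Longrightarrow> loops_null (star B) M"
proof -
  assume "B \<in> \<B>"
  with good[unfolded good_cover_def, THEN conjunct2, THEN conjunct2, THEN conjunct2, THEN conjunct2]
  have "\<exists>U. contracts U \<and> (\<forall>B'\<in>\<B>. B \<inter> B' \<noteq> {} \<longrightarrow> B' \<subseteq> U)" by (rule bspec)
  then obtain U where U: "contracts U" "\<forall>B'\<in>\<B>. B \<inter> B' \<noteq> {} \<longrightarrow> B' \<subseteq> U" by (elim exE conjE)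
  have "star B \<subseteq> M0 \<inter> f -` U" using U(2) unfolding star_def by blast
  then show ?thesis by (rule loops_null_mono[OF loops_null_contracts[OF U(1)]])
qed

lemma node_star: "v \<in> V \<Longrightarrow> B \<inter> fst v \<noteq> {} \<Longrightarrow> snd v \<subseteq> star B"
  using V_D(1,2)[of v] unfolding star_def by blast

lemma edge_path_star:
  assumes "e \<in> Edges" "B \<inter> fst (fst e) \<noteq> {}" "B \<inter> fst (snd e) \<noteq> {}"
  shows "path_image (edge_path e) \<subseteq> star B"
  using edge_path(2)[OF assms(1)] node_star[OF Edges_D(1)[OF assms(1)] assms(2)]
    node_star[OF Edges_D(2)[OF assms(1)] assms(3)] by blast

definition chain_of where
  "chain_of c = frag_extend (\<lambda>e. path_simplex (edge_path e)) c"

lemma edge_path_M0: "e \<in> Edges \<Longrightarrow> path_image (edge_path e) \<subseteq> M0"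
  using edge_path(2) V_D(2)[OF Edges_D(1)] V_D(2)[OF Edges_D(2)] by blast

lemma chain_of_cycle:
  assumes "Poly_Mapping.keys c \<subseteq> Edges" "edge_boundary c = 0"
  shows "cycle1 M (chain_of c)"
proof -
  have "singular_chain 1 (top_of_set M) (chain_of c)"
    unfolding chain_of_def
    by (rule singular_chain_frag_extend_paths) (use assms(1) edge_path(1) edge_path_M0 in blast)+
  moreover have "chain_boundary 1 (chain_of c) = frag_extend (\<lambda>v. point_simplex (base v)) (edge_boundary c)"
  proof -
    have "chain_boundary 1 (chain_of c) = frag_extend (\<lambda>e. point_simplex (base (snd e)) - point_simplex (base (fst e))) c"
      unfolding chain_of_def chain_boundary_frag_extend chain_boundary_path_simplex
    proof (rule frag_extend_eq)
      fix e assume "e \<in> Poly_Mapping.keys c"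
      then have "e \<in> Edges" using assms(1) by blast
      from edge_path(3,4)[OF this]
      show "point_simplex (edge_path e 1) - point_simplex (edge_path e 0) = point_simplex (base (snd e)) - point_simplex (base (fst e))"
        by (simp add: pathstart_def pathfinish_def)
    qed
    then show ?thesis by (simp only: frag_extend_frag_extend frag_extend_diff frag_extend_of)
  qed
  ultimately show ?thesis unfolding singular_cycle assms(2) by simp
qed

text \<open>The paths of all three edges stay in the star of \<open>B1\<close>, where closed loops
  bound.\<close>

lemma chain_of_relator:
  assumes "t \<in> Relators"
  shows "null_chain M (chain_of t)"
proof -
  obtain B1 B2 B3 y where t: "t = relator_of (node B1 y) (node B2 y) (node B3 y)"
    and B: "B1 \<in> \<B>" "B2 \<in> \<B>" "B3 \<in> \<B>" and y: "y \<in> M0" "f y \<in> B1" "f y \<in> B2" "f y \<in> B3"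
    using assms unfolding Relators_def by blast
  let ?e = "(node B1 y, node B2 y)" and ?e' = "(node B2 y, node B3 y)" and ?e'' = "(node B1 y, node B3 y)"
  have yM: "y \<in> M" using y(1) by blast
  have E: "?e \<in> Edges" "?e' \<in> Edges" "?e'' \<in> Edges" using edge_in_Edges yM B y by simp_all
  have ne: "B1 \<inter> B1 \<noteq> {}" "B1 \<inter> B2 \<noteq> {}" "B1 \<inter> B3 \<noteq> {}" using y by auto
  have "null_chain M (path_simplex (edge_path ?e) + path_simplex (edge_path ?e') - path_simplex (edge_path ?e''))"
    using edge_path(1,3,4)[OF E(1)] edge_path(1,3,4)[OF E(2)] edge_path(1,3,4)[OF E(3)]
      edge_path_star[OF E(1), of B1] edge_path_star[OF E(2), of B1] edge_path_star[OF E(3), of B1] ne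
    by (intro loops_null_triangle[OF star_null[OF B(1)]]) simp_all
  then show ?thesis unfolding t chain_of_def by (simp only: frag_extend_add frag_extend_diff frag_extend_of)
qed

text \<open>Being joined by an edge chain is an equivalence relation. The vertex attached to a point
  stays in one class near that point, so connectedness of \<open>M0\<close> joins all of
  them.\<close>

lemma edges_connect:
  assumes "a \<in> V" "b \<in> V"
  shows "\<exists>y. Poly_Mapping.keys y \<subseteq> Edges \<and> edge_boundary y = frag_of b - frag_of a"
proof -
  define R where "R a b \<longleftrightarrow> (\<exists>y. Poly_Mapping.keys y \<subseteq> Edges \<and> edge_boundary y = frag_of b - frag_of a)" for a b
  have R_sym: "R b a" if ab: "R a b" for a b
  proof -
    obtain y where "Poly_Mapping.keys y \<subseteq> Edges" "edge_boundary y = frag_of b - frag_of a" using ab[unfolded R_def] by (elim exE conjE)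
    then show ?thesis unfolding R_def by (intro exI[of _ "- y"]) (simp add: frag_extend_minus)
  qed
  have R_trans: "R a c" if ab: "R a b" and bc: "R b c" for a b c
  proof -
    obtain y where "Poly_Mapping.keys y \<subseteq> Edges" "edge_boundary y = frag_of b - frag_of a" using ab[unfolded R_def] by (elim exE conjE)
    moreover obtain y' where "Poly_Mapping.keys y' \<subseteq> Edges" "edge_boundary y' = frag_of c - frag_of b" using bc[unfolded R_def] by (elim exE conjE)
    ultimately show ?thesis unfolding R_def
      by (intro exI[of _ "y + y'"]) (simp add: frag_extend_add keys_add_subset)
  qed
  have R_edge: "R a b" if "(a, b) \<in> Edges" for a b
    unfolding R_def using that by (intro exI[of _ "frag_of (a, b)"]) simp
  define w where "w x = node (SOME B. B \<in> \<B> \<and> f x \<in> B) x" for x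
  have w: "(SOME B. B \<in> \<B> \<and> f x \<in> B) \<in> \<B> \<and> f x \<in> (SOME B. B \<in> \<B> \<and> f x \<in> B)" if "x \<in> M" for x
    by (rule someI_ex) (use \<B>_cover[OF that] in blast)
  have near: "R (w x) (node B x)" "R (node B x) (w x)" if x: "x \<in> M" "B \<in> \<B>" "f x \<in> B" for x B
    unfolding w_def
    by (rule R_edge[OF edge_in_Edges[OF x(1) conjunct1[OF w[OF x(1)]] x(2) conjunct2[OF w[OF x(1)]] x(3)]])
      (rule R_edge[OF edge_in_Edges[OF x(1,2) conjunct1[OF w[OF x(1)]] x(3) conjunct2[OF w[OF x(1)]]]])
  have R_w: "R (w x) (w y)" if "x \<in> M0" "y \<in> M0" for x y
  proof (rule connected_equivalence_relation[OF connected_E that, where R = "\<lambda>x y. R (w x) (w y)"])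
    fix x assume x: "x \<in> M0"
    then have xM: "x \<in> M" by blast
    obtain B where B: "B \<in> \<B>" "f x \<in> B" using \<B>_cover[OF xM] by blast
    have "openin (top_of_set M) (M \<inter> f -` B)" by (rule openin_preimage[OF B(1)])
    moreover have "x \<in> M \<inter> f -` B" using xM B(2) by blast
    ultimately obtain U where U: "openin (top_of_set M) U" "x \<in> U" "U \<subseteq> M \<inter> f -` B" "path_connected U"
      by (rule good_neighbourhood)
    have "R (w x) (w z)" if z: "z \<in> U" for z
    proof -
      have "path_component U x z" using U(2,4) z unfolding path_connected_component by blast
      then have "node B z = node B x" using W_cong[OF path_component_of_subset[OF U(3)]] by simp
      moreover have z': "z \<in> M" "f z \<in> B" using U(3) z by auto
      ultimately have "R (w x) (node B z)" using near(1)[OF xM B] by (simp only:)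
      then show ?thesis by (rule R_trans[OF _ near(2)[OF z'(1) B(1) z'(2)]])
    qed
    moreover have "openin (top_of_set M0) (U \<inter> M0)"
      by (rule openin_subset_trans[OF openin_Int[OF U(1) openin_M0]]) auto
    ultimately show "\<exists>T. openin (top_of_set M0) T \<and> x \<in> T \<and> (\<forall>z\<in>T. R (w x) (w z))"
      using U(2) x by (intro exI[of _ "U \<inter> M0"] conjI ballI) (blast+)
  next
    show "R (w y) (w x)" if "R (w x) (w y)" for x y by (rule R_sym[OF that])
    show "R (w x) (w z)" if "R (w x) (w y)" "R (w y) (w z)" for x y z by (rule R_trans[OF that])
  qed
  obtain B x where a: "a = node B x" "B \<in> \<B>" "x \<in> M0" "f x \<in> B" using assms(1) unfolding V_def by blast
  obtain B' y where b: "b = node B' y" "B' \<in> \<B>" "y \<in> M0" "f y \<in> B'" using assms(2) unfolding V_def by blast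
  have xy: "x \<in> M" "y \<in> M" using a(3) b(3) by auto
  have "R (node B x) (w y)" by (rule R_trans[OF near(2)[OF xy(1) a(2,4)] R_w[OF a(3) b(3)]])
  then have "R (node B x) (node B' y)" by (rule R_trans[OF _ near(1)[OF xy(2) b(2,4)]])
  from this[folded a(1) b(1)] have "R a b" .
  then show ?thesis by (simp only: R_def)
qed

end

section \<open>From small singular chains to edge chains\<close>

context nerve
begin

definition home :: "'a \<Rightarrow> (complex \<times> complex) set" where
  "home x = (SOME B. B \<in> \<B> \<and> f x \<in> B)"

lemma home: "x \<in> M \<Longrightarrow> home x \<in> \<B>" "x \<in> M \<Longrightarrow> f x \<in> home x"
proof -
  assume x: "x \<in> M"
  have "home x \<in> \<B> \<and> f x \<in> home x" unfolding home_def by (rule someI_ex) (use \<B>_cover[OF x] in blast)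
  then show "home x \<in> \<B>" "f x \<in> home x" by simp_all
qed

abbreviation "w x \<equiv> node (home x) x"

lemma w_V: "x \<in> M \<Longrightarrow> w x \<in> V" by (rule node_in_V[OF _ home])

definition small :: "((nat \<Rightarrow> real) \<Rightarrow> 'a) \<Rightarrow> bool" where
  "small \<sigma> \<longleftrightarrow> singular_simplex 1 (top_of_set M) \<sigma> \<and> (\<exists>B\<in>\<B>. \<sigma> ` standard_simplex 1 \<subseteq> f -` B)"

definition patch :: "((nat \<Rightarrow> real) \<Rightarrow> 'a) \<Rightarrow> (complex \<times> complex) set" where
  "patch \<sigma> = (SOME B. B \<in> \<B> \<and> \<sigma> ` standard_simplex 1 \<subseteq> f -` B)"

definition simplex_path :: "((nat \<Rightarrow> real) \<Rightarrow> 'a) \<Rightarrow> real \<Rightarrow> 'a" where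
  "simplex_path \<sigma> = (SOME g. path g \<and> path_image g = \<sigma> ` standard_simplex 1 \<and> frag_of \<sigma> = path_simplex g)"

abbreviation "src \<sigma> \<equiv> pathstart (simplex_path \<sigma>)"
abbreviation "tgt \<sigma> \<equiv> pathfinish (simplex_path \<sigma>)"

lemma small:
  assumes "small \<sigma>"
  shows small_path: "path (simplex_path \<sigma>)" "path_image (simplex_path \<sigma>) = \<sigma> ` standard_simplex 1"
      "frag_of \<sigma> = path_simplex (simplex_path \<sigma>)"
    and small_patch: "patch \<sigma> \<in> \<B>" "path_image (simplex_path \<sigma>) \<subseteq> M \<inter> f -` patch \<sigma>"
    and small_boundary: "chain_boundary 1 (frag_of \<sigma>) = point_simplex (tgt \<sigma>) - point_simplex (src \<sigma>)"
    and small_ends: "src \<sigma> \<in> M" "tgt \<sigma> \<in> M" "f (src \<sigma>) \<in> patch \<sigma>" "f (tgt \<sigma>) \<in> patch \<sigma>"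
      "W (patch \<sigma>) (tgt \<sigma>) = W (patch \<sigma>) (src \<sigma>)"
proof -
  have s: "singular_simplex 1 (top_of_set M) \<sigma>" and B: "\<exists>B. B \<in> \<B> \<and> \<sigma> ` standard_simplex 1 \<subseteq> f -` B"
    using assms unfolding small_def by auto
  obtain g where "path g" "path_image g = \<sigma> ` standard_simplex 1" "frag_of \<sigma> = path_simplex g"
    by (rule singular_simplex_1_path[OF s])
  then have "\<exists>g. path g \<and> path_image g = \<sigma> ` standard_simplex 1 \<and> frag_of \<sigma> = path_simplex g"
    by (intro exI[of _ g] conjI)
  from someI_ex[OF this, folded simplex_path_def]
  show p: "path (simplex_path \<sigma>)" "path_image (simplex_path \<sigma>) = \<sigma> ` standard_simplex 1"
      "frag_of \<sigma> = path_simplex (simplex_path \<sigma>)" by simp_all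
  show "chain_boundary 1 (frag_of \<sigma>) = point_simplex (tgt \<sigma>) - point_simplex (src \<sigma>)"
    unfolding p(3) chain_boundary_path_simplex pathfinish_def pathstart_def ..
  have b: "patch \<sigma> \<in> \<B> \<and> \<sigma> ` standard_simplex 1 \<subseteq> f -` patch \<sigma>"
    unfolding patch_def by (rule someI_ex[OF B])
  then show "patch \<sigma> \<in> \<B>" by simp
  have "\<sigma> ` standard_simplex 1 \<subseteq> M"
    using s singular_simplex_subtopology[of 1 euclidean M \<sigma>] by auto
  with b show i: "path_image (simplex_path \<sigma>) \<subseteq> M \<inter> f -` patch \<sigma>" unfolding p(2) by simp
  have e: "src \<sigma> \<in> M \<inter> f -` patch \<sigma>" "tgt \<sigma> \<in> M \<inter> f -` patch \<sigma>"
    using i pathstart_in_path_image pathfinish_in_path_image by blast+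
  then show "src \<sigma> \<in> M" "tgt \<sigma> \<in> M" "f (src \<sigma>) \<in> patch \<sigma>" "f (tgt \<sigma>) \<in> patch \<sigma>" by simp_all
  have "path_component (M \<inter> f -` patch \<sigma>) (src \<sigma>) (tgt \<sigma>)"
    unfolding path_component_def using p(1) i by (intro exI[of _ "simplex_path \<sigma>"]) simp
  then show "W (patch \<sigma>) (tgt \<sigma>) = W (patch \<sigma>) (src \<sigma>)" by (rule W_cong)
qed

text \<open>The walk from the vertex of the source to the vertex of the target through the node of
  the patch; its second edge is traversed backwards, hence the sign. For small simplices the patch
  has the same node at both ends.\<close>

definition trail :: "((nat \<Rightarrow> real) \<Rightarrow> 'a) \<Rightarrow>
    (((complex \<times> complex) set \<times> 'a set) \<times> ((complex \<times> complex) set \<times> 'a set) \<Rightarrow>\<^sub>0 int)" where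
  "trail \<sigma> = frag_of (w (src \<sigma>), node (patch \<sigma>) (src \<sigma>)) - frag_of (w (tgt \<sigma>), node (patch \<sigma>) (src \<sigma>))"

lemma trail_edges:
  assumes "small \<sigma>"
  shows "(w (src \<sigma>), node (patch \<sigma>) (src \<sigma>)) \<in> Edges" "(w (tgt \<sigma>), node (patch \<sigma>) (src \<sigma>)) \<in> Edges"
proof -
  note s = small_patch[OF assms] small_ends[OF assms]
  show "(w (src \<sigma>), node (patch \<sigma>) (src \<sigma>)) \<in> Edges"
    by (rule edge_in_Edges[OF s(3) home(1)[OF s(3)] s(1) home(2)[OF s(3)] s(5)])
  show "(w (tgt \<sigma>), node (patch \<sigma>) (src \<sigma>)) \<in> Edges"
    using edge_in_Edges[OF s(4) home(1)[OF s(4)] s(1) home(2)[OF s(4)] s(6)] unfolding s(7) .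
qed

lemma keys_trail: "small \<sigma> \<Longrightarrow> Poly_Mapping.keys (trail \<sigma>) \<subseteq> Edges"
  unfolding trail_def by (intro keys_diff_subset) (simp_all add: trail_edges)

lemma edge_boundary_trail: "edge_boundary (trail \<sigma>) = frag_of (w (tgt \<sigma>)) - frag_of (w (src \<sigma>))"
  unfolding trail_def by (simp add: frag_extend_diff)

lemma chain_of_trail: "chain_of (trail \<sigma>) =
    path_simplex (edge_path (w (src \<sigma>), node (patch \<sigma>) (src \<sigma>))) - path_simplex (edge_path (w (tgt \<sigma>), node (patch \<sigma>) (src \<sigma>)))"
  unfolding chain_of_def trail_def by (simp only: frag_extend_diff frag_extend_of)

lemma chain_of_frag_extend: "chain_of (frag_extend g c) = frag_extend (\<lambda>x. chain_of (g x)) c"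
  unfolding chain_of_def by (rule frag_extend_frag_extend)

lemma trail_ends_sum:
  assumes "\<And>\<sigma>. \<sigma> \<in> Poly_Mapping.keys y \<Longrightarrow> small \<sigma>" "chain_boundary 1 y = 0"
  shows "frag_extend (\<lambda>\<sigma>. frag_of (tgt \<sigma>) - frag_of (src \<sigma>)) y = 0"
  by (rule ends_sum_zero[OF small_boundary[OF assms(1)] assms(2)])

lemma trail_cycle:
  assumes y: "\<And>\<sigma>. \<sigma> \<in> Poly_Mapping.keys y \<Longrightarrow> small \<sigma>" "chain_boundary 1 y = 0"
  shows "Poly_Mapping.keys (frag_extend trail y) \<subseteq> Edges" "edge_boundary (frag_extend trail y) = 0"
proof -
  show "Poly_Mapping.keys (frag_extend trail y) \<subseteq> Edges"
    by (intro keys_frag_extend_subset keys_trail y(1))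
  have "edge_boundary (frag_extend trail y) = frag_extend (\<lambda>x. frag_of (w x)) (frag_extend (\<lambda>\<sigma>. frag_of (tgt \<sigma>) - frag_of (src \<sigma>)) y)"
    by (simp only: frag_extend_frag_extend edge_boundary_trail frag_extend_diff frag_extend_of)
  moreover have "frag_extend (\<lambda>\<sigma>. frag_of (tgt \<sigma>) - frag_of (src \<sigma>)) y = 0" by (rule trail_ends_sum) (fact y)+
  ultimately show "edge_boundary (frag_extend trail y) = 0" by simp
qed

text \<open>Short paths \<open>\<mu> x\<close> from each point to the base point of its vertex serve
  as potentials: in the star of the patch they close up the simplex and its trail to a loop.\<close>

lemma chain_of_trail_null:
  assumes y: "\<And>\<sigma>. \<sigma> \<in> Poly_Mapping.keys y \<Longrightarrow> small \<sigma>" "cycle1 M0 y"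
  shows "null_chain M (chain_of (frag_extend trail y) - y)"
proof -
  have yc: "singular_chain 1 (top_of_set M0) y" "chain_boundary 1 y = 0" using y(2) by (auto simp: singular_cycle)
  have pM0: "path_image (simplex_path \<sigma>) \<subseteq> M0" if \<sigma>: "\<sigma> \<in> Poly_Mapping.keys y" for \<sigma>
  proof -
    have "singular_simplex 1 (top_of_set M0) \<sigma>" using yc(1) \<sigma> by (auto simp: singular_chain_def)
    then show ?thesis
      using singular_simplex_subtopology[of 1 euclidean M0 \<sigma>] unfolding small_path(2)[OF y(1)[OF \<sigma>]] by auto
  qed
  have "\<forall>x\<in>M0. \<exists>\<mu>. path \<mu> \<and> path_image \<mu> \<subseteq> snd (w x) \<and> pathstart \<mu> = x \<and> pathfinish \<mu> = base (w x)"
  proof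
    fix x assume x: "x \<in> M0"
    then have xM: "x \<in> M" by blast
    have "x \<in> snd (w x)" using W_refl[OF x home(2)[OF xM]] by simp
    then obtain \<mu> where "path \<mu>" "path_image \<mu> \<subseteq> snd (w x)" "pathstart \<mu> = x" "pathfinish \<mu> = base (w x)"
      by (rule path_in_node[OF w_V[OF xM] _ V_D(4)[OF w_V[OF xM]]])
    then show "\<exists>\<mu>. path \<mu> \<and> path_image \<mu> \<subseteq> snd (w x) \<and> pathstart \<mu> = x \<and> pathfinish \<mu> = base (w x)"
      by (intro exI[of _ \<mu>] conjI)
  qed
  from bchoice[OF this] obtain \<mu> where
    \<mu>0: "\<forall>x\<in>M0. path (\<mu> x) \<and> path_image (\<mu> x) \<subseteq> snd (w x) \<and> pathstart (\<mu> x) = x \<and> pathfinish (\<mu> x) = base (w x)" ..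
  have sq: "null_chain M (chain_of (trail \<sigma>) - frag_of \<sigma> - (path_simplex (\<mu> (tgt \<sigma>)) - path_simplex (\<mu> (src \<sigma>))))"
    if \<sigma>: "\<sigma> \<in> Poly_Mapping.keys y" for \<sigma>
  proof -
    note s = small_path[OF y(1)[OF \<sigma>]] small_patch[OF y(1)[OF \<sigma>]] small_ends[OF y(1)[OF \<sigma>]]
    let ?B = "patch \<sigma>" and ?s = "src \<sigma>" and ?t = "tgt \<sigma>" and ?g = "simplex_path \<sigma>"
    let ?e = "(w ?s, node ?B ?s)" and ?e' = "(w ?t, node ?B ?s)"
    have E: "?e \<in> Edges" "?e' \<in> Edges" using trail_edges[OF y(1)[OF \<sigma>]] .
    have M0: "?s \<in> M0" "?t \<in> M0" using pM0[OF \<sigma>] pathstart_in_path_image pathfinish_in_path_image by blast+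
    note \<mu>s = bspec[OF \<mu>0 M0(1)] and \<mu>t = bspec[OF \<mu>0 M0(2)]
    have ne: "?B \<inter> fst (w ?s) \<noteq> {}" "?B \<inter> fst (w ?t) \<noteq> {}" "?B \<inter> fst (node ?B ?s) \<noteq> {}"
      using s(8,9) home(2)[OF s(6)] home(2)[OF s(7)] by auto
    note st = star_null[OF s(4)]
    have i1: "path_image (\<mu> ?s) \<subseteq> star ?B" using \<mu>s node_star[OF w_V[OF s(6)] ne(1)] by blast
    have i2: "path_image (\<mu> ?t) \<subseteq> star ?B" using \<mu>t node_star[OF w_V[OF s(7)] ne(2)] by blast
    have i3: "path_image (edge_path ?e) \<subseteq> star ?B" by (rule edge_path_star[OF E(1)]) (use ne in simp_all)
    have i4: "path_image (edge_path ?e') \<subseteq> star ?B" by (rule edge_path_star[OF E(2)]) (use ne in simp_all)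
    have "?B \<inter> ?B \<noteq> {}" using ne(3) by simp
    then have i5: "path_image ?g \<subseteq> star ?B" using pM0[OF \<sigma>] s(4,5) unfolding star_def by blast
    have starM: "star ?B \<subseteq> M" unfolding star_def by blast
    let ?j = "\<mu> ?t +++ edge_path ?e'"
    have j: "path ?j" "path_image ?j \<subseteq> star ?B" "pathstart ?j = ?t" "pathfinish ?j = base (node ?B ?s)"
      using \<mu>t edge_path(1,3,4)[OF E(2)] i2 i4 by (simp_all add: path_image_join)
    have 1: "null_chain M (path_simplex (\<mu> ?s) + path_simplex (edge_path ?e) - (path_simplex ?g + path_simplex ?j))"
      by (rule loops_null_square[OF st _ _ s(1) j(1) i1 i3 i5 j(2)])
        (use \<mu>s edge_path(1,3,4)[OF E(1)] j(3,4) in simp_all)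
    have 2: "null_chain M (path_simplex (\<mu> ?t) + path_simplex (edge_path ?e') - path_simplex ?j)"
      by (rule path_simplex_join) (use \<mu>t edge_path(1,3)[OF E(2)] i2 i4 starM in auto)
    have "chain_of (trail \<sigma>) - frag_of \<sigma> - (path_simplex (\<mu> ?t) - path_simplex (\<mu> ?s)) =
      (path_simplex (\<mu> ?s) + path_simplex (edge_path ?e) - (path_simplex ?g + path_simplex ?j)) -
      (path_simplex (\<mu> ?t) + path_simplex (edge_path ?e') - path_simplex ?j)"
      unfolding chain_of_trail s(3) by simp
    then show ?thesis using singular_relboundary_diff[OF 1 2] by (simp only:)
  qed
  have "null_chain M (frag_extend (\<lambda>\<sigma>. chain_of (trail \<sigma>) - frag_of \<sigma>) y)"
    by (rule potential_sum[where S = "Poly_Mapping.keys y" and t = tgt and s = src and l = "\<lambda>x. path_simplex (\<mu> x)",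
        OF order_refl _ _ _ trail_ends_sum[OF y(1) yc(2)]])
      (simp, rule singular_relboundary_diff, assumption, assumption, rule sq)
  then show ?thesis by (simp only: frag_extend_diff_fun chain_of_frag_extend frag_expansion[symmetric])
qed

definition relation :: "(((complex \<times> complex) set \<times> 'a set) \<times> ((complex \<times> complex) set \<times> 'a set) \<Rightarrow>\<^sub>0 int) \<Rightarrow> bool" where
  "relation c \<longleftrightarrow> (\<exists>d. Poly_Mapping.keys d \<subseteq> Relators \<and> c = frag_extend id d)"

lemma relation_0: "relation 0" unfolding relation_def by (intro exI[of _ 0]) simp

lemma relation_diff: "relation a \<Longrightarrow> relation b \<Longrightarrow> relation (a - b)"
proof -
  assume "relation a" "relation b"
  then obtain d e where "Poly_Mapping.keys d \<subseteq> Relators" "a = frag_extend id d" "Poly_Mapping.keys e \<subseteq> Relators" "b = frag_extend id e"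
    unfolding relation_def by (elim exE conjE)
  then show ?thesis unfolding relation_def by (intro exI[of _ "d - e"]) (simp add: keys_diff_subset frag_extend_diff)
qed

lemma relation_relator: "t \<in> Relators \<Longrightarrow> relation t"
  unfolding relation_def by (intro exI[of _ "frag_of t"]) simp

text \<open>All points of the simplex have the same node over \<open>B\<close>. Coning off to this
  node writes each trail, up to a potential, as a difference of two triangle relations.\<close>

lemma trail_boundary_simplex:
  assumes S: "singular_simplex (Suc 1) (top_of_set M) S" and B: "B \<in> \<B>" "S ` standard_simplex (Suc 1) \<subseteq> f -` B"
  shows "relation (frag_extend trail (chain_boundary (Suc 1) (frag_of S)))"
proof -
  let ?T = "S ` standard_simplex (Suc 1)" and ?z = "chain_boundary (Suc 1) (frag_of S)"
  have TM: "?T \<subseteq> M" and Se: "singular_simplex (Suc 1) euclidean S"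
    using S singular_simplex_subtopology[of "Suc 1" euclidean M S] by auto
  have ST: "singular_simplex (Suc 1) (top_of_set ?T) S"
    using Se singular_simplex_subtopology[of "Suc 1" euclidean ?T S] by simp
  have chain: "singular_chain 1 (top_of_set ?T) ?z"
    by (rule singular_chain_boundary_alt) (simp only: singular_chain_of ST)
  have "path_connectedin euclidean ?T"
  proof -
    have "continuous_map (subtopology (powertop_real UNIV) (standard_simplex (Suc 1))) euclidean S"
      using Se by (simp add: singular_simplex_def)
    moreover have "path_connectedin (subtopology (powertop_real UNIV) (standard_simplex (Suc 1))) (standard_simplex (Suc 1))"
      by (simp add: path_connectedin_subtopology path_connectedin_standard_simplex)
    ultimately show ?thesis by (rule path_connectedin_continuous_map_image)
  qed
  then have pc: "path_connected ?T" by simp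
  obtain x0 where x0: "x0 \<in> ?T" using nonempty_standard_simplex by blast
  have TB: "?T \<subseteq> M \<inter> f -` B" using TM B(2) by blast
  have Weq: "W B x = W B x0" if "x \<in> ?T" for x
  proof -
    have "path_component ?T x0 x" using pc x0 that unfolding path_connected_component by blast
    then show ?thesis by (rule W_cong[OF path_component_of_subset[OF TB]])
  qed
  have im: "\<sigma> ` standard_simplex 1 \<subseteq> ?T" "singular_simplex 1 euclidean \<sigma>" if "\<sigma> \<in> Poly_Mapping.keys ?z" for \<sigma>
  proof -
    have "singular_simplex 1 (top_of_set ?T) \<sigma>" using chain that by (auto simp: singular_chain_def)
    then show "\<sigma> ` standard_simplex 1 \<subseteq> ?T" "singular_simplex 1 euclidean \<sigma>"
      using singular_simplex_subtopology[of 1 euclidean ?T \<sigma>] by auto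
  qed
  have sm: "small \<sigma>" if "\<sigma> \<in> Poly_Mapping.keys ?z" for \<sigma>
    unfolding small_def
  proof
    show "singular_simplex 1 (top_of_set M) \<sigma>"
      using im[OF that] TM singular_simplex_subtopology[of 1 euclidean M \<sigma>] by auto
    show "\<exists>B\<in>\<B>. \<sigma> ` standard_simplex 1 \<subseteq> f -` B"
      using order_trans[OF im(1)[OF that] B(2)] B(1) by (intro bexI[of _ B])
  qed
  have bd0: "chain_boundary 1 ?z = 0"
    by (rule chain_boundary_boundary_alt[of 1 "top_of_set ?T"]) (simp only: singular_chain_of ST)
  let ?c = "node B x0"
  show ?thesis
  proof (rule potential_sum[where S = "Poly_Mapping.keys ?z" and t = tgt and s = src and l = "\<lambda>x. - frag_of (w x, ?c)",
        OF order_refl relation_0 relation_diff _ trail_ends_sum[OF sm bd0]])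
    fix \<sigma> assume \<sigma>: "\<sigma> \<in> Poly_Mapping.keys ?z"
    note s = small_path[OF sm[OF \<sigma>]] small_patch[OF sm[OF \<sigma>]] small_ends[OF sm[OF \<sigma>]]
    let ?s = "src \<sigma>" and ?t = "tgt \<sigma>"
    have sT: "?s \<in> ?T" "?t \<in> ?T"
      using im(1)[OF \<sigma>] pathstart_in_path_image[of "simplex_path \<sigma>"] pathfinish_in_path_image[of "simplex_path \<sigma>"]
      unfolding s(2) by blast+
    have fB: "f ?s \<in> B" "f ?t \<in> B" using sT B(2) by auto
    have "relator_of (w ?s) (node (patch \<sigma>) ?s) (node B ?s) \<in> Relators"
      by (rule relator_in_Relators[OF s(6) home(1)[OF s(6)] s(4) B(1) home(2)[OF s(6)] s(8) fB(1)])
    then have 1: "relation (relator_of (w ?s) (node (patch \<sigma>) ?s) ?c)" unfolding Weq[OF sT(1)] by (rule relation_relator)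
    have "relator_of (w ?t) (node (patch \<sigma>) ?t) (node B ?t) \<in> Relators"
      by (rule relator_in_Relators[OF s(7) home(1)[OF s(7)] s(4) B(1) home(2)[OF s(7)] s(9) fB(2)])
    then have 2: "relation (relator_of (w ?t) (node (patch \<sigma>) ?s) ?c)"
      unfolding Weq[OF sT(2)] s(10) by (rule relation_relator)
    have "trail \<sigma> - (- frag_of (w ?t, ?c) - - frag_of (w ?s, ?c)) =
        relator_of (w ?s) (node (patch \<sigma>) ?s) ?c - relator_of (w ?t) (node (patch \<sigma>) ?s) ?c"
      unfolding trail_def by simp
    then show "relation (trail \<sigma> - (- frag_of (w ?t, ?c) - - frag_of (w ?s, ?c)))"
      using relation_diff[OF 1 2] by (simp only:)
  qed
qed

lemma trail_boundary:
  assumes "singular_chain (Suc 1) (top_of_set M) D"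
    and small: "\<And>S. S \<in> Poly_Mapping.keys D \<Longrightarrow> \<exists>B\<in>\<B>. S ` standard_simplex (Suc 1) \<subseteq> f -` B"
  shows "relation (frag_extend trail (chain_boundary (Suc 1) D))"
proof -
  let ?Q = "{S. singular_simplex (Suc 1) (top_of_set M) S \<and> (\<exists>B\<in>\<B>. S ` standard_simplex (Suc 1) \<subseteq> f -` B)}"
  have "Poly_Mapping.keys D \<subseteq> ?Q" using assms by (auto simp: singular_chain_def)
  then show ?thesis
  proof (induction D rule: frag_induction)
    case zero
    then show ?case using relation_0 by simp
  next
    case (one S)
    then show ?case using trail_boundary_simplex by blast
  next
    case (diff a b)
    then show ?case using relation_diff by (simp only: chain_boundary_diff frag_extend_diff)
  qed
qed

end

lemma iterated_subdivision:
  assumes "singular_chain p X c"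
  shows "singular_chain p X ((singular_subdivision p ^^ m) c)"
    and "chain_boundary p ((singular_subdivision p ^^ m) c) = (singular_subdivision (p - Suc 0) ^^ m) (chain_boundary p c)"
proof (induction m)
  case (Suc m)
  {
    case 1
    show ?case using singular_chain_singular_subdivision[OF Suc(1)] by simp
  next
    case 2
    show ?case using chain_boundary_singular_subdivision[OF Suc(1)] Suc(2) by simp
  }
qed (use assms in simp_all)

lemma iterated_subdivision_homologous:
  assumes "singular_relcycle p X {} c"
  shows "homologous_rel p X {} ((singular_subdivision p ^^ m) c) c"
proof (induction m)
  case 0
  then show ?case by simp
next
  case (Suc m)
  have "singular_relcycle p X {} ((singular_subdivision p ^^ m) c)"
    using homologous_rel_singular_relcycle[OF Suc] assms by simp
  from homologous_rel_trans[OF Suc homologous_rel_singular_subdivision[OF this]] show ?case by simp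
qed

lemma iterated_subdivision_cmul:
  "(singular_subdivision p ^^ m) (frag_cmul k c) = frag_cmul k ((singular_subdivision p ^^ m) c)"
  by (induction m) (simp_all add: singular_subdivision_def frag_extend_cmul)

context nerve
begin

text \<open>If \<open>N z\<close> bounds, subdivide the cycle and the bounding chain until both are
  small. The trail of the cycle is the lift, and the trail of the boundary of each small 2-simplex
  is a combination of relations.\<close>

lemma torsion_lift:
  assumes x: "x \<in> torsion_part (H1 M)"
  shows "\<exists>c N d. (Poly_Mapping.keys c \<subseteq> Edges \<and> edge_boundary c = 0) \<and> class1 M (chain_of c) = x \<and> N > 0 \<and>
    Poly_Mapping.keys d \<subseteq> Relators \<and> frag_cmul N c = frag_extend id d"
proof -
  obtain z N where z: "cycle1 M z" "x = class1 M z" "N > (0::int)" "null_chain M (frag_cmul N z)"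
    by (rule torsion_part_H1[OF x])
  obtain z' where z': "cycle1 M0 z'" "null_chain M (z - z')" by (rule homologous_in_M0[OF z(1)])
  have "frag_cmul N z' = frag_cmul N z - frag_cmul N (z - z')"
    by (intro poly_mapping_eqI) (simp add: lookup_minus right_diff_distrib)
  then have "null_chain M (frag_cmul N z')"
    using singular_relboundary_diff[OF z(4) singular_relboundary_cmul[OF z'(2)]] by (simp only:)
  then obtain C where C: "singular_chain (Suc 1) (top_of_set M) C" "chain_boundary (Suc 1) C = frag_cmul N z'"
    unfolding singular_boundary by (elim exE conjE)
  have z'M0: "singular_chain 1 (top_of_set M0) z'" using z'(1) by (simp add: singular_cycle)
  have z'c: "singular_chain 1 (top_of_set M) z'"
    by (rule singular_chain_mono[OF z'M0]) simp
  let ?\<C> = "(\<lambda>B. M \<inter> f -` B) ` \<B>"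
  have cov: "topspace (top_of_set M) \<subseteq> \<Union>?\<C>" using \<B>_cover by auto
  have opn: "openin (top_of_set M) U" if "U \<in> ?\<C>" for U using that openin_preimage by blast
  obtain m1 where m1: "\<forall>m \<sigma>. m1 \<le> m \<longrightarrow> \<sigma> \<in> Poly_Mapping.keys ((singular_subdivision 1 ^^ m) z') \<longrightarrow>
      (\<exists>U\<in>?\<C>. \<sigma> \<in> standard_simplex 1 \<rightarrow> U)"
    by (rule sufficient_iterated_singular_subdivision_exists[OF opn cov z'c]) (assumption, rule that, blast)
  obtain m2 where m2: "\<forall>m \<sigma>. m2 \<le> m \<longrightarrow> \<sigma> \<in> Poly_Mapping.keys ((singular_subdivision (Suc 1) ^^ m) C) \<longrightarrow>
      (\<exists>U\<in>?\<C>. \<sigma> \<in> standard_simplex (Suc 1) \<rightarrow> U)"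
    by (rule sufficient_iterated_singular_subdivision_exists[OF opn cov C(1)]) (assumption, rule that, blast)
  \<comment> \<open>Both chains are subdivided equally often, as subdivision commutes with the
    boundary and \<open>D\<close> then still bounds \<open>N\<close> times \<open>y\<close>.\<close>
  define m where "m = max m1 m2"
  define y where "y = (singular_subdivision 1 ^^ m) z'"
  define D where "D = (singular_subdivision (Suc 1) ^^ m) C"
  have y: "homologous_rel 1 (top_of_set M0) {} y z'"
    unfolding y_def by (rule iterated_subdivision_homologous[OF z'(1)])
  have yc: "cycle1 M0 y" using homologous_rel_singular_relcycle[OF y] z'(1) by simp
  have ybd: "chain_boundary 1 y = 0" using yc by (simp add: singular_cycle)
  have yM: "singular_chain 1 (top_of_set M) y" unfolding y_def by (rule iterated_subdivision(1)[OF z'c])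
  have DM: "singular_chain (Suc 1) (top_of_set M) D" unfolding D_def by (rule iterated_subdivision(1)[OF C(1)])
  have Dbd: "chain_boundary (Suc 1) D = frag_cmul N y"
    unfolding D_def iterated_subdivision(2)[OF C(1)] C(2) y_def by (simp add: iterated_subdivision_cmul One_nat_def)
  have ysmall: "small \<sigma>" if \<sigma>: "\<sigma> \<in> Poly_Mapping.keys y" for \<sigma>
  proof -
    have "\<exists>U\<in>?\<C>. \<sigma> \<in> standard_simplex 1 \<rightarrow> U" using m1 \<sigma> unfolding y_def m_def by (meson max.cobounded1)
    then have "\<exists>B\<in>\<B>. \<sigma> ` standard_simplex 1 \<subseteq> f -` B" by blast
    then show ?thesis using yM \<sigma> unfolding small_def singular_chain_def by blast
  qed
  have Dsmall: "\<exists>B\<in>\<B>. S ` standard_simplex (Suc 1) \<subseteq> f -` B" if S: "S \<in> Poly_Mapping.keys D" for S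
  proof -
    have "\<exists>U\<in>?\<C>. S \<in> standard_simplex (Suc 1) \<rightarrow> U" using m2 S unfolding D_def m_def by (meson max.cobounded2)
    then show ?thesis by blast
  qed
  let ?c = "frag_extend trail y"
  have "relation (frag_extend trail (chain_boundary (Suc 1) D))" by (rule trail_boundary[OF DM]) (rule Dsmall)
  then obtain d where d: "Poly_Mapping.keys d \<subseteq> Relators" "frag_cmul N ?c = frag_extend id d"
    unfolding Dbd relation_def frag_extend_cmul by (elim exE conjE)
  have c: "Poly_Mapping.keys ?c \<subseteq> Edges" "edge_boundary ?c = 0"
    by (rule trail_cycle[OF _ ybd], erule ysmall)+
  have n1: "null_chain M (chain_of ?c - y)" by (rule chain_of_trail_null[OF _ yc]) (rule ysmall)
  have n2: "null_chain M (y - z')"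
    by (rule null_chain_mono[OF y[unfolded homologous_rel_def]]) simp
  have "null_chain M ((chain_of ?c - y) + (y - z') - (z - z'))"
    by (rule singular_relboundary_diff[OF singular_relboundary_add[OF n1 n2] z'(2)])
  then have "null_chain M (chain_of ?c - z)" by simp
  then have "class1 M (chain_of ?c) = x" unfolding z(2) class1_eq_iff .
  then show ?thesis using c z(3) d by (intro exI[of _ ?c] exI[of _ N] exI[of _ d] conjI)
qed

section \<open>The turn acting on the nerve\<close>

definition shift :: "(complex \<times> complex) set \<times> 'a set \<Rightarrow> (complex \<times> complex) set \<times> 'a set" where
  "shift v = node (fst v) (turn (base v))"

text \<open>The definition uses the chosen base point of the component; the turn carries a path
  inside the component to a path in one component, so any other point gives the same vertex.\<close>

lemma shift_node:
  assumes "B \<in> \<B>" "y \<in> M0" "f y \<in> B"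
  shows "shift (node B y) = node B (turn y)"
proof -
  let ?z = "base (node B y)"
  have yM: "y \<in> M" using assms(2) by blast
  note V = node_in_V[OF yM assms(1,3)]
  have "y \<in> snd (node B y)" using W_refl[OF assms(2,3)] by simp
  then obtain g where g: "path g" "path_image g \<subseteq> W B y" "pathstart g = y" "pathfinish g = ?z"
    using path_in_node[OF V _ V_D(4)[OF V]] by (metis snd_conv)
  have gM: "path_image g \<subseteq> M0 \<inter> f -` B" using g(2) W_subset by blast
  have "continuous_on (path_image g) turn" by (rule continuous_on_subset[OF continuous_turn]) (use gM in blast)
  then have "path (turn \<circ> g)" by (rule path_continuous_image[OF g(1)])
  moreover have "path_image (turn \<circ> g) \<subseteq> M \<inter> f -` B"
    using gM turn_E f_turn by (auto simp: path_image_compose subset_iff)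
  ultimately have "path_component (M \<inter> f -` B) (turn y) (turn ?z)"
    unfolding path_component_def using g(3,4) by (intro exI[of _ "turn \<circ> g"]) (simp add: pathstart_compose pathfinish_compose)
  then show ?thesis unfolding shift_def by (simp add: W_cong)
qed

lemma funpow_shift_node:
  assumes "B \<in> \<B>" "y \<in> M0" "f y \<in> B"
  shows "(shift ^^ j) (node B y) = node B ((turn ^^ j) y)"
proof (induction j)
  case (Suc j)
  have "shift (node B ((turn ^^ j) y)) = node B (turn ((turn ^^ j) y))"
    by (rule shift_node[OF assms(1) funpow_turn_E[OF assms(2)]]) (simp only: f_funpow_turn[OF assms(2)] assms(3))
  then show ?case using Suc by simp
qed simp

lemma V_E:
  assumes "v \<in> V"
  obtains B y where "v = node B y" "B \<in> \<B>" "y \<in> M0" "f y \<in> B"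
  using assms unfolding V_def by blast

lemma Edges_E:
  assumes "e \<in> Edges"
  obtains B B' y where "e = (node B y, node B' y)" "B \<in> \<B>" "B' \<in> \<B>" "y \<in> M0" "f y \<in> B" "f y \<in> B'"
  using assms unfolding Edges_def by blast

lemma shift_V: "v \<in> V \<Longrightarrow> shift v \<in> V"
proof (elim V_E)
  fix B y assume v: "v = node B y" "B \<in> \<B>" "y \<in> M0" "f y \<in> B"
  show ?thesis unfolding v(1) shift_node[OF v(2-4)]
    by (rule node_in_V[OF _ v(2)]) (use turn_E[OF v(3)] f_turn[OF v(3)] v(4) in simp_all)
qed

lemma shift_Edges: "e \<in> Edges \<Longrightarrow> map_prod shift shift e \<in> Edges"
proof (elim Edges_E)
  fix B B' y assume e: "e = (node B y, node B' y)" "B \<in> \<B>" "B' \<in> \<B>" "y \<in> M0" "f y \<in> B" "f y \<in> B'"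
  show ?thesis unfolding e(1) map_prod_simp shift_node[OF e(2,4,5)] shift_node[OF e(3,4,6)]
    by (rule edge_in_Edges[OF _ e(2,3)]) (use turn_E[OF e(4)] f_turn[OF e(4)] e(5,6) in simp_all)
qed

text \<open>The potential at a vertex is the orbit segment of its base point followed by a path
  inside the shifted vertex. The flow moves an edge path to its image under the turn, and this image
  is compared with the edge path of the shifted edge inside a star.\<close>

lemma chain_of_shift:
  assumes c: "Poly_Mapping.keys c \<subseteq> Edges" "edge_boundary c = 0"
  shows "null_chain M (chain_of (frag_extend (\<lambda>e. frag_of (map_prod shift shift e)) c) - chain_of c)"
proof -
  have "\<forall>v\<in>V. \<exists>\<kappa>. path \<kappa> \<and> path_image \<kappa> \<subseteq> snd (shift v) \<and> pathstart \<kappa> = turn (base v) \<and> pathfinish \<kappa> = base (shift v)"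
  proof
    fix v assume v: "v \<in> V"
    have bM0: "base v \<in> M0" by (rule base_M0[OF v])
    have "f (base v) \<in> fst v" using V_D(2,4)[OF v] by blast
    then have "turn (base v) \<in> snd (shift v)"
      unfolding shift_def using W_refl[OF turn_E[OF bM0]] f_turn[OF bM0] by simp
    then obtain \<kappa> where "path \<kappa>" "path_image \<kappa> \<subseteq> snd (shift v)" "pathstart \<kappa> = turn (base v)" "pathfinish \<kappa> = base (shift v)"
      by (rule path_in_node[OF shift_V[OF v] _ V_D(4)[OF shift_V[OF v]]])
    then show "\<exists>\<kappa>. path \<kappa> \<and> path_image \<kappa> \<subseteq> snd (shift v) \<and> pathstart \<kappa> = turn (base v) \<and> pathfinish \<kappa> = base (shift v)"
      by (intro exI[of _ \<kappa>] conjI)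
  qed
  from bchoice[OF this] obtain \<kappa> where
    \<kappa>0: "\<forall>v\<in>V. path (\<kappa> v) \<and> path_image (\<kappa> v) \<subseteq> snd (shift v) \<and> pathstart (\<kappa> v) = turn (base v) \<and> pathfinish (\<kappa> v) = base (shift v)" ..
  let ?fl = "\<lambda>v. path_simplex (\<lambda>s. lift_flow (s, base v))"
  let ?l = "\<lambda>v. path_simplex (\<kappa> v) + ?fl v"
  let ?h = "map_prod shift shift"
  have sq: "null_chain M (path_simplex (edge_path (?h e)) - path_simplex (edge_path e) - (?l (snd e) - ?l (fst e)))"
    if e: "e \<in> Edges" for e
  proof -
    let ?a = "fst e" and ?b = "snd e" and ?g = "edge_path e" and ?g' = "edge_path (?h e)"
    note V = Edges_D(1,2)[OF e]
    note g = edge_path[OF e] and g' = edge_path[OF shift_Edges[OF e]]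
    note \<kappa>a = bspec[OF \<kappa>0 V(1)] and \<kappa>b = bspec[OF \<kappa>0 V(2)]
    have fs: "fst (shift ?a) = fst ?a" "fst (shift ?b) = fst ?b" by (simp_all add: shift_def)
    have ne: "fst ?a \<inter> fst ?a \<noteq> {}" "fst ?a \<inter> fst ?b \<noteq> {}" using Edges_D(4)[OF e] by auto
    let ?S = "star (fst ?a)"
    have gM0: "path_image ?g \<subseteq> M0" by (rule edge_path_M0[OF e])
    have gS: "path_image ?g \<subseteq> ?S" by (rule edge_path_star[OF e ne])
    have tg: "path (turn \<circ> ?g)"
      by (rule path_continuous_image[OF g(1) continuous_on_subset[OF continuous_turn gM0]])
    have tgS: "path_image (turn \<circ> ?g) \<subseteq> ?S"
    proof
      fix z assume "z \<in> path_image (turn \<circ> ?g)"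
      then obtain y where y: "y \<in> path_image ?g" "z = turn y" unfolding path_image_compose by blast
      have "y \<in> M0" using y(1) gM0 by blast
      then have "z \<in> M0" "f z = f y" unfolding y(2) by (rule turn_E, rule f_turn)
      then show "z \<in> ?S" using subsetD[OF gS y(1)] unfolding star_def by (simp only: Int_iff vimage_eq simp_thms)
    qed
    have \<kappa>aS: "path_image (\<kappa> ?a) \<subseteq> ?S" using \<kappa>a node_star[OF shift_V[OF V(1)], of "fst ?a"] ne(1) unfolding fs by blast
    have \<kappa>bS: "path_image (\<kappa> ?b) \<subseteq> ?S" using \<kappa>b node_star[OF shift_V[OF V(2)], of "fst ?a"] ne(2) unfolding fs by blast
    have g'S: "path_image ?g' \<subseteq> ?S"
      by (rule edge_path_star[OF shift_Edges[OF e]]) (use ne fs in simp_all)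
    have 1: "null_chain M (path_simplex (turn \<circ> ?g) + path_simplex (\<kappa> ?b) - (path_simplex (\<kappa> ?a) + path_simplex ?g'))"
      by (rule loops_null_square[OF star_null[OF V_D(1)[OF V(1)]] tg _ _ g'(1) tgS \<kappa>bS \<kappa>aS g'S])
        (use \<kappa>a \<kappa>b g(3,4) g'(3,4) in \<open>simp_all add: pathstart_compose pathfinish_compose\<close>)
    have 2: "null_chain M (path_simplex (turn \<circ> ?g) - path_simplex ?g - ?fl ?b + ?fl ?a)"
      using null_chain_mono[OF path_simplex_turn[OF g(1) gM0], of M] unfolding g(3,4) by simp
    have "path_simplex ?g' - path_simplex ?g - (?l ?b - ?l ?a) =
      (path_simplex (turn \<circ> ?g) - path_simplex ?g - ?fl ?b + ?fl ?a) -
      (path_simplex (turn \<circ> ?g) + path_simplex (\<kappa> ?b) - (path_simplex (\<kappa> ?a) + path_simplex ?g'))"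
      by simp
    then show ?thesis using singular_relboundary_diff[OF 2 1] by (simp only:)
  qed
  have "null_chain M (frag_extend (\<lambda>e. path_simplex (edge_path (?h e)) - path_simplex (edge_path e)) c)"
    by (rule potential_sum[where t = snd and s = fst and l = ?l, OF c(1) _ _ _ c(2)])
      (simp, rule singular_relboundary_diff, assumption, assumption, rule sq)
  moreover have "chain_of (frag_extend (\<lambda>e. frag_of (?h e)) c) = frag_extend (\<lambda>e. path_simplex (edge_path (?h e))) c"
    unfolding chain_of_frag_extend by (simp only: chain_of_def frag_extend_of)
  ultimately show ?thesis by (simp only: frag_extend_diff_fun chain_of_def)
qed

section \<open>Counting orbits of edges and vertices\<close>

abbreviation \<P> where "\<P> \<equiv> {(B, B'). B \<in> \<B> \<and> B' \<in> \<B> \<and> B \<inter> B' \<noteq> {}}"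

definition centre :: "(complex \<times> complex) set \<times> (complex \<times> complex) set \<Rightarrow> complex \<times> complex" where
  "centre b = (SOME q. q \<in> fst b \<inter> snd b - L)"

definition fibre :: "(complex \<times> complex) set \<times> (complex \<times> complex) set \<Rightarrow> 'a set" where
  "fibre b = {x \<in> M0. f x = centre b}"

abbreviation edge_at where "edge_at b x \<equiv> (node (fst b) x, node (snd b) x)"

lemma centre: "b \<in> \<P> \<Longrightarrow> centre b \<in> fst b \<inter> snd b - L" "b \<in> \<P> \<Longrightarrow> centre b \<in> X"
proof -
  assume b: "b \<in> \<P>"
  then have B: "fst b \<in> \<B>" "snd b \<in> \<B>" "fst b \<inter> snd b \<noteq> {}" by auto
  show c: "centre b \<in> fst b \<inter> snd b - L"
    unfolding centre_def by (rule some_in_eq[THEN iffD2, OF \<B>_Int(2)[OF B]])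
  show "centre b \<in> X" using c openin_imp_subset[OF openin_\<B>[OF B(1)]] unfolding link_complement_def by blast
qed

text \<open>A path in \<open>B \<inter> B' - L\<close> from \<open>f y\<close> to the centre lifts
  to a path that stays in the two components of \<open>y\<close>. So every edge over the pair is
  seen in the fibre of a single point.\<close>

lemma Edges_eq: "Edges = (\<Union>b\<in>\<P>. edge_at b ` fibre b)"
proof (intro equalityI subsetI)
  fix e assume "e \<in> Edges"
  then obtain B B' y where e: "e = (node B y, node B' y)" "B \<in> \<B>" "B' \<in> \<B>" "y \<in> M0" "f y \<in> B" "f y \<in> B'"
    by (rule Edges_E)
  have b: "(B, B') \<in> \<P>" using e by blast
  let ?q = "centre (B, B')"
  have q: "?q \<in> B \<inter> B' - L" using centre(1)[OF b] by simp
  have fy: "f y \<in> B \<inter> B' - L" using e(4-6) unfolding M0_eq by blast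
  have "path_connected (B \<inter> B' - L)" by (rule \<B>_Int(1)[OF e(2,3)]) (use fy in blast)
  then obtain g where g: "path g" "path_image g \<subseteq> B \<inter> B' - L" "pathstart g = f y" "pathfinish g = ?q"
    unfolding path_connected_def using fy q by blast
  have gX: "path_image g \<subseteq> X"
    using g(2) openin_imp_subset[OF openin_\<B>[OF e(2)]] unfolding link_complement_def by blast
  obtain k where k: "path k" "path_image k \<subseteq> M0" "pathstart k = y" "\<And>t. t \<in> {0..1} \<Longrightarrow> f (k t) = g t"
    by (rule covering_space_lift_path_strong[OF covering e(4) g(1) gX g(3)]) (rule that)
  have kB: "path_image k \<subseteq> M \<inter> f -` B" "path_image k \<subseteq> M \<inter> f -` B'"
    using k(2,4) g(2) unfolding path_image_def by auto
  have pc: "path_component S y (pathfinish k)" if "path_image k \<subseteq> S" for S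
    unfolding path_component_def using k(1,3) that by (intro exI[of _ k]) simp
  have W: "W B (pathfinish k) = W B y" "W B' (pathfinish k) = W B' y"
    by (rule W_cong[OF pc[OF kB(1)]], rule W_cong[OF pc[OF kB(2)]])
  have "pathfinish k \<in> fibre (B, B')"
    unfolding fibre_def using k(2) pathfinish_in_path_image[of k] k(4)[of 1] g(4)
    by (auto simp: pathfinish_def)
  moreover have "e = edge_at (B, B') (pathfinish k)" unfolding e(1) using W by simp
  ultimately show "e \<in> (\<Union>b\<in>\<P>. edge_at b ` fibre b)" using b by blast
next
  fix e assume "e \<in> (\<Union>b\<in>\<P>. edge_at b ` fibre b)"
  then obtain b x where b: "b \<in> \<P>" "x \<in> fibre b" "e = edge_at b x" by blast
  then have s: "fst b \<in> \<B>" "snd b \<in> \<B>" "x \<in> M" "f x \<in> fst b" "f x \<in> snd b"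
    using centre(1)[OF b(1)] unfolding fibre_def by auto
  show "e \<in> Edges" unfolding b(3) by (rule edge_in_Edges[OF s(3,1,2,4,5)])
qed

lemma finite_\<P>: "finite \<P>" and card_\<P>: "card \<P> \<le> (card \<B>)\<^sup>2"
proof -
  have sub: "\<P> \<subseteq> \<B> \<times> \<B>" by blast
  show "finite \<P>" by (rule finite_subset[OF sub]) (simp add: finite_\<B>)
  show "card \<P> \<le> (card \<B>)\<^sup>2"
    using card_mono[OF _ sub] finite_\<B> by (simp add: card_cartesian_product power2_eq_square)
qed

lemma finite_Edges: "finite Edges"
  unfolding Edges_eq
proof (intro finite_UN_I finite_\<P> finite_imageI)
  fix b assume "b \<in> \<P>"
  then show "finite (fibre b)" unfolding fibre_def using finite_fibre(1)[OF n_pos centre(2)] by blast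
qed

lemma V_subset_Edges: "V \<subseteq> fst ` Edges"
proof
  fix v assume "v \<in> V"
  then obtain B y where v: "v = node B y" "B \<in> \<B>" "y \<in> M0" "f y \<in> B" by (rule V_E)
  have "y \<in> M" using v(3) by blast
  from edge_in_Edges[OF this v(2,2,4,4)] show "v \<in> fst ` Edges" unfolding v(1) by force
qed

lemma V_diagonal: "v \<in> V \<Longrightarrow> (v, v) \<in> Edges"
proof (elim V_E)
  fix B y assume v: "v = node B y" "B \<in> \<B>" "y \<in> M0" "f y \<in> B"
  have "y \<in> M" using v(3) by blast
  from edge_in_Edges[OF this v(2,2,4,4)] show ?thesis unfolding v(1) .
qed

lemma funpow_map_prod_pair: "(map_prod h h ^^ j) (a, b) = ((h ^^ j) a, (h ^^ j) b)" for h :: "'b \<Rightarrow> 'b"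
  by (induction j) simp_all

lemma orbit_edge_at:
  assumes "b \<in> \<P>" "x \<in> fibre b"
  shows "orbit (map_prod shift shift) (edge_at b x) = edge_at b ` orbit turn x"
proof -
  have b: "fst b \<in> \<B>" "snd b \<in> \<B>" "x \<in> M0" "f x \<in> fst b" "f x \<in> snd b"
    using assms centre(1)[OF assms(1)] unfolding fibre_def by auto
  show ?thesis
    unfolding orbit_def image_image funpow_map_prod_pair funpow_shift_node[OF b(1,3,4)] funpow_shift_node[OF b(2,3,5)] ..
qed

lemma card_edge_orbits:
  "card (orbit (map_prod shift shift) ` Edges) \<le> (card \<B>)\<^sup>2 * (p * q' * n ^ (d - 1))"
proof -
  let ?o = "orbit (map_prod shift shift)"
  have "?o ` Edges = (\<Union>b\<in>\<P>. ?o ` edge_at b ` fibre b)" unfolding Edges_eq by blast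
  also have "\<dots> = (\<Union>b\<in>\<P>. image (edge_at b) ` orbit turn ` fibre b)"
    unfolding image_image by (intro SUP_cong image_cong refl orbit_edge_at)
  finally have "card (?o ` Edges) \<le> (\<Sum>b\<in>\<P>. card (image (edge_at b) ` orbit turn ` fibre b))"
    using card_UN_le[OF finite_\<P>] by simp
  also have "\<dots> \<le> (\<Sum>b\<in>\<P>. p * q' * n ^ (d - 1))"
  proof (intro sum_mono)
    fix b assume b: "b \<in> \<P>"
    have fin: "finite (fibre b)" unfolding fibre_def by (rule finite_fibre(1)[OF n_pos centre(2)[OF b]])
    have "card (image (edge_at b) ` orbit turn ` fibre b) \<le> card (orbit turn ` fibre b)"
      by (intro card_image_le finite_imageI fin)
    also have "\<dots> \<le> p * q' * n ^ (d - 1)"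
      unfolding fibre_def by (rule card_orbits_fibre[OF n_pos centre(2)[OF b]])
    finally show "card (image (edge_at b) ` orbit turn ` fibre b) \<le> p * q' * n ^ (d - 1)" .
  qed
  also have "\<dots> = card \<P> * (p * q' * n ^ (d - 1))" by simp
  also have "\<dots> \<le> (card \<B>)\<^sup>2 * (p * q' * n ^ (d - 1))" using card_\<P> by (rule mult_right_mono) simp
  finally show ?thesis .
qed

text \<open>The orbit of \<open>v\<close> is the projection of the orbit of the diagonal edge
  \<open>(v, v)\<close>.\<close>

lemma card_vertex_orbits: "card (orbit shift ` V) \<le> card (orbit (map_prod shift shift) ` Edges)"
proof -
  have "orbit shift v \<in> image fst ` orbit (map_prod shift shift) ` Edges" if "v \<in> V" for v
  proof -
    have "orbit shift v = fst ` orbit (map_prod shift shift) (v, v)"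
      unfolding orbit_def image_image funpow_map_prod_pair by simp
    then show ?thesis using V_diagonal[OF that] by blast
  qed
  then have "orbit shift ` V \<subseteq> image fst ` orbit (map_prod shift shift) ` Edges" by blast
  then have "card (orbit shift ` V) \<le> card (image fst ` orbit (map_prod shift shift) ` Edges)"
    by (intro card_mono finite_imageI finite_Edges)
  also have "\<dots> \<le> card (orbit (map_prod shift shift) ` Edges)" by (intro card_image_le finite_imageI finite_Edges)
  finally show ?thesis .
qed

lemma V_nonempty: "V \<noteq> {}"
proof -
  obtain x where x: "x \<in> M" using E_nonempty by blast
  then show ?thesis using w_V by blast
qed

sublocale graph_action V Edges shift n
proof
  show "finite V" by (rule finite_subset[OF V_subset_Edges]) (intro finite_imageI finite_Edges)
  show "V \<noteq> {}" by (rule V_nonempty)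
  show "Edges \<subseteq> V \<times> V" using Edges_D(1,2) by (auto simp: mem_Times_iff)
  show "n > 0" by (rule n_pos)
  show "shift v \<in> V" if "v \<in> V" for v by (rule shift_V[OF that])
  show "map_prod shift shift e \<in> Edges" if "e \<in> Edges" for e by (rule shift_Edges[OF that])
  show "(shift ^^ n) v = v" if "v \<in> V" for v
    using that by (elim V_E) (simp add: funpow_shift_node funpow_turn_n)
  show "\<exists>y. Poly_Mapping.keys y \<subseteq> Edges \<and> edge_boundary y = frag_of b - frag_of a" if "a \<in> V" "b \<in> V" for a b
    by (rule edges_connect[OF that])
qed

sublocale graph_realization V Edges shift n "H1 M" Relators "\<lambda>c. class1 M (chain_of c)"
proof (intro graph_realization.intro graph_realization_axioms.intro)
  show "graph_action V Edges shift n" by (rule graph_action_axioms)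
  show "comm_group (H1 M)" by (rule abelian_homology_group)
  show "\<exists>e1\<in>Edges. \<exists>e2\<in>Edges. \<exists>e3\<in>Edges. t = frag_of e1 + frag_of e2 - frag_of e3" "edge_boundary t = 0"
    if "t \<in> Relators" for t
  proof -
    obtain B1 B2 B3 y where t: "t = relator_of (node B1 y) (node B2 y) (node B3 y)"
      and B: "B1 \<in> \<B>" "B2 \<in> \<B>" "B3 \<in> \<B>" and y: "y \<in> M0" "f y \<in> B1" "f y \<in> B2" "f y \<in> B3"
      using \<open>t \<in> Relators\<close> unfolding Relators_def by blast
    have yM: "y \<in> M" using y(1) by blast
    show "\<exists>e1\<in>Edges. \<exists>e2\<in>Edges. \<exists>e3\<in>Edges. t = frag_of e1 + frag_of e2 - frag_of e3"
      unfolding t using edge_in_Edges[OF yM B(1,2) y(2,3)] edge_in_Edges[OF yM B(2,3) y(3,4)] edge_in_Edges[OF yM B(1,3) y(2,4)]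
      by (intro bexI[of _ "(node B1 y, node B2 y)"] bexI[of _ "(node B2 y, node B3 y)"] bexI[of _ "(node B1 y, node B3 y)"] refl)
    show "edge_boundary t = 0" unfolding t by (simp add: frag_extend_add frag_extend_diff)
  qed
  show "class1 M (chain_of t) = \<one>\<^bsub>H1 M\<^esub>" if "t \<in> Relators" for t
    unfolding class1_eq_one by (rule chain_of_relator[OF that])
  have cyc: "cycle1 M (chain_of c)" if "cycle c" for c
    using that unfolding cycle_def by (intro chain_of_cycle) simp_all
  show "class1 M (chain_of c) \<in> carrier (H1 M)" if "cycle c" for c by (rule class1_in_carrier[OF cyc[OF that]])
  show "class1 M (chain_of (a + b)) = class1 M (chain_of a) \<otimes>\<^bsub>H1 M\<^esub> class1 M (chain_of b)" if "cycle a" "cycle b" for a b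
    unfolding class1_add[OF cyc[OF that(1)] cyc[OF that(2)]] by (simp only: chain_of_def frag_extend_add)
  show "class1 M (chain_of (E.act c)) = class1 M (chain_of c)" if "cycle c" for c
    unfolding class1_eq_iff using that unfolding cycle_def by (intro chain_of_shift) simp_all
  show "\<exists>c N d. cycle c \<and> class1 M (chain_of c) = x \<and> N > 0 \<and> Poly_Mapping.keys d \<subseteq> Relators \<and> frag_cmul N c = frag_extend id d"
    if "x \<in> torsion_part (H1 M)" for x
    unfolding cycle_def by (rule torsion_lift[OF that])
qed

theorem card_torsion_bound:
  fixes K :: nat
  defines "K \<equiv> (card \<B>)\<^sup>2 * (p * q' * n ^ (d - 1))"
  shows "finite (torsion_part (H1 M))" "card (torsion_part (H1 M)) \<le> n ^ K * (6 * K + 1) ^ K"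
proof -
  let ?k = "card (orbit (map_prod shift shift) ` Edges)" and ?r = "card (orbit shift ` V)"
  have k: "?k \<le> K" unfolding K_def by (rule card_edge_orbits)
  have r: "?r \<le> K" by (rule order_trans[OF card_vertex_orbits k])
  show "finite (torsion_part (H1 M))" by (rule card_torsion_le(1))
  have "card (torsion_part (H1 M)) \<le> n ^ ?r * (6 * ?k + 1) ^ ?k" by (rule card_torsion_le(2))
  also have "\<dots> \<le> n ^ K * (6 * K + 1) ^ K"
  proof (rule mult_mono)
    show "n ^ ?r \<le> n ^ K" using n_pos r by (intro power_increasing) auto
    have "(6 * ?k + 1) ^ ?k \<le> (6 * K + 1) ^ ?k" using k by (intro power_mono) auto
    also have "\<dots> \<le> (6 * K + 1) ^ K" using k by (intro power_increasing) auto
    finally show "(6 * ?k + 1) ^ ?k \<le> (6 * K + 1) ^ K" .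
  qed auto
  finally show "card (torsion_part (H1 M)) \<le> n ^ K * (6 * K + 1) ^ K" .
qed

end

declare One_nat_def [simp]

section \<open>Mahler measure\<close>

text \<open>Concavity puts the sine above its chord on each half of the interval. The product form
  is chosen because its logarithm splits into two integrable terms.\<close>

lemma sin_pi_lower: "sin (pi * x) \<ge> x * (1 - x)" if "x \<in> {0..1}" for x :: real
proof -
  have concave: "concave_on {0..pi} sin"
    by (rule f''_le0_imp_concave[where f' = cos and f'' = "\<lambda>x. - sin x"])
      (auto intro!: derivative_eq_intros sin_ge_zero)
  have half: "sin (pi * y) \<ge> y" if "0 \<le> y" "y \<le> 1/2" for y :: real
  proof -
    have "sin ((1 - 2 * y) *\<^sub>R 0 + (2 * y) *\<^sub>R (pi / 2)) \<ge> (1 - 2 * y) * sin 0 + (2 * y) * sin (pi / 2)"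
      using that by (intro concave_onD[OF concave]) auto
    then show ?thesis using that by (simp add: mult.commute)
  qed
  show ?thesis
  proof (cases "x \<le> 1/2")
    case True
    have "x * (1 - x) \<le> x" using that by (simp add: mult_left_le)
    then show ?thesis using half[of x] True that by auto
  next
    case False
    have "x * (1 - x) \<le> 1 - x" using that by (simp add: mult_left_le_one_le)
    moreover have "sin (pi * (1 - x)) = sin (pi * x)" by (simp add: right_diff_distrib)
    ultimately show ?thesis using half[of "1 - x"] False that by auto
  qed
qed

definition log_dist :: "real \<Rightarrow> real" where "log_dist x = ln (cmod (cis (2 * pi * x) - 1))"

lemma cmod_cis_minus_1: "cmod (cis (2 * pi * x) - 1) = 2 * \<bar>sin (pi * x)\<bar>"
proof -
  have "(cmod (cis (2 * pi * x) - 1))\<^sup>2 = (cos (2 * pi * x) - 1)\<^sup>2 + (sin (2 * pi * x))\<^sup>2"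
    by (simp add: cmod_power2)
  also have "\<dots> = 2 - 2 * cos (2 * (pi * x))"
    using sin_cos_squared_add[of "2 * (pi * x)"] by (simp add: power2_diff mult.assoc)
  also have "\<dots> = (2 * \<bar>sin (pi * x)\<bar>)\<^sup>2"
    by (simp add: cos_double_sin power_mult_distrib)
  finally show ?thesis by (rule power2_eq_imp_eq) auto
qed

text \<open>The antiderivative \<open>x * ln x - x\<close> extends continuously to 0, where the
  convention \<open>ln 0 = 0\<close> gives the right value 0.\<close>

lemma has_integral_ln: "(ln has_integral (-1)) {0..1::real}"
proof -
  define G where "G x = x * ln x - x" for x :: real
  have "(G has_vector_derivative ln x) (at x)" if "x \<in> {0<..<1}" for x
    using that unfolding G_def
    by (auto intro!: derivative_eq_intros simp flip: has_real_derivative_iff_has_vector_derivative)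
  moreover have "continuous_on {0..1} G"
    unfolding continuous_on_eq_continuous_within
  proof
    fix x :: real assume x: "x \<in> {0..1}"
    show "continuous (at x within {0..1}) G"
    proof (cases "x = 0")
      case False
      then show ?thesis using x unfolding G_def by (intro continuous_intros) auto
    next
      case True
      have "((\<lambda>x::real. x * ln x - x) \<longlongrightarrow> 0) (at_right 0)" by real_asymp
      moreover have "at (0::real) within {0..1} = at_right 0" by (rule at_within_Icc_at_right) simp
      ultimately show ?thesis using True by (simp add: continuous_within G_def[abs_def])
    qed
  qed
  ultimately have "(ln has_integral (G 1 - G 0)) {0..1}"
    by (intro fundamental_theorem_of_calculus_interior) auto
  then show ?thesis by (simp add: G_def)
qed

lemma integrable_bound_log_dist: "(\<lambda>x::real. 1 - ln x - ln (1 - x)) integrable_on {0..1}"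
proof -
  have "((\<lambda>x. ln ((-1) *\<^sub>R x + 1)) has_integral (1 / (\<bar>-1\<bar> ^ DIM(real))) *\<^sub>R (-1)) ((\<lambda>x. (1 / (-1)) *\<^sub>R x + - ((1 / (-1)) *\<^sub>R 1)) ` cbox 0 (1::real))"
    by (rule has_integral_affinity) (use has_integral_ln in auto)
  moreover have "(\<lambda>x. (1 / (-1)) *\<^sub>R x + - ((1 / (-1)) *\<^sub>R 1)) ` cbox 0 (1::real) = {0..1}"
    using image_affinity_atLeastAtMost[of "-1" 1 0 "1::real"] by simp
  ultimately have "(\<lambda>x::real. ln (1 - x)) integrable_on {0..1}"
    by (auto simp: integrable_on_def)
  then show ?thesis using has_integral_ln by (intro integrable_diff integrable_const_ivl) (auto simp: integrable_on_def)
qed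

lemma log_dist_bound: "\<bar>log_dist x\<bar> \<le> 1 - ln x - ln (1 - x)" if x: "x \<in> {0..1}"
proof (cases "x = 0 \<or> x = 1")
  case True
  then show ?thesis by (auto simp: log_dist_def)
next
  case False
  then have x': "0 < x" "x < 1" using x by auto
  have s: "x * (1 - x) \<le> sin (pi * x)" by (rule sin_pi_lower[OF x])
  have pos: "0 < x * (1 - x)" using x' by simp
  have "ln (x * (1 - x)) \<le> ln (2 * sin (pi * x))" using s pos by (intro ln_mono) linarith+
  then have 1: "ln x + ln (1 - x) \<le> ln (2 * sin (pi * x))" using x' by (simp add: ln_mult)
  have "ln (2 * sin (pi * x)) \<le> ln 2" using s pos by (intro ln_mono) auto
  also have "ln 2 \<le> (1::real)" using ln_2_less_1 by linarith
  finally have 2: "ln (2 * sin (pi * x)) \<le> 1" .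
  have "log_dist x = ln (2 * sin (pi * x))" using s pos by (simp add: log_dist_def cmod_cis_minus_1)
  moreover have "ln x \<le> 0" "ln (1 - x) \<le> 0" using x' by auto
  ultimately show ?thesis using 1 2 by linarith
qed

lemma borel_log_dist [measurable]: "log_dist \<in> borel_measurable borel"
  unfolding log_dist_def cis_conv_exp by measurable

lemma absolutely_integrable_log_dist: "log_dist absolutely_integrable_on {0..1}"
proof (rule measurable_bounded_by_integrable_imp_absolutely_integrable[OF _ _ integrable_bound_log_dist])
  show "log_dist \<in> borel_measurable (lebesgue_on {0..1})"
    using borel_log_dist by (simp add: borel_measurable_if_I measurable_completion measurable_restrict_space1)
qed (use log_dist_bound in auto)

lemma log_dist_periodic: "log_dist (x + 1) = log_dist x"
proof -
  have "cis (2 * pi * (x + 1)) = cis (2 * pi * x)" by (simp add: distrib_left cis_mult[symmetric])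
  then show ?thesis by (simp add: log_dist_def)
qed

lemma has_integral_shift_periodic:
  fixes h :: "real \<Rightarrow> real"
  assumes per: "\<And>x. h (x + 1) = h x" and I: "(h has_integral I) {0..1}" and c: "c \<in> {0..1}"
  shows "((\<lambda>x. h (x + c)) has_integral I) {0..1}"
proof -
  have a: "(h has_integral (integral {0..c} h)) {0..c}" "(h has_integral (integral {c..1} h)) {c..1}"
    using integrable_on_subinterval[of h "{0..1}"] has_integral_integrable[OF I] c
    by (simp_all add: integrable_integral)
  have "(h has_integral (integral {0..c} h + integral {c..1} h)) {0..1}"
    by (rule has_integral_combine[OF _ _ a]) (use c in auto)
  then have I_eq: "integral {0..c} h + integral {c..1} h = I" using I by (rule has_integral_unique)
  have "((\<lambda>x. h (1 *\<^sub>R x + -1)) has_integral (integral {0..c} h /\<^sub>R 1 ^ DIM(real))) (cbox ((0 - -1) /\<^sub>R 1) ((c - -1) /\<^sub>R 1))"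
    by (rule has_integral_affinity') (use a in auto)
  moreover have "h (x - 1) = h x" for x using per[of "x - 1"] by simp
  ultimately have b: "(h has_integral (integral {0..c} h)) {1..1 + c}" by (simp add: add.commute)
  have "(h has_integral (integral {c..1} h + integral {0..c} h)) {c..1 + c}"
    by (rule has_integral_combine[OF _ _ a(2) b]) (use c in auto)
  then have "(h has_integral I) (cbox c (1 + c))" using I_eq by (simp add: add.commute)
  then have "((\<lambda>x. h (1 *\<^sub>R x + c)) has_integral (I /\<^sub>R 1 ^ DIM(real))) (cbox ((c - c) /\<^sub>R 1) ((1 + c - c) /\<^sub>R 1))"
    by (rule has_integral_affinity') simp
  then show ?thesis by simp
qed

text \<open>The integral \<open>J\<close> satisfies \<open>J = 2 * J\<close> since \<open>z\<^sup>2 - 1 = (z - 1) (z + 1)\<close>.\<close>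

lemma has_integral_log_dist: "(log_dist has_integral 0) {0..1}"
proof -
  define J where "J = integral {0..1} log_dist"
  have J: "(log_dist has_integral J) {0..1}"
    unfolding J_def using absolutely_integrable_log_dist
    by (intro integrable_integral) (simp add: absolutely_integrable_on_def)
  have "(log_dist has_integral J) {1..2}"
  proof -
    have "((\<lambda>x. log_dist (1 *\<^sub>R x + -1)) has_integral (J /\<^sub>R 1 ^ DIM(real))) (cbox ((0 - -1) /\<^sub>R 1) ((1 - -1) /\<^sub>R 1))"
      by (rule has_integral_affinity') (use J in auto)
    moreover have "log_dist (x - 1) = log_dist x" for x using log_dist_periodic[of "x - 1"] by simp
    ultimately show ?thesis by simp
  qed
  then have "(log_dist has_integral (J + J)) {0..2}"
    using has_integral_combine[of 0 1 2 log_dist J J] J by simp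
  then have "(log_dist has_integral (J + J)) (cbox 0 2)" by simp
  then have "((\<lambda>x. log_dist (2 *\<^sub>R x + 0)) has_integral ((J + J) /\<^sub>R 2 ^ DIM(real))) (cbox ((0 - 0) /\<^sub>R 2) ((2 - 0) /\<^sub>R 2))"
    by (rule has_integral_affinity') simp
  then have 1: "((\<lambda>x. log_dist (2 * x)) has_integral J) {0..1}" by simp
  have "((\<lambda>x. log_dist (x + 1/2)) has_integral J) {0..1}"
    by (rule has_integral_shift_periodic[OF log_dist_periodic J]) simp
  from has_integral_add[OF J this]
  have 2: "((\<lambda>x. log_dist x + log_dist (x + 1/2)) has_integral (J + J)) {0..1}" .
  have "((\<lambda>x. log_dist (2 * x)) has_integral (J + J)) {0..1}"
  \<comment> \<open>At the excluded points one of the factors vanishes and the product rule for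
    \<open>ln\<close> can fail.\<close>
  proof (rule has_integral_spike_finite[OF _ _ 2, of "{0, 1/2, 1}"])
    fix x :: real assume x: "x \<in> {0..1} - {0, 1/2, 1}"
    have "sin (pi * x) \<noteq> 0" using x sin_gt_zero[of "pi * x"] by auto
    then have n1: "cis (2 * pi * x) - 1 \<noteq> 0" using cmod_cis_minus_1[of x] by (metis abs_eq_0 mult_eq_0_iff norm_zero zero_neq_numeral)
    have shift: "cis (2 * pi * (x + 1/2)) = - cis (2 * pi * x)"
      by (simp add: distrib_left cis_mult[symmetric])
    have "cos (pi * x) \<noteq> 0"
    proof
      assume "cos (pi * x) = 0"
      then have "cos (pi * x) = cos (pi / 2)" by simp
      moreover have "pi * x \<in> {0..pi}" "pi / 2 \<in> {0..pi}" using x by auto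
      ultimately have "pi * x = pi / 2" by (meson cos_inj_pi atLeastAtMost_iff)
      then show False using x by simp
    qed
    moreover have "sin (pi * (x + 1/2)) = cos (pi * x)" by (simp add: distrib_left sin_add)
    ultimately have n2: "- cis (2 * pi * x) - 1 \<noteq> 0"
      using cmod_cis_minus_1[of "x + 1/2"] unfolding shift by (metis abs_eq_0 mult_eq_0_iff norm_zero zero_neq_numeral)
    have "cis (2 * pi * (2 * x)) - 1 = - ((cis (2 * pi * x) - 1) * (- cis (2 * pi * x) - 1))"
      using cis_mult[of "2 * pi * x" "2 * pi * x"] by (simp add: algebra_simps)
    then show "log_dist (2 * x) = log_dist x + log_dist (x + 1/2)"
      unfolding log_dist_def shift using n1 n2 by (simp add: norm_mult ln_mult)
  qed simp
  then have "J = J + J" using 1 has_integral_unique by blast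
  then show ?thesis using J by simp
qed

text \<open>A rotation moves \<open>w\<close> to 1, and the integral over a full period is invariant
  under translation.\<close>

lemma set_integral_log_dist_shift:
  assumes w: "cmod w = 1"
  shows "set_integrable lborel {0..1} (\<lambda>x. ln (cmod (cis (2 * pi * x) - w)))"
    and "(LINT x:{0..1}|lborel. ln (cmod (cis (2 * pi * x) - w))) = 0"
proof -
  obtain c where c: "c \<in> {0..1}" "cis (2 * pi * c) * w = 1"
  proof -
    define a where "a = - Arg w / (2 * pi)"
    define c where "c = a - of_int \<lfloor>a\<rfloor>"
    have "c \<in> {0..1}" unfolding c_def using floor_correct[of a] by (simp; linarith)
    moreover have "cis (2 * pi * c) = cis (- Arg w) * cis (2 * pi * of_int (- \<lfloor>a\<rfloor>))"
      by (simp add: c_def a_def cis_mult right_diff_distrib)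
    then have "cis (2 * pi * c) = cis (- Arg w)" by (simp only: cis_multiple_2pi[OF Ints_of_int] mult_1_right)
    then have "cis (2 * pi * c) * w = 1"
      using rcis_cmod_Arg[of w] w by (metis cis_mult cis_zero rcis_def mult_1 of_real_1 add.left_inverse)
    ultimately show thesis by (rule that)
  qed
  have eq: "ln (cmod (cis (2 * pi * x) - w)) = log_dist (x + c)" for x
  proof -
    have "cis (2 * pi * (x + c)) - 1 = cis (2 * pi * c) * (cis (2 * pi * x) - w)"
    proof -
      have "cis (2 * pi * (x + c)) = cis (2 * pi * c) * cis (2 * pi * x)"
        unfolding cis_mult by (simp only: distrib_left add.commute)
      then show ?thesis using c(2) by (simp add: right_diff_distrib)
    qed
    then have "cmod (cis (2 * pi * (x + c)) - 1) = cmod (cis (2 * pi * x) - w)" by (simp add: norm_mult)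
    then show ?thesis by (simp add: log_dist_def)
  qed
  have "(log_dist has_integral 0) {0..1}" by (rule has_integral_log_dist)
  from has_integral_shift_periodic[OF log_dist_periodic this c(1)]
  have I: "((\<lambda>x. log_dist (x + c)) has_integral 0) {0..1}" .
  have "set_integrable lebesgue {0..1} (\<lambda>x. log_dist (x + c))"
  proof -
    \<comment> \<open>Two points of the unit circle are at distance at most 2, so
      \<open>ln 2\<close> minus the integrand is nonnegative and integrability becomes
      absolute.\<close>
    have "((\<lambda>x. ln 2 - log_dist (x + c)) has_integral (ln 2 - 0)) {0..1}"
      using has_integral_const_real[of "ln 2" 0 "1::real"] I by (intro has_integral_diff) auto
    moreover have "0 \<le> ln 2 - log_dist (x + c)" for x
    proof (cases "sin (pi * (x + c)) = 0")
      case True then show ?thesis by (simp add: log_dist_def cmod_cis_minus_1)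
    next
      case False
      then have "log_dist (x + c) \<le> ln 2" unfolding log_dist_def cmod_cis_minus_1 by (intro ln_mono) auto
      then show ?thesis by simp
    qed
    ultimately have 1: "(\<lambda>x. ln 2 - log_dist (x + c)) absolutely_integrable_on {0..1}"
      by (intro nonnegative_absolutely_integrable_1) (auto simp: integrable_on_def)
    have 2: "(\<lambda>x::real. ln 2 :: real) absolutely_integrable_on {0..1}" by (intro absolutely_integrable_on_const) simp
    show ?thesis using set_integral_diff(1)[OF 2 1] by simp
  qed
  then have leb: "set_integrable lebesgue {0..1} (\<lambda>x. log_dist (x + c))" .
  have m: "(\<lambda>x. indicator {0..1} x *\<^sub>R log_dist (x + c)) \<in> borel_measurable lborel" by measurable
  show "set_integrable lborel {0..1} (\<lambda>x. ln (cmod (cis (2 * pi * x) - w)))"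
    using leb integrable_completion[OF m] unfolding eq set_integrable_def by simp
  have "(LINT x:{0..1}|lborel. log_dist (x + c)) = (LINT x:{0..1}|lebesgue. log_dist (x + c))"
    unfolding set_lebesgue_integral_def by (rule integral_completion[OF m, symmetric])
  also have "\<dots> = integral {0..1} (\<lambda>x. log_dist (x + c))" by (rule set_lebesgue_integral_eq_integral(2)[OF leb])
  also have "\<dots> = 0" using I by (rule integral_unique)
  finally show "(LINT x:{0..1}|lborel. ln (cmod (cis (2 * pi * x) - w))) = 0" unfolding eq .
qed

lemma AE_cis_neq: "AE x in lborel. cis (2 * pi * x) \<noteq> w"
proof (cases "\<exists>y. cis (2 * pi * y) = w")
  case True
  then obtain y where y: "cis (2 * pi * y) = w" by blast
  have "{x. cis (2 * pi * x) = w} \<subseteq> range (\<lambda>m::int. y + of_int m)"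
  proof
    fix x assume "x \<in> {x. cis (2 * pi * x) = w}"
    then have "cis (2 * pi * x) = cis (2 * pi * y)" using y by simp
    then have "sin (2 * pi * x) = sin (2 * pi * y) \<and> cos (2 * pi * x) = cos (2 * pi * y)" by (simp add: complex_eq_iff)
    then obtain m :: int where "2 * pi * x = 2 * pi * y + 2 * pi * m" unfolding sin_cos_eq_iff by blast
    then have "2 * pi * x = 2 * pi * (y + of_int m)" by (simp add: distrib_left)
    then have "x = y + of_int m" by simp
    then show "x \<in> range (\<lambda>m::int. y + of_int m)" by blast
  qed
  then have "countable {x. cis (2 * pi * x) = w}" by (rule countable_subset) simp
  then have "{x. cis (2 * pi * x) = w} \<in> null_sets lborel" by (rule countable_imp_null_set_lborel)
  from AE_not_in[OF this] show ?thesis by simp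
qed auto

lemma borel_ln_poly_cis [measurable]:
  "(\<lambda>x. ln (cmod (poly P (cis (2 * pi * x))))) \<in> borel_measurable lborel" for P :: "complex poly"
proof -
  have "continuous_on UNIV (\<lambda>x. poly P (cis (2 * pi * x)))"
    unfolding cis_conv_exp by (intro continuous_intros)
  then have "(\<lambda>x. poly P (cis (2 * pi * x))) \<in> borel_measurable lborel"
    using borel_measurable_continuous_onI by simp
  then show ?thesis by measurable
qed

text \<open>Jensen's formula in the case of roots at 0 or on the unit circle: splitting off the
  roots one by one, a root at 0 contributes \<open>ln 1\<close> and a root on the circle contributes
  0.\<close>

lemma integral_ln_poly_cis:
  fixes P :: "complex poly"
  assumes "P \<noteq> 0" "\<And>z. poly P z = 0 \<Longrightarrow> z = 0 \<or> cmod z = 1"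
  shows "set_integrable lborel {0..1} (\<lambda>x. ln (cmod (poly P (cis (2 * pi * x))))) \<and>
    (LINT x:{0..1}|lborel. ln (cmod (poly P (cis (2 * pi * x))))) = ln (cmod (lead_coeff P))"
  using assms
proof (induction "degree P" arbitrary: P)
  case 0
  then obtain c where c: "P = [:c:]" by (metis degree_eq_zeroE)
  then show ?case by (simp add: set_integrable_def set_lebesgue_integral_def)
next
  case (Suc k)
  have "\<not> constant (poly P)" using Suc.hyps(2) by (simp add: constant_degree)
  then obtain w where w: "poly P w = 0" using fundamental_theorem_of_algebra by blast
  then obtain R where R: "P = [:- w, 1:] * R" by (meson dvdE poly_eq_0_iff_dvd)
  have R0: "R \<noteq> 0" using Suc.prems(1) R by auto
  have "degree P = 1 + degree R" unfolding R using R0 by (subst degree_mult_eq) auto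
  then have degR: "k = degree R" using Suc.hyps(2) by simp
  have "set_integrable lborel {0..1} (\<lambda>x. ln (cmod (poly R (cis (2 * pi * x))))) \<and>
    (LINT x:{0..1}|lborel. ln (cmod (poly R (cis (2 * pi * x))))) = ln (cmod (lead_coeff R))"
    using Suc.prems(2) by (intro Suc.hyps(1)[OF degR R0]) (simp add: R)
  then have IR: "set_integrable lborel {0..1} (\<lambda>x. ln (cmod (poly R (cis (2 * pi * x)))))"
    "(LINT x:{0..1}|lborel. ln (cmod (poly R (cis (2 * pi * x))))) = ln (cmod (lead_coeff R))" by auto
  have Iw: "set_integrable lborel {0..1} (\<lambda>x. ln (cmod (cis (2 * pi * x) - w))) \<and>
    (LINT x:{0..1}|lborel. ln (cmod (cis (2 * pi * x) - w))) = 0"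
    using Suc.prems(2)[OF w] set_integral_log_dist_shift[of w]
    by (auto simp: set_integrable_def set_lebesgue_integral_def)
  let ?f = "\<lambda>x. indicator {0..1} x *\<^sub>R ln (cmod (poly P (cis (2 * pi * x))))"
  let ?g = "\<lambda>x. indicator {0..1} x *\<^sub>R ln (cmod (cis (2 * pi * x) - w)) + indicator {0..1} x *\<^sub>R ln (cmod (poly R (cis (2 * pi * x))))"
  have fin: "finite {z. poly R z = 0}" using R0 by (rule poly_roots_finite)
  have AE: "AE x in lborel. ?f x = ?g x"
  proof -
    have "AE x in lborel. \<forall>z\<in>{z. poly R z = 0}. cis (2 * pi * x) \<noteq> z"
      using fin AE_cis_neq by (subst AE_finite_all) auto
    with AE_cis_neq[of w] show ?thesis
    proof eventually_elim
      case (elim x)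
      have "cmod (poly P (cis (2 * pi * x))) = cmod (cis (2 * pi * x) - w) * cmod (poly R (cis (2 * pi * x)))"
        by (simp add: R norm_mult algebra_simps flip: norm_mult)
      moreover have "cmod (cis (2 * pi * x) - w) > 0" "cmod (poly R (cis (2 * pi * x))) > 0" using elim by auto
      ultimately show ?case by (simp add: ln_mult distrib_left)
    qed
  qed
  have mf: "?f \<in> borel_measurable lborel" by measurable
  have ig: "integrable lborel ?g" using Iw IR(1) unfolding set_integrable_def by (intro Bochner_Integration.integrable_add) auto
  have "integrable lborel ?f"
    using ig AE mf by (subst integrable_cong_AE[of _ _ ?g]) (auto dest: borel_measurable_integrable)
  moreover have "integral\<^sup>L lborel ?f = integral\<^sup>L lborel ?g"
    using AE mf borel_measurable_integrable[OF ig] by (intro integral_cong_AE) auto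
  moreover have "integral\<^sup>L lborel ?g = 0 + ln (cmod (lead_coeff R))"
    using Iw IR unfolding set_integrable_def set_lebesgue_integral_def by (subst Bochner_Integration.integral_add) auto
  moreover have "lead_coeff P = lead_coeff R" unfolding R lead_coeff_mult by simp
  ultimately show ?case by (simp add: set_integrable_def set_lebesgue_integral_def)
qed

section \<open>Leading parts of divisors of \<open>(t^\<eta> - 1)^m\<close>\<close>

lemma mult_frag_of: "frag_of a * frag_of b = (frag_of (a + b) :: 'a::monoid_add \<Rightarrow>\<^sub>0 int)"
  by (simp add: mult_single)

lemma bilinear_induct:
  fixes P Q :: "'a::monoid_add \<Rightarrow>\<^sub>0 int" and g h :: "('a \<Rightarrow>\<^sub>0 int) \<Rightarrow> ('a \<Rightarrow>\<^sub>0 int) \<Rightarrow> 'c::ab_group_add"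
  assumes "Poly_Mapping.keys P \<subseteq> S" "Poly_Mapping.keys Q \<subseteq> S'"
    and "\<And>a b. a \<in> S \<Longrightarrow> b \<in> S' \<Longrightarrow> g (frag_of a) (frag_of b) = h (frag_of a) (frag_of b)"
    and "\<And>a b c. g (a - b) c = g a c - g b c" "\<And>a b c. g a (b - c) = g a b - g a c"
    and "\<And>a b c. h (a - b) c = h a c - h b c" "\<And>a b c. h a (b - c) = h a b - h a c"
  shows "g P Q = h P Q"
proof -
  have zero: "g 0 c = 0" "g c 0 = 0" "h 0 c = 0" "h c 0 = 0" for c
    using assms(4)[of 0 0 c] assms(5)[of c 0 0] assms(6)[of 0 0 c] assms(7)[of c 0 0] by auto
  have 1: "g (frag_of a) Q = h (frag_of a) Q" if "a \<in> S" for a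
    using assms(2) by (induction Q rule: frag_induction) (auto simp: zero assms(3)[OF that] assms(5,7))
  show ?thesis
    using assms(1) by (induction P rule: frag_induction) (auto simp: zero 1 assms(4,6))
qed

lemma weighted_sum_mult:
  assumes "\<And>a b. w (a + b) = w a * w b"
  shows "weighted_sum w (P * Q) = weighted_sum w P * weighted_sum w Q"
  by (rule bilinear_induct[where S = UNIV and S' = UNIV and g = "\<lambda>P Q. weighted_sum w (P * Q)"])
    (auto simp: mult_frag_of assms left_diff_distrib right_diff_distrib weighted_sum_diff)

lemma lookup_mult_upper:
  fixes P Q :: "'a::linordered_ab_group_add \<Rightarrow>\<^sub>0 int"
  assumes "Poly_Mapping.keys P \<subseteq> {..\<alpha>}" "Poly_Mapping.keys Q \<subseteq> {..\<beta>}"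
  shows "Poly_Mapping.lookup (P * Q) (\<alpha> + \<beta>) = Poly_Mapping.lookup P \<alpha> * Poly_Mapping.lookup Q \<beta>"
proof (rule bilinear_induct[OF assms, where g = "\<lambda>P Q. Poly_Mapping.lookup (P * Q) (\<alpha> + \<beta>)"])
  fix a b assume "a \<in> {..\<alpha>}" "b \<in> {..\<beta>}"
  then have "\<alpha> + \<beta> = a + b \<longleftrightarrow> \<alpha> = a \<and> \<beta> = b" by (metis add_le_less_mono add_less_le_mono atMost_iff less_irrefl order_le_less)
  then show "Poly_Mapping.lookup (frag_of a * frag_of b) (\<alpha> + \<beta>) = Poly_Mapping.lookup (frag_of a) \<alpha> * Poly_Mapping.lookup (frag_of b) \<beta>"
    unfolding mult_frag_of by simp
qed (auto simp: left_diff_distrib right_diff_distrib lookup_minus)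

lemma lookup_mult_lower:
  fixes P Q :: "'a::linordered_ab_group_add \<Rightarrow>\<^sub>0 int"
  assumes "Poly_Mapping.keys P \<subseteq> {\<alpha>..}" "Poly_Mapping.keys Q \<subseteq> {\<beta>..}"
  shows "Poly_Mapping.lookup (P * Q) (\<alpha> + \<beta>) = Poly_Mapping.lookup P \<alpha> * Poly_Mapping.lookup Q \<beta>"
proof (rule bilinear_induct[OF assms, where g = "\<lambda>P Q. Poly_Mapping.lookup (P * Q) (\<alpha> + \<beta>)"])
  fix a b assume "a \<in> {\<alpha>..}" "b \<in> {\<beta>..}"
  then have "\<alpha> + \<beta> = a + b \<longleftrightarrow> \<alpha> = a \<and> \<beta> = b" by (metis add_le_less_mono add_less_le_mono atLeast_iff less_irrefl order_le_less)
  then show "Poly_Mapping.lookup (frag_of a * frag_of b) (\<alpha> + \<beta>) = Poly_Mapping.lookup (frag_of a) \<alpha> * Poly_Mapping.lookup (frag_of b) \<beta>"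
    unfolding mult_frag_of by simp
qed (auto simp: left_diff_distrib right_diff_distrib lookup_minus)

text \<open>In a linearly ordered group the largest and the smallest exponents of the factors both
  add up to \<open>c\<close> without cancellation. Hence largest and smallest agree in each
  factor.\<close>

lemma factor_of_monomial:
  fixes A B :: "'a::linordered_ab_group_add \<Rightarrow>\<^sub>0 int"
  assumes AB: "A * B = Poly_Mapping.single c 1"
  obtains \<alpha> u where "A = Poly_Mapping.single \<alpha> u" "\<bar>u\<bar> = 1"
proof -
  have "A \<noteq> 0" "B \<noteq> 0" using AB by auto
  then have ne: "Poly_Mapping.keys A \<noteq> {}" "Poly_Mapping.keys B \<noteq> {}" by auto
  define \<alpha> \<beta> \<alpha>' \<beta>' where "\<alpha> = Max (Poly_Mapping.keys A)" and "\<beta> = Max (Poly_Mapping.keys B)"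
    and "\<alpha>' = Min (Poly_Mapping.keys A)" and "\<beta>' = Min (Poly_Mapping.keys B)"
  have mem: "\<alpha> \<in> Poly_Mapping.keys A" "\<beta> \<in> Poly_Mapping.keys B" "\<alpha>' \<in> Poly_Mapping.keys A" "\<beta>' \<in> Poly_Mapping.keys B"
    using ne by (auto simp: \<alpha>_def \<beta>_def \<alpha>'_def \<beta>'_def)
  have up: "Poly_Mapping.lookup (A * B) (\<alpha> + \<beta>) = Poly_Mapping.lookup A \<alpha> * Poly_Mapping.lookup B \<beta>"
    by (rule lookup_mult_upper) (auto simp: \<alpha>_def \<beta>_def)
  have low: "Poly_Mapping.lookup (A * B) (\<alpha>' + \<beta>') = Poly_Mapping.lookup A \<alpha>' * Poly_Mapping.lookup B \<beta>'"
    by (rule lookup_mult_lower) (auto simp: \<alpha>'_def \<beta>'_def)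
  have "Poly_Mapping.lookup A \<alpha> * Poly_Mapping.lookup B \<beta> \<noteq> 0" "Poly_Mapping.lookup A \<alpha>' * Poly_Mapping.lookup B \<beta>' \<noteq> 0"
    using mem by (auto simp: in_keys_iff)
  then have c: "\<alpha> + \<beta> = c" "\<alpha>' + \<beta>' = c"
    using up low unfolding AB by (auto simp: lookup_single when_def split: if_splits)
  have le: "\<alpha>' \<le> \<alpha>" "\<beta>' \<le> \<beta>" using mem by (auto simp: \<alpha>'_def \<beta>'_def)
  have eq: "\<alpha>' = \<alpha>"
  proof (rule ccontr)
    assume "\<alpha>' \<noteq> \<alpha>"
    then have "\<alpha>' + \<beta>' < \<alpha> + \<beta>" using le by (intro add_less_le_mono) auto
    then show False using c by simp
  qed
  have "a = \<alpha>" if "a \<in> Poly_Mapping.keys A" for a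
  proof -
    have "a \<le> \<alpha>" "\<alpha>' \<le> a" using that by (auto simp: \<alpha>_def \<alpha>'_def)
    then show ?thesis using eq by simp
  qed
  then have keys: "Poly_Mapping.lookup A a = 0" if "a \<noteq> \<alpha>" for a using that by (auto simp: in_keys_iff)
  have "Poly_Mapping.lookup A \<alpha> * Poly_Mapping.lookup B \<beta> = 1"
    using up unfolding AB c(1) by simp
  then have "\<bar>Poly_Mapping.lookup A \<alpha>\<bar> = 1" using abs_zmult_eq_1 by (metis abs_1)
  moreover have "A = Poly_Mapping.single \<alpha> (Poly_Mapping.lookup A \<alpha>)"
    by (rule poly_mapping_eqI) (auto simp: lookup_single when_def keys)
  ultimately show thesis using that by blast
qed

definition homogeneous_part :: "nat \<Rightarrow> int \<Rightarrow> int laurent \<Rightarrow> int laurent" where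
  "homogeneous_part j k = frag_extend (\<lambda>a. if Poly_Mapping.lookup a j = k then frag_of a else 0)"

lemma homogeneous_part_mult:
  assumes "Poly_Mapping.keys P \<subseteq> {a. Poly_Mapping.lookup a j \<le> k}" "Poly_Mapping.keys Q \<subseteq> {a. Poly_Mapping.lookup a j \<le> l}"
  shows "homogeneous_part j (k + l) (P * Q) = homogeneous_part j k P * homogeneous_part j l Q"
  by (rule bilinear_induct[OF assms, where g = "\<lambda>P Q. homogeneous_part j (k + l) (P * Q)"])
    (auto simp: mult_frag_of left_diff_distrib right_diff_distrib homogeneous_part_def frag_extend_diff lookup_add)

lemma lookup_homogeneous_part:
  "Poly_Mapping.lookup (homogeneous_part j k P) a = (if Poly_Mapping.lookup a j = k then Poly_Mapping.lookup P a else 0)"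
proof -
  have "Poly_Mapping.keys P \<subseteq> UNIV" by simp
  then show ?thesis unfolding homogeneous_part_def
    by (induction P rule: frag_induction) (auto simp: frag_extend_diff lookup_minus)
qed

lemma keys_mult_degree:
  assumes "Poly_Mapping.keys P \<subseteq> {a. Poly_Mapping.lookup a j \<le> k}" "Poly_Mapping.keys Q \<subseteq> {a. Poly_Mapping.lookup a j \<le> l}"
  shows "Poly_Mapping.keys (P * Q :: int laurent) \<subseteq> {a. Poly_Mapping.lookup a j \<le> k + l}"
proof
  fix x assume "x \<in> Poly_Mapping.keys (P * Q)"
  then obtain a b where "x = a + b" "a \<in> Poly_Mapping.keys P" "b \<in> Poly_Mapping.keys Q" using keys_mult[of P Q] by blast
  then have "Poly_Mapping.lookup a j \<le> k" "Poly_Mapping.lookup b j \<le> l" using assms by blast+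
  with \<open>x = a + b\<close> show "x \<in> {a. Poly_Mapping.lookup a j \<le> k + l}" by (simp add: lookup_add)
qed

lemma power_binomial_top:
  assumes N: "Poly_Mapping.lookup \<eta> j > 0"
  shows "Poly_Mapping.keys ((Poly_Mapping.single \<eta> 1 - 1) ^ m :: int laurent) \<subseteq> {a. Poly_Mapping.lookup a j \<le> int m * Poly_Mapping.lookup \<eta> j} \<and>
    (\<exists>c. homogeneous_part j (int m * Poly_Mapping.lookup \<eta> j) ((Poly_Mapping.single \<eta> 1 - 1) ^ m) = Poly_Mapping.single c 1)"
proof (induction m)
  case 0
  have "homogeneous_part j 0 1 = Poly_Mapping.single 0 1"
    by (rule poly_mapping_eqI) (simp add: lookup_homogeneous_part lookup_one lookup_single when_def)
  then have "\<exists>c. homogeneous_part j 0 1 = Poly_Mapping.single c 1" by (intro exI[of _ 0])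
  then show ?case by (auto simp: in_keys_iff lookup_one when_def split: if_splits)
next
  case (Suc m)
  let ?N = "Poly_Mapping.lookup \<eta> j" and ?P = "Poly_Mapping.single \<eta> 1 - 1 :: int laurent"
  have kP: "Poly_Mapping.keys ?P \<subseteq> {a. Poly_Mapping.lookup a j \<le> ?N}"
    using N by (auto simp: in_keys_iff lookup_minus lookup_single lookup_one when_def split: if_splits)
  have hP: "homogeneous_part j ?N ?P = Poly_Mapping.single \<eta> 1"
    by (rule poly_mapping_eqI) (use N in \<open>auto simp: lookup_homogeneous_part lookup_minus lookup_single lookup_one when_def\<close>)
  have e: "int (Suc m) * ?N = ?N + int m * ?N" by (simp add: algebra_simps)
  from Suc obtain c where c: "homogeneous_part j (int m * ?N) (?P ^ m) = Poly_Mapping.single c 1" by blast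
  have "homogeneous_part j (?N + int m * ?N) (?P * ?P ^ m) = Poly_Mapping.single (\<eta> + c) 1"
    using Suc kP by (subst homogeneous_part_mult) (auto simp: hP c mult_single)
  moreover have "Poly_Mapping.keys (?P * ?P ^ m) \<subseteq> {a. Poly_Mapping.lookup a j \<le> ?N + int m * ?N}"
    using Suc kP by (intro keys_mult_degree) auto
  ultimately show ?case unfolding e power_Suc by blast
qed

text \<open>Parts of top degree in variable \<open>j\<close> multiply, and that of the power of
  \<open>t^\<eta> - 1\<close> is a monomial with coefficient 1. So the one of a divisor is a
  monomial up to sign.\<close>

lemma top_part_of_factor:
  assumes N: "Poly_Mapping.lookup \<eta> j > 0" and dvd: "\<Delta> dvd (Poly_Mapping.single \<eta> 1 - 1 :: int laurent) ^ m"
  obtains k \<alpha> u where "Poly_Mapping.keys \<Delta> \<subseteq> {a. Poly_Mapping.lookup a j \<le> k}"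
    "homogeneous_part j k \<Delta> = Poly_Mapping.single \<alpha> u" "\<bar>u\<bar> = 1"
proof -
  let ?N = "Poly_Mapping.lookup \<eta> j" and ?D = "(Poly_Mapping.single \<eta> 1 - 1 :: int laurent) ^ m"
  obtain Q where Q: "?D = \<Delta> * Q" using dvd by (rule dvdE)
  obtain c where kD: "Poly_Mapping.keys ?D \<subseteq> {a. Poly_Mapping.lookup a j \<le> int m * ?N}"
    and hD: "homogeneous_part j (int m * ?N) ?D = Poly_Mapping.single c 1"
    using power_binomial_top[OF N, of m] by blast
  have "homogeneous_part j (int m * ?N) 0 = 0" by (simp add: homogeneous_part_def)
  then have D0: "?D \<noteq> 0" using hD by (metis frag_of_nonzero)
  then have nz: "\<Delta> \<noteq> 0" "Q \<noteq> 0" unfolding Q by auto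
  have top: "\<exists>k. Poly_Mapping.keys P \<subseteq> {a. Poly_Mapping.lookup a j \<le> k} \<and> homogeneous_part j k P \<noteq> 0"
    if "P \<noteq> 0" for P :: "int laurent"
  proof -
    let ?S = "(\<lambda>a. Poly_Mapping.lookup a j) ` Poly_Mapping.keys P"
    have ne: "?S \<noteq> {}" using that by simp
    then have "Max ?S \<in> ?S" by (intro Max_in) auto
    then obtain a where a: "a \<in> Poly_Mapping.keys P" "Max ?S = Poly_Mapping.lookup a j" by auto
    then have "Poly_Mapping.lookup (homogeneous_part j (Max ?S) P) a \<noteq> 0"
      by (simp add: lookup_homogeneous_part in_keys_iff)
    then have "homogeneous_part j (Max ?S) P \<noteq> 0" by auto
    moreover have "Poly_Mapping.keys P \<subseteq> {a. Poly_Mapping.lookup a j \<le> Max ?S}" by (auto intro: Max_ge)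
    ultimately show ?thesis by blast
  qed
  obtain k where k: "Poly_Mapping.keys \<Delta> \<subseteq> {a. Poly_Mapping.lookup a j \<le> k}" "homogeneous_part j k \<Delta> \<noteq> 0" using top[OF nz(1)] by blast
  obtain l where l: "Poly_Mapping.keys Q \<subseteq> {a. Poly_Mapping.lookup a j \<le> l}" "homogeneous_part j l Q \<noteq> 0" using top[OF nz(2)] by blast
  have hm: "homogeneous_part j (k + l) ?D = homogeneous_part j k \<Delta> * homogeneous_part j l Q"
    unfolding Q by (rule homogeneous_part_mult[OF k(1) l(1)])
  have nonzero_part: "\<exists>a\<in>Poly_Mapping.keys P. Poly_Mapping.lookup a j = i" if "homogeneous_part j i P \<noteq> 0" for i P
  proof (rule ccontr)
    assume "\<not> ?thesis"
    then have "homogeneous_part j i P = 0" by (intro poly_mapping_eqI) (auto simp: lookup_homogeneous_part in_keys_iff)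
    then show False using that by simp
  qed
  have "homogeneous_part j (k + l) ?D \<noteq> 0" unfolding hm using k l by simp
  from nonzero_part[OF this] kD have 1: "k + l \<le> int m * ?N" by auto
  have "homogeneous_part j (int m * ?N) ?D \<noteq> 0" unfolding hD by simp
  from nonzero_part[OF this] have 2: "int m * ?N \<le> k + l" using keys_mult_degree[OF k(1) l(1)] unfolding Q by force
  have "homogeneous_part j k \<Delta> * homogeneous_part j l Q = Poly_Mapping.single c 1"
    using hm hD 1 2 by (metis order_antisym)
  then show thesis using factor_of_monomial that k(1) by metis
qed

section \<open>Integrating out one variable\<close>

definition monomial_value :: "nat \<Rightarrow> (nat \<Rightarrow> complex) \<Rightarrow> (nat \<Rightarrow>\<^sub>0 int) \<Rightarrow> complex" where
  "monomial_value r x a = (\<Prod>i<r. x i powi Poly_Mapping.lookup a i)"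

lemma laurent_eval_of_int:
  "laurent_eval r (Poly_Mapping.map of_int P) x = weighted_sum (monomial_value r x) P"
proof -
  have l: "Poly_Mapping.lookup (Poly_Mapping.map of_int P) a = (of_int (Poly_Mapping.lookup P a) :: complex)" for a
    by (simp add: Poly_Mapping.map.rep_eq when_def)
  then have "Poly_Mapping.keys (Poly_Mapping.map of_int P :: complex laurent) = Poly_Mapping.keys P"
    by (auto simp: in_keys_iff)
  then show ?thesis by (simp add: laurent_eval_def weighted_sum_def monomial_value_def l)
qed

lemma monomial_value_add:
  assumes "\<And>i. i < r \<Longrightarrow> x i \<noteq> 0"
  shows "monomial_value r x (a + b) = monomial_value r x a * monomial_value r x b"
  unfolding monomial_value_def prod.distrib[symmetric]
  using assms by (intro prod.cong) (auto simp: lookup_add power_int_add)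

lemma monomial_value_update:
  assumes "j < r"
  shows "monomial_value r (x(j := z)) a = monomial_value r (x(j := 1)) a * z powi Poly_Mapping.lookup a j"
proof -
  have "monomial_value r (x(j := z)) a = z powi Poly_Mapping.lookup a j * (\<Prod>i\<in>{..<r} - {j}. x i powi Poly_Mapping.lookup a i)" for z
    unfolding monomial_value_def using assms by (subst prod.remove[of _ j]) (auto intro!: prod.cong)
  from this[of z] this[of 1] show ?thesis by simp
qed

lemma norm_monomial_value:
  assumes "\<And>i. i < r \<Longrightarrow> cmod (x i) = 1"
  shows "cmod (monomial_value r x a) = 1"
  unfolding monomial_value_def prod_norm[symmetric] using assms by (intro prod.neutral) (simp add: norm_power_int)

text \<open>As a function of the coordinate \<open>z = x\<^sub>j\<close>, a factor of \<open>(t\<^sup>\<eta> - 1)\<^sup>m\<close> has all its zeros on the unit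
  circle and a unimodular leading coefficient.\<close>

lemma inner_log_integral:
  assumes N: "Poly_Mapping.lookup \<eta> j > 0" and j: "j < r"
    and dvd: "\<Delta> dvd (Poly_Mapping.single \<eta> 1 - 1 :: int laurent) ^ m"
    and x: "\<And>i. i < r \<Longrightarrow> cmod (x i) = 1"
  shows "(LINT t:{0..1}|lborel. ln (cmod (weighted_sum (monomial_value r (x(j := cis (2 * pi * t)))) \<Delta>))) = 0"
proof -
  let ?deg = "\<lambda>a. Poly_Mapping.lookup a j"
  obtain k \<alpha> u where k: "Poly_Mapping.keys \<Delta> \<subseteq> {a. ?deg a \<le> k}"
    and top: "homogeneous_part j k \<Delta> = Poly_Mapping.single \<alpha> u" and u: "\<bar>u\<bar> = 1"
    using top_part_of_factor[OF N dvd] .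
  \<comment> \<open>Multiplication by \<open>z\<^sup>M\<close> clears the negative exponents of
    \<open>z\<close> and leaves the modulus on the unit circle unchanged. Including \<open>k\<close>
    keeps the position of the top coefficient nonnegative.\<close>
  define M where "M = Max (insert \<bar>k\<bar> ((\<lambda>a. \<bar>?deg a\<bar>) ` Poly_Mapping.keys \<Delta>))"
  have M: "0 \<le> ?deg a + M" if "a \<in> Poly_Mapping.keys \<Delta>" for a
  proof -
    have "\<bar>?deg a\<bar> \<le> M" unfolding M_def using that by (intro Max_ge) auto
    then show ?thesis by linarith
  qed
  have Mk: "0 \<le> k + M"
  proof -
    have "\<bar>k\<bar> \<le> M" unfolding M_def by (intro Max_ge) auto
    then show ?thesis by linarith
  qed
  define c where "c a = of_int (Poly_Mapping.lookup \<Delta> a) * monomial_value r (x(j := 1)) a" for a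
  define P where "P = (\<Sum>a\<in>Poly_Mapping.keys \<Delta>. Polynomial.monom (c a) (nat (?deg a + M)))"
  have P_eval: "poly P z = z powi M * weighted_sum (monomial_value r (x(j := z))) \<Delta>" if "z \<noteq> 0" for z
  proof -
    have "poly P z = (\<Sum>a\<in>Poly_Mapping.keys \<Delta>. c a * z powi (?deg a + M))"
      unfolding P_def poly_sum using M by (intro sum.cong) (auto simp: poly_monom power_int_def)
    also have "\<dots> = (\<Sum>a\<in>Poly_Mapping.keys \<Delta>. z powi M * (of_int (Poly_Mapping.lookup \<Delta> a) * monomial_value r (x(j := z)) a))"
      using that by (intro sum.cong) (auto simp: c_def monomial_value_update[OF j, of x z] power_int_add)
    finally show ?thesis by (simp add: weighted_sum_def sum_distrib_left)
  qed
  have coeff: "Polynomial.coeff P (nat (k + M)) = weighted_sum (monomial_value r (x(j := 1))) (homogeneous_part j k \<Delta>)"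
  proof -
    have "Polynomial.coeff P (nat (k + M)) = (\<Sum>a\<in>Poly_Mapping.keys \<Delta>. if ?deg a = k then c a else 0)"
      unfolding P_def coeff_sum using M Mk by (intro sum.cong) (auto simp: nat_eq_iff)
    also have "\<dots> = (\<Sum>a\<in>Poly_Mapping.keys \<Delta>. of_int (Poly_Mapping.lookup (homogeneous_part j k \<Delta>) a) * monomial_value r (x(j := 1)) a)"
      by (intro sum.cong) (auto simp: c_def lookup_homogeneous_part)
    also have "\<dots> = weighted_sum (monomial_value r (x(j := 1))) (homogeneous_part j k \<Delta>)"
      by (rule weighted_sum_superset[symmetric]) (auto simp: in_keys_iff lookup_homogeneous_part split: if_splits)
    finally show ?thesis .
  qed
  have "weighted_sum w (Poly_Mapping.single \<alpha> u) = of_int u * w \<alpha>" for w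
    using u by (simp add: weighted_sum_def)
  then have "cmod (Polynomial.coeff P (nat (k + M))) = \<bar>real_of_int u\<bar> * cmod (monomial_value r (x(j := 1)) \<alpha>)"
    unfolding coeff top by (simp add: norm_mult)
  also have "cmod (monomial_value r (x(j := 1)) \<alpha>) = 1" using x by (intro norm_monomial_value) auto
  also have "\<bar>real_of_int u\<bar> = 1" using u by linarith
  finally have lc: "cmod (Polynomial.coeff P (nat (k + M))) = 1" by simp
  then have P0: "P \<noteq> 0" by auto
  have "degree P \<le> nat (k + M)"
    unfolding P_def using k by (intro degree_sum_le order_trans[OF degree_monom_le] nat_mono) auto
  moreover have "nat (k + M) \<le> degree P" using lc by (intro le_degree) auto
  ultimately have lead: "cmod (lead_coeff P) = 1" using lc by simp
  \<comment> \<open>At a nonzero root the divisor forces \<open>y\<^sup>\<eta> = 1\<close>. All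
    other coordinates have modulus 1, so a positive power of \<open>cmod z\<close> equals 1.\<close>
  have roots: "z = 0 \<or> cmod z = 1" if z: "poly P z = 0" for z
  proof (rule ccontr)
    assume "\<not> ?thesis"
    then have z0: "z \<noteq> 0" and z1: "cmod z \<noteq> 1" by auto
    define y where "y = x(j := z)"
    have y0: "y i \<noteq> 0" if "i < r" for i using x[OF that] z0 by (auto simp: y_def)
    have mult: "weighted_sum (monomial_value r y) (A * B) = weighted_sum (monomial_value r y) A * weighted_sum (monomial_value r y) B" for A B
      by (rule weighted_sum_mult) (rule monomial_value_add, rule y0)
    have one: "weighted_sum (monomial_value r y) 1 = 1"
      by (simp add: monomial_value_def flip: single_one)
    have pow: "weighted_sum (monomial_value r y) (A ^ m) = weighted_sum (monomial_value r y) A ^ m" for A m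
      by (induction m) (auto simp: one mult)
    have "z powi M * weighted_sum (monomial_value r y) \<Delta> = 0" 
      unfolding y_def using P_eval[OF z0] z by (rule trans[OF sym])
    moreover have "z powi M \<noteq> 0" using z0 by simp
    ultimately have \<Delta>0: "weighted_sum (monomial_value r y) \<Delta> = 0" by (simp only: mult_eq_0_iff simp_thms)
    have "weighted_sum (monomial_value r y) ((Poly_Mapping.single \<eta> 1 - 1) ^ m) = 0"
    proof -
      obtain Q where "(Poly_Mapping.single \<eta> 1 - 1 :: int laurent) ^ m = \<Delta> * Q" using dvd by (rule dvdE)
      then show ?thesis by (simp only: mult \<Delta>0 mult_zero_left)
    qed
    then have "weighted_sum (monomial_value r y) (Poly_Mapping.single \<eta> 1 - 1) ^ m = 0"
      unfolding pow .
    then have "weighted_sum (monomial_value r y) (Poly_Mapping.single \<eta> 1 - 1) = 0"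
      by (simp only: power_eq_0_iff)
    moreover have "weighted_sum (monomial_value r y) (Poly_Mapping.single \<eta> 1) = monomial_value r y \<eta>"
      by (simp add: weighted_sum_def)
    ultimately have y1: "monomial_value r y \<eta> = 1"
      by (simp only: weighted_sum_diff one right_minus_eq)
    have "cmod (monomial_value r (x(j := 1)) \<eta>) * cmod z powi ?deg \<eta> = 1"
    proof -
      have "cmod (monomial_value r (x(j := 1)) \<eta>) * cmod z powi ?deg \<eta> = cmod (monomial_value r y \<eta>)"
        by (simp only: y_def monomial_value_update[OF j, of x z \<eta>] norm_mult norm_power_int)
      then show ?thesis by (simp only: y1 norm_one)
    qed
    moreover have "cmod (monomial_value r (x(j := 1)) \<eta>) = 1" using x by (intro norm_monomial_value) auto
    ultimately have "cmod z ^ nat (?deg \<eta>) = 1" using N by (simp add: power_int_def)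
    moreover have "0 < nat (?deg \<eta>)" using N by simp
    ultimately have "cmod z = 1" using power_eq_1_iff[of "cmod z" "nat (?deg \<eta>)"] by simp
    then show False using z1 by contradiction
  qed
  have eq: "cmod (poly P (cis (2 * pi * t))) = cmod (weighted_sum (monomial_value r (x(j := cis (2 * pi * t)))) \<Delta>)" for t
  proof -
    have "cmod (cis (2 * pi * t) powi M) = 1" by (simp only: norm_power_int norm_cis power_int_1_left)
    then show ?thesis by (simp only: P_eval[OF cis_neq_zero] norm_mult mult_1)
  qed
  have "(LINT t:{0..1}|lborel. ln (cmod (poly P (cis (2 * pi * t))))) = ln 1"
    using conjunct2[OF integral_ln_poly_cis[OF P0 roots]] unfolding lead .
  then show ?thesis unfolding eq ln_one .
qed

text \<open>Fubini with variable \<open>j\<close> innermost: the inner integral vanishes for every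
  value of the other variables.\<close>

lemma log_mahler_measure_factor:
  assumes N: "Poly_Mapping.lookup \<eta> j > 0" and j: "j < r"
    and dvd: "\<Delta> dvd (Poly_Mapping.single \<eta> 1 - 1 :: int laurent) ^ m"
  shows "log_mahler_measure r (Poly_Mapping.map of_int \<Delta>) = 0"
proof -
  let ?I = "{..<r} - {j}"
  let ?x = "\<lambda>\<theta> i. cis (2 * pi * \<theta> i)"
  let ?L = "\<lambda>\<theta>. ln (cmod (weighted_sum (monomial_value r (?x \<theta>)) \<Delta>))"
  let ?f = "\<lambda>\<theta>. indicator (Pi\<^sub>E {..<r} (\<lambda>_. {0..1})) \<theta> *\<^sub>R ?L \<theta>"
  interpret product_sigma_finite "\<lambda>_::nat. lborel :: real measure" by unfold_locales
  have ins: "insert j ?I = {..<r}" using j by auto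
  have eq: "log_mahler_measure r (Poly_Mapping.map of_int \<Delta>) = integral\<^sup>L (Pi\<^sub>M {..<r} (\<lambda>_. lborel)) ?f"
    unfolding log_mahler_measure_def set_lebesgue_integral_def laurent_eval_of_int ..
  have inner: "(\<integral>t. ?f (\<theta>(j := t)) \<partial>lborel) = 0" for \<theta> :: "nat \<Rightarrow> real"
  proof -
    have xj: "?x (\<theta>(j := t)) = (?x \<theta>)(j := cis (2 * pi * t))" for t by auto
    \<comment> \<open>The indicator of the cube splits into a factor for the coordinates other than
      \<open>j\<close>, obtained by putting 1 at \<open>j\<close>, and one for
      \<open>j\<close>.\<close>
    define e where "e = indicat_real (Pi\<^sub>E {..<r} (\<lambda>_. {0..1})) (\<theta>(j := 1))"
    have ind: "indicat_real (Pi\<^sub>E {..<r} (\<lambda>_. {0..1})) (\<theta>(j := t)) = e * indicat_real {0..1} t" for t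
      unfolding e_def
      using j by (auto simp: indicator_def PiE_iff extensional_def)
    have "(\<integral>t. ?f (\<theta>(j := t)) \<partial>lborel) = e * (LINT t:{0..1}|lborel. ln (cmod (weighted_sum (monomial_value r ((?x \<theta>)(j := cis (2 * pi * t)))) \<Delta>)))"
      unfolding set_lebesgue_integral_def xj ind by (simp add: mult.assoc)
    also have "\<dots> = 0" by (subst inner_log_integral[OF N j dvd]) auto
    finally show ?thesis .
  qed
  show ?thesis
  proof (cases "integrable (Pi\<^sub>M {..<r} (\<lambda>_. lborel)) ?f")
    \<comment> \<open>The Bochner integral of a function that is not integrable is 0 by
      convention.\<close>
    case False
    then show ?thesis unfolding eq by (rule not_integrable_integral_eq)
  next
    case True
    then have "integral\<^sup>L (Pi\<^sub>M {..<r} (\<lambda>_. lborel)) ?f = (\<integral>\<theta>. (\<integral>t. ?f (\<theta>(j := t)) \<partial>lborel) \<partial>Pi\<^sub>M ?I (\<lambda>_. lborel))"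
      using product_integral_insert[of ?I j ?f] unfolding ins by simp
    also have "\<dots> = 0" unfolding inner by simp
    finally show ?thesis unfolding eq by simp
  qed
qed

theorem log_mahler_measure_dvd:
  assumes N: "Poly_Mapping.lookup \<eta> j \<noteq> 0" and j: "j < r"
    and dvd: "\<Delta> dvd (Poly_Mapping.single \<eta> 1 - 1 :: int laurent) ^ m"
  shows "\<Delta> \<noteq> 0 \<and> log_mahler_measure r (Poly_Mapping.map of_int \<Delta>) = 0"
proof
  have "Poly_Mapping.lookup (Poly_Mapping.single \<eta> 1 - 1 :: int laurent) \<eta> \<noteq> 0"
    using N by (auto simp: lookup_minus lookup_single lookup_one when_def)
  then have "(Poly_Mapping.single \<eta> 1 - 1 :: int laurent) \<noteq> 0" by (metis lookup_zero)
  then show "\<Delta> \<noteq> 0" using dvd by auto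
  show "log_mahler_measure r (Poly_Mapping.map of_int \<Delta>) = 0"
  proof (cases "Poly_Mapping.lookup \<eta> j > 0")
    case True
    then show ?thesis by (rule log_mahler_measure_factor[OF _ j dvd])
  next
    case False
    \<comment> \<open>A negative exponent is made positive: \<open>t^(-\<eta>) - 1\<close> and
      \<open>t^\<eta> - 1\<close> differ by a unit.\<close>
    have "Poly_Mapping.single (- \<eta>) 1 - 1 = - (Poly_Mapping.single (- \<eta>) 1) * (Poly_Mapping.single \<eta> 1 - 1 :: int laurent)"
      by (simp add: right_diff_distrib mult_single)
    then have "\<Delta> dvd (Poly_Mapping.single (- \<eta>) 1 - 1) ^ m"
      using dvd by (simp only: power_mult_distrib dvd_mult)
    then show ?thesis using False N by (intro log_mahler_measure_factor[OF _ j, of "- \<eta>"]) auto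
  qed
qed

section \<open>Growth of torsion\<close>

lemma branched_cover_fox:
  assumes pq: "p > 0" "q > 0" and n: "n \<ge> 1" and fox: "fox_completed_cover (gcd p q) (torus_link p q) n M f"
  shows "\<exists>\<phi>. branched_cover p q \<phi> n M f"
proof -
  obtain \<phi> where \<phi>: "meridian_iso (gcd p q) (torus_link p q) \<phi>"
    "abelian_cover (gcd p q) (torus_link p q) \<phi> n (M \<inter> f -` link_complement (gcd p q) (torus_link p q)) f"
    using fox unfolding fox_completed_cover_def by (elim conjE exE)
  have M: "compact M" "continuous_on M f" "f ` M = sphere 0 1"
    using fox unfolding fox_completed_cover_def by simp_all
  note charts = fox[unfolded fox_completed_cover_def, THEN conjunct2, THEN conjunct2, THEN conjunct2, THEN conjunct2]
  have "\<phi> \<in> Group.iso (H1 (link_complement (gcd p q) (torus_link p q))) (free_Abelian_group {..<gcd p q})"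
    using \<phi>(1) unfolding meridian_iso_def by (rule conjunct1)
  then have "branched_cover p q \<phi> n M f"
    using pq n \<phi>(2) M charts
    by (intro branched_cover.intro torus_cover.intro torus.intro torus_cover_axioms.intro branched_cover_axioms.intro) simp_all
  then show ?thesis by (intro exI[of _ \<phi>])
qed

lemma torsion_growth_bound:
  fixes n d c t :: nat
  assumes n: "n > 0" and d: "d > 0" and t: "t > 0"
    and bound: "t \<le> n ^ (c * n ^ (d - 1)) * (6 * (c * n ^ (d - 1)) + 1) ^ (c * n ^ (d - 1))"
  shows "\<bar>1 / real n ^ d * ln (real t)\<bar> \<le> real c * (real d * ln (real n) + ln (6 * real c + 1)) / real n"
proof -
  let ?K = "c * n ^ (d - 1)"
  have n1: "real n \<ge> 1" using n by simp
  have nd: "real n ^ d = real n * real n ^ (d - 1)" using d by (simp flip: power_Suc)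
  have "real t \<le> real n ^ ?K * (6 * real ?K + 1) ^ ?K"
    using of_nat_mono[OF bound, where 'a = real] by (simp add: add.commute)
  then have "ln (real t) \<le> ln (real n ^ ?K * (6 * real ?K + 1) ^ ?K)" using t by (intro ln_mono) auto
  also have "\<dots> = real ?K * (ln (real n) + ln (6 * real ?K + 1))"
  proof -
    have pos: "real n > 0" "6 * real ?K + 1 > 0" using n by (simp_all add: add_nonneg_pos)
    have "ln (real n ^ ?K * (6 * real ?K + 1) ^ ?K) = ln (real n ^ ?K) + ln ((6 * real ?K + 1) ^ ?K)"
      by (intro ln_mult_pos zero_less_power pos)
    then show ?thesis by (simp only: ln_realpow distrib_left)
  qed
  also have "\<dots> \<le> real ?K * (ln (real n) + (ln (6 * real c + 1) + real (d - 1) * ln (real n)))"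
  proof (intro mult_left_mono add_left_mono)
    \<comment> \<open>Absorbing the summand 1 into the power of \<open>n\<close> makes the logarithm
      linear in \<open>ln n\<close>.\<close>
    have "1 \<le> real n ^ (d - 1)" using n1 by (rule one_le_power)
    then have "6 * real ?K + 1 \<le> (6 * real c + 1) * real n ^ (d - 1)" by (simp add: algebra_simps)
    then have "ln (6 * real ?K + 1) \<le> ln ((6 * real c + 1) * real n ^ (d - 1))" by (intro ln_mono) (simp_all add: add_nonneg_pos)
    also have "\<dots> = ln (6 * real c + 1) + real (d - 1) * ln (real n)"
      using n by (subst ln_mult) (auto simp: ln_realpow add_nonneg_pos)
    finally show "ln (6 * real ?K + 1) \<le> ln (6 * real c + 1) + real (d - 1) * ln (real n)" .
  qed simp
  also have "\<dots> = real n ^ (d - 1) * (real c * (real d * ln (real n) + ln (6 * real c + 1)))"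
    using d by (simp add: of_nat_diff algebra_simps)
  finally have "ln (real t) \<le> real n ^ (d - 1) * (real c * (real d * ln (real n) + ln (6 * real c + 1)))" .
  then have "ln (real t) / real n ^ d \<le> real n ^ (d - 1) * (real c * (real d * ln (real n) + ln (6 * real c + 1))) / real n ^ d"
    by (rule divide_right_mono) simp
  also have "\<dots> = real c * (real d * ln (real n) + ln (6 * real c + 1)) / real n"
    unfolding nd using n by simp
  finally have "ln (real t) / real n ^ d \<le> real c * (real d * ln (real n) + ln (6 * real c + 1)) / real n" .
  moreover have "0 \<le> ln (real t) / real n ^ d" using t by simp
  ultimately show ?thesis by simp
qed

lemma torsion_growth:
  fixes M :: "nat \<Rightarrow> 'a::real_normed_vector set"
  assumes pq: "p > 0" "q > 0"
    and fox: "\<forall>n\<ge>1. fox_completed_cover (gcd p q) (torus_link p q) n (M n) (f n)"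
  shows "(\<lambda>n. 1 / real n ^ gcd p q * ln (real (card (torsion_part (homology_group 1 (top_of_set (M n))))))) \<longlonglongrightarrow> 0"
proof -
  interpret torus p q using pq by unfold_locales
  have bc: "\<exists>\<phi>. branched_cover p q \<phi> n (M n) (f n)" if "n \<ge> 1" for n
    by (rule branched_cover_fox[OF pq that]) (use fox that in simp)
  \<comment> \<open>The good cover of the sphere is taken from the case \<open>n = 1\<close> and
    reused for all \<open>n\<close>, so \<open>c\<close> is a constant.\<close>
  obtain \<phi> where "branched_cover p q \<phi> 1 (M 1) (f 1)" using bc[of 1] by auto
  then obtain \<B> where \<B>: "good_cover \<B>" using branched_cover.good_cover_exists by blast
  define c where "c = (card \<B>)\<^sup>2 * (p * q')"
  have d: "gcd p q > 0" using pq by simp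
  have bound: "\<bar>1 / real n ^ gcd p q * ln (real (card (torsion_part (H1 (M n)))))\<bar>
      \<le> real c * (real (gcd p q) * ln (real n) + ln (6 * real c + 1)) / real n" if n: "n \<ge> 1" for n
  proof -
    obtain \<phi> where b: "branched_cover p q \<phi> n (M n) (f n)" using bc[OF n] ..
    interpret N: nerve p q \<phi> n "M n" "f n" \<B>
      using b \<B> by (intro nerve.intro nerve_axioms.intro)
    \<comment> \<open>The neutral element makes the count positive; its logarithm is then
      nonnegative, and an upper bound suffices.\<close>
    have "\<one>\<^bsub>H1 (M n)\<^esub> \<in> torsion_part (H1 (M n))"
      unfolding torsion_part_def using N.G.nat_pow_one by (intro CollectI conjI N.G.one_closed exI[of _ 1]) simp_all
    then have t: "card (torsion_part (H1 (M n))) > 0"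
      using N.card_torsion_bound(1) by (auto simp: card_gt_0_iff)
    show ?thesis
      using N.card_torsion_bound(2) n by (intro torsion_growth_bound[OF _ d t]) (simp_all add: c_def mult.assoc)
  qed
  have "(\<lambda>n. real c * (real (gcd p q) * ln (real n) + ln (6 * real c + 1)) / real n) \<longlonglongrightarrow> 0"
    by real_asymp
  then show ?thesis
    by (rule Lim_null_comparison[rotated]) (use bound in \<open>auto simp: eventually_sequentially intro!: exI[of _ 1]\<close>)
qed

theorem theorem6:
  fixes p q :: nat
  assumes "p > 0" and "q > 0"
  shows "(\<forall>\<Delta>. alexander_polynomial (gcd p q) (torus_link p q) \<Delta> \<longrightarrow>
            \<Delta> \<noteq> 0 \<and> log_mahler_measure (gcd p q) (Poly_Mapping.map of_int \<Delta>) = 0) \<and>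
         (\<forall>(M :: nat \<Rightarrow> 'a::real_normed_vector set) f.
            (\<forall>n\<ge>1. fox_completed_cover (gcd p q) (torus_link p q) n (M n) (f n)) \<longrightarrow>
            (\<lambda>n. 1 / real n ^ gcd p q *
                 ln (real (card (torsion_part (homology_group 1 (top_of_set (M n)))))))
              \<longlonglongrightarrow> 0)"
proof (intro conjI allI impI)
  fix \<Delta> assume "alexander_polynomial (gcd p q) (torus_link p q) \<Delta>"
  then obtain \<eta> m where "\<exists>j<gcd p q. Poly_Mapping.lookup \<eta> j \<noteq> 0" and dvd: "\<Delta> dvd (Poly_Mapping.single \<eta> 1 - 1) ^ m"
    by (rule alexander_polynomial_dvd[OF assms])
  then obtain j where "j < gcd p q" "Poly_Mapping.lookup \<eta> j \<noteq> 0" by blast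
  from log_mahler_measure_dvd[OF this(2,1) dvd]
  show "\<Delta> \<noteq> 0" "log_mahler_measure (gcd p q) (Poly_Mapping.map of_int \<Delta>) = 0" by simp_all
next
  fix M :: "nat \<Rightarrow> 'a::real_normed_vector set" and f
  assume "\<forall>n\<ge>1. fox_completed_cover (gcd p q) (torus_link p q) n (M n) (f n)"
  then show "(\<lambda>n. 1 / real n ^ gcd p q *
                 ln (real (card (torsion_part (homology_group 1 (top_of_set (M n)))))))
              \<longlonglongrightarrow> 0"
    by (rule torsion_growth[OF assms])
qed

end
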